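(* Let $C$ be a regular ring containing a field of characteristic zero, let $n,m\ge2$, and let $R=C[X_1,\dots,X_n,Y_1,\dots,Y_m]$ be $\mathbb{Z}^2$-graded with $\operatorname{bideg} c=(0,0)$ for $c\in C$, $\operatorname{bideg}X_i=(1,0)$, $\operatorname{bideg}Y_j=(0,1)$. Let $\mathcal{T}$ be a bigraded Lyubeznik functor on ${}^*\mathrm{Mod}(R)$ and $M=\mathcal{T}(R)=\bigoplus_{(u,v)\in\mathbb{Z}^2}M_{(u,v)}$. Let $(u,v)\in\mathbb{Z}^2$ with $-n<u<0$ and $-m<v<0$. Then (i) $\operatorname{injdim} M_{(u,v)}\le\min\{\operatorname{injdim}M_{(0,0)},\operatorname{injdim}M_{(-n,0)},\operatorname{injdim}M_{(-n,-m)},\operatorname{injdim}M_{(0,-m)}\}$; (ii) $\dim M_{(u,v)}\le\min\{\dim M_{(0,0)},\dim M_{(-n,0)},\dim M_{(-n,-m)},\dim M_{(0,-m)}\}$. Furthermore, let $\mathcal{R}\subset\mathbb{Z}^2$ be one of the following regions, with the indicated pair of corners $\{(u_1,v_1),(u_2,v_2)\}$: $\mathrm{Trun}(\mathcal{N})=\{-n<u<0,v\ge0\}$ with corners $(0,0),(-n,0)$; $\mathrm{Trun}(\mathcal{W^*})=\{u\le-n,-m<v<0\}$ with corners $(-n,0),(-n,-m)$; $\mathrm{Trun}(\mathcal{S^*})=\{-n<u<0,v\le-m\}$ with corners $(-n,-m),(0,-m)$; $\mathrm{Trun}(\mathcal{E})=\{u\ge0,-m<v<0\}$ with corners $(0,-m),(0,0)$.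 Then for all $(u,v)\in\mathcal{R}$, $$\operatorname{injdim} M_{(u,v)}\le\min\{\operatorname{injdim}M_{(u_1,v_1)},\operatorname{injdim}M_{(u_2,v_2)}\},\qquad \dim M_{(u,v)}\le\min\{\dim M_{(u_1,v_1)},\dim M_{(u_2,v_2)}\}.$$
   Context: For a (not necessarily finitely generated) $C$-module $N$, $\operatorname{injdim} N$ is its injective dimension over $C$ and $\dim N$ is the dimension of its support in $\operatorname{Spec} C$; both are taken to be $-\infty$ for $N=0$. Bigraded Lyubeznik functor: a subset $Y$ of $\operatorname{Spec} R$ is bihomogeneous closed if $Y=V(I)$ for a bihomogeneous ideal $I$, and bihomogeneous locally closed if $Y=Y''\setminus Y'$ with $Y'\subseteq Y''$ bihomogeneous closed. For such $Y',Y'',Y$ there is a long exact sequence of functors on the category ${}^*\mathrm{Mod}(R)$ of bigraded $R$-modules, $\cdots\to H^i_{Y'}(-)\to H^i_{Y''}(-)\to H^i_{Y}(-)\to H^{i+1}_{Y'}(-)\to\cdots$ (local cohomology with supports). A bigraded Lyubeznik functor is a composite $\mathcal{T}=\mathcal{T}_1\circ\cdots\circ\mathcal{T}_k$ where each $\mathcal{T}_l$ is either $H^i_{Y}(-)$ for some $i\ge0$ and some bihomogeneous locally closed $Y$, or the kernel, image or cokernel of an arrow in such a long exact sequence. In particular $H^i_I(-)$, for $I$ a bihomogeneous ideal, is such a functor. *)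

theory Defs
  imports
    "HOL-Algebra.Indexed_Polynomials"
    "HOL-Library.Extended_Real"
    "HOL-Library.Product_Plus"
begin

section \<open>Spectra, dimension, regular rings\<close>

definition Spec :: "('r, 'x) ring_scheme \<Rightarrow> 'r set set" where
  "Spec R = {p. primeideal p R}"

text \<open>
  Krull dimension of a set of primes: the supremum of the lengths of strictly increasing chains of
  members of the set, and \<open>- \<infinity>\<close> for the empty set. For a set that is closed under passing to
  larger primes, such as the support of a module, this is also the supremum of the dimensions of
  the rings \<open>R / p\<close> with \<open>p\<close> in the set.
\<close>
definition dim_primes :: "'r set set \<Rightarrow> ereal" where
  "dim_primes Y =
     (SUP k\<in>{k::nat. \<exists>p::nat \<Rightarrow> 'r set. (\<forall>i\<le>k. p i \<in> Y) \<and> (\<forall>i<k. p i \<subset> p (Suc i))}. ereal (real k))"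

definition krull_dim :: "('r, 'x) ring_scheme \<Rightarrow> ereal" where
  "krull_dim R = dim_primes (Spec R)"

text \<open>Localization at a multiplicatively closed set \<open>S\<close>; the class of \<open>r / s\<close> is a set of pairs.\<close>

definition frac_class :: "('r, 'x) ring_scheme \<Rightarrow> 'r set \<Rightarrow> 'r \<times> 'r \<Rightarrow> ('r \<times> 'r) set" where
  "frac_class R S = (\<lambda>(r, s). {(r', s'). r' \<in> carrier R \<and> s' \<in> S \<and>
     (\<exists>t\<in>S. t \<otimes>\<^bsub>R\<^esub> (s' \<otimes>\<^bsub>R\<^esub> r) = t \<otimes>\<^bsub>R\<^esub> (s \<otimes>\<^bsub>R\<^esub> r'))})"

definition localization :: "('r, 'x) ring_scheme \<Rightarrow> 'r set \<Rightarrow> ('r \<times> 'r) set ring" where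
  "localization R S =
     \<lparr>carrier = frac_class R S ` (carrier R \<times> S),
      monoid.mult = (\<lambda>A B. \<Union>(r, s)\<in>A. \<Union>(r', s')\<in>B. frac_class R S (r \<otimes>\<^bsub>R\<^esub> r', s \<otimes>\<^bsub>R\<^esub> s')),
      one = frac_class R S (\<one>\<^bsub>R\<^esub>, \<one>\<^bsub>R\<^esub>),
      zero = frac_class R S (\<zero>\<^bsub>R\<^esub>, \<one>\<^bsub>R\<^esub>),
      add = (\<lambda>A B. \<Union>(r, s)\<in>A. \<Union>(r', s')\<in>B.
               frac_class R S ((s' \<otimes>\<^bsub>R\<^esub> r) \<oplus>\<^bsub>R\<^esub> (s \<otimes>\<^bsub>R\<^esub> r'), s \<otimes>\<^bsub>R\<^esub> s'))\<rparr>"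

definition regular_local_ring :: "('r, 'x) ring_scheme \<Rightarrow> bool" where
  "regular_local_ring R \<longleftrightarrow>
     cring R \<and> noetherian_ring R \<and> (\<exists>!p. maximalideal p R) \<and>
     (\<exists>p S. maximalideal p R \<and> S \<subseteq> carrier R \<and> finite S \<and>
        p = genideal R S \<and> ereal (real (card S)) = krull_dim R)"

text \<open>No finiteness of the Krull dimension is required.\<close>

definition regular_ring :: "('r, 'x) ring_scheme \<Rightarrow> bool" where
  "regular_ring R \<longleftrightarrow>
     cring R \<and> noetherian_ring R \<and>
     (\<forall>p\<in>Spec R. regular_local_ring (localization R (carrier R - p)))"

definition contains_field_char_0 :: "('r, 'x) ring_scheme \<Rightarrow> bool" where
  "contains_field_char_0 R \<longleftrightarrow>
     (\<exists>K. subfield K R \<and> (\<forall>k::nat. k > 0 \<longrightarrow> [k] \<cdot>\<^bsub>R\<^esub> \<one>\<^bsub>R\<^esub> \<noteq> \<zero>\<^bsub>R\<^esub>))"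


section \<open>Modules: support and injective dimension\<close>

text \<open>
  The support of a section: the image of \<open>x\<close> in the stalk \<open>M\<^sub>p\<close> is nonzero iff no element
  outside \<open>p\<close> kills \<open>x\<close>. Consequently \<open>M\<^sub>p\<close> is nonzero iff this holds for some \<open>x\<close>.
\<close>
definition elt_supp :: "('r, 'x) ring_scheme \<Rightarrow> ('r, 'a, 'y) module_scheme \<Rightarrow> 'a \<Rightarrow> 'r set set" where
  "elt_supp R M x = {p \<in> Spec R. \<forall>s \<in> carrier R - p. s \<odot>\<^bsub>M\<^esub> x \<noteq> \<zero>\<^bsub>M\<^esub>}"

definition module_supp :: "('r, 'x) ring_scheme \<Rightarrow> ('r, 'a, 'y) module_scheme \<Rightarrow> 'r set set" where
  "module_supp R M = (\<Union>x\<in>carrier M. elt_supp R M x)"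

definition module_dim :: "('r, 'x) ring_scheme \<Rightarrow> ('r, 'a, 'y) module_scheme \<Rightarrow> ereal" where
  "module_dim R M = dim_primes (module_supp R M)"

definition module_hom ::
  "('r, 'x) ring_scheme \<Rightarrow> ('r, 'a, 'y) module_scheme \<Rightarrow> ('r, 'b, 'z) module_scheme \<Rightarrow> ('a \<Rightarrow> 'b) set" where
  "module_hom R M N = {f \<in> hom (add_monoid M) (add_monoid N).
     \<forall>a\<in>carrier R. \<forall>x\<in>carrier M. f (a \<odot>\<^bsub>M\<^esub> x) = a \<odot>\<^bsub>N\<^esub> f x}"

text \<open>
  The lifting property is tested on monomorphisms of modules whose carriers lie in the type
  \<open>'r + 'e\<close>, since a definition cannot quantify over types. All ideals of \<open>R\<close>
  occur there, so by Baer's criterion this is injectivity without restriction on the test modules.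
\<close>
definition injective_module :: "('r, 'x) ring_scheme \<Rightarrow> ('r, 'e) module \<Rightarrow> bool" where
  "injective_module R E \<longleftrightarrow> module R E \<and>
     (\<forall>(A :: ('r, 'r + 'e) module) (B :: ('r, 'r + 'e) module) j f.
        module R A \<and> module R B \<and> j \<in> module_hom R A B \<and> inj_on j (carrier A) \<and>
        f \<in> module_hom R A E \<longrightarrow>
        (\<exists>g \<in> module_hom R B E. \<forall>x\<in>carrier A. g (j x) = f x))"

definition injective_resolution ::
  "('r, 'x) ring_scheme \<Rightarrow> ('r, 'a) module \<Rightarrow> (nat \<Rightarrow> ('r, 'e) module) \<Rightarrow>
   ('a \<Rightarrow> 'e) \<Rightarrow> (nat \<Rightarrow> 'e \<Rightarrow> 'e) \<Rightarrow> bool" where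
  "injective_resolution R N E \<epsilon> d \<longleftrightarrow>
     module R N \<and> (\<forall>i. injective_module R (E i)) \<and>
     \<epsilon> \<in> module_hom R N (E 0) \<and> (\<forall>i. d i \<in> module_hom R (E i) (E (Suc i))) \<and>
     inj_on \<epsilon> (carrier N) \<and> \<epsilon> ` carrier N = a_kernel (E 0) (E 1) (d 0) \<and>
     (\<forall>i. d i ` carrier (E i) = a_kernel (E (Suc i)) (E (Suc (Suc i))) (d (Suc i)))"

text \<open>
  The resolutions live in the type \<open>(nat + 'r + 'a) set\<close>, of cardinality \<open>2 ^ \<kappa>\<close> with \<open>\<kappa>\<close>
  infinite, \<open>\<kappa> \<ge> |R|\<close> and \<open>\<kappa> \<ge> |N|\<close>. Since \<open>(2 ^ \<kappa>) ^ |R| \<le> 2 ^ \<kappa>\<close>, every module of at most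
  this cardinality embeds into an injective one of at most this cardinality, so \<open>N\<close> has minimal
  injective resolutions in this type and the infimum is not affected by the choice of the type.
\<close>
definition injdim :: "('r, 'x) ring_scheme \<Rightarrow> ('r, 'a) module \<Rightarrow> ereal" where
  "injdim R N = (if carrier N = {\<zero>\<^bsub>N\<^esub>} then - \<infinity> else
     (INF k\<in>{k::nat. \<exists>(E :: nat \<Rightarrow> ('r, (nat + 'r + 'a) set) module) \<epsilon> d.
               injective_resolution R N E \<epsilon> d \<and> (\<forall>i>k. carrier (E i) = {\<zero>\<^bsub>E i\<^esub>})}.
        ereal (real k)))"


section \<open>Bigraded modules\<close>

record ('r, 'a) bigraded = "('r, 'a) module" +
  homog :: "int \<times> int \<Rightarrow> 'a set"

text \<open>A bigraded ring is represented as a bigraded module over itself.\<close>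

definition bigraded_module :: "('r, 'r) bigraded \<Rightarrow> ('r, 'a) bigraded \<Rightarrow> bool" where
  "bigraded_module R M \<longleftrightarrow>
     module R M \<and>
     (\<forall>e. additive_subgroup (homog M e) M) \<and>
     (\<forall>x\<in>carrier M. \<exists>!f. (\<forall>e. f e \<in> homog M e) \<and> finite {e. f e \<noteq> \<zero>\<^bsub>M\<^esub>} \<and>
        x = finsum M f {e. f e \<noteq> \<zero>\<^bsub>M\<^esub>}) \<and>
     (\<forall>e e'. \<forall>a\<in>homog R e. \<forall>x\<in>homog M e'. a \<odot>\<^bsub>M\<^esub> x \<in> homog M (e + e'))"

definition bigraded_hom ::
  "('r, 'r) bigraded \<Rightarrow> ('r, 'a) bigraded \<Rightarrow> ('r, 'b) bigraded \<Rightarrow> ('a \<Rightarrow> 'b) set" where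
  "bigraded_hom R M N = {f \<in> module_hom R M N. \<forall>e. f ` homog M e \<subseteq> homog N e}"

definition bigraded_iso :: "('r, 'r) bigraded \<Rightarrow> ('r, 'a) bigraded \<Rightarrow> ('r, 'b) bigraded \<Rightarrow> bool" where
  "bigraded_iso R M N \<longleftrightarrow> bigraded_module R M \<and> bigraded_module R N \<and>
     (\<exists>f \<in> bigraded_hom R M N. bij_betw f (carrier M) (carrier N))"

definition bigraded_sub :: "('r, 'a) bigraded \<Rightarrow> 'a set \<Rightarrow> ('r, 'a) bigraded" where
  "bigraded_sub M A = M\<lparr>carrier := A, homog := (\<lambda>e. homog M e \<inter> A)\<rparr>"

text \<open>
  The quotient \<open>M / B\<close>. The ring multiplication and unit present in every module record carry no
  meaning and are filled arbitrarily.
\<close>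
definition bigraded_quot :: "('r, 'a) bigraded \<Rightarrow> 'a set \<Rightarrow> ('r, 'a set) bigraded" where
  "bigraded_quot M B =
     \<lparr>carrier = A_RCOSETS M B, monoid.mult = (\<lambda>_ _. B), one = B, zero = B, add = set_add M,
      smult = (\<lambda>a K. \<Union>x\<in>K. B +>\<^bsub>M\<^esub> (a \<odot>\<^bsub>M\<^esub> x)),
      homog = (\<lambda>e. (\<lambda>x. B +>\<^bsub>M\<^esub> x) ` homog M e)\<rparr>"

text \<open>The map \<open>A \<rightarrow> N / B\<close>, \<open>K \<mapsto>\<close> the class of \<open>\<phi> x\<close>, for any \<open>x \<in> K\<close>, on some quotient \<open>A\<close>.\<close>

definition coset_map :: "('r, 'b) bigraded \<Rightarrow> 'b set \<Rightarrow> ('a \<Rightarrow> 'b) \<Rightarrow> 'a set \<Rightarrow> 'b set" where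
  "coset_map N B \<phi> K = (\<Union>x\<in>K. B +>\<^bsub>N\<^esub> \<phi> x)"

definition bigraded_kernel ::
  "('r, 'a) bigraded \<Rightarrow> ('r, 'b) bigraded \<Rightarrow> ('a \<Rightarrow> 'b) \<Rightarrow> ('r, 'a) bigraded" where
  "bigraded_kernel M N f = bigraded_sub M (a_kernel M N f)"

definition bigraded_image ::
  "('r, 'a) bigraded \<Rightarrow> ('r, 'b) bigraded \<Rightarrow> ('a \<Rightarrow> 'b) \<Rightarrow> ('r, 'b) bigraded" where
  "bigraded_image M N f = bigraded_sub N (f ` carrier M)"

definition bigraded_cokernel ::
  "('r, 'a) bigraded \<Rightarrow> ('r, 'b) bigraded \<Rightarrow> ('a \<Rightarrow> 'b) \<Rightarrow> ('r, 'b set) bigraded" where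
  "bigraded_cokernel M N f = bigraded_quot N (f ` carrier M)"

text \<open>
  Injective objects of the category of bigraded modules and degree preserving maps. As for
  \<open>injective_module\<close>, the test type contains all bihomogeneous ideals, with all their shifts.
\<close>
definition bigraded_injective :: "('r, 'r) bigraded \<Rightarrow> ('r, 'e) bigraded \<Rightarrow> bool" where
  "bigraded_injective R E \<longleftrightarrow> bigraded_module R E \<and>
     (\<forall>(A :: ('r, 'r + 'e) bigraded) (B :: ('r, 'r + 'e) bigraded) j f.
        bigraded_module R A \<and> bigraded_module R B \<and>
        j \<in> bigraded_hom R A B \<and> inj_on j (carrier A) \<and> f \<in> bigraded_hom R A E \<longrightarrow>
        (\<exists>g \<in> bigraded_hom R B E. \<forall>x\<in>carrier A. g (j x) = f x))"

definition bigraded_injective_resolution ::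
  "('r, 'r) bigraded \<Rightarrow> ('r, 'a) bigraded \<Rightarrow> (nat \<Rightarrow> ('r, 'e) bigraded) \<Rightarrow>
   ('a \<Rightarrow> 'e) \<Rightarrow> (nat \<Rightarrow> 'e \<Rightarrow> 'e) \<Rightarrow> bool" where
  "bigraded_injective_resolution R M E \<epsilon> d \<longleftrightarrow>
     bigraded_module R M \<and> (\<forall>i. bigraded_injective R (E i)) \<and>
     \<epsilon> \<in> bigraded_hom R M (E 0) \<and> (\<forall>i. d i \<in> bigraded_hom R (E i) (E (Suc i))) \<and>
     inj_on \<epsilon> (carrier M) \<and> \<epsilon> ` carrier M = a_kernel (E 0) (E 1) (d 0) \<and>
     (\<forall>i. d i ` carrier (E i) = a_kernel (E (Suc i)) (E (Suc (Suc i))) (d (Suc i)))"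


section \<open>Local cohomology with supports and its long exact sequence\<close>

definition bihomogeneous_ideal :: "('r, 'r) bigraded \<Rightarrow> 'r set \<Rightarrow> bool" where
  "bihomogeneous_ideal R I \<longleftrightarrow> (\<exists>S. S \<subseteq> (\<Union>e. homog R e) \<and> I = genideal R S)"

definition bihomogeneous_closed :: "('r, 'r) bigraded \<Rightarrow> 'r set set \<Rightarrow> bool" where
  "bihomogeneous_closed R Y \<longleftrightarrow>
     (\<exists>I. bihomogeneous_ideal R I \<and> Y = {p \<in> Spec R. I \<subseteq> p})"

definition coboundaries ::
  "(nat \<Rightarrow> ('r, 'e) bigraded) \<Rightarrow> (nat \<Rightarrow> 'e \<Rightarrow> 'e) \<Rightarrow> nat \<Rightarrow> 'e set" where
  "coboundaries K d i =
     (case i of 0 \<Rightarrow> {\<zero>\<^bsub>K 0\<^esub>} | Suc k \<Rightarrow> d k ` carrier (K k))"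

definition cohomology ::
  "(nat \<Rightarrow> ('r, 'e) bigraded) \<Rightarrow> (nat \<Rightarrow> 'e \<Rightarrow> 'e) \<Rightarrow> nat \<Rightarrow> ('r, 'e set) bigraded" where
  "cohomology K d i = bigraded_quot (bigraded_kernel (K i) (K (Suc i)) (d i)) (coboundaries K d i)"

definition sections_supp :: "('r, 'r) bigraded \<Rightarrow> 'r set set \<Rightarrow> ('r, 'e) bigraded \<Rightarrow> ('r, 'e) bigraded" where
  "sections_supp R Y E = bigraded_sub E {x \<in> carrier E. elt_supp R E x \<subseteq> Y}"

text \<open>
  Let \<open>Y = Y'' - Y'\<close>. Local cohomology with supports in \<open>Y\<close> is computed by applying to an
  injective resolution the functor of sections over \<open>Spec R - Y'\<close> with support in \<open>Y\<close>. On an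
  injective object \<open>E\<close> over a Noetherian ring these sections are \<open>\<Gamma>(Y'', E) / \<Gamma>(Y', E)\<close>, where
  \<open>\<Gamma>(Z, E)\<close> stands for \<open>sections_supp R Z E\<close>. The arrows below are those of the long exact
  sequence of the complexes \<open>0 \<rightarrow> \<Gamma>(Y', E) \<rightarrow> \<Gamma>(Y'', E) \<rightarrow> \<Gamma>(Y'', E) / \<Gamma>(Y', E) \<rightarrow> 0\<close>.
\<close>

definition supp_complex ::
  "('r, 'r) bigraded \<Rightarrow> 'r set set \<Rightarrow> (nat \<Rightarrow> ('r, 'e) bigraded) \<Rightarrow> nat \<Rightarrow> ('r, 'e) bigraded" where
  "supp_complex R Y E i = sections_supp R Y (E i)"

definition lc_complex ::
  "('r, 'r) bigraded \<Rightarrow> 'r set set \<Rightarrow> 'r set set \<Rightarrow> (nat \<Rightarrow> ('r, 'e) bigraded) \<Rightarrow>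
   nat \<Rightarrow> ('r, 'e set) bigraded" where
  "lc_complex R Y' Y'' E i =
     bigraded_quot (sections_supp R Y'' (E i)) (carrier (sections_supp R Y' (E i)))"

definition lc_diff ::
  "('r, 'r) bigraded \<Rightarrow> 'r set set \<Rightarrow> (nat \<Rightarrow> ('r, 'e) bigraded) \<Rightarrow> (nat \<Rightarrow> 'e \<Rightarrow> 'e) \<Rightarrow>
   nat \<Rightarrow> 'e set \<Rightarrow> 'e set" where
  "lc_diff R Y' E d i =
     coset_map (E (Suc i)) (carrier (sections_supp R Y' (E (Suc i)))) (d i)"

definition H_closed ::
  "('r, 'r) bigraded \<Rightarrow> 'r set set \<Rightarrow> (nat \<Rightarrow> ('r, 'e) bigraded) \<Rightarrow> (nat \<Rightarrow> 'e \<Rightarrow> 'e) \<Rightarrow>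
   nat \<Rightarrow> ('r, 'e set) bigraded" where
  "H_closed R Y E d i = cohomology (supp_complex R Y E) d i"

definition H_lc ::
  "('r, 'r) bigraded \<Rightarrow> 'r set set \<Rightarrow> 'r set set \<Rightarrow> (nat \<Rightarrow> ('r, 'e) bigraded) \<Rightarrow> (nat \<Rightarrow> 'e \<Rightarrow> 'e) \<Rightarrow>
   nat \<Rightarrow> ('r, 'e set set) bigraded" where
  "H_lc R Y' Y'' E d i = cohomology (lc_complex R Y' Y'' E) (lc_diff R Y' E d) i"

definition les_incl ::
  "('r, 'r) bigraded \<Rightarrow> 'r set set \<Rightarrow> (nat \<Rightarrow> ('r, 'e) bigraded) \<Rightarrow> (nat \<Rightarrow> 'e \<Rightarrow> 'e) \<Rightarrow>
   nat \<Rightarrow> 'e set \<Rightarrow> 'e set" where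
  "les_incl R Y'' E d i =
     coset_map (supp_complex R Y'' E i) (coboundaries (supp_complex R Y'' E) d i) (\<lambda>x. x)"

definition les_restr ::
  "('r, 'r) bigraded \<Rightarrow> 'r set set \<Rightarrow> 'r set set \<Rightarrow> (nat \<Rightarrow> ('r, 'e) bigraded) \<Rightarrow> (nat \<Rightarrow> 'e \<Rightarrow> 'e) \<Rightarrow>
   nat \<Rightarrow> 'e set \<Rightarrow> 'e set set" where
  "les_restr R Y' Y'' E d i =
     coset_map (lc_complex R Y' Y'' E i) (coboundaries (lc_complex R Y' Y'' E) (lc_diff R Y' E d) i)
       (\<lambda>x. carrier (sections_supp R Y' (E i)) +>\<^bsub>E i\<^esub> x)"

text \<open>The class of the class of \<open>x\<close>, where \<open>d x\<close> is supported in \<open>Y'\<close>, goes to the class of \<open>d x\<close>.\<close>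

definition les_conn ::
  "('r, 'r) bigraded \<Rightarrow> 'r set set \<Rightarrow> (nat \<Rightarrow> ('r, 'e) bigraded) \<Rightarrow> (nat \<Rightarrow> 'e \<Rightarrow> 'e) \<Rightarrow>
   nat \<Rightarrow> 'e set set \<Rightarrow> 'e set" where
  "les_conn R Y' E d i \<xi> =
     (\<Union>K\<in>\<xi>. coset_map (supp_complex R Y' E (Suc i)) (coboundaries (supp_complex R Y' E) d (Suc i)) (d i) K)"


section \<open>Bigraded Lyubeznik functors\<close>

text \<open>
  With \<open>H i Z\<close> for the local cohomology functor, the arrows are \<open>H i Y' \<rightarrow> H i Y''\<close>,
  \<open>H i Y'' \<rightarrow> H i Y\<close> and \<open>H i Y \<rightarrow> H (i + 1) Y'\<close>.
\<close>
datatype les_arrow = Incl nat | Restr nat | Conn nat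

datatype arrow_part = Kernel | Image | Cokernel

text \<open>
  A single factor of a Lyubeznik functor, the last two arguments being \<open>Y'\<close> and \<open>Y''\<close>:
  \<open>Coh i Y' Y''\<close> is \<open>H i Y\<close> for \<open>Y = Y'' - Y'\<close>.
\<close>
datatype 'r lyubeznik_step =
    Coh nat "'r set set" "'r set set"
  | Part arrow_part les_arrow "'r set set" "'r set set"

definition arrow_part_value ::
  "('r, 'r) bigraded \<Rightarrow> arrow_part \<Rightarrow> ('r, 'a) bigraded \<Rightarrow> ('r, 'b) bigraded \<Rightarrow> ('a \<Rightarrow> 'b) \<Rightarrow>
   ('r, 'c) bigraded \<Rightarrow> bool" where
  "arrow_part_value R \<pi> A B f N = (case \<pi> of
       Kernel \<Rightarrow> bigraded_iso R (bigraded_kernel A B f) N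
     | Image \<Rightarrow> bigraded_iso R (bigraded_image A B f) N
     | Cokernel \<Rightarrow> bigraded_iso R (bigraded_cokernel A B f) N)"

fun valid_step :: "('r, 'r) bigraded \<Rightarrow> 'r lyubeznik_step \<Rightarrow> bool" where
  "valid_step R (Coh i Y' Y'') \<longleftrightarrow>
     bihomogeneous_closed R Y' \<and> bihomogeneous_closed R Y'' \<and> Y' \<subseteq> Y''"
| "valid_step R (Part \<pi> \<alpha> Y' Y'') \<longleftrightarrow>
     bihomogeneous_closed R Y' \<and> bihomogeneous_closed R Y'' \<and> Y' \<subseteq> Y''"

text \<open>A Lyubeznik functor \<open>T\<^sub>1 \<circ> \<dots> \<circ> T\<^sub>k\<close> is represented by the list of its factors.\<close>

definition lyubeznik_functor :: "('r, 'r) bigraded \<Rightarrow> 'r lyubeznik_step list \<Rightarrow> bool" where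
  "lyubeznik_functor R T \<longleftrightarrow> T \<noteq> [] \<and> (\<forall>t\<in>set T. valid_step R t)"

text \<open>
  Derived functors are determined up to isomorphism, so the value of a functor is a relation: \<open>N\<close>
  is isomorphic to the module computed from some injective resolution of \<open>M\<close> in the category of
  bigraded modules.
\<close>
fun resolution_value ::
  "('r, 'r) bigraded \<Rightarrow> 'r lyubeznik_step \<Rightarrow> (nat \<Rightarrow> ('r, 'e) bigraded) \<Rightarrow> (nat \<Rightarrow> 'e \<Rightarrow> 'e) \<Rightarrow>
   ('r, 'b) bigraded \<Rightarrow> bool" where
  "resolution_value R (Coh i Y' Y'') E d N = bigraded_iso R (H_lc R Y' Y'' E d i) N"
| "resolution_value R (Part \<pi> (Incl i) Y' Y'') E d N =
     arrow_part_value R \<pi> (H_closed R Y' E d i) (H_closed R Y'' E d i) (les_incl R Y'' E d i) N"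
| "resolution_value R (Part \<pi> (Restr i) Y' Y'') E d N =
     arrow_part_value R \<pi> (H_closed R Y'' E d i) (H_lc R Y' Y'' E d i) (les_restr R Y' Y'' E d i) N"
| "resolution_value R (Part \<pi> (Conn i) Y' Y'') E d N =
     arrow_part_value R \<pi> (H_lc R Y' Y'' E d i) (H_closed R Y' E d (Suc i)) (les_conn R Y' E d i) N"

definition step_value ::
  "('r, 'r) bigraded \<Rightarrow> 'r lyubeznik_step \<Rightarrow> ('r, 'u) bigraded \<Rightarrow> ('r, 'u) bigraded \<Rightarrow> bool" where
  "step_value R t M N \<longleftrightarrow>
     (\<exists>(E :: nat \<Rightarrow> ('r, 'u) bigraded) \<epsilon> d.
        bigraded_injective_resolution R M E \<epsilon> d \<and> resolution_value R t E d N)"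

text \<open>
  \<open>lyubeznik_value R T M N\<close>: \<open>N\<close> is \<open>T(M)\<close>. All intermediate modules and injective resolutions
  live in the type \<open>'u\<close> of \<open>N\<close>. This is no restriction for a statement made for every \<open>'u\<close>,
  because every value \<open>T(M)\<close> arises in a sufficiently large type, for example in
  \<open>(nat + 'r + 'a) set\<close>.
\<close>
fun lyubeznik_value ::
  "('r, 'r) bigraded \<Rightarrow> 'r lyubeznik_step list \<Rightarrow> ('r, 'a) bigraded \<Rightarrow> ('r, 'u) bigraded \<Rightarrow> bool" where
  "lyubeznik_value R [] M N = bigraded_iso R M N"
| "lyubeznik_value R (t # T) M N =
     (\<exists>M' :: ('r, 'u) bigraded. lyubeznik_value R T M M' \<and> step_value R t M' N)"


section \<open>The bigraded polynomial ring\<close>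

text \<open>
  Monomials are multisets of variables; \<open>Inl i\<close> stands for \<open>X\<^sub>i\<close> and \<open>Inr j\<close> for \<open>Y\<^sub>j\<close>.
\<close>
definition bideg :: "(nat + nat) multiset \<Rightarrow> int \<times> int" where
  "bideg \<mu> = (int (size (filter_mset isl \<mu>)), int (size (filter_mset (\<lambda>v. \<not> isl v) \<mu>)))"

definition mpoly_mult ::
  "('c, 'x) ring_scheme \<Rightarrow> ('v multiset \<Rightarrow> 'c) \<Rightarrow> ('v multiset \<Rightarrow> 'c) \<Rightarrow> 'v multiset \<Rightarrow> 'c" where
  "mpoly_mult C p q = (\<lambda>\<mu>. finsum C (\<lambda>\<nu>. p \<nu> \<otimes>\<^bsub>C\<^esub> q (\<mu> - \<nu>)) {\<nu>. \<nu> \<subseteq># \<mu>})"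

definition mpoly_carrier :: "('c, 'x) ring_scheme \<Rightarrow> nat \<Rightarrow> nat \<Rightarrow> ((nat + nat) multiset \<Rightarrow> 'c) set" where
  "mpoly_carrier C n m = ring.indexed_pset C (Inl ` {1..n} \<union> Inr ` {1..m}) (carrier C)"

definition bipoly_ring ::
  "('c, 'x) ring_scheme \<Rightarrow> nat \<Rightarrow> nat \<Rightarrow>
   ((nat + nat) multiset \<Rightarrow> 'c, (nat + nat) multiset \<Rightarrow> 'c) bigraded" where
  "bipoly_ring C n m =
     \<lparr>carrier = mpoly_carrier C n m,
      monoid.mult = mpoly_mult C,
      one = ring.indexed_const C \<one>\<^bsub>C\<^esub>,
      zero = ring.indexed_const C \<zero>\<^bsub>C\<^esub>,
      add = ring.indexed_padd C,
      smult = mpoly_mult C,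
      homog = (\<lambda>e. {p \<in> mpoly_carrier C n m. \<forall>\<mu>. p \<mu> \<noteq> \<zero>\<^bsub>C\<^esub> \<longrightarrow> bideg \<mu> = e})\<rparr>"

text \<open>The \<open>C\<close>-module \<open>M\<^sub>e\<close>, with \<open>C\<close> acting through the constant polynomials.\<close>

definition component ::
  "('c, 'x) ring_scheme \<Rightarrow> ((nat + nat) multiset \<Rightarrow> 'c, 'a) bigraded \<Rightarrow> int \<times> int \<Rightarrow> ('c, 'a) module" where
  "component C M e =
     \<lparr>carrier = homog M e, monoid.mult = monoid.mult M, one = one M, zero = \<zero>\<^bsub>M\<^esub>, add = add M,
      smult = (\<lambda>c x. ring.indexed_const C c \<odot>\<^bsub>M\<^esub> x)\<rparr>"

end

theory Submission
  imports Defs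
begin

text \<open>
  The partial derivatives by the \<open>X\<^sub>i\<close> make \<open>R\<close> a module over a Weyl algebra, on which \<open>\<Sum> X\<^sub>i \<partial>\<^sub>i\<close> acts in
  degree \<open>(u, v)\<close> as multiplication by \<open>u\<close>. Every value of a Lyubeznik functor inherits operators
  \<open>D\<^sub>i\<close> of degree \<open>(- 1, 0)\<close> with the Leibniz rule and this Euler identity: the \<open>D\<^sub>i\<close> lift to an injective
  resolution, where the identity holds up to a linear homotopy, and both the lifts and the homotopy
  preserve sections with support in a closed set.

  In degree \<open>(u, v)\<close> we have \<open>\<Sum> X\<^sub>i D\<^sub>i = u\<close> and \<open>\<Sum> D\<^sub>i X\<^sub>i = u + n\<close>. These maps are linear over \<open>C\<close>, so
  \<open>M\<^bsub>(u, v)\<^esub>\<close> is a direct summand of a power of \<open>M\<^bsub>(u - 1, v)\<^esub>\<close> if \<open>u \<noteq> 0\<close>, and of a power of \<open>M\<^bsub>(u + 1, v)\<^esub>\<close> if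
  \<open>u \<noteq> - n\<close>. Injective dimension and dimension of the support do not increase under passage to such
  summands. The same holds for the \<open>Y\<^sub>j\<close>, and all inequalities follow by moving to the corners.
\<close>

section \<open>Linear maps\<close>

text \<open>The value of a functor is a relation, met by every isomorphic copy of the module
  computed from some injective resolution. No structure can therefore be read off a construction,
  and what passes through a composite of functors is an existence statement: there are operators
  with the Leibniz rule and the Euler identity. Two obstacles shape the lifting to a resolution. The
  operators are not linear, so the defining property of an injective module does not apply to them;
  this is why sums with a twisted action appear. The lifts satisfy the Euler identity on
  \<open>M\<close> but not on the modules of the resolution. Its defect there is linear and vanishes
  on \<open>M\<close>, so it is \<open>d h + h d\<close>, which on a cocycle is a coboundary,
  provided that \<open>h\<close> respects the subcomplexes in question.
  \<open>\<Sum> D\<^sub>i X\<^sub>i = u + n\<close> is the first identity combined with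
  \<open>D\<^sub>i X\<^sub>i = X\<^sub>i D\<^sub>i + 1\<close>. Characteristic zero makes every
  nonzero integer a unit of \<open>C\<close>. So the only values that block a move are
  \<open>u = 0\<close> downwards and \<open>u = - n\<close> upwards, and these are the coordinates
  of the corners.\<close>

lemma module_homI:
  assumes "\<And>x. x \<in> carrier M \<Longrightarrow> f x \<in> carrier N"
    and "\<And>x y. x \<in> carrier M \<Longrightarrow> y \<in> carrier M \<Longrightarrow> f (x \<oplus>\<^bsub>M\<^esub> y) = f x \<oplus>\<^bsub>N\<^esub> f y"
    and "\<And>a x. a \<in> carrier R \<Longrightarrow> x \<in> carrier M \<Longrightarrow> f (a \<odot>\<^bsub>M\<^esub> x) = a \<odot>\<^bsub>N\<^esub> f x"
  shows "f \<in> module_hom R M N"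
  using assms by (auto simp: module_hom_def hom_def)

lemma module_hom_closed: "f \<in> module_hom R M N \<Longrightarrow> x \<in> carrier M \<Longrightarrow> f x \<in> carrier N"
  by (auto simp: module_hom_def hom_def)

lemma module_hom_add:
  "f \<in> module_hom R M N \<Longrightarrow> x \<in> carrier M \<Longrightarrow> y \<in> carrier M \<Longrightarrow> f (x \<oplus>\<^bsub>M\<^esub> y) = f x \<oplus>\<^bsub>N\<^esub> f y"
  by (auto simp: module_hom_def hom_def)

lemma module_hom_smult:
  "f \<in> module_hom R M N \<Longrightarrow> a \<in> carrier R \<Longrightarrow> x \<in> carrier M \<Longrightarrow> f (a \<odot>\<^bsub>M\<^esub> x) = a \<odot>\<^bsub>N\<^esub> f x"
  by (auto simp: module_hom_def)

text \<open>Maps with a Leibniz rule are additive without being linear, so zero, differences and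
  finite sums are treated for additive maps.\<close>

lemma additive_zero:
  assumes "abelian_group M" "abelian_group N" "f \<zero>\<^bsub>M\<^esub> \<in> carrier N"
    and "\<And>x y. x \<in> carrier M \<Longrightarrow> y \<in> carrier M \<Longrightarrow> f (x \<oplus>\<^bsub>M\<^esub> y) = f x \<oplus>\<^bsub>N\<^esub> f y"
  shows "f \<zero>\<^bsub>M\<^esub> = \<zero>\<^bsub>N\<^esub>"
proof -
  interpret M: abelian_group M by fact
  interpret N: abelian_group N by fact
  have "f \<zero>\<^bsub>M\<^esub> \<oplus>\<^bsub>N\<^esub> f \<zero>\<^bsub>M\<^esub> = f \<zero>\<^bsub>M\<^esub>" using assms(4)[of "\<zero>\<^bsub>M\<^esub>" "\<zero>\<^bsub>M\<^esub>"] by simp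
  then show ?thesis using assms(3) N.add.r_cancel_one' by auto
qed

lemma additive_minus:
  assumes "abelian_group M" "abelian_group N" "\<And>x. x \<in> carrier M \<Longrightarrow> f x \<in> carrier N"
    and "\<And>x y. x \<in> carrier M \<Longrightarrow> y \<in> carrier M \<Longrightarrow> f (x \<oplus>\<^bsub>M\<^esub> y) = f x \<oplus>\<^bsub>N\<^esub> f y"
    and "x \<in> carrier M" "y \<in> carrier M"
  shows "f (x \<ominus>\<^bsub>M\<^esub> y) = f x \<ominus>\<^bsub>N\<^esub> f y"
proof -
  interpret M: abelian_group M by fact
  interpret N: abelian_group N by fact
  have "f (x \<ominus>\<^bsub>M\<^esub> y) \<oplus>\<^bsub>N\<^esub> f y = f x"
    using assms(4)[of "x \<ominus>\<^bsub>M\<^esub> y" y] assms(5,6) by (simp add: M.minus_eq M.a_assoc M.l_neg)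
  then show ?thesis
    using assms(3,5,6) by (metis M.minus_closed N.minus_eq N.add.inv_solve_right)
qed

lemma additive_finsum:
  assumes "abelian_group M" "abelian_group N" "\<And>x. x \<in> carrier M \<Longrightarrow> f x \<in> carrier N"
    and "\<And>x y. x \<in> carrier M \<Longrightarrow> y \<in> carrier M \<Longrightarrow> f (x \<oplus>\<^bsub>M\<^esub> y) = f x \<oplus>\<^bsub>N\<^esub> f y"
    and "finite A" "g \<in> A \<rightarrow> carrier M"
  shows "f (finsum M g A) = finsum N (\<lambda>i. f (g i)) A"
proof -
  interpret M: abelian_group M by fact
  interpret N: abelian_group N by fact
  show ?thesis using assms(5,6)
  proof (induction A rule: finite_induct)
    case empty
    then show ?case using additive_zero[OF assms(1,2) _ assms(4)] assms(3) by simp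
  next
    case (insert a A)
    then have "finsum M g (insert a A) = g a \<oplus>\<^bsub>M\<^esub> finsum M g A" by (intro M.finsum_insert) auto
    moreover have "finsum N (\<lambda>i. f (g i)) (insert a A) = f (g a) \<oplus>\<^bsub>N\<^esub> finsum N (\<lambda>i. f (g i)) A"
      using insert assms(3) by (intro N.finsum_insert) auto
    ultimately show ?case using insert assms(4) by (simp add: Pi_iff)
  qed
qed

lemma module_abelian_group: "module R M \<Longrightarrow> abelian_group M"
  by (simp add: module_def)

lemma module_hom_zero:
  assumes "module R M" "module R N" "f \<in> module_hom R M N"
  shows "f \<zero>\<^bsub>M\<^esub> = \<zero>\<^bsub>N\<^esub>"
proof -
  interpret M: module R M by fact
  show ?thesis using assms
    by (intro additive_zero) (auto intro: module_abelian_group module_hom_closed module_hom_add)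
qed

lemma module_hom_diff:
  assumes "module R M" "module R N" "f \<in> module_hom R M N" "x \<in> carrier M" "y \<in> carrier M"
  shows "f (x \<ominus>\<^bsub>M\<^esub> y) = f x \<ominus>\<^bsub>N\<^esub> f y"
  using assms
  by (intro additive_minus) (auto intro: module_abelian_group module_hom_closed module_hom_add)

lemma module_hom_id: "(\<lambda>x. x) \<in> module_hom R M M"
  by (auto intro: module_homI)

lemma module_hom_comp:
  "f \<in> module_hom R M N \<Longrightarrow> g \<in> module_hom R N P \<Longrightarrow> (\<lambda>x. g (f x)) \<in> module_hom R M P"
  by (auto intro!: module_homI simp: module_hom_closed module_hom_add module_hom_smult)

lemma module_hom_plus:
  assumes "module R N" "f \<in> module_hom R M N" "g \<in> module_hom R M N"
  shows "(\<lambda>x. f x \<oplus>\<^bsub>N\<^esub> g x) \<in> module_hom R M N"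
proof -
  interpret N: module R N by fact
  show ?thesis using assms(2,3)
    by (intro module_homI)
      (auto simp: module_hom_closed module_hom_add module_hom_smult N.M.a_ac N.smult_r_distr)
qed

lemma module_hom_minus:
  assumes "module R N" "f \<in> module_hom R M N" "g \<in> module_hom R M N"
  shows "(\<lambda>x. f x \<ominus>\<^bsub>N\<^esub> g x) \<in> module_hom R M N"
proof -
  interpret N: module R N by fact
  show ?thesis using assms(2,3)
    by (intro module_homI)
      (auto simp: module_hom_closed module_hom_add module_hom_smult N.M.minus_eq N.M.minus_add
        N.M.a_ac N.smult_r_distr N.smult_r_minus)
qed

lemma module_hom_const_zero:
  "module R N \<Longrightarrow> (\<lambda>x. \<zero>\<^bsub>N\<^esub>) \<in> module_hom R M N"
  by (auto intro!: module_homI simp: module.smult_r_null abelian_group.axioms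
      abelian_monoid.zero_closed abelian_monoid.l_zero module_abelian_group)

lemma module_hom_smult_const:
  assumes "module R M" "c \<in> carrier R"
  shows "(\<lambda>x. c \<odot>\<^bsub>M\<^esub> x) \<in> module_hom R M M"
proof -
  interpret M: module R M by fact
  show ?thesis using assms(2)
    by (intro module_homI) (auto simp: M.smult_r_distr M.smult_assoc1[symmetric] M.R.m_comm)
qed

lemma (in abelian_group) diff_zero_eq:
  "x \<in> carrier G \<Longrightarrow> y \<in> carrier G \<Longrightarrow> x \<ominus> y = \<zero> \<Longrightarrow> x = y"
  by (metis a_minus_def add.inv_closed add.inv_equality minus_minus r_neg)

lemma (in abelian_group) diff_add_cancel:
  "x \<in> carrier G \<Longrightarrow> y \<in> carrier G \<Longrightarrow> (x \<ominus> y) \<oplus> y = x"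
  by (simp add: minus_eq a_assoc l_neg)

lemma module_hom_inj_iff:
  assumes "module R M" "module R N" "f \<in> module_hom R M N"
  shows "inj_on f (carrier M) \<longleftrightarrow> (\<forall>x\<in>carrier M. f x = \<zero>\<^bsub>N\<^esub> \<longrightarrow> x = \<zero>\<^bsub>M\<^esub>)"
proof -
  interpret M: module R M by fact
  interpret N: module R N by fact
  show ?thesis
  proof
    assume "inj_on f (carrier M)"
    then show "\<forall>x\<in>carrier M. f x = \<zero>\<^bsub>N\<^esub> \<longrightarrow> x = \<zero>\<^bsub>M\<^esub>"
      using module_hom_zero[OF assms] by (metis M.M.zero_closed inj_onD)
  next
    assume *: "\<forall>x\<in>carrier M. f x = \<zero>\<^bsub>N\<^esub> \<longrightarrow> x = \<zero>\<^bsub>M\<^esub>"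
    show "inj_on f (carrier M)"
    proof (rule inj_onI)
      fix x y assume xy: "x \<in> carrier M" "y \<in> carrier M" "f x = f y"
      then have "f (x \<ominus>\<^bsub>M\<^esub> y) = \<zero>\<^bsub>N\<^esub>"
        using module_hom_diff[OF assms, of x y] module_hom_closed[OF assms(3)]
        by (simp add: N.M.minus_eq N.M.r_neg)
      then show "x = y" using * xy M.M.diff_zero_eq by auto
    qed
  qed
qed

text \<open>Apart from the existence of additive inverses, the module axioms are closure conditions
  and identities, and a surjection that respects the operations carries them over. The same argument
  serves transported modules, records with a smaller carrier, and quotients.\<close>

lemma surj_image_module:
  assumes M: "module R M"
    and surj: "carrier Q = q ` carrier M"
    and add: "\<And>x y. x \<in> carrier M \<Longrightarrow> y \<in> carrier M \<Longrightarrow> q (x \<oplus>\<^bsub>M\<^esub> y) = q x \<oplus>\<^bsub>Q\<^esub> q y"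
    and smult: "\<And>a x. a \<in> carrier R \<Longrightarrow> x \<in> carrier M \<Longrightarrow> q (a \<odot>\<^bsub>M\<^esub> x) = a \<odot>\<^bsub>Q\<^esub> q x"
    and zero: "q \<zero>\<^bsub>M\<^esub> = \<zero>\<^bsub>Q\<^esub>"
  shows "module R Q"
proof -
  interpret M: module R M by fact
  note s = add[symmetric] smult[symmetric] zero[symmetric]
  show ?thesis
  proof (rule moduleI)
    show "cring R" by (rule M.R.is_cring)
    show "abelian_group Q"
    proof (rule abelian_groupI)
      fix x assume "x \<in> carrier Q"
      then show "\<exists>y\<in>carrier Q. y \<oplus>\<^bsub>Q\<^esub> x = \<zero>\<^bsub>Q\<^esub>"
      proof -
        obtain z where "z \<in> carrier M" "x = q z" using \<open>x \<in> carrier Q\<close> surj by auto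
        then show ?thesis
          using surj by (intro bexI[of _ "q (\<ominus>\<^bsub>M\<^esub> z)"]) (auto simp: s M.M.l_neg)
      qed
    qed (auto simp: surj s M.M.a_ac)
  qed (auto simp: surj s M.smult_l_distr M.smult_r_distr M.smult_assoc1)
qed

text \<open>Injectivity is tested, and injective dimension is measured, on carriers in one
  prescribed type; an injection \<open>g\<close> moves a module into it. Sums and multiples are
  computed at preimages under \<open>g\<close>, and the ring multiplication and unit of the record
  are filled arbitrarily.\<close>

definition transport :: "('b \<Rightarrow> 'c) \<Rightarrow> ('r, 'b, 'z) module_scheme \<Rightarrow> ('r, 'c) module" where
  "transport g M = (let g' = inv_into (carrier M) g in
     \<lparr>carrier = g ` carrier M, monoid.mult = (\<lambda>_ _. g \<zero>\<^bsub>M\<^esub>), one = g \<zero>\<^bsub>M\<^esub>, zero = g \<zero>\<^bsub>M\<^esub>,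
      add = (\<lambda>x y. g (g' x \<oplus>\<^bsub>M\<^esub> g' y)), smult = (\<lambda>a x. g (a \<odot>\<^bsub>M\<^esub> g' x))\<rparr>)"

lemma transport_simps:
  "carrier (transport g M) = g ` carrier M"
  "\<zero>\<^bsub>transport g M\<^esub> = g \<zero>\<^bsub>M\<^esub>"
  "inj_on g (carrier M) \<Longrightarrow> x \<in> carrier M \<Longrightarrow> y \<in> carrier M \<Longrightarrow>
    g x \<oplus>\<^bsub>transport g M\<^esub> g y = g (x \<oplus>\<^bsub>M\<^esub> y)"
  "inj_on g (carrier M) \<Longrightarrow> x \<in> carrier M \<Longrightarrow> a \<odot>\<^bsub>transport g M\<^esub> g x = g (a \<odot>\<^bsub>M\<^esub> x)"
  by (simp_all add: transport_def Let_def)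

lemma transport_module:
  "module R M \<Longrightarrow> inj_on g (carrier M) \<Longrightarrow> module R (transport g M)"
  by (rule surj_image_module[where q = g]) (auto simp: transport_simps)

lemma transport_hom:
  "module R M \<Longrightarrow> inj_on g (carrier M) \<Longrightarrow> g \<in> module_hom R M (transport g M)"
  by (auto intro!: module_homI simp: transport_simps)

lemma transport_inv_hom:
  assumes "module R M" "inj_on g (carrier M)"
  shows "inv_into (carrier M) g \<in> module_hom R (transport g M) M"
proof -
  interpret M: module R M by fact
  show ?thesis using assms(2) by (intro module_homI) (auto simp: transport_simps inv_into_f_f)
qed

section \<open>Submodules\<close>

lemma submodule_simps:
  assumes "module R M" "submodule H R M"
  shows "H \<subseteq> carrier M" "\<zero>\<^bsub>M\<^esub> \<in> H" "x \<in> H \<Longrightarrow> y \<in> H \<Longrightarrow> x \<oplus>\<^bsub>M\<^esub> y \<in> H"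
    "x \<in> H \<Longrightarrow> y \<in> H \<Longrightarrow> x \<ominus>\<^bsub>M\<^esub> y \<in> H" "a \<in> carrier R \<Longrightarrow> x \<in> H \<Longrightarrow> a \<odot>\<^bsub>M\<^esub> x \<in> H"
proof -
  interpret M: module R M by fact
  note E = M.submoduleE[OF assms(2)]
  show "H \<subseteq> carrier M" "x \<in> H \<Longrightarrow> y \<in> H \<Longrightarrow> x \<oplus>\<^bsub>M\<^esub> y \<in> H"
    "x \<in> H \<Longrightarrow> y \<in> H \<Longrightarrow> x \<ominus>\<^bsub>M\<^esub> y \<in> H" "a \<in> carrier R \<Longrightarrow> x \<in> H \<Longrightarrow> a \<odot>\<^bsub>M\<^esub> x \<in> H"
    using E by (auto simp: M.M.minus_eq)
  show "\<zero>\<^bsub>M\<^esub> \<in> H" using subgroup.one_closed[OF submodule.axioms(1)[OF assms(2)]] by simp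
qed

lemma submodule_is_module':
  "module R M \<Longrightarrow> submodule H R M \<Longrightarrow> module R (M\<lparr>carrier := H\<rparr>)"
  by (rule submodule.submodule_is_module)

lemma submoduleI':
  assumes "module R M" "H \<subseteq> carrier M" "\<zero>\<^bsub>M\<^esub> \<in> H"
    "\<And>x y. x \<in> H \<Longrightarrow> y \<in> H \<Longrightarrow> x \<oplus>\<^bsub>M\<^esub> y \<in> H" "\<And>a x. a \<in> carrier R \<Longrightarrow> x \<in> H \<Longrightarrow> a \<odot>\<^bsub>M\<^esub> x \<in> H"
  shows "submodule H R M"
proof -
  interpret M: module R M by fact
  show ?thesis
  proof (rule M.submoduleI)
    fix x assume x: "x \<in> H"
    have "(\<ominus>\<^bsub>R\<^esub> \<one>\<^bsub>R\<^esub>) \<odot>\<^bsub>M\<^esub> x = \<ominus>\<^bsub>M\<^esub> x" using x assms(2) by (subst M.smult_l_minus) auto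
    then show "\<ominus>\<^bsub>M\<^esub> x \<in> H" using assms(5)[of "\<ominus>\<^bsub>R\<^esub> \<one>\<^bsub>R\<^esub>" x] x by simp
  qed (use assms in auto)
qed

lemma image_submodule:
  assumes "module R M" "module R N" "f \<in> module_hom R M N"
  shows "submodule (f ` carrier M) R N"
proof -
  interpret M: module R M by fact
  interpret N: module R N by fact
  show ?thesis
  proof (rule submoduleI'[OF assms(2)])
    show "\<zero>\<^bsub>N\<^esub> \<in> f ` carrier M" using module_hom_zero[OF assms] M.M.zero_closed by (metis imageI)
  qed (auto simp: module_hom_closed[OF assms(3)] module_hom_add[OF assms(3), symmetric] 
      module_hom_smult[OF assms(3), symmetric])
qed

lemma module_zero_closed: "module R M \<Longrightarrow> \<zero>\<^bsub>M\<^esub> \<in> carrier M"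
  by (simp add: module_def abelian_group_def abelian_monoid.zero_closed)

section \<open>Direct products and injective dimension\<close>

text \<open>An induction on resolutions in one type needs the product of two modules on
  \<open>'e\<close> to be again a module on \<open>'e\<close>. Hence a product is not the module of
  pairs but any module whose two projections are jointly bijective.\<close>

definition is_product ::
  "('r, 'x) ring_scheme \<Rightarrow> ('r, 'e) module \<Rightarrow> ('r, 'a) module \<Rightarrow> ('r, 'b) module \<Rightarrow>
   ('e \<Rightarrow> 'a) \<Rightarrow> ('e \<Rightarrow> 'b) \<Rightarrow> bool" where
  "is_product R S A B p q \<longleftrightarrow> module R S \<and> module R A \<and> module R B \<and>
     p \<in> module_hom R S A \<and> q \<in> module_hom R S B \<and>
     bij_betw (\<lambda>x. (p x, q x)) (carrier S) (carrier A \<times> carrier B)"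

lemma is_productD:
  assumes "is_product R S A B p q"
  shows "module R S" "module R A" "module R B" "p \<in> module_hom R S A" "q \<in> module_hom R S B"
  using assms by (auto simp: is_product_def)

lemma is_product_eqI:
  assumes "is_product R S A B p q" "x \<in> carrier S" "y \<in> carrier S" "p x = p y" "q x = q y"
  shows "x = y"
  using assms by (auto simp: is_product_def bij_betw_def dest: inj_onD)

lemma is_product_ex:
  assumes "is_product R S A B p q" "a \<in> carrier A" "b \<in> carrier B"
  obtains x where "x \<in> carrier S" "p x = a" "q x = b"
proof -
  have "(a, b) \<in> (\<lambda>x. (p x, q x)) ` carrier S"
    using assms by (auto simp: is_product_def bij_betw_def)
  then show thesis using that by auto
qed

lemma is_product_universal:
  assumes P: "is_product R S A B p q" and N: "module R N"
    and f: "f \<in> module_hom R N A" and g: "g \<in> module_hom R N B"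
  shows "\<exists>h\<in>module_hom R N S. \<forall>x\<in>carrier N. p (h x) = f x \<and> q (h x) = g x"
proof -
  note D = is_productD[OF P]
  interpret S: module R S by (rule D)
  interpret N: module R N by (rule N)
  have "\<forall>x\<in>carrier N. \<exists>y\<in>carrier S. p y = f x \<and> q y = g x"
    by (meson P f g is_product_ex module_hom_closed)
  then obtain h where h: "\<And>x. x \<in> carrier N \<Longrightarrow> h x \<in> carrier S \<and> p (h x) = f x \<and> q (h x) = g x"
    by metis
  have 1: "h (x \<oplus>\<^bsub>N\<^esub> y) = h x \<oplus>\<^bsub>S\<^esub> h y" if "x \<in> carrier N" "y \<in> carrier N" for x y
    using that h f g D by - (rule is_product_eqI[OF P], (auto simp: module_hom_add)+)
  have 2: "h (a \<odot>\<^bsub>N\<^esub> x) = a \<odot>\<^bsub>S\<^esub> h x" if "a \<in> carrier R" "x \<in> carrier N" for a x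
    using that h f g D by - (rule is_product_eqI[OF P], (auto simp: module_hom_smult)+)
  show ?thesis by (rule bexI[of _ h]) (auto intro!: module_homI simp: h 1 2)
qed

definition pair_module :: "('r, 'a, 'y) module_scheme \<Rightarrow> ('r, 'b, 'z) module_scheme \<Rightarrow> ('r, 'a \<times> 'b) module" where
  "pair_module A B =
     \<lparr>carrier = carrier A \<times> carrier B, monoid.mult = (\<lambda>x y. x), one = (\<zero>\<^bsub>A\<^esub>, \<zero>\<^bsub>B\<^esub>),
      zero = (\<zero>\<^bsub>A\<^esub>, \<zero>\<^bsub>B\<^esub>),
      add = (\<lambda>x y. (fst x \<oplus>\<^bsub>A\<^esub> fst y, snd x \<oplus>\<^bsub>B\<^esub> snd y)),
      smult = (\<lambda>a x. (a \<odot>\<^bsub>A\<^esub> fst x, a \<odot>\<^bsub>B\<^esub> snd x))\<rparr>"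

lemma pair_module_module:
  assumes "module R A" "module R B"
  shows "module R (pair_module A B)"
proof -
  interpret A: module R A by fact
  interpret B: module R B by fact
  show ?thesis
  proof (rule moduleI)
    show "abelian_group (pair_module A B)"
    proof (rule abelian_groupI)
      fix x assume "x \<in> carrier (pair_module A B)"
      then show "\<exists>y\<in>carrier (pair_module A B). y \<oplus>\<^bsub>pair_module A B\<^esub> x = \<zero>\<^bsub>pair_module A B\<^esub>"
        by (intro bexI[of _ "(\<ominus>\<^bsub>A\<^esub> fst x, \<ominus>\<^bsub>B\<^esub> snd x)"])
          (auto simp: pair_module_def A.M.l_neg B.M.l_neg)
    qed (auto simp: pair_module_def A.M.a_ac B.M.a_ac)
  qed (auto simp: pair_module_def A.smult_l_distr A.smult_r_distr A.smult_assoc1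
      B.smult_l_distr B.smult_r_distr B.smult_assoc1 A.R.is_cring)
qed

lemma ex_product:
  fixes j :: "'e \<times> 'e \<Rightarrow> 'e" and A B :: "('r, 'e) module"
  assumes "inj j" "module R A" "module R B"
  obtains S :: "('r, 'e) module" and p q where "is_product R S A B p q"
proof -
  let ?P = "pair_module A B" and ?i = "inv_into (carrier (pair_module A B)) j"
  have j: "inj_on j (carrier ?P)" using assms(1) by (rule inj_on_subset) simp
  note m = pair_module_module[OF assms(2,3)]
  have i: "?i \<in> module_hom R (transport j ?P) ?P" by (rule transport_inv_hom[OF m j])
  have 1: "fst \<in> module_hom R ?P A" "snd \<in> module_hom R ?P B"
    by (auto intro!: module_homI simp: pair_module_def)
  have "bij_betw ?i (carrier (transport j ?P)) (carrier ?P)"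
    using j by (simp add: transport_simps bij_betw_inv_into inj_on_imp_bij_betw)
  moreover have "carrier ?P = carrier A \<times> carrier B" by (simp add: pair_module_def)
  ultimately have "is_product R (transport j ?P) A B (\<lambda>x. fst (?i x)) (\<lambda>x. snd (?i x))"
    unfolding is_product_def
    using assms transport_module[OF m j] module_hom_comp[OF i 1(1)] module_hom_comp[OF i 1(2)]
    by simp
  then show thesis by (rule that)
qed

section \<open>Injective modules and the bound on injective dimension\<close>

lemma injective_module_module: "injective_module R I \<Longrightarrow> module R I"
  by (simp add: injective_module_def)

lemma injective_module_extend:
  fixes I :: "('r, 'e) module" and A B :: "('r, 'r + 'e) module"
  assumes "injective_module R I" "module R A" "module R B" "j \<in> module_hom R A B"
    "inj_on j (carrier A)" "f \<in> module_hom R A I"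
  shows "\<exists>g\<in>module_hom R B I. \<forall>x\<in>carrier A. g (j x) = f x"
  using assms unfolding injective_module_def by blast

text \<open>The definition tests modules on \<open>'r + 'e\<close> only; test modules on
  \<open>'e\<close> itself are moved there by \<open>Inr\<close>.\<close>

lemma injective_module_extend':
  fixes I A B :: "('r, 'e) module"
  assumes I: "injective_module R I" and A: "module R A" and B: "module R B"
    and j: "j \<in> module_hom R A B" "inj_on j (carrier A)" and f: "f \<in> module_hom R A I"
  obtains g where "g \<in> module_hom R B I" "\<And>x. x \<in> carrier A \<Longrightarrow> g (j x) = f x"
proof -
  let ?t = "\<lambda>M :: ('r, 'e) module. transport (Inr :: 'e \<Rightarrow> 'r + 'e) M"
  let ?i = "\<lambda>M :: ('r, 'e) module. inv_into (carrier M) (Inr :: 'e \<Rightarrow> 'r + 'e)"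
  have t: "module R (?t M)" "?i M \<in> module_hom R (?t M) M" "Inr \<in> module_hom R M (?t M)"
    if "module R M" for M
    using that by (auto intro: transport_module transport_inv_hom transport_hom)
  have eq: "?i A (Inr x) = x" if "x \<in> carrier A" for x
    using that by (simp add: inv_into_f_f)
  have "(\<lambda>x. Inr (j (?i A x))) \<in> module_hom R (?t A) (?t B)"
    using module_hom_comp[OF module_hom_comp[OF t(2)[OF A] j(1)] t(3)[OF B]] .
  moreover have "(\<lambda>x. f (?i A x)) \<in> module_hom R (?t A) I"
    by (rule module_hom_comp[OF t(2)[OF A] f])
  moreover have "inj_on (\<lambda>x. Inr (j (?i A x)) :: 'r + 'e) (carrier (?t A))"
    using j(2) by (auto simp: inj_on_def transport_simps eq)
  ultimately obtain g where g: "g \<in> module_hom R (?t B) I"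
    "\<forall>x\<in>carrier (?t A). g (Inr (j (?i A x))) = f (?i A x)"
    using injective_module_extend[OF I t(1)[OF A] t(1)[OF B]] by blast
  show thesis
  proof (rule that[of "\<lambda>x. g (Inr x)"])
    show "(\<lambda>x. g (Inr x)) \<in> module_hom R B I" by (rule module_hom_comp[OF t(3)[OF B] g(1)])
  qed (use g(2) eq in \<open>auto simp: transport_simps\<close>)
qed

lemma injective_module_retract:
  fixes I :: "('r, 'e) module" and N :: "('r, 'e) module"
  assumes I: "injective_module R I" and N: "module R N"
    and f: "f \<in> module_hom R N I" and r: "r \<in> module_hom R I N"
    and rf: "\<And>x. x \<in> carrier N \<Longrightarrow> r (f x) = x"
  shows "injective_module R N"
  unfolding injective_module_def
proof (intro conjI allI impI N)
  fix A B :: "('r, 'r + 'e) module" and j g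
  assume *: "module R A \<and> module R B \<and> j \<in> module_hom R A B \<and> inj_on j (carrier A) \<and>
    g \<in> module_hom R A N"
  then have "(\<lambda>x. f (g x)) \<in> module_hom R A I" using f by (auto intro: module_hom_comp)
  then obtain h where h: "h \<in> module_hom R B I" "\<forall>x\<in>carrier A. h (j x) = f (g x)"
    using injective_module_extend[OF I] * by metis
  then show "\<exists>h\<in>module_hom R B N. \<forall>x\<in>carrier A. h (j x) = g x"
    using * r rf by (intro bexI[of _ "\<lambda>x. r (h x)"]) (auto intro: module_hom_comp simp: module_hom_closed)
qed

lemma injective_module_product:
  fixes S I J :: "('r, 'e) module"
  assumes P: "is_product R S I J p q" and I: "injective_module R I" and J: "injective_module R J"
  shows "injective_module R S"
  unfolding injective_module_def
proof (intro conjI allI impI)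
  show "module R S" by (rule is_productD[OF P])
  fix A B :: "('r, 'r + 'e) module" and j g
  assume *: "module R A \<and> module R B \<and> j \<in> module_hom R A B \<and> inj_on j (carrier A) \<and>
    g \<in> module_hom R A S"
  then have "(\<lambda>x. p (g x)) \<in> module_hom R A I" "(\<lambda>x. q (g x)) \<in> module_hom R A J"
    using is_productD[OF P] by (auto intro: module_hom_comp)
  then obtain h k where h: "h \<in> module_hom R B I" "\<forall>x\<in>carrier A. h (j x) = p (g x)"
    and k: "k \<in> module_hom R B J" "\<forall>x\<in>carrier A. k (j x) = q (g x)"
    using injective_module_extend[OF I, of A B j "\<lambda>x. p (g x)"]
      injective_module_extend[OF J, of A B j "\<lambda>x. q (g x)"] * by blast
  from * have B: "module R B" by blast
  obtain l where l: "l \<in> module_hom R B S" "\<And>x. x \<in> carrier B \<Longrightarrow> p (l x) = h x"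
    "\<And>x. x \<in> carrier B \<Longrightarrow> q (l x) = k x"
    using is_product_universal[OF P B h(1) k(1)] by blast
  have "l (j x) = g x" if "x \<in> carrier A" for x
    using that * l h k by - (rule is_product_eqI[OF P], (auto simp: module_hom_closed)+)
  then show "\<exists>h\<in>module_hom R B S. \<forall>x\<in>carrier A. h (j x) = g x" using l(1) by blast
qed

lemma zero_module: "module R M \<Longrightarrow> module R (M\<lparr>carrier := {\<zero>\<^bsub>M\<^esub>}\<rparr>)"
  by (intro submodule_is_module' submoduleI')
    (auto simp: module.smult_r_null abelian_group.axioms abelian_monoid.l_zero
      abelian_monoid.zero_closed module_abelian_group)

lemma injective_zero_module:
  fixes Z :: "('r, 'e) module"
  assumes "module R Z" "carrier Z = {\<zero>\<^bsub>Z\<^esub>}"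
  shows "injective_module R Z"
  unfolding injective_module_def
proof (intro conjI allI impI assms(1))
  fix A B :: "('r, 'r + 'e) module" and j g
  assume *: "module R A \<and> module R B \<and> j \<in> module_hom R A B \<and> inj_on j (carrier A) \<and>
    g \<in> module_hom R A Z"
  then have "g x = \<zero>\<^bsub>Z\<^esub>" if "x \<in> carrier A" for x
    using that * assms(2) module_hom_closed[of g R A Z x] by blast
  then show "\<exists>h\<in>module_hom R B Z. \<forall>x\<in>carrier A. h (j x) = g x"
    using assms(1) module_hom_const_zero by (intro bexI[of _ "\<lambda>_. \<zero>\<^bsub>Z\<^esub>"]) auto
qed

text \<open>Equivalent to the existence of an injective resolution that vanishes in degrees above \<open>k\<close>.\<close>

fun injdim_le :: "('r, 'x) ring_scheme \<Rightarrow> nat \<Rightarrow> ('r, 'e) module \<Rightarrow> bool" where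
  "injdim_le R 0 Q \<longleftrightarrow> injective_module R Q"
| "injdim_le R (Suc k) Q \<longleftrightarrow> module R Q \<and>
     (\<exists>(I :: ('r, 'e) module) (K :: ('r, 'e) module) i p.
        injective_module R I \<and> i \<in> module_hom R Q I \<and> inj_on i (carrier Q) \<and>
        p \<in> module_hom R I K \<and> p ` carrier I = carrier K \<and>
        (\<forall>x\<in>carrier I. p x = \<zero>\<^bsub>K\<^esub> \<longleftrightarrow> x \<in> i ` carrier Q) \<and> injdim_le R k K)"

lemma injdim_le_SucI:
  fixes Q I K :: "('r, 'e) module"
  assumes "module R Q" "injective_module R I" "i \<in> module_hom R Q I" "inj_on i (carrier Q)"
    "p \<in> module_hom R I K" "p ` carrier I = carrier K"
    "\<And>x. x \<in> carrier I \<Longrightarrow> p x = \<zero>\<^bsub>K\<^esub> \<longleftrightarrow> x \<in> i ` carrier Q" "injdim_le R k K"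
  shows "injdim_le R (Suc k) Q"
  unfolding injdim_le.simps
  by (rule conjI[OF assms(1)], rule exI[of _ I], rule exI[of _ K], rule exI[of _ i], rule exI[of _ p])
    (intro conjI ballI assms)

lemma injdim_le_module: "injdim_le R k Q \<Longrightarrow> module R Q"
  by (cases k) (auto simp: injective_module_module)

lemma injdim_le_injective: "injective_module R I \<Longrightarrow> injdim_le R k I"
proof (induction k arbitrary: I)
  case (Suc k)
  then have I: "module R I" by (simp add: injective_module_module)
  let ?Z = "I\<lparr>carrier := {\<zero>\<^bsub>I\<^esub>}\<rparr>"
  have Z: "module R ?Z" by (rule zero_module[OF I])
  then have "injdim_le R k ?Z" by (intro Suc.IH injective_zero_module) auto
  moreover have "(\<lambda>_. \<zero>\<^bsub>?Z\<^esub>) \<in> module_hom R I ?Z" using Z by (rule module_hom_const_zero)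
  ultimately show ?case
    using Suc.prems I module_hom_id[of R I] module_zero_closed[OF I]
    by (simp, intro exI[of _ I] conjI exI[of _ ?Z] exI[of _ "\<lambda>x. x"] exI[of _ "\<lambda>_. \<zero>\<^bsub>I\<^esub>"])
      auto
qed simp

text \<open>The product of the two short exact sequences is a short exact sequence with injective
  middle term, and its last term is the product of the two cokernels.\<close>

lemma injdim_le_product:
  fixes A B S :: "('r, 'e) module" and j :: "'e \<times> 'e \<Rightarrow> 'e"
  assumes j: "inj j" and P: "is_product R S A B p q" and "injdim_le R k A" "injdim_le R k B"
  shows "injdim_le R k S"
  using assms(2-)
proof (induction k arbitrary: A B S p q)
  case 0
  then show ?case by (auto intro: injective_module_product)
next
  case (Suc k)
  note P = Suc.prems(1) note D = is_productD[OF P]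
  from Suc.prems(2) obtain I K :: "('r, 'e) module" and i u where
    A: "injective_module R I" "i \<in> module_hom R A I" "inj_on i (carrier A)" "u \<in> module_hom R I K"
    "u ` carrier I = carrier K" "\<And>x. x \<in> carrier I \<Longrightarrow> u x = \<zero>\<^bsub>K\<^esub> \<longleftrightarrow> x \<in> i ` carrier A" "injdim_le R k K"
    by auto
  from Suc.prems(3) obtain J L :: "('r, 'e) module" and i' v where
    B: "injective_module R J" "i' \<in> module_hom R B J" "inj_on i' (carrier B)" "v \<in> module_hom R J L"
    "v ` carrier J = carrier L" "\<And>x. x \<in> carrier J \<Longrightarrow> v x = \<zero>\<^bsub>L\<^esub> \<longleftrightarrow> x \<in> i' ` carrier B" "injdim_le R k L"
    by auto
  have IJ: "module R I" "module R J" "module R K" "module R L"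
    using A B by (auto simp: injective_module_module injdim_le_module)
  obtain T :: "('r, 'e) module" and p1 q1 where T: "is_product R T I J p1 q1" using ex_product[OF j IJ(1,2)] .
  obtain W :: "('r, 'e) module" and p2 q2 where W: "is_product R W K L p2 q2" using ex_product[OF j IJ(3,4)] .
  note DT = is_productD[OF T] note DW = is_productD[OF W]
  obtain s where s: "s \<in> module_hom R S T" "\<And>x. x \<in> carrier S \<Longrightarrow> p1 (s x) = i (p x)"
    "\<And>x. x \<in> carrier S \<Longrightarrow> q1 (s x) = i' (q x)"
    using is_product_universal[OF T D(1) module_hom_comp[OF D(4) A(2)] module_hom_comp[OF D(5) B(2)]] by blast
  obtain t where t: "t \<in> module_hom R T W" "\<And>x. x \<in> carrier T \<Longrightarrow> p2 (t x) = u (p1 x)"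
    "\<And>x. x \<in> carrier T \<Longrightarrow> q2 (t x) = v (q1 x)"
    using is_product_universal[OF W DT(1) module_hom_comp[OF DT(4) A(4)] module_hom_comp[OF DT(5) B(4)]] by blast
  have cl: "p x \<in> carrier A" "q x \<in> carrier B" if "x \<in> carrier S" for x
    using that D by (auto simp: module_hom_closed)
  have clT: "p1 x \<in> carrier I" "q1 x \<in> carrier J" "t x \<in> carrier W" if "x \<in> carrier T" for x
    using that DT t by (auto simp: module_hom_closed)
  have inj: "inj_on s (carrier S)"
  proof (rule inj_onI)
    fix x y assume xy: "x \<in> carrier S" "y \<in> carrier S" "s x = s y"
    then have "i (p x) = i (p y)" "i' (q x) = i' (q y)" using s(2,3) by metis+
    then show "x = y"
      using xy cl
      by (intro is_product_eqI[OF P xy(1,2) inj_onD[OF A(3)] inj_onD[OF B(3)]]) simp_all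
  qed
  have W0: "\<zero>\<^bsub>W\<^esub> \<in> carrier W" "p2 \<zero>\<^bsub>W\<^esub> = \<zero>\<^bsub>K\<^esub>" "q2 \<zero>\<^bsub>W\<^esub> = \<zero>\<^bsub>L\<^esub>"
    using DW by (auto simp: module_hom_zero module_def abelian_group_def abelian_monoid.zero_closed)
  have surj: "t ` carrier T = carrier W"
  proof
    show "carrier W \<subseteq> t ` carrier T"
    proof
      fix w assume w: "w \<in> carrier W"
      then have "p2 w \<in> u ` carrier I" "q2 w \<in> v ` carrier J"
        using DW A(5) B(5) by (auto simp: module_hom_closed)
      then obtain x y where xy: "x \<in> carrier I" "p2 w = u x" "y \<in> carrier J" "q2 w = v y" by auto
      obtain z where "z \<in> carrier T" "p1 z = x" "q1 z = y" using is_product_ex[OF T xy(1,3)] .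
      then show "w \<in> t ` carrier T"
        using xy w t clT by - (rule image_eqI[of _ _ z], rule is_product_eqI[OF W], auto)
    qed
  qed (use clT in auto)
  have ker: "t x = \<zero>\<^bsub>W\<^esub> \<longleftrightarrow> x \<in> s ` carrier S" if x: "x \<in> carrier T" for x
  proof
    assume "t x = \<zero>\<^bsub>W\<^esub>"
    then have "u (p1 x) = \<zero>\<^bsub>K\<^esub>" "v (q1 x) = \<zero>\<^bsub>L\<^esub>" using t(2,3)[OF x] W0 by auto
    then obtain a b where ab: "a \<in> carrier A" "p1 x = i a" "b \<in> carrier B" "q1 x = i' b"
      using A(6) B(6) clT[OF x] by blast
    obtain z where "z \<in> carrier S" "p z = a" "q z = b" using is_product_ex[OF P ab(1,3)] .
    then show "x \<in> s ` carrier S"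
      using ab x s by - (rule image_eqI[of _ _ z], rule is_product_eqI[OF T], (auto simp: module_hom_closed)+)
  next
    assume "x \<in> s ` carrier S"
    then obtain z where z: "z \<in> carrier S" "x = s z" by auto
    then have "u (p1 x) = \<zero>\<^bsub>K\<^esub>" "v (q1 x) = \<zero>\<^bsub>L\<^esub>"
      using A(6)[OF clT(1)[OF x]] B(6)[OF clT(2)[OF x]] s(2,3)[OF z(1)] cl[OF z(1)] by auto
    then show "t x = \<zero>\<^bsub>W\<^esub>"
      using t(2,3)[OF x] W0 clT[OF x] by - (rule is_product_eqI[OF W], auto)
  qed
  have "injective_module R T" by (rule injective_module_product[OF T A(1) B(1)])
  moreover have "injdim_le R k W" by (rule Suc.IH[OF W A(7) B(7)])
  ultimately show ?case
    by (intro injdim_le_SucI[OF D(1) _ s(1) inj t(1) surj ker])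
qed

text \<open>
  Let \<open>\<beta>\<close> extend the idempotent \<open>f \<circ> r\<close> from \<open>Q\<close> to \<open>I\<close>. Then \<open>N\<close> is the kernel of \<open>s x = (u x, x - \<beta> x)\<close>
  from \<open>I\<close> to \<open>K \<oplus> I\<close>, and \<open>(u x, y) \<mapsto> s (\<beta> x + y)\<close> retracts \<open>K \<oplus> I\<close> onto the image of \<open>s\<close>.
\<close>

lemma injdim_le_retract:
  fixes Q N :: "('r, 'e) module" and j :: "'e \<times> 'e \<Rightarrow> 'e"
  assumes j: "inj j" and "injdim_le R k Q" "module R N"
    and "f \<in> module_hom R N Q" "r \<in> module_hom R Q N" "\<And>x. x \<in> carrier N \<Longrightarrow> r (f x) = x"
  shows "injdim_le R k N"
  using assms(2-)
proof (induction k arbitrary: Q N f r)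
  case 0
  then show ?case using injective_module_retract[of R Q N f r] by auto
next
  case (Suc k)
  note f = Suc.prems(3) and r = Suc.prems(4) and rf = Suc.prems(5) and N = Suc.prems(2)
  from Suc.prems(1) obtain I K :: "('r, 'e) module" and i u where
    Q: "module R Q" "injective_module R I" "i \<in> module_hom R Q I" "inj_on i (carrier Q)" "u \<in> module_hom R I K"
    "u ` carrier I = carrier K" "\<And>x. x \<in> carrier I \<Longrightarrow> u x = \<zero>\<^bsub>K\<^esub> \<longleftrightarrow> x \<in> i ` carrier Q" "injdim_le R k K"
    by auto
  have I: "module R I" and K: "module R K" using Q by (auto simp: injective_module_module injdim_le_module)
  interpret I: module R I by (rule I)
  interpret K: module R K by (rule K)
  interpret Q: module R Q by (rule Q)
  obtain S :: "('r, 'e) module" and p q where S: "is_product R S K I p q" using ex_product[OF j K I] .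
  note D = is_productD[OF S]
  interpret S: module R S by (rule D)
  \<comment> \<open>Adding the injective \<open>I\<close> to the cokernel \<open>K\<close> does not
    change the bound, so the induction hypothesis applies to retracts of \<open>S\<close>.\<close>
  have SI: "injdim_le R k S" by (rule injdim_le_product[OF j S Q(8) injdim_le_injective[OF Q(2)]])
  have "(\<lambda>x. i (f (r x))) \<in> module_hom R Q I"
    using module_hom_comp[OF module_hom_comp[OF r f] Q(3)] .
  then obtain \<beta> where \<beta>: "\<beta> \<in> module_hom R I I" "\<And>x. x \<in> carrier Q \<Longrightarrow> \<beta> (i x) = i (f (r x))"
    using injective_module_extend'[OF Q(2) Q(1) I Q(3,4)] by metis
  note cl [simp] = module_hom_closed[OF \<beta>(1)] module_hom_closed[OF f] module_hom_closed[OF r]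
    module_hom_closed[OF Q(3)] module_hom_closed[OF Q(5)]
  have "(\<lambda>x. x \<ominus>\<^bsub>I\<^esub> \<beta> x) \<in> module_hom R I I" using module_hom_minus[OF I module_hom_id \<beta>(1)] .
  then obtain s where s: "s \<in> module_hom R I S" "\<And>x. x \<in> carrier I \<Longrightarrow> p (s x) = u x"
    "\<And>x. x \<in> carrier I \<Longrightarrow> q (s x) = x \<ominus>\<^bsub>I\<^esub> \<beta> x"
    using is_product_universal[OF S I Q(5)] by blast
  have z: "p \<zero>\<^bsub>S\<^esub> = \<zero>\<^bsub>K\<^esub>" "q \<zero>\<^bsub>S\<^esub> = \<zero>\<^bsub>I\<^esub>" using D by (auto simp: module_hom_zero)
  have ker: "s x = \<zero>\<^bsub>S\<^esub> \<longleftrightarrow> x \<in> (\<lambda>y. i (f y)) ` carrier N" if x: "x \<in> carrier I" for x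
  proof
    assume "s x = \<zero>\<^bsub>S\<^esub>"
    then have 1: "u x = \<zero>\<^bsub>K\<^esub>" "x \<ominus>\<^bsub>I\<^esub> \<beta> x = \<zero>\<^bsub>I\<^esub>" using s(2,3)[OF x] z by auto
    then obtain y where y: "y \<in> carrier Q" "x = i y" using Q(7)[OF x] by auto
    have "x = \<beta> x" using 1 x by - (rule I.M.diff_zero_eq, auto)
    then show "x \<in> (\<lambda>y. i (f y)) ` carrier N" using y \<beta>(2) by auto
  next
    assume "x \<in> (\<lambda>y. i (f y)) ` carrier N"
    then obtain y where y: "y \<in> carrier N" "x = i (f y)" by auto
    then have "\<beta> x = x" using \<beta>(2) rf by auto
    then have "x \<ominus>\<^bsub>I\<^esub> \<beta> x = \<zero>\<^bsub>I\<^esub>" using x by (simp add: I.M.minus_eq I.M.r_neg)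
    moreover have "u x = \<zero>\<^bsub>K\<^esub>" using Q(7)[OF x] y by auto
    ultimately show "s x = \<zero>\<^bsub>S\<^esub>"
      using s x z module_hom_closed[OF s(1)] by - (rule is_product_eqI[OF S], auto)
  qed
  define L where "L = S\<lparr>carrier := s ` carrier I\<rparr>"
  have L: "module R L"
    unfolding L_def by (rule submodule_is_module'[OF D(1) image_submodule[OF I D(1) s(1)]])
  interpret L: module R L by (rule L)
  have Ls: "carrier L = s ` carrier I" "\<zero>\<^bsub>L\<^esub> = \<zero>\<^bsub>S\<^esub>"
    "\<And>x y. x \<oplus>\<^bsub>L\<^esub> y = x \<oplus>\<^bsub>S\<^esub> y" "\<And>a x. a \<odot>\<^bsub>L\<^esub> x = a \<odot>\<^bsub>S\<^esub> x"
    by (auto simp: L_def)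
  have sL: "s \<in> module_hom R I L"
    using s(1) by (auto simp: module_hom_def hom_def Ls)
  \<comment> \<open>The kernel of \<open>u\<close> is the image of \<open>Q\<close>, and
    \<open>\<beta>\<close> sends it into the image of \<open>N\<close>, which is the kernel of
    \<open>s\<close>. So \<open>s \<circ> \<beta>\<close> factors through \<open>u\<close>.\<close>
  have sb: "s (\<beta> x) = s (\<beta> y)" if "x \<in> carrier I" "y \<in> carrier I" "u x = u y" for x y
  proof -
    have "u (x \<ominus>\<^bsub>I\<^esub> y) = \<zero>\<^bsub>K\<^esub>"
      using that by (simp add: module_hom_diff[OF I K Q(5)] K.M.minus_eq K.M.r_neg)
    moreover have "x \<ominus>\<^bsub>I\<^esub> y \<in> carrier I" using that by simp
    ultimately obtain w where w: "w \<in> carrier Q" "x \<ominus>\<^bsub>I\<^esub> y = i w"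
      using Q(7) by blast
    have "s (\<beta> (x \<ominus>\<^bsub>I\<^esub> y)) = \<zero>\<^bsub>S\<^esub>"
      unfolding w(2) using w(1) \<beta>(2) ker[of "i (f (r w))"] by auto
    then have "s (\<beta> x) \<ominus>\<^bsub>S\<^esub> s (\<beta> y) = \<zero>\<^bsub>S\<^esub>"
      using that by (simp add: module_hom_diff[OF I I \<beta>(1)] module_hom_diff[OF I D(1) s(1)])
    then show ?thesis using that module_hom_closed[OF s(1)] by - (rule S.M.diff_zero_eq, auto)
  qed
  \<comment> \<open>Only a set-theoretic section of \<open>u\<close>; linearity is obtained for its
    composite with \<open>s \<circ> \<beta>\<close>.\<close>
  define \<sigma> where "\<sigma> = inv_into (carrier I) u"
  have \<sigma>: "\<sigma> x \<in> carrier I" "u (\<sigma> x) = x" if "x \<in> carrier K" for x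
    using that Q(6) by (auto simp: \<sigma>_def inv_into_into f_inv_into_f)
  have b: "(\<lambda>x. s (\<beta> (\<sigma> x))) \<in> module_hom R K L"
  proof (rule module_homI)
    fix x y assume xy: "x \<in> carrier K" "y \<in> carrier K"
    have "s (\<beta> (\<sigma> (x \<oplus>\<^bsub>K\<^esub> y))) = s (\<beta> (\<sigma> x \<oplus>\<^bsub>I\<^esub> \<sigma> y))"
      using xy \<sigma> by (intro sb) (auto simp: module_hom_add[OF Q(5)])
    then show "s (\<beta> (\<sigma> (x \<oplus>\<^bsub>K\<^esub> y))) = s (\<beta> (\<sigma> x)) \<oplus>\<^bsub>L\<^esub> s (\<beta> (\<sigma> y))"
      using xy \<sigma> by (simp add: module_hom_add[OF \<beta>(1)] module_hom_add[OF s(1)] Ls)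
  next
    fix a x assume xy: "a \<in> carrier R" "x \<in> carrier K"
    have "s (\<beta> (\<sigma> (a \<odot>\<^bsub>K\<^esub> x))) = s (\<beta> (a \<odot>\<^bsub>I\<^esub> \<sigma> x))"
      using xy \<sigma> by (intro sb) (auto simp: module_hom_smult[OF Q(5)])
    then show "s (\<beta> (\<sigma> (a \<odot>\<^bsub>K\<^esub> x))) = a \<odot>\<^bsub>L\<^esub> s (\<beta> (\<sigma> x))"
      using xy \<sigma> by (simp add: module_hom_smult[OF \<beta>(1)] module_hom_smult[OF s(1)] Ls)
  qed (use \<sigma> in \<open>auto simp: Ls\<close>)
  have "(\<lambda>x. s (\<beta> (\<sigma> (p x))) \<oplus>\<^bsub>L\<^esub> s (q x)) \<in> module_hom R S L"
    by (rule module_hom_plus[OF L module_hom_comp[OF D(4) b] module_hom_comp[OF D(5) sL]])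
  moreover have "(\<lambda>x. x) \<in> module_hom R L S"
    using module_hom_closed[OF s(1)] by (auto intro!: module_homI simp: Ls)
  moreover have "s (\<beta> (\<sigma> (p x))) \<oplus>\<^bsub>L\<^esub> s (q x) = x" if "x \<in> carrier L" for x
  proof -
    obtain y where y: "y \<in> carrier I" "x = s y" using \<open>x \<in> carrier L\<close> Ls by auto
    have "s (\<beta> (\<sigma> (p x))) = s (\<beta> y)" using y \<sigma> s(2) by (intro sb) auto
    moreover have "s (\<beta> y) \<oplus>\<^bsub>S\<^esub> s (y \<ominus>\<^bsub>I\<^esub> \<beta> y) = s (\<beta> y \<oplus>\<^bsub>I\<^esub> (y \<ominus>\<^bsub>I\<^esub> \<beta> y))"
      using y by (simp add: module_hom_add[OF s(1)])
    moreover have "\<beta> y \<oplus>\<^bsub>I\<^esub> (y \<ominus>\<^bsub>I\<^esub> \<beta> y) = y"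
      using I.M.diff_add_cancel[of y "\<beta> y"] y by (simp add: I.M.a_comm)
    ultimately show ?thesis using y s(3) Ls by simp
  qed
  ultimately have "injdim_le R k L" by (intro Suc.IH[OF SI L])
  moreover have "inj_on (\<lambda>y. i (f y)) (carrier N)"
  proof (rule inj_onI)
    fix x y assume xy: "x \<in> carrier N" "y \<in> carrier N" "i (f x) = i (f y)"
    then have "f x = f y" using inj_onD[OF Q(4)] cl(2) by blast
    then show "x = y" using rf xy by metis
  qed
  ultimately show ?case
    using ker Ls by (intro injdim_le_SucI[OF N Q(2) module_hom_comp[OF f Q(3)] _ sL]) simp_all
qed

text \<open>Packs all \<open>f i\<close> and \<open>g i\<close> into one map to, and one map from, a
  power \<open>B\<close> of \<open>A\<close>, so that an identity for their sum says that
  \<open>N\<close> is a retract of \<open>B\<close>. The power is built one factor at a time from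
  the zero module, since all carriers must stay in \<open>'e\<close>.\<close>

lemma injdim_le_power:
  fixes A N :: "('r, 'e) module" and j :: "'e \<times> 'e \<Rightarrow> 'e"
  assumes j: "inj j" and A: "injdim_le R k A" and N: "module R N" and "finite J"
    and "\<And>i. i \<in> J \<Longrightarrow> f i \<in> module_hom R N A" "\<And>i. i \<in> J \<Longrightarrow> g i \<in> module_hom R A N"
  shows "\<exists>(B :: ('r, 'e) module) F G. injdim_le R k B \<and> F \<in> module_hom R N B \<and> G \<in> module_hom R B N \<and>
    (\<forall>x\<in>carrier N. G (F x) = finsum N (\<lambda>i. g i (f i x)) J)"
  using assms(4-)
proof (induction J rule: finite_induct)
  case empty
  interpret N: module R N by (rule N)
  have Z: "module R (N\<lparr>carrier := {\<zero>\<^bsub>N\<^esub>}\<rparr>)" by (rule zero_module[OF N])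
  have "injdim_le R k (N\<lparr>carrier := {\<zero>\<^bsub>N\<^esub>}\<rparr>)"
    by (rule injdim_le_injective[OF injective_zero_module[OF Z]]) simp
  then show ?case
    using module_hom_const_zero[OF Z, of N] module_hom_const_zero[OF N, of "N\<lparr>carrier := {\<zero>\<^bsub>N\<^esub>}\<rparr>"]
    by (intro exI[of _ "N\<lparr>carrier := {\<zero>\<^bsub>N\<^esub>}\<rparr>"] exI[of _ "\<lambda>_. \<zero>\<^bsub>N\<^esub>"]) simp
next
  case (insert i J)
  interpret N: module R N by (rule N)
  note A' = injdim_le_module[OF A]
  obtain B :: "('r, 'e) module" and F G where B: "injdim_le R k B" "F \<in> module_hom R N B" "G \<in> module_hom R B N"
    "\<forall>x\<in>carrier N. G (F x) = finsum N (\<lambda>i. g i (f i x)) J"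
    using insert.IH insert.prems by auto
  obtain S :: "('r, 'e) module" and p q where S: "is_product R S A B p q" using ex_product[OF j A' injdim_le_module[OF B(1)]] .
  note D = is_productD[OF S]
  have fg: "f i \<in> module_hom R N A" "g i \<in> module_hom R A N" using insert.prems by auto
  obtain h where h: "h \<in> module_hom R N S" "\<And>x. x \<in> carrier N \<Longrightarrow> p (h x) = f i x"
    "\<And>x. x \<in> carrier N \<Longrightarrow> q (h x) = F x"
    using is_product_universal[OF S N fg(1) B(2)] by blast
  have "(\<lambda>x. g i (p x) \<oplus>\<^bsub>N\<^esub> G (q x)) \<in> module_hom R S N"
    using module_hom_plus[OF N module_hom_comp[OF D(4) fg(2)] module_hom_comp[OF D(5) B(3)]] .
  moreover have "g i (p (h x)) \<oplus>\<^bsub>N\<^esub> G (q (h x)) = finsum N (\<lambda>i. g i (f i x)) (insert i J)"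
    if x: "x \<in> carrier N" for x
  proof -
    have "finsum N (\<lambda>i. g i (f i x)) (insert i J) = g i (f i x) \<oplus>\<^bsub>N\<^esub> finsum N (\<lambda>i. g i (f i x)) J"
      using insert.hyps module_hom_closed[OF insert.prems(1) x] module_hom_closed[OF insert.prems(2)]
      by (intro N.M.finsum_insert) auto
    then show ?thesis using h x B(4) by simp
  qed
  moreover have "injdim_le R k S" by (rule injdim_le_product[OF j S A B(1)])
  ultimately show ?case using h(1) by blast
qed

section \<open>Injective resolutions of bounded length\<close>

lemma module_hom_inv_into:
  assumes "module R M" "module R N" "f \<in> module_hom R M N" "bij_betw f (carrier M) (carrier N)"
  shows "inv_into (carrier M) f \<in> module_hom R N M"
proof -
  interpret M: module R M by fact
  interpret N: module R N by fact
  let ?g = "inv_into (carrier M) f"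
  have g: "?g y \<in> carrier M" "f (?g y) = y" if "y \<in> carrier N" for y
    using that assms(4) by (auto simp: bij_betw_def inv_into_into f_inv_into_f)
  have inj: "x = y" if "f x = f y" "x \<in> carrier M" "y \<in> carrier M" for x y
    using that assms(4) by (auto simp: bij_betw_def dest: inj_onD)
  show ?thesis
  proof (rule module_homI)
    show "?g (x \<oplus>\<^bsub>N\<^esub> y) = ?g x \<oplus>\<^bsub>M\<^esub> ?g y" if "x \<in> carrier N" "y \<in> carrier N" for x y
      using that g by - (rule inj, auto simp: module_hom_add[OF assms(3)])
    show "?g (a \<odot>\<^bsub>N\<^esub> y) = a \<odot>\<^bsub>M\<^esub> ?g y" if "a \<in> carrier R" "y \<in> carrier N" for a y
      using that g by - (rule inj, auto simp: module_hom_smult[OF assms(3)])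
  qed (use g in auto)
qed

lemma injective_resolutionD:
  assumes "injective_resolution R N E \<epsilon> d"
  shows "module R N" "injective_module R (E i)" "module R (E i)" "\<epsilon> \<in> module_hom R N (E 0)"
    "d i \<in> module_hom R (E i) (E (Suc i))" "inj_on \<epsilon> (carrier N)"
    "\<epsilon> ` carrier N = a_kernel (E 0) (E 1) (d 0)"
    "d i ` carrier (E i) = a_kernel (E (Suc i)) (E (Suc (Suc i))) (d (Suc i))"
proof -
  note a = assms[unfolded injective_resolution_def]
  show "module R N" "injective_module R (E i)" "\<epsilon> \<in> module_hom R N (E 0)"
    "d i \<in> module_hom R (E i) (E (Suc i))" "inj_on \<epsilon> (carrier N)"
    "\<epsilon> ` carrier N = a_kernel (E 0) (E 1) (d 0)"
    "d i ` carrier (E i) = a_kernel (E (Suc i)) (E (Suc (Suc i))) (d (Suc i))"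
    using a by blast+
  then show "module R (E i)" by (intro injective_module_module)
qed

lemma injective_resolutionI:
  assumes "module R N" "\<And>i. injective_module R (E i)" "\<epsilon> \<in> module_hom R N (E 0)"
    "\<And>i. d i \<in> module_hom R (E i) (E (Suc i))" "inj_on \<epsilon> (carrier N)"
    "\<epsilon> ` carrier N = a_kernel (E 0) (E 1) (d 0)"
    "\<And>i. d i ` carrier (E i) = a_kernel (E (Suc i)) (E (Suc (Suc i))) (d (Suc i))"
  shows "injective_resolution R N E \<epsilon> d"
  unfolding injective_resolution_def by (intro conjI allI assms)

text \<open>The image of \<open>d 0\<close> is the cokernel of \<open>\<epsilon>\<close>, and the
  shifted complex resolves it with a bound that is smaller by one. For \<open>k = 0\<close> the
  vanishing of \<open>E 1\<close> makes \<open>\<epsilon>\<close> surjective onto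
  \<open>E 0\<close>.\<close>

lemma injective_resolution_injdim_le:
  fixes N :: "('r, 'e) module" and E :: "nat \<Rightarrow> ('r, 'e) module"
  assumes "injective_resolution R N E \<epsilon> d" "\<And>i. i > k \<Longrightarrow> carrier (E i) = {\<zero>\<^bsub>E i\<^esub>}"
  shows "injdim_le R k N"
  using assms
proof (induction k arbitrary: N E \<epsilon> d)
  case 0
  note res = injective_resolutionD[OF 0(1)]
  note E = res(3) and N = res(1) and eps = res(4,6)
  have "d 0 x = \<zero>\<^bsub>E 1\<^esub>" if "x \<in> carrier (E 0)" for x
    using module_hom_closed[OF res(5) that] 0(2)[of 1] by auto
  then have "\<epsilon> ` carrier N = carrier (E 0)" unfolding res(7) by (auto simp: a_kernel_def')
  then have b: "bij_betw \<epsilon> (carrier N) (carrier (E 0))" using eps by (auto simp: bij_betw_def)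
  show ?case
    using injective_module_retract[OF res(2) N eps(1) module_hom_inv_into[OF N E eps(1) b]]
      inv_into_f_f[OF eps(2)] by simp
next
  case (Suc k)
  note res = injective_resolutionD[OF Suc.prems(1)]
  note E = res(3) and d = res(5)
  define K where "K = (E 1)\<lparr>carrier := d 0 ` carrier (E 0)\<rparr>"
  have K: "module R K"
    unfolding K_def using image_submodule[OF E E d, of 0] by (intro submodule_is_module'[OF E]) simp
  have Ks: "carrier K = d 0 ` carrier (E 0)" "\<zero>\<^bsub>K\<^esub> = \<zero>\<^bsub>E 1\<^esub>"
    "\<And>x y. x \<oplus>\<^bsub>K\<^esub> y = x \<oplus>\<^bsub>E 1\<^esub> y" "\<And>a x. a \<odot>\<^bsub>K\<^esub> x = a \<odot>\<^bsub>E 1\<^esub> x"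
    by (auto simp: K_def)
  have dK: "d 0 \<in> module_hom R (E 0) K"
    using d[of 0] by (auto simp: module_hom_def hom_def Ks)
  have "(\<lambda>x. x) \<in> module_hom R K (E 1)"
    using module_hom_closed[OF d] by (auto intro!: module_homI simp: Ks)
  then have "injective_resolution R K (\<lambda>i. E (Suc i)) (\<lambda>x. x) (\<lambda>i. d (Suc i))"
    using K res(2,5) res(8)[of 0] res(8)
    unfolding injective_resolution_def Ks(1) by (simp add: inj_on_def)
  then have "injdim_le R k K" by (rule Suc.IH) (use Suc.prems(2) in auto)
  moreover have "d 0 x = \<zero>\<^bsub>K\<^esub> \<longleftrightarrow> x \<in> \<epsilon> ` carrier N" if "x \<in> carrier (E 0)" for x
    unfolding res(7) using that by (auto simp: a_kernel_def' Ks)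
  ultimately show ?case
    using Ks(1) by (intro injdim_le_SucI[OF res(1,2,4,6) dK]) simp_all
qed

text \<open>Splices \<open>I\<close> in front of a resolution of the cokernel \<open>K\<close>; the
  new first differential is \<open>\<epsilon> \<circ> p\<close>.\<close>

lemma injdim_le_injective_resolution:
  fixes N :: "('r, 'e) module"
  assumes "injdim_le R k N"
  shows "\<exists>(E :: nat \<Rightarrow> ('r, 'e) module) \<epsilon> d. injective_resolution R N E \<epsilon> d \<and>
    (\<forall>i>k. carrier (E i) = {\<zero>\<^bsub>E i\<^esub>})"
  using assms
proof (induction k arbitrary: N)
  case 0
  then have inj: "injective_module R N" and N: "module R N"
    by (auto simp: injective_module_module)
  let ?Z = "N\<lparr>carrier := {\<zero>\<^bsub>N\<^esub>}\<rparr>"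
  let ?E = "\<lambda>i. if i = 0 then N else ?Z" and ?d = "\<lambda>i x. if i = 0 then \<zero>\<^bsub>N\<^esub> else x :: 'e"
  have Z: "module R ?Z" by (rule zero_module[OF N])
  have "injective_module R ?Z" by (rule injective_zero_module[OF Z]) simp
  moreover have "(\<lambda>_. \<zero>\<^bsub>N\<^esub>) \<in> module_hom R N ?Z" using module_hom_const_zero[OF Z] by simp
  ultimately have "injective_resolution R N ?E (\<lambda>x. x) (\<lambda>i. if i = 0 then \<lambda>x. \<zero>\<^bsub>N\<^esub> else (\<lambda>x. \<zero>\<^bsub>N\<^esub>))"
    using inj N module_hom_id[of R N] module_hom_const_zero[OF Z, of ?Z] module_zero_closed[OF N]
    by (auto simp: injective_resolution_def a_kernel_def')
  then show ?case by (intro exI[of _ ?E] exI conjI) auto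
next
  case (Suc k)
  then obtain I K :: "('r, 'e) module" and i p where
    N: "module R N" and I: "injective_module R I" "i \<in> module_hom R N I" "inj_on i (carrier N)"
    "p \<in> module_hom R I K" "p ` carrier I = carrier K"
    "\<forall>x\<in>carrier I. p x = \<zero>\<^bsub>K\<^esub> \<longleftrightarrow> x \<in> i ` carrier N" "injdim_le R k K"
    unfolding injdim_le.simps by blast
  obtain E :: "nat \<Rightarrow> ('r, 'e) module" and \<epsilon> d where
    res: "injective_resolution R K E \<epsilon> d" and z: "\<forall>i>k. carrier (E i) = {\<zero>\<^bsub>E i\<^esub>}"
    using Suc.IH[OF I(7)] by blast
  note r = injective_resolutionD[OF res]
  note E = r(3) and K = r(1) and eps = r(4,6)
  let ?E = "\<lambda>n. case n of 0 \<Rightarrow> I | Suc n \<Rightarrow> E n"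
  let ?d = "\<lambda>n. case n of 0 \<Rightarrow> (\<lambda>x. \<epsilon> (p x)) | Suc n \<Rightarrow> d n"
  have "(\<lambda>x. \<epsilon> (p x)) \<in> module_hom R I (E 0)" by (rule module_hom_comp[OF I(4) eps(1)])
  moreover have "i ` carrier N = a_kernel I (E 0) (\<lambda>x. \<epsilon> (p x))"
  proof -
    have "\<epsilon> (p x) = \<zero>\<^bsub>E 0\<^esub> \<longleftrightarrow> x \<in> i ` carrier N" if x: "x \<in> carrier I" for x
    proof -
      have "p x \<in> carrier K" using module_hom_closed[OF I(4) x] .
      then have "\<epsilon> (p x) = \<zero>\<^bsub>E 0\<^esub> \<longleftrightarrow> p x = \<zero>\<^bsub>K\<^esub>"
        using module_hom_zero[OF K E eps(1)] inj_on_eq_iff[OF eps(2) _ module_zero_closed[OF K]] by metis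
      then show ?thesis using I(6) x by simp
    qed
    then show ?thesis using module_hom_closed[OF I(2)] by (auto simp: a_kernel_def')
  qed
  moreover have "(\<lambda>x. \<epsilon> (p x)) ` carrier I = a_kernel (E 0) (E 1) (d 0)"
    using r(7) I(5) by (metis image_image)
  ultimately have "injective_resolution R N ?E i ?d"
    using N I(1-3) r(2,5,8) by (intro injective_resolutionI) (simp_all split: nat.split)
  moreover have "\<forall>j>Suc k. carrier (?E j) = {\<zero>\<^bsub>?E j\<^esub>}" using z by (auto split: nat.split)
  ultimately show ?case by blast
qed

text \<open>A pair of subsets of \<open>'b\<close> is a subset of \<open>'b + 'b\<close>, which has
  the cardinality of the infinite \<open>'b\<close>. This makes the type of the resolutions in
  \<open>injdim\<close> closed under products.\<close>

lemma ex_inj_square_powerset: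
  assumes "infinite (UNIV :: 'b set)"
  shows "\<exists>j :: 'b set \<times> 'b set \<Rightarrow> 'b set. inj j"
proof -
  have "\<exists>h. bij_betw h ((UNIV :: 'b set) <+> (UNIV :: 'b set)) (UNIV :: 'b set)"
    unfolding card_of_ordIso by (rule card_of_Plus_infinite1[OF assms ordIso_imp_ordLeq[OF card_of_refl]])
  then obtain h :: "'b + 'b \<Rightarrow> 'b" where h: "inj h"
    by (auto simp: bij_betw_def UNIV_Plus_UNIV)
  have "inj (\<lambda>(A, B). h ` (A <+> B))"
  proof (rule injI, clarify)
    fix A B C D :: "'b set" assume "h ` (A <+> B) = h ` (C <+> D)"
    then have "A <+> B = C <+> D" using h by (simp add: inj_image_eq_iff)
    then have "Inl -` (A <+> B) = Inl -` (C <+> D)" "Inr -` (A <+> B) = Inr -` (C <+> D)" by simp_all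
    moreover have "Inl -` (S <+> T) = S" "Inr -` (S <+> T) = T" for S T :: "'b set" by auto
    ultimately show "A = C \<and> B = D" by simp
  qed
  then show ?thesis by blast
qed

text \<open>As \<open>c\<close> is a unit, the sum identity makes \<open>N\<close> a retract of a
  power of \<open>A\<close>. Every resolution of \<open>A\<close> that vanishes above degree
  \<open>k\<close> therefore yields one of \<open>N\<close>, and the infimum for \<open>N\<close>
  runs over at least as many bounds.\<close>

theorem injdim_le_of_factorization:
  fixes A N :: "('r, 'a) module"
  assumes A: "module R A" and N: "module R N" and J: "finite J"
    and f: "\<And>i. i \<in> J \<Longrightarrow> f i \<in> module_hom R N A" and g: "\<And>i. i \<in> J \<Longrightarrow> g i \<in> module_hom R A N"
    and c: "c \<in> carrier R" "c' \<in> carrier R" "c' \<otimes>\<^bsub>R\<^esub> c = \<one>\<^bsub>R\<^esub>"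
    and sum: "\<And>x. x \<in> carrier N \<Longrightarrow> finsum N (\<lambda>i. g i (f i x)) J = c \<odot>\<^bsub>N\<^esub> x"
  shows "injdim R N \<le> injdim R A"
proof (cases "carrier N = {\<zero>\<^bsub>N\<^esub>}")
  case True
  then show ?thesis by (simp add: injdim_def)
next
  case False
  interpret N: module R N by (rule N)
  interpret A: module R A by (rule A)
  have inv: "c' \<odot>\<^bsub>N\<^esub> (c \<odot>\<^bsub>N\<^esub> x) = x" if "x \<in> carrier N" for x
    using that c by (simp add: N.smult_assoc1[symmetric])
  \<comment> \<open>Since \<open>injdim\<close> of the zero module is minus infinity, a vanishing
    \<open>A\<close> must force \<open>N\<close> to vanish.\<close>
  have Anz: "carrier A \<noteq> {\<zero>\<^bsub>A\<^esub>}"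
  proof
    assume Az: "carrier A = {\<zero>\<^bsub>A\<^esub>}"
    have "x = \<zero>\<^bsub>N\<^esub>" if x: "x \<in> carrier N" for x
    proof -
      have "g i (f i x) = \<zero>\<^bsub>N\<^esub>" if i: "i \<in> J" for i
        using module_hom_closed[OF f[OF i] x] module_hom_zero[OF A N g[OF i]] Az by auto
      then have "finsum N (\<lambda>i. g i (f i x)) J = finsum N (\<lambda>i. \<zero>\<^bsub>N\<^esub>) J"
        by (intro N.M.finsum_cong') auto
      then have "c \<odot>\<^bsub>N\<^esub> x = \<zero>\<^bsub>N\<^esub>" using sum[OF x] by simp
      then show ?thesis using inv[OF x] c by simp
    qed
    then show False using False by auto
  qed
  \<comment> \<open>\<open>injdim_le\<close> relates modules in one type only, so \<open>A\<close>
    and \<open>N\<close> are moved into the type of the resolutions as singletons.\<close>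
  let ?e = "\<lambda>a :: 'a. {Inr (Inr a)} :: (nat + 'r + 'a) set"
  have inje: "inj_on ?e S" for S by (auto simp: inj_on_def)
  have "infinite (UNIV :: (nat + 'r + 'a) set)"
    by (metis finite_Plus_UNIV_iff infinite_UNIV_nat)
  then obtain j :: "(nat + 'r + 'a) set \<times> (nat + 'r + 'a) set \<Rightarrow> (nat + 'r + 'a) set" where j: "inj j"
    using ex_inj_square_powerset by blast
  have step: "\<exists>(E :: nat \<Rightarrow> ('r, (nat + 'r + 'a) set) module) \<epsilon> d.
      injective_resolution R N E \<epsilon> d \<and> (\<forall>i>k. carrier (E i) = {\<zero>\<^bsub>E i\<^esub>})"
    if res: "injective_resolution R A E \<epsilon> d" and z: "\<forall>i>k. carrier (E i) = {\<zero>\<^bsub>E i\<^esub>}"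
    for k and E :: "nat \<Rightarrow> ('r, (nat + 'r + 'a) set) module" and \<epsilon> d
  proof -
    let ?A = "transport ?e A" and ?N = "transport ?e N"
    have tA: "module R ?A" "inv_into (carrier A) ?e \<in> module_hom R ?A A" "?e \<in> module_hom R A ?A"
      and tN: "module R ?N" "inv_into (carrier N) ?e \<in> module_hom R ?N N" "?e \<in> module_hom R N ?N"
      using A N inje by (auto intro!: transport_module transport_inv_hom transport_hom)
    have eN: "inv_into (carrier N) ?e (?e x) = x" if "x \<in> carrier N" for x
      using that by (rule inv_into_f_f[OF inje])
    have eA: "inv_into (carrier A) ?e (?e x) = x" if "x \<in> carrier A" for x
      using that by (rule inv_into_f_f[OF inje])
    have "injective_resolution R ?A E (\<lambda>x. \<epsilon> (inv_into (carrier A) ?e x)) d"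
    proof -
      have im: "inv_into (carrier A) ?e ` carrier ?A = carrier A"
        using eA by (force simp: transport_simps image_image)
      have "inj_on (\<lambda>x. \<epsilon> (inv_into (carrier A) ?e x)) (carrier ?A)"
        using injective_resolutionD(6)[OF res] eA by (auto simp: inj_on_def transport_simps)
      moreover have "(\<lambda>x. \<epsilon> (inv_into (carrier A) ?e x)) ` carrier ?A = \<epsilon> ` carrier A"
        using im by (metis image_image)
      ultimately show ?thesis
        using injective_resolutionD[OF res] tA(1) module_hom_comp[OF tA(2) injective_resolutionD(4)[OF res]]
        by (intro injective_resolutionI) simp_all
    qed
    then have "injdim_le R k ?A" by (rule injective_resolution_injdim_le) (use z in auto)
    moreover have "(\<lambda>x. ?e (f i (inv_into (carrier N) ?e x))) \<in> module_hom R ?N ?A"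
      "(\<lambda>x. ?e (g i (inv_into (carrier A) ?e x))) \<in> module_hom R ?A ?N" if "i \<in> J" for i
      using module_hom_comp[OF module_hom_comp[OF tN(2) f[OF that]] tA(3)]
        module_hom_comp[OF module_hom_comp[OF tA(2) g[OF that]] tN(3)] .
    ultimately obtain B :: "('r, (nat + 'r + 'a) set) module" and F G where
      B: "injdim_le R k B" "F \<in> module_hom R ?N B" "G \<in> module_hom R B ?N"
      "\<forall>x\<in>carrier ?N. G (F x) = finsum ?N (\<lambda>i. ?e (g i (inv_into (carrier A) ?e
         (?e (f i (inv_into (carrier N) ?e x)))))) J"
      using injdim_le_power[OF j _ tN(1) J, of k ?A
          "\<lambda>i x. ?e (f i (inv_into (carrier N) ?e x))" "\<lambda>i x. ?e (g i (inv_into (carrier A) ?e x))"]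
      by blast
    have GF: "c' \<odot>\<^bsub>?N\<^esub> G (F x) = x" if x: "x \<in> carrier ?N" for x
    proof -
      obtain y where y: "y \<in> carrier N" "x = ?e y" using x by (auto simp: transport_simps)
      have fy: "f i y \<in> carrier A" "g i (f i y) \<in> carrier N" if "i \<in> J" for i
        using y f[OF that] g[OF that] by (auto simp: module_hom_closed)
      have "G (F x) = finsum ?N (\<lambda>i. ?e (g i (f i y))) J"
        unfolding B(4)[rule_format, OF x] unfolding y(2) eN[OF y(1)]
        using fy eA module_hom_closed[OF tN(3)]
        by (intro abelian_monoid.finsum_cong'[OF abelian_group.axioms(1)[OF module_abelian_group[OF tN(1)]]]) auto
      also have "\<dots> = ?e (finsum N (\<lambda>i. g i (f i y)) J)"
        using fy tN module_hom_closed[OF tN(3)] module_hom_add[OF tN(3)] J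
        by (intro additive_finsum[symmetric] module_abelian_group) (auto intro: N)
      also have "\<dots> = ?e (c \<odot>\<^bsub>N\<^esub> y)" using sum[OF y(1)] by simp
      finally show ?thesis
        using module_hom_smult[OF tN(3) c(2), of "c \<odot>\<^bsub>N\<^esub> y"] inv[OF y(1)] y c by simp
    qed
    have "injdim_le R k ?N"
      by (rule injdim_le_retract[OF j B(1) tN(1) B(2) module_hom_comp[OF B(3) module_hom_smult_const[OF tN(1) c(2)]] GF])
    from injdim_le_injective_resolution[OF this]
    obtain E' :: "nat \<Rightarrow> ('r, (nat + 'r + 'a) set) module" and \<epsilon>' d' where
      r: "injective_resolution R ?N E' \<epsilon>' d'" "\<forall>i>k. carrier (E' i) = {\<zero>\<^bsub>E' i\<^esub>}" by blast
    have "injective_resolution R N E' (\<lambda>x. \<epsilon>' (?e x)) d'"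
    proof -
      have "inj_on (\<lambda>x. \<epsilon>' (?e x)) (carrier N)"
        using injective_resolutionD(6)[OF r(1)] by (auto simp: inj_on_def transport_simps)
      moreover have "(\<lambda>x. \<epsilon>' (?e x)) ` carrier N = \<epsilon>' ` carrier ?N"
        by (simp add: transport_simps image_image)
      ultimately show ?thesis
        using injective_resolutionD[OF r(1)] N module_hom_comp[OF tN(3) injective_resolutionD(4)[OF r(1)]]
        by (intro injective_resolutionI) simp_all
    qed
    then show ?thesis using r(2) by blast
  qed
  show ?thesis
    unfolding injdim_def if_not_P[OF False] if_not_P[OF Anz]
    by (rule INF_superset_mono) (use step in blast)+
qed

section \<open>Bigraded modules\<close>

text \<open>These rules would split a quantifier over degrees into two, and the fact would no longer apply to a fixed degree \<open>e\<close>.\<close>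

declare split_paired_All [simp del] split_paired_Ex [simp del]

lemma additive_subgroupI_minus:
  assumes "abelian_group G" "H \<subseteq> carrier G" "\<zero>\<^bsub>G\<^esub> \<in> H"
    "\<And>x y. x \<in> H \<Longrightarrow> y \<in> H \<Longrightarrow> x \<ominus>\<^bsub>G\<^esub> y \<in> H"
  shows "additive_subgroup H G"
proof -
  interpret G: abelian_group G by fact
  have inv: "\<ominus>\<^bsub>G\<^esub> x \<in> H" if "x \<in> H" for x
    using assms(4)[OF assms(3) that] that assms(2) by (simp add: G.minus_eq subset_eq)
  have "x \<oplus>\<^bsub>G\<^esub> y \<in> H" if "x \<in> H" "y \<in> H" for x y
  proof -
    have "x \<oplus>\<^bsub>G\<^esub> y = x \<ominus>\<^bsub>G\<^esub> (\<ominus>\<^bsub>G\<^esub> y)"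
      using that assms(2) by (simp add: G.minus_eq subset_eq)
    then show ?thesis using assms(4) inv that by simp
  qed
  then show ?thesis
    using assms(2,3) inv by (intro additive_subgroupI G.add.subgroupI) (auto simp: a_inv_def)
qed

lemma bigraded_moduleD:
  assumes "bigraded_module R M"
  shows "module R M" "additive_subgroup (homog M e) M" "homog M e \<subseteq> carrier M" "\<zero>\<^bsub>M\<^esub> \<in> homog M e"
    "x \<in> homog M e \<Longrightarrow> x \<in> carrier M"
    "x \<in> homog M e \<Longrightarrow> y \<in> homog M e \<Longrightarrow> x \<oplus>\<^bsub>M\<^esub> y \<in> homog M e"
    "x \<in> homog M e \<Longrightarrow> y \<in> homog M e \<Longrightarrow> x \<ominus>\<^bsub>M\<^esub> y \<in> homog M e"
    "a \<in> homog R e' \<Longrightarrow> x \<in> homog M e \<Longrightarrow> a \<odot>\<^bsub>M\<^esub> x \<in> homog M (e' + e)"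
proof -
  show M: "module R M" "additive_subgroup (homog M e) M"
    and "a \<in> homog R e' \<Longrightarrow> x \<in> homog M e \<Longrightarrow> a \<odot>\<^bsub>M\<^esub> x \<in> homog M (e' + e)"
    using assms unfolding bigraded_module_def by blast+
  interpret A: additive_subgroup "homog M e" M by (rule M(2))
  interpret M: module R M by (rule M(1))
  show "homog M e \<subseteq> carrier M" "\<zero>\<^bsub>M\<^esub> \<in> homog M e" "x \<in> homog M e \<Longrightarrow> x \<in> carrier M"
    "x \<in> homog M e \<Longrightarrow> y \<in> homog M e \<Longrightarrow> x \<oplus>\<^bsub>M\<^esub> y \<in> homog M e"
    using A.a_subset by auto
  show "x \<in> homog M e \<Longrightarrow> y \<in> homog M e \<Longrightarrow> x \<ominus>\<^bsub>M\<^esub> y \<in> homog M e"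
    unfolding M.M.minus_eq by (metis A.a_closed A.a_inv_closed M.M.abelian_group_axioms)
qed

lemma homog_finsum:
  assumes "bigraded_module R M" "finite A" "\<And>i. i \<in> A \<Longrightarrow> f i \<in> homog M e"
  shows "finsum M f A \<in> homog M e"
proof -
  interpret M: module R M by (rule bigraded_moduleD[OF assms(1)])
  show ?thesis using assms(2,3)
  proof (induction A rule: finite_induct)
    case empty
    then show ?case using bigraded_moduleD(4)[OF assms(1)] by simp
  next
    case (insert i A)
    then have "finsum M f (insert i A) = f i \<oplus>\<^bsub>M\<^esub> finsum M f A"
      using insert bigraded_moduleD(3)[OF assms(1), of e] by (intro M.M.finsum_insert) blast+
    then show ?case using insert bigraded_moduleD(6)[OF assms(1)] by simp
  qed
qed

definition hcomp :: "('r, 'a) bigraded \<Rightarrow> 'a \<Rightarrow> int \<times> int \<Rightarrow> 'a" where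
  "hcomp M x = (THE f. (\<forall>e. f e \<in> homog M e) \<and> finite {e. f e \<noteq> \<zero>\<^bsub>M\<^esub>} \<and>
     x = finsum M f {e. f e \<noteq> \<zero>\<^bsub>M\<^esub>})"

lemma finsum_support:
  assumes "abelian_group M" "finite A" "\<And>e. e \<in> A \<Longrightarrow> f e \<in> carrier M" "{e. f e \<noteq> \<zero>\<^bsub>M\<^esub>} \<subseteq> A"
  shows "finsum M f {e. f e \<noteq> \<zero>\<^bsub>M\<^esub>} = finsum M f A"
proof -
  interpret M: abelian_group M by fact
  show ?thesis using assms by (intro M.add.finprod_mono_neutral_cong_left) auto
qed

context
  fixes R :: "('r, 'r) bigraded" and M :: "('r, 'a) bigraded"
  assumes M: "bigraded_module R M"
begin

interpretation M: module R M by (rule bigraded_moduleD[OF M])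

lemma hcomp_props:
  assumes "x \<in> carrier M"
  shows "hcomp M x e \<in> homog M e" "finite {e. hcomp M x e \<noteq> \<zero>\<^bsub>M\<^esub>}"
    "x = finsum M (hcomp M x) {e. hcomp M x e \<noteq> \<zero>\<^bsub>M\<^esub>}" "hcomp M x e \<in> carrier M"
proof -
  have "\<exists>!f. (\<forall>e. f e \<in> homog M e) \<and> finite {e. f e \<noteq> \<zero>\<^bsub>M\<^esub>} \<and> x = finsum M f {e. f e \<noteq> \<zero>\<^bsub>M\<^esub>}"
    using M assms unfolding bigraded_module_def by blast
  from theI'[OF this] show "hcomp M x e \<in> homog M e" "finite {e. hcomp M x e \<noteq> \<zero>\<^bsub>M\<^esub>}"
    "x = finsum M (hcomp M x) {e. hcomp M x e \<noteq> \<zero>\<^bsub>M\<^esub>}"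
    unfolding hcomp_def by blast+
  then show "hcomp M x e \<in> carrier M" using bigraded_moduleD(5)[OF M] by blast
qed

lemma hcomp_sum:
  assumes "x \<in> carrier M" "finite A" "{e. hcomp M x e \<noteq> \<zero>\<^bsub>M\<^esub>} \<subseteq> A"
  shows "finsum M (hcomp M x) A = x"
proof -
  have "finsum M (hcomp M x) A = finsum M (hcomp M x) {e. hcomp M x e \<noteq> \<zero>\<^bsub>M\<^esub>}"
    using finsum_support[OF M.M.abelian_group_axioms assms(2) _ assms(3)] hcomp_props(4)[OF assms(1)] by simp
  also have "\<dots> = x" by (rule hcomp_props(3)[OF assms(1), symmetric])
  finally show ?thesis .
qed

lemma hcomp_unique:
  assumes "finite A" "\<And>e. f e \<in> homog M e" "\<And>e. e \<notin> A \<Longrightarrow> f e = \<zero>\<^bsub>M\<^esub>"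
  shows "hcomp M (finsum M f A) = f"
proof -
  let ?x = "finsum M f A"
  have f: "f e \<in> carrier M" for e using assms(2) bigraded_moduleD(5)[OF M] by blast
  then have x: "?x \<in> carrier M" by (intro M.M.finsum_closed) auto
  have "{e. f e \<noteq> \<zero>\<^bsub>M\<^esub>} \<subseteq> A" using assms(3) by auto
  then have "?x = finsum M f {e. f e \<noteq> \<zero>\<^bsub>M\<^esub>}" "finite {e. f e \<noteq> \<zero>\<^bsub>M\<^esub>}"
    using finsum_support[OF M.M.abelian_group_axioms assms(1), of f] f finite_subset[OF _ assms(1)] by auto
  moreover have "\<exists>!f. (\<forall>e. f e \<in> homog M e) \<and> finite {e. f e \<noteq> \<zero>\<^bsub>M\<^esub>} \<and> ?x = finsum M f {e. f e \<noteq> \<zero>\<^bsub>M\<^esub>}"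
    using M x unfolding bigraded_module_def by blast
  ultimately show ?thesis unfolding hcomp_def using assms(2) by (intro the1_equality) blast+
qed

lemma hcomp_homog:
  assumes "x \<in> homog M e"
  shows "hcomp M x = (\<lambda>e'. if e' = e then x else \<zero>\<^bsub>M\<^esub>)"
proof -
  have "x \<in> carrier M" using assms bigraded_moduleD(5)[OF M] by blast
  then have "finsum M (\<lambda>e'. if e' = e then x else \<zero>\<^bsub>M\<^esub>) {e} = x"
    by (subst M.M.finsum_insert) auto
  then show ?thesis
    using hcomp_unique[of "{e}" "\<lambda>e'. if e' = e then x else \<zero>\<^bsub>M\<^esub>"] assms bigraded_moduleD(4)[OF M] by auto
qed

lemma hcomp_add:
  assumes "x \<in> carrier M" "y \<in> carrier M"
  shows "hcomp M (x \<oplus>\<^bsub>M\<^esub> y) = (\<lambda>e. hcomp M x e \<oplus>\<^bsub>M\<^esub> hcomp M y e)"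
proof -
  let ?A = "{e. hcomp M x e \<noteq> \<zero>\<^bsub>M\<^esub>} \<union> {e. hcomp M y e \<noteq> \<zero>\<^bsub>M\<^esub>}"
  have A: "finite ?A" using hcomp_props(2)[OF assms(1)] hcomp_props(2)[OF assms(2)] by simp
  have "finsum M (\<lambda>e. hcomp M x e \<oplus>\<^bsub>M\<^esub> hcomp M y e) ?A = finsum M (hcomp M x) ?A \<oplus>\<^bsub>M\<^esub> finsum M (hcomp M y) ?A"
    using hcomp_props(4) assms by (intro M.M.finsum_addf) auto
  also have "\<dots> = x \<oplus>\<^bsub>M\<^esub> y" using hcomp_sum[OF assms(1) A] hcomp_sum[OF assms(2) A] by auto
  finally show ?thesis
    using hcomp_unique[OF A, of "\<lambda>e. hcomp M x e \<oplus>\<^bsub>M\<^esub> hcomp M y e"] hcomp_props(1) assms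
      bigraded_moduleD(6)[OF M] by auto
qed

text \<open>Additive statements can be checked on homogeneous elements, because every element is a
  finite sum of these.\<close>

lemma bigraded_induct:
  assumes "x \<in> carrier M" "\<And>e x. x \<in> homog M e \<Longrightarrow> P x"
    "\<And>x y. x \<in> carrier M \<Longrightarrow> y \<in> carrier M \<Longrightarrow> P x \<Longrightarrow> P y \<Longrightarrow> P (x \<oplus>\<^bsub>M\<^esub> y)"
  shows "P x"
proof -
  have "P (finsum M (hcomp M x) A) \<and> finsum M (hcomp M x) A \<in> carrier M" if "finite A" for A
    using that
  proof (induction A rule: finite_induct)
    case empty
    then show ?case using assms(2)[OF bigraded_moduleD(4)[OF M]] by simp
  next
    case (insert e A)
    have "finsum M (hcomp M x) (insert e A) = hcomp M x e \<oplus>\<^bsub>M\<^esub> finsum M (hcomp M x) A"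
      using insert hcomp_props(4)[OF assms(1)] by (intro M.M.finsum_insert) auto
    then show ?case
      using insert assms(3) assms(2)[OF hcomp_props(1)[OF assms(1)]] hcomp_props(4)[OF assms(1)] by simp
  qed
  from this[OF hcomp_props(2)[OF assms(1)]] show ?thesis
    unfolding hcomp_sum[OF assms(1) hcomp_props(2)[OF assms(1)] order_refl] by blast
qed

text \<open>The Euler identity has a different scalar in each degree. \<open>W\<close> joins these
  scalars into one additive map, so that the defect of the identity is defined on all of
  \<open>M\<close>.\<close>

lemma weight_operator:
  assumes "\<And>e. w e \<in> carrier R"
  obtains W where "\<And>x. x \<in> carrier M \<Longrightarrow> W x \<in> carrier M"
    "\<And>x y. x \<in> carrier M \<Longrightarrow> y \<in> carrier M \<Longrightarrow> W (x \<oplus>\<^bsub>M\<^esub> y) = W x \<oplus>\<^bsub>M\<^esub> W y"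
    "\<And>e x. x \<in> homog M e \<Longrightarrow> W x = w e \<odot>\<^bsub>M\<^esub> x"
proof -
  define W where "W = (\<lambda>x. finsum M (\<lambda>e. w e \<odot>\<^bsub>M\<^esub> hcomp M x e) {e. hcomp M x e \<noteq> \<zero>\<^bsub>M\<^esub>})"
  \<comment> \<open>The sum may run over any finite set of degrees that contains the support, so two
    elements can share one index set.\<close>
  have W: "W x = finsum M (\<lambda>e. w e \<odot>\<^bsub>M\<^esub> hcomp M x e) A"
    if "x \<in> carrier M" "finite A" "{e. hcomp M x e \<noteq> \<zero>\<^bsub>M\<^esub>} \<subseteq> A" for x A
    unfolding W_def using that hcomp_props(4)[OF that(1)] assms
    by (intro M.M.add.finprod_mono_neutral_cong_left) auto
  show thesis
  proof (rule that[of W])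
    fix x y assume xy: "x \<in> carrier M" "y \<in> carrier M"
    show "W x \<in> carrier M"
      unfolding W_def using hcomp_props(4)[OF xy(1)] assms by (intro M.M.finsum_closed) auto
    let ?A = "{e. hcomp M x e \<noteq> \<zero>\<^bsub>M\<^esub>} \<union> {e. hcomp M y e \<noteq> \<zero>\<^bsub>M\<^esub>}"
    have A: "finite ?A" using hcomp_props(2)[OF xy(1)] hcomp_props(2)[OF xy(2)] by simp
    have "W (x \<oplus>\<^bsub>M\<^esub> y) = finsum M (\<lambda>e. w e \<odot>\<^bsub>M\<^esub> hcomp M x e \<oplus>\<^bsub>M\<^esub> w e \<odot>\<^bsub>M\<^esub> hcomp M y e) ?A"
    proof (subst W[of _ ?A])
      show "{e. hcomp M (x \<oplus>\<^bsub>M\<^esub> y) e \<noteq> \<zero>\<^bsub>M\<^esub>} \<subseteq> ?A" using hcomp_add[OF xy] by auto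
      show "finsum M (\<lambda>e. w e \<odot>\<^bsub>M\<^esub> hcomp M (x \<oplus>\<^bsub>M\<^esub> y) e) ?A =
        finsum M (\<lambda>e. w e \<odot>\<^bsub>M\<^esub> hcomp M x e \<oplus>\<^bsub>M\<^esub> w e \<odot>\<^bsub>M\<^esub> hcomp M y e) ?A"
        using hcomp_add[OF xy] hcomp_props(4)[OF xy(1)] hcomp_props(4)[OF xy(2)] assms
        by (intro M.M.finsum_cong') (auto simp: M.smult_r_distr)
      show "x \<oplus>\<^bsub>M\<^esub> y \<in> carrier M" using xy by simp
    qed (rule A)
    also have "\<dots> = W x \<oplus>\<^bsub>M\<^esub> W y"
      unfolding W[OF xy(1) A Un_upper1] W[OF xy(2) A Un_upper2]
      using hcomp_props(4)[OF xy(1)] hcomp_props(4)[OF xy(2)] assms by (intro M.M.finsum_addf) auto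
    finally show "W (x \<oplus>\<^bsub>M\<^esub> y) = W x \<oplus>\<^bsub>M\<^esub> W y" .
  next
    fix e x assume x: "x \<in> homog M e"
    then have "x \<in> carrier M" using bigraded_moduleD(5)[OF M] by blast
    then have "W x = finsum M (\<lambda>e. w e \<odot>\<^bsub>M\<^esub> hcomp M x e) {e}"
      using hcomp_homog[OF x] by (intro W) auto
    also have "\<dots> = w e \<odot>\<^bsub>M\<^esub> x"
      using hcomp_homog[OF x] \<open>x \<in> carrier M\<close> assms by (subst M.M.finsum_insert) auto
    finally show "W x = w e \<odot>\<^bsub>M\<^esub> x" .
  qed
qed

end

text \<open>Uniqueness of the decomposition comes from the additive projections
  \<open>\<pi> e\<close>: applied to any decomposition of \<open>x\<close>, they leave exactly its
  term of degree \<open>e\<close>.\<close>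

lemma bigraded_moduleI:
  fixes R :: "('r, 'r) bigraded" and M :: "('r, 'a) bigraded"
  assumes M: "module R M" and sub: "\<And>e. additive_subgroup (homog M e) M"
    and cl: "\<And>e x. x \<in> carrier M \<Longrightarrow> \<pi> e x \<in> homog M e"
    and fin: "\<And>x. x \<in> carrier M \<Longrightarrow> \<exists>A. finite A \<and> (\<forall>e. e \<notin> A \<longrightarrow> \<pi> e x = \<zero>\<^bsub>M\<^esub>) \<and> x = finsum M (\<lambda>e. \<pi> e x) A"
    and add: "\<And>e x y. x \<in> carrier M \<Longrightarrow> y \<in> carrier M \<Longrightarrow> \<pi> e (x \<oplus>\<^bsub>M\<^esub> y) = \<pi> e x \<oplus>\<^bsub>M\<^esub> \<pi> e y"
    and proj: "\<And>e e' x. x \<in> homog M e' \<Longrightarrow> \<pi> e x = (if e = e' then x else \<zero>\<^bsub>M\<^esub>)"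
    and smult: "\<And>e e' a x. a \<in> homog R e \<Longrightarrow> x \<in> homog M e' \<Longrightarrow> a \<odot>\<^bsub>M\<^esub> x \<in> homog M (e + e')"
  shows "bigraded_module R M"
  unfolding bigraded_module_def
proof (intro conjI allI ballI M sub smult)
  interpret M: module R M by (rule M)
  have hM: "x \<in> carrier M" if "x \<in> homog M e" for x e
    using that additive_subgroup.a_subset[OF sub] by blast
  fix x assume x: "x \<in> carrier M"
  obtain A where A: "finite A" "\<And>e. e \<notin> A \<Longrightarrow> \<pi> e x = \<zero>\<^bsub>M\<^esub>" "x = finsum M (\<lambda>e. \<pi> e x) A" using fin[OF x] by blast
  have \<pi>: "\<pi> e x \<in> carrier M" for e using cl[OF x] hM by blast
  have supp: "{e. \<pi> e x \<noteq> \<zero>\<^bsub>M\<^esub>} \<subseteq> A" using A(2) by blast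
  show "\<exists>!f. (\<forall>e. f e \<in> homog M e) \<and> finite {e. f e \<noteq> \<zero>\<^bsub>M\<^esub>} \<and> x = finsum M f {e. f e \<noteq> \<zero>\<^bsub>M\<^esub>}"
  proof (rule ex1I[of _ "\<lambda>e. \<pi> e x"], intro conjI allI cl[OF x])
    show "finite {e. \<pi> e x \<noteq> \<zero>\<^bsub>M\<^esub>}" using supp A(1) finite_subset by blast
    show "x = finsum M (\<lambda>e. \<pi> e x) {e. \<pi> e x \<noteq> \<zero>\<^bsub>M\<^esub>}"
      using A(3) finsum_support[OF M.M.abelian_group_axioms A(1) _ supp] \<pi> by simp
  next
    fix f assume f: "(\<forall>e. f e \<in> homog M e) \<and> finite {e. f e \<noteq> \<zero>\<^bsub>M\<^esub>} \<and> x = finsum M f {e. f e \<noteq> \<zero>\<^bsub>M\<^esub>}"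
    show "f = (\<lambda>e. \<pi> e x)"
    proof (rule ext)
      fix e
      let ?S = "{e. f e \<noteq> \<zero>\<^bsub>M\<^esub>}"
      have "\<pi> e x = \<pi> e (finsum M f ?S)" using f by simp
      also have "\<dots> = finsum M (\<lambda>e'. \<pi> e (f e')) ?S"
        using f hM cl add
        by (intro additive_finsum[OF M.M.abelian_group_axioms M.M.abelian_group_axioms]) blast+
      also have "\<dots> = finsum M (\<lambda>e'. if e = e' then f e' else \<zero>\<^bsub>M\<^esub>) ?S"
      proof (rule M.M.finsum_cong')
        have fe: "f e' \<in> homog M e'" for e' using f by blast
        then have fc: "f e' \<in> carrier M" for e' using hM by blast
        then show "(\<lambda>e'. if e = e' then f e' else \<zero>\<^bsub>M\<^esub>) \<in> ?S \<rightarrow> carrier M" by simp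
        show "\<pi> e (f e') = (if e = e' then f e' else \<zero>\<^bsub>M\<^esub>)" for e' using proj[OF fe] by simp
      qed simp
      also have "\<dots> = f e"
      proof (cases "e \<in> ?S")
        case True
        then show ?thesis using M.M.finsum_singleton[OF True, of f] f hM by blast
      next
        case False
        have "finsum M (\<lambda>e'. if e = e' then f e' else \<zero>\<^bsub>M\<^esub>) ?S = finsum M (\<lambda>e'. \<zero>\<^bsub>M\<^esub>) ?S"
          using False by (intro M.M.finsum_cong') auto
        then show ?thesis using False by simp
      qed
      finally show "f e = \<pi> e x" by simp
    qed
  qed
qed

lemma bigraded_homD:
  assumes "f \<in> bigraded_hom R M N"
  shows "f \<in> module_hom R M N" "x \<in> homog M e \<Longrightarrow> f x \<in> homog N e"
  using assms by (simp_all add: bigraded_hom_def image_subset_iff)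

lemma bigraded_homI:
  assumes "f \<in> module_hom R M N" "\<And>e x. x \<in> homog M e \<Longrightarrow> f x \<in> homog N e"
  shows "f \<in> bigraded_hom R M N"
  using assms by (simp_all add: bigraded_hom_def image_subset_iff)

lemma hcomp_hom:
  assumes M: "bigraded_module R M" and N: "bigraded_module R N" and f: "f \<in> bigraded_hom R M N"
    and x: "x \<in> carrier M"
  shows "hcomp N (f x) e = f (hcomp M x e)"
proof -
  note M' = bigraded_moduleD(1)[OF M] and N' = bigraded_moduleD(1)[OF N] and f' = bigraded_homD(1)[OF f]
  let ?A = "{e. hcomp M x e \<noteq> \<zero>\<^bsub>M\<^esub>}"
  have A: "finite ?A" by (rule hcomp_props(2)[OF M x])
  have "f x = f (finsum M (hcomp M x) ?A)" using hcomp_sum[OF M x A] by simp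
  also have "\<dots> = finsum N (\<lambda>e. f (hcomp M x e)) ?A"
    using hcomp_props(4)[OF M x]
    by (intro additive_finsum[OF module_abelian_group[OF M'] module_abelian_group[OF N'] _ _ A])
      (auto intro: module_hom_closed[OF f'] simp: module_hom_add[OF f'])
  finally have "hcomp N (f x) = (\<lambda>e. f (hcomp M x e))"
    using hcomp_unique[OF N A, of "\<lambda>e. f (hcomp M x e)"] bigraded_homD(2)[OF f] hcomp_props(1)[OF M x]
      module_hom_zero[OF M' N' f'] by auto
  then show ?thesis by simp
qed

lemma bigraded_sub_simps [simp]:
  "carrier (bigraded_sub M A) = A" "\<zero>\<^bsub>bigraded_sub M A\<^esub> = \<zero>\<^bsub>M\<^esub>"
  "x \<oplus>\<^bsub>bigraded_sub M A\<^esub> y = x \<oplus>\<^bsub>M\<^esub> y" "a \<odot>\<^bsub>bigraded_sub M A\<^esub> x = a \<odot>\<^bsub>M\<^esub> x"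
  "homog (bigraded_sub M A) e = homog M e \<inter> A"
  by (simp_all add: bigraded_sub_def)

lemma bigraded_sub_module:
  assumes "module R M" "submodule A R M"
  shows "module R (bigraded_sub M A)"
proof (rule surj_image_module[OF submodule_is_module'[OF assms], where q = "\<lambda>x. x"])
qed simp_all

lemma bigraded_sub_bigraded:
  assumes R: "bigraded_module R R" and M: "bigraded_module R M" and A: "submodule A R M"
    and comp: "\<And>x e. x \<in> A \<Longrightarrow> hcomp M x e \<in> A"
  shows "bigraded_module R (bigraded_sub M A)"
proof -
  note M' = bigraded_moduleD(1)[OF M]
  interpret M: module R M by (rule M')
  note S = submodule_simps[OF M' A]
  have N': "module R (bigraded_sub M A)" by (rule bigraded_sub_module[OF M' A])
  interpret N: module R "bigraded_sub M A" by (rule N')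
  have AM: "x \<in> carrier M" if "x \<in> A" for x using that S(1) by blast
  show ?thesis
  proof (rule bigraded_moduleI[OF N', where \<pi> = "\<lambda>e x. hcomp M x e"])
    show "additive_subgroup (homog (bigraded_sub M A) e) (bigraded_sub M A)" for e
    proof (rule additive_subgroupI_minus[OF N.M.abelian_group_axioms])
      fix x y assume xy: "x \<in> homog (bigraded_sub M A) e" "y \<in> homog (bigraded_sub M A) e"
      then have "x \<ominus>\<^bsub>bigraded_sub M A\<^esub> y = x \<ominus>\<^bsub>M\<^esub> y"
        using additive_minus[OF N.M.abelian_group_axioms M.M.abelian_group_axioms, of "\<lambda>x. x" x y] AM by simp
      then show "x \<ominus>\<^bsub>bigraded_sub M A\<^esub> y \<in> homog (bigraded_sub M A) e"
        using xy bigraded_moduleD(7)[OF M, of x e y] S(4) by simp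
    qed (use bigraded_moduleD(4)[OF M, of e] S in simp_all)
  next
    fix x assume x: "x \<in> carrier (bigraded_sub M A)"
    let ?A = "{e. hcomp M x e \<noteq> \<zero>\<^bsub>M\<^esub>}"
    have xM: "x \<in> carrier M" and xA: "x \<in> A" using x AM by auto
    have fA: "finite ?A" by (rule hcomp_props(2)[OF M xM])
    have "finsum (bigraded_sub M A) (hcomp M x) ?A = finsum M (hcomp M x) ?A"
      using additive_finsum[OF N.M.abelian_group_axioms M.M.abelian_group_axioms, of "\<lambda>x. x" ?A "hcomp M x"]
        fA comp[OF xA] AM by auto
    then show "\<exists>B. finite B \<and> (\<forall>e. e \<notin> B \<longrightarrow> hcomp M x e = \<zero>\<^bsub>bigraded_sub M A\<^esub>) \<and>
        x = finsum (bigraded_sub M A) (\<lambda>e. hcomp M x e) B"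
      using fA hcomp_sum[OF M xM fA] by (intro exI[of _ ?A]) auto
  next
    fix e x assume x: "x \<in> carrier (bigraded_sub M A)"
    then show "hcomp M x e \<in> homog (bigraded_sub M A) e"
      using AM[of x] hcomp_props(1)[OF M, of x e] comp[of x e] by simp
    fix y assume "y \<in> carrier (bigraded_sub M A)"
    then show "hcomp M (x \<oplus>\<^bsub>bigraded_sub M A\<^esub> y) e =
        hcomp M x e \<oplus>\<^bsub>bigraded_sub M A\<^esub> hcomp M y e"
      using x AM[of x] AM[of y] hcomp_add[OF M, of x y] by simp
  next
    fix e e' x assume "x \<in> homog (bigraded_sub M A) e'"
    then show "hcomp M x e = (if e = e' then x else \<zero>\<^bsub>bigraded_sub M A\<^esub>)"
      using hcomp_homog[OF M, of x e'] by simp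
  next
    fix e e' a x assume a: "a \<in> homog R e" and x: "x \<in> homog (bigraded_sub M A) e'"
    then have "a \<in> carrier R" using bigraded_moduleD(5)[OF R] by blast
    then show "a \<odot>\<^bsub>bigraded_sub M A\<^esub> x \<in> homog (bigraded_sub M A) (e + e')"
      using a x bigraded_moduleD(8)[OF M, of a e x e'] S(5)[of a x] by simp
  qed
qed

section \<open>Graded modules moved to the test type\<close>

definition bigraded_transport :: "('a \<Rightarrow> 'b) \<Rightarrow> ('r, 'a) bigraded \<Rightarrow> ('r, 'b) bigraded" where
  "bigraded_transport g M = module.extend (transport g M) (bigraded.fields (\<lambda>e. g ` homog M e))"

lemma bigraded_transport_simps:
  "carrier (bigraded_transport g M) = g ` carrier M"
  "\<zero>\<^bsub>bigraded_transport g M\<^esub> = g \<zero>\<^bsub>M\<^esub>"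
  "inj_on g (carrier M) \<Longrightarrow> x \<in> carrier M \<Longrightarrow> y \<in> carrier M \<Longrightarrow>
    g x \<oplus>\<^bsub>bigraded_transport g M\<^esub> g y = g (x \<oplus>\<^bsub>M\<^esub> y)"
  "inj_on g (carrier M) \<Longrightarrow> x \<in> carrier M \<Longrightarrow> a \<odot>\<^bsub>bigraded_transport g M\<^esub> g x = g (a \<odot>\<^bsub>M\<^esub> x)"
  "homog (bigraded_transport g M) e = g ` homog M e"
  by (simp_all add: bigraded_transport_def module.extend_def bigraded.fields_def transport_def Let_def)

lemma bigraded_transport_bigraded:
  assumes M: "bigraded_module R M" and g: "inj_on g (carrier M)"
  shows "bigraded_module R (bigraded_transport g M)"
proof -
  let ?N = "bigraded_transport g M" and ?g = "inv_into (carrier M) g"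
  note M' = bigraded_moduleD(1)[OF M]
  interpret M: module R M by (rule M')
  have N': "module R ?N"
    by (rule surj_image_module[OF M', where q = g]) (simp_all add: bigraded_transport_simps g)
  interpret N: module R ?N by (rule N')
  have gi: "?g (g x) = x" if "x \<in> carrier M" for x using inv_into_f_f[OF g that] .
  have hM: "x \<in> carrier M" if "x \<in> homog M e" for e x using bigraded_moduleD(5)[OF M that] .
  have g_cl: "g x \<in> carrier ?N" if "x \<in> carrier M" for x using that by (simp add: bigraded_transport_simps)
  have g_add: "g (x \<oplus>\<^bsub>M\<^esub> y) = g x \<oplus>\<^bsub>?N\<^esub> g y" if "x \<in> carrier M" "y \<in> carrier M" for x y
    using that g by (simp add: bigraded_transport_simps)
  show ?thesis
  proof (rule bigraded_moduleI[OF N', where \<pi> = "\<lambda>e x. g (hcomp M (?g x) e)"])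
    show "additive_subgroup (homog ?N e) ?N" for e
    proof (rule additive_subgroupI_minus[OF N.M.abelian_group_axioms])
      fix x y assume "x \<in> homog ?N e" "y \<in> homog ?N e"
      then obtain x' y' where xy: "x' \<in> homog M e" "y' \<in> homog M e" "x = g x'" "y = g y'"
        unfolding bigraded_transport_simps by blast
      then have "x \<ominus>\<^bsub>?N\<^esub> y = g (x' \<ominus>\<^bsub>M\<^esub> y')"
        using additive_minus[OF M.M.abelian_group_axioms N.M.abelian_group_axioms g_cl g_add hM[OF xy(1)] hM[OF xy(2)]]
        by simp
      then show "x \<ominus>\<^bsub>?N\<^esub> y \<in> homog ?N e"
        using bigraded_moduleD(7)[OF M xy(1,2)] unfolding bigraded_transport_simps by blast
    qed (use bigraded_moduleD(3,4)[OF M, of e] in \<open>auto simp: bigraded_transport_simps\<close>)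
  next
    fix x assume "x \<in> carrier ?N"
    then obtain y where y: "y \<in> carrier M" "x = g y" unfolding bigraded_transport_simps by blast
    let ?A = "{e. hcomp M y e \<noteq> \<zero>\<^bsub>M\<^esub>}"
    have fA: "finite ?A" by (rule hcomp_props(2)[OF M y(1)])
    have "g (finsum M (hcomp M y) ?A) = finsum ?N (\<lambda>e. g (hcomp M y e)) ?A"
      using hcomp_props(4)[OF M y(1)]
      by (intro additive_finsum[OF M.M.abelian_group_axioms N.M.abelian_group_axioms g_cl g_add fA]) auto
    then have "x = finsum ?N (\<lambda>e. g (hcomp M y e)) ?A"
      unfolding hcomp_sum[OF M y(1) fA order_refl] y(2)[symmetric] .
    moreover have "?g x = y" using y gi by simp
    ultimately have *: "x = finsum ?N (\<lambda>e. g (hcomp M (?g x) e)) ?A" by simp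
    show "\<exists>B. finite B \<and> (\<forall>e. e \<notin> B \<longrightarrow> g (hcomp M (?g x) e) = \<zero>\<^bsub>?N\<^esub>) \<and>
        x = finsum ?N (\<lambda>e. g (hcomp M (?g x) e)) B"
    proof (intro exI conjI)
      show "\<forall>e. e \<notin> ?A \<longrightarrow> g (hcomp M (?g x) e) = \<zero>\<^bsub>?N\<^esub>"
        using y gi by (simp add: bigraded_transport_simps)
    qed (fact fA *)+
  next
    fix e x assume "x \<in> carrier ?N"
    then obtain x' where x: "x' \<in> carrier M" "x = g x'" unfolding bigraded_transport_simps by blast
    then show "g (hcomp M (?g x) e) \<in> homog ?N e"
      using hcomp_props(1)[OF M x(1), of e] gi by (simp add: bigraded_transport_simps)
    fix y assume "y \<in> carrier ?N"
    then obtain y' where y: "y' \<in> carrier M" "y = g y'" unfolding bigraded_transport_simps by blast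
    show "g (hcomp M (?g (x \<oplus>\<^bsub>?N\<^esub> y)) e) = g (hcomp M (?g x) e) \<oplus>\<^bsub>?N\<^esub> g (hcomp M (?g y) e)"
      using x y gi hcomp_add[OF M x(1) y(1)] hcomp_props(4)[OF M x(1), of e] hcomp_props(4)[OF M y(1), of e]
      by (simp add: g_add[symmetric])
  next
    fix e e' x assume "x \<in> homog ?N e'"
    then obtain x' where x: "x' \<in> homog M e'" "x = g x'" unfolding bigraded_transport_simps by blast
    then show "g (hcomp M (?g x) e) = (if e = e' then x else \<zero>\<^bsub>?N\<^esub>)"
      using hcomp_homog[OF M x(1)] gi[OF hM[OF x(1)]] by (simp add: bigraded_transport_simps)
  next
    fix e e' a x assume a: "a \<in> homog R e" and "x \<in> homog ?N e'"
    then obtain x' where x: "x' \<in> homog M e'" "x = g x'" unfolding bigraded_transport_simps by blast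
    then show "a \<odot>\<^bsub>?N\<^esub> x \<in> homog ?N (e + e')"
      using bigraded_moduleD(8)[OF M a x(1)] hM[OF x(1)] g by (simp add: bigraded_transport_simps)
  qed
qed

text \<open>Test modules live on \<open>'r + 'e\<close>, while the twisted sums below live on pairs.
  The injection \<open>h\<close> moves such a module and its submodule to the test type, where the
  inclusion of one in the other is the identity map.\<close>

lemma bigraded_injective_extend_sub:
  fixes B :: "('r, 'b) bigraded" and E :: "('r, 'e) bigraded" and h :: "'b \<Rightarrow> 'r + 'e"
  assumes R: "bigraded_module R R" and E: "bigraded_injective R E" and B: "bigraded_module R B"
    and H: "submodule H R B" and comp: "\<And>x e. x \<in> H \<Longrightarrow> hcomp B x e \<in> H"
    and h: "inj h" and f: "f \<in> bigraded_hom R (bigraded_sub B H) E"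
  shows "\<exists>g\<in>bigraded_hom R B E. \<forall>x\<in>H. g x = f x"
proof -
  let ?A = "bigraded_sub B H"
  have A: "bigraded_module R ?A" by (rule bigraded_sub_bigraded[OF R B H comp])
  note B' = bigraded_moduleD(1)[OF B] and A' = bigraded_moduleD(1)[OF A]
  have HB: "H \<subseteq> carrier B" by (rule submodule_simps[OF B' H])
  have inj: "inj_on h S" for S using h by (rule inj_on_subset) simp
  let ?TA = "bigraded_transport h ?A" and ?TB = "bigraded_transport h B"
  let ?f = "\<lambda>x. f (inv_into H h x)"
  note t = bigraded_transport_simps(3-4)[OF inj]
  have i: "inv_into H h (h x) = x" if "x \<in> H" for x using inv_into_f_f[OF inj that] .
  note f' = bigraded_homD(1)[OF f]
  have "?f \<in> bigraded_hom R ?TA E"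
  proof (rule bigraded_homI[OF module_homI])
    fix x assume "x \<in> carrier ?TA"
    then obtain x' where x: "x' \<in> H" "x = h x'" by (auto simp: bigraded_transport_simps)
    show "?f x \<in> carrier E" using x i module_hom_closed[OF f', of x'] by simp
    { fix y assume "y \<in> carrier ?TA"
      then obtain y' where y: "y' \<in> H" "y = h y'" by (auto simp: bigraded_transport_simps)
      have "x' \<oplus>\<^bsub>B\<^esub> y' \<in> H" using submodule_simps(3)[OF B' H] x y by simp
      then show "?f (x \<oplus>\<^bsub>?TA\<^esub> y) = ?f x \<oplus>\<^bsub>E\<^esub> ?f y"
        using x y i t(1)[of x' ?A y'] module_hom_add[OF f', of x' y'] by simp }
    { fix a assume a: "a \<in> carrier R"
      have "a \<odot>\<^bsub>B\<^esub> x' \<in> H" using submodule_simps(5)[OF B' H] a x by simp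
      then show "?f (a \<odot>\<^bsub>?TA\<^esub> x) = a \<odot>\<^bsub>E\<^esub> ?f x"
        using a x i t(2)[of x' ?A a] module_hom_smult[OF f' a, of x'] by simp }
  next
    fix e x assume "x \<in> homog ?TA e"
    then obtain x' where x: "x' \<in> H" "x' \<in> homog B e" "x = h x'" by (auto simp: bigraded_transport_simps)
    then show "?f x \<in> homog E e" using i bigraded_homD(2)[OF f, of x' e] by simp
  qed
  moreover have "(\<lambda>x. x) \<in> bigraded_hom R ?TA ?TB"
  proof (rule bigraded_homI[OF module_homI])
    show "x \<oplus>\<^bsub>?TA\<^esub> y = x \<oplus>\<^bsub>?TB\<^esub> y" if xy: "x \<in> carrier ?TA" "y \<in> carrier ?TA" for x y
    proof -
      obtain x' y' where "x' \<in> H" "x = h x'" "y' \<in> H" "y = h y'"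
        using xy by (auto simp: bigraded_transport_simps)
      then show ?thesis using t(1)[of x' ?A y'] t(1)[of x' B y'] subsetD[OF HB] by simp
    qed
    show "a \<odot>\<^bsub>?TA\<^esub> x = a \<odot>\<^bsub>?TB\<^esub> x" if x: "x \<in> carrier ?TA" for a x
    proof -
      obtain x' where "x' \<in> H" "x = h x'" using x by (auto simp: bigraded_transport_simps)
      then show ?thesis using t(2)[of x' ?A a] t(2)[of x' B a] subsetD[OF HB] by simp
    qed
  qed (use HB in \<open>auto simp: bigraded_transport_simps\<close>)
  ultimately obtain g where g: "g \<in> bigraded_hom R ?TB E" "\<forall>x\<in>carrier ?TA. g x = ?f x"
    using E bigraded_transport_bigraded[OF A inj] bigraded_transport_bigraded[OF B inj]
    unfolding bigraded_injective_def by (metis inj_on_id2)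
  have "h \<in> bigraded_hom R B ?TB"
    by (intro bigraded_homI module_homI) (simp_all add: bigraded_transport_simps inj)
  then have "(\<lambda>x. g (h x)) \<in> bigraded_hom R B E"
    using bigraded_homD[OF g(1)] bigraded_homD[of h R B ?TB]
    by (intro bigraded_homI module_hom_comp[of h R B ?TB g E]) blast+
  then show ?thesis using g(2) i by (intro bexI[of _ "\<lambda>x. g (h x)"]) (simp_all add: bigraded_transport_simps)
qed

section \<open>Maps satisfying a Leibniz rule\<close>

definition graded_derivation :: "('r, 'r) bigraded \<Rightarrow> int \<times> int \<Rightarrow> ('r \<Rightarrow> 'r) \<Rightarrow> bool" where
  "graded_derivation R s \<delta> \<longleftrightarrow>
     (\<forall>a\<in>carrier R. \<delta> a \<in> carrier R) \<and>
     (\<forall>a\<in>carrier R. \<forall>b\<in>carrier R. \<delta> (a \<oplus>\<^bsub>R\<^esub> b) = \<delta> a \<oplus>\<^bsub>R\<^esub> \<delta> b) \<and>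
     (\<forall>a\<in>carrier R. \<forall>b\<in>carrier R. \<delta> (a \<otimes>\<^bsub>R\<^esub> b) = a \<otimes>\<^bsub>R\<^esub> \<delta> b \<oplus>\<^bsub>R\<^esub> \<delta> a \<otimes>\<^bsub>R\<^esub> b) \<and>
     (\<forall>e. \<forall>a\<in>homog R e. \<delta> a \<in> homog R (e + s))"

text \<open>The Leibniz term is taken along a map \<open>\<phi>\<close>. With \<open>\<phi>\<close>
  the identity these are the lifts of a derivation to a module; composing such a lift with a linear
  map \<open>f\<close> gives the case \<open>\<phi> = f\<close>; and \<open>\<delta> = 0\<close>,
  \<open>s = 0\<close> gives the degree preserving linear maps.\<close>

definition leibniz_map ::
  "('r, 'r) bigraded \<Rightarrow> int \<times> int \<Rightarrow> ('r \<Rightarrow> 'r) \<Rightarrow> ('a \<Rightarrow> 'b) \<Rightarrow> ('r, 'a) bigraded \<Rightarrow> ('r, 'b) bigraded \<Rightarrow>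
   ('a \<Rightarrow> 'b) \<Rightarrow> bool" where
  "leibniz_map R s \<delta> \<phi> E F D \<longleftrightarrow>
     (\<forall>x\<in>carrier E. D x \<in> carrier F) \<and>
     (\<forall>x\<in>carrier E. \<forall>y\<in>carrier E. D (x \<oplus>\<^bsub>E\<^esub> y) = D x \<oplus>\<^bsub>F\<^esub> D y) \<and>
     (\<forall>a\<in>carrier R. \<forall>x\<in>carrier E. D (a \<odot>\<^bsub>E\<^esub> x) = a \<odot>\<^bsub>F\<^esub> D x \<oplus>\<^bsub>F\<^esub> \<delta> a \<odot>\<^bsub>F\<^esub> \<phi> x) \<and>
     (\<forall>e. \<forall>x\<in>homog E e. D x \<in> homog F (e + s))"

lemma leibniz_mapD:
  assumes "leibniz_map R s \<delta> \<phi> E F D"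
  shows "x \<in> carrier E \<Longrightarrow> D x \<in> carrier F"
    "x \<in> carrier E \<Longrightarrow> y \<in> carrier E \<Longrightarrow> D (x \<oplus>\<^bsub>E\<^esub> y) = D x \<oplus>\<^bsub>F\<^esub> D y"
    "a \<in> carrier R \<Longrightarrow> x \<in> carrier E \<Longrightarrow> D (a \<odot>\<^bsub>E\<^esub> x) = a \<odot>\<^bsub>F\<^esub> D x \<oplus>\<^bsub>F\<^esub> \<delta> a \<odot>\<^bsub>F\<^esub> \<phi> x"
    "x \<in> homog E e \<Longrightarrow> D x \<in> homog F (e + s)"
  using assms unfolding leibniz_map_def by blast+

lemma leibniz_mapI:
  assumes "\<And>x. x \<in> carrier E \<Longrightarrow> D x \<in> carrier F"
    "\<And>x y. x \<in> carrier E \<Longrightarrow> y \<in> carrier E \<Longrightarrow> D (x \<oplus>\<^bsub>E\<^esub> y) = D x \<oplus>\<^bsub>F\<^esub> D y"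
    "\<And>a x. a \<in> carrier R \<Longrightarrow> x \<in> carrier E \<Longrightarrow> D (a \<odot>\<^bsub>E\<^esub> x) = a \<odot>\<^bsub>F\<^esub> D x \<oplus>\<^bsub>F\<^esub> \<delta> a \<odot>\<^bsub>F\<^esub> \<phi> x"
    "\<And>e x. x \<in> homog E e \<Longrightarrow> D x \<in> homog F (e + s)"
  shows "leibniz_map R s \<delta> \<phi> E F D"
  unfolding leibniz_map_def by (intro conjI allI ballI assms)

lemma graded_derivation_zero:
  assumes "bigraded_module R R"
  shows "graded_derivation R s (\<lambda>_. \<zero>\<^bsub>R\<^esub>)"
proof -
  interpret module R R by (rule bigraded_moduleD[OF assms])
  show ?thesis using bigraded_moduleD(4)[OF assms] by (simp add: graded_derivation_def)
qed

text \<open>Through this case one extension theorem yields both the lifts of the derivations and the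
  linear homotopy.\<close>

lemma leibniz_zero_iff_hom:
  assumes "module R F" "\<And>x. x \<in> carrier E \<Longrightarrow> \<phi> x \<in> carrier F"
  shows "leibniz_map R 0 (\<lambda>_. \<zero>\<^bsub>R\<^esub>) \<phi> E F f \<longleftrightarrow> f \<in> bigraded_hom R E F"
proof -
  interpret F: module R F by fact
  show ?thesis
  proof
    assume f: "leibniz_map R 0 (\<lambda>_. \<zero>\<^bsub>R\<^esub>) \<phi> E F f"
    show "f \<in> bigraded_hom R E F"
    proof (rule bigraded_homI[OF module_homI])
      show "f x \<in> homog F e" if "x \<in> homog E e" for e x using leibniz_mapD(4)[OF f that] by simp
    qed (use leibniz_mapD(1-3)[OF f] assms(2) in simp_all)
  next
    assume f: "f \<in> bigraded_hom R E F"
    note f' = bigraded_homD(1)[OF f]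
    show "leibniz_map R 0 (\<lambda>_. \<zero>\<^bsub>R\<^esub>) \<phi> E F f"
      using module_hom_closed[OF f'] module_hom_add[OF f'] module_hom_smult[OF f'] bigraded_homD(2)[OF f] assms(2)
      by (intro leibniz_mapI) simp_all
  qed
qed

text \<open>On \<open>E \<oplus> F\<close> the ring acts by \<open>r (x, y) = (r x, r y + \<delta> r \<phi> x)\<close>, so that a map \<open>x \<mapsto> - G (x, 0)\<close>
  satisfies the Leibniz rule if \<open>G\<close> is linear and \<open>G (0, y) = y\<close>.\<close>

definition twisted_sum ::
  "('r \<Rightarrow> 'r) \<Rightarrow> int \<times> int \<Rightarrow> ('a \<Rightarrow> 'b) \<Rightarrow> ('r, 'a) bigraded \<Rightarrow> ('r, 'b) bigraded \<Rightarrow> ('r, 'a \<times> 'b) bigraded" where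
  "twisted_sum \<delta> s \<phi> E F =
     \<lparr>carrier = carrier E \<times> carrier F, monoid.mult = (\<lambda>x y. x), one = (\<zero>\<^bsub>E\<^esub>, \<zero>\<^bsub>F\<^esub>), zero = (\<zero>\<^bsub>E\<^esub>, \<zero>\<^bsub>F\<^esub>),
      add = (\<lambda>p q. (fst p \<oplus>\<^bsub>E\<^esub> fst q, snd p \<oplus>\<^bsub>F\<^esub> snd q)),
      smult = (\<lambda>a p. (a \<odot>\<^bsub>E\<^esub> fst p, a \<odot>\<^bsub>F\<^esub> snd p \<oplus>\<^bsub>F\<^esub> \<delta> a \<odot>\<^bsub>F\<^esub> \<phi> (fst p))),
      homog = (\<lambda>e. homog E (e - s) \<times> homog F e)\<rparr>"

lemma twisted_sum_simps [simp]:
  "carrier (twisted_sum \<delta> s \<phi> E F) = carrier E \<times> carrier F"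
  "\<zero>\<^bsub>twisted_sum \<delta> s \<phi> E F\<^esub> = (\<zero>\<^bsub>E\<^esub>, \<zero>\<^bsub>F\<^esub>)"
  "p \<oplus>\<^bsub>twisted_sum \<delta> s \<phi> E F\<^esub> q = (fst p \<oplus>\<^bsub>E\<^esub> fst q, snd p \<oplus>\<^bsub>F\<^esub> snd q)"
  "a \<odot>\<^bsub>twisted_sum \<delta> s \<phi> E F\<^esub> p = (a \<odot>\<^bsub>E\<^esub> fst p, a \<odot>\<^bsub>F\<^esub> snd p \<oplus>\<^bsub>F\<^esub> \<delta> a \<odot>\<^bsub>F\<^esub> \<phi> (fst p))"
  "homog (twisted_sum \<delta> s \<phi> E F) e = homog E (e - s) \<times> homog F e"
  by (simp_all add: twisted_sum_def)

lemma graded_derivationD: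
  assumes "graded_derivation R s \<delta>"
  shows "a \<in> carrier R \<Longrightarrow> \<delta> a \<in> carrier R"
    "a \<in> carrier R \<Longrightarrow> b \<in> carrier R \<Longrightarrow> \<delta> (a \<oplus>\<^bsub>R\<^esub> b) = \<delta> a \<oplus>\<^bsub>R\<^esub> \<delta> b"
    "a \<in> carrier R \<Longrightarrow> b \<in> carrier R \<Longrightarrow> \<delta> (a \<otimes>\<^bsub>R\<^esub> b) = a \<otimes>\<^bsub>R\<^esub> \<delta> b \<oplus>\<^bsub>R\<^esub> \<delta> a \<otimes>\<^bsub>R\<^esub> b"
    "a \<in> homog R e \<Longrightarrow> \<delta> a \<in> homog R (e + s)"
  using assms unfolding graded_derivation_def by blast+

text \<open>Associativity of the action is the Leibniz rule of \<open>\<delta>\<close>, and the unit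
  law is \<open>\<delta> 1 = 0\<close>, which comes from the Leibniz rule for the product of
  \<open>1\<close> with itself.\<close>

lemma twisted_sum_module:
  assumes E: "module R E" and F: "module R F" and \<delta>: "graded_derivation R s \<delta>" and \<phi>: "\<phi> \<in> module_hom R E F"
  shows "module R (twisted_sum \<delta> s \<phi> E F)"
proof -
  interpret E: module R E by fact
  interpret F: module R F by fact
  note d = graded_derivationD(1-3)[OF \<delta>]
  note p = module_hom_closed[OF \<phi>] module_hom_add[OF \<phi>] module_hom_smult[OF \<phi>]
  have "\<delta> \<one>\<^bsub>R\<^esub> \<oplus>\<^bsub>R\<^esub> \<delta> \<one>\<^bsub>R\<^esub> = \<delta> \<one>\<^bsub>R\<^esub>" using d(3)[of "\<one>\<^bsub>R\<^esub>" "\<one>\<^bsub>R\<^esub>"] d(1)[of "\<one>\<^bsub>R\<^esub>"] by simp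
  then have one: "\<delta> \<one>\<^bsub>R\<^esub> = \<zero>\<^bsub>R\<^esub>" using d(1)[of "\<one>\<^bsub>R\<^esub>"] E.R.add.r_cancel_one' by auto
  show ?thesis
  proof (rule moduleI)
    show "cring R" by (rule E.R.is_cring)
    show "abelian_group (twisted_sum \<delta> s \<phi> E F)"
    proof (rule abelian_groupI)
      fix x assume "x \<in> carrier (twisted_sum \<delta> s \<phi> E F)"
      then show "\<exists>y\<in>carrier (twisted_sum \<delta> s \<phi> E F). y \<oplus>\<^bsub>twisted_sum \<delta> s \<phi> E F\<^esub> x = \<zero>\<^bsub>twisted_sum \<delta> s \<phi> E F\<^esub>"
        by (intro bexI[of _ "(\<ominus>\<^bsub>E\<^esub> fst x, \<ominus>\<^bsub>F\<^esub> snd x)"]) (auto simp: E.M.l_neg F.M.l_neg)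
    qed (auto simp: E.M.a_ac F.M.a_ac)
  qed (auto simp: E.smult_l_distr E.smult_r_distr E.smult_assoc1 F.smult_l_distr F.smult_r_distr
      F.smult_assoc1 d p one F.M.a_ac)
qed

text \<open>The degrees of \<open>E\<close> are shifted by \<open>s\<close> because
  \<open>\<delta>\<close> changes degrees by \<open>s\<close>: for \<open>a\<close> of degree
  \<open>e\<close> and \<open>x\<close> of degree \<open>e' - s\<close>, the product of
  \<open>\<delta> a\<close> and \<open>\<phi> x\<close> has degree \<open>e + e'\<close>.\<close>

lemma twisted_sum_bigraded:
  assumes E: "bigraded_module R E" and F: "bigraded_module R F" and \<delta>: "graded_derivation R s \<delta>"
    and \<phi>: "\<phi> \<in> bigraded_hom R E F"
  shows "bigraded_module R (twisted_sum \<delta> s \<phi> E F)"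
    "x \<in> carrier E \<Longrightarrow> y \<in> carrier F \<Longrightarrow>
      hcomp (twisted_sum \<delta> s \<phi> E F) (x, y) e = (hcomp E x (e - s), hcomp F y e)"
proof -
  let ?J = "twisted_sum \<delta> s \<phi> E F"
  note E' = bigraded_moduleD(1)[OF E] and F' = bigraded_moduleD(1)[OF F] and \<phi>' = bigraded_homD(1)[OF \<phi>]
  interpret E: module R E by (rule E')
  interpret F: module R F by (rule F')
  have J: "module R ?J" by (rule twisted_sum_module[OF E' F' \<delta> \<phi>'])
  interpret J: module R ?J by (rule J)
  have hE: "x \<in> carrier E" if "x \<in> homog E e" for x e using bigraded_moduleD(5)[OF E that] .
  have hF: "x \<in> carrier F" if "x \<in> homog F e" for x e using bigraded_moduleD(5)[OF F that] .
  have sum: "\<exists>A. finite A \<and> (\<forall>e. e \<notin> A \<longrightarrow> (hcomp E x (e - s), hcomp F y e) = \<zero>\<^bsub>?J\<^esub>) \<and>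
      (x, y) = finsum ?J (\<lambda>e. (hcomp E x (e - s), hcomp F y e)) A"
    if x: "x \<in> carrier E" and y: "y \<in> carrier F" for x y
  proof -
    let ?A = "(\<lambda>e. e + s) ` {e. hcomp E x e \<noteq> \<zero>\<^bsub>E\<^esub>} \<union> {e. hcomp F y e \<noteq> \<zero>\<^bsub>F\<^esub>}"
    let ?g = "\<lambda>e. (hcomp E x (e - s), hcomp F y e)"
    have fA: "finite ?A" using hcomp_props(2)[OF E x] hcomp_props(2)[OF F y] by simp
    have g: "?g \<in> ?A \<rightarrow> carrier ?J" using hcomp_props(4)[OF E x] hcomp_props(4)[OF F y] by simp
    have eA: "e + s \<in> ?A" if "hcomp E x e \<noteq> \<zero>\<^bsub>E\<^esub>" for e using that by blast
    have zero: "?g e = \<zero>\<^bsub>?J\<^esub>" if "e \<notin> ?A" for e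
      using that eA[of "e - s"] by auto
    have "fst (finsum ?J ?g ?A) = finsum E (\<lambda>e. fst (?g e)) ?A"
      by (rule additive_finsum[OF J.M.abelian_group_axioms E.M.abelian_group_axioms _ _ fA g]) auto
    also have "\<dots> = finsum E (hcomp E x) ((\<lambda>e. e - s) ` ?A)"
      using hcomp_props(4)[OF E x] by (subst E.M.finsum_reindex) (auto simp: inj_on_def)
    also have "\<dots> = x"
    proof (rule hcomp_sum[OF E x])
      show "{e. hcomp E x e \<noteq> \<zero>\<^bsub>E\<^esub>} \<subseteq> (\<lambda>e. e - s) ` ?A"
      proof
        fix e assume "e \<in> {e. hcomp E x e \<noteq> \<zero>\<^bsub>E\<^esub>}"
        then show "e \<in> (\<lambda>e. e - s) ` ?A" using eA[of e] by (intro image_eqI[of _ _ "e + s"]) simp_all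
      qed
    qed (use fA in simp)
    finally have 1: "fst (finsum ?J ?g ?A) = x" .
    have "snd (finsum ?J ?g ?A) = finsum F (\<lambda>e. snd (?g e)) ?A"
      by (rule additive_finsum[OF J.M.abelian_group_axioms F.M.abelian_group_axioms _ _ fA g]) auto
    also have "\<dots> = y" using hcomp_sum[OF F y fA] by simp
    finally have 2: "snd (finsum ?J ?g ?A) = y" .
    have "(x, y) = finsum ?J ?g ?A" by (rule prod_eqI) (simp_all only: 1 2 fst_conv snd_conv)
    then show ?thesis using fA zero by blast
  qed
  show bJ: "bigraded_module R ?J"
  proof (rule bigraded_moduleI[OF J, where \<pi> = "\<lambda>e p. (hcomp E (fst p) (e - s), hcomp F (snd p) e)"])
    show "additive_subgroup (homog ?J e) ?J" for e
    proof (rule additive_subgroupI_minus[OF J.M.abelian_group_axioms])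
      show "homog ?J e \<subseteq> carrier ?J"
        using bigraded_moduleD(3)[OF E, of "e - s"] bigraded_moduleD(3)[OF F, of e] by auto
      show "\<zero>\<^bsub>?J\<^esub> \<in> homog ?J e"
        using bigraded_moduleD(4)[OF E, of "e - s"] bigraded_moduleD(4)[OF F, of e] by simp
      fix p q assume pq: "p \<in> homog ?J e" "q \<in> homog ?J e"
      then have "p \<in> carrier ?J" "q \<in> carrier ?J"
        using bigraded_moduleD(3)[OF E, of "e - s"] bigraded_moduleD(3)[OF F, of e] by auto
      then have "fst (p \<ominus>\<^bsub>?J\<^esub> q) = fst p \<ominus>\<^bsub>E\<^esub> fst q" "snd (p \<ominus>\<^bsub>?J\<^esub> q) = snd p \<ominus>\<^bsub>F\<^esub> snd q"
        using additive_minus[OF J.M.abelian_group_axioms E.M.abelian_group_axioms, of fst p q]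
          additive_minus[OF J.M.abelian_group_axioms F.M.abelian_group_axioms, of snd p q] by auto
      then show "p \<ominus>\<^bsub>?J\<^esub> q \<in> homog ?J e"
        using pq bigraded_moduleD(7)[OF E, of "fst p" "e - s" "fst q"] bigraded_moduleD(7)[OF F, of "snd p" e "snd q"]
        by (simp add: mem_Times_iff)
    qed
  next
    fix p assume "p \<in> carrier ?J"
    then show "\<exists>A. finite A \<and> (\<forall>e. e \<notin> A \<longrightarrow> (hcomp E (fst p) (e - s), hcomp F (snd p) e) = \<zero>\<^bsub>?J\<^esub>) \<and>
        p = finsum ?J (\<lambda>e. (hcomp E (fst p) (e - s), hcomp F (snd p) e)) A"
      using sum[of "fst p" "snd p"] by (simp add: mem_Times_iff)
  next
    fix e e' a p assume a: "a \<in> homog R e" and p: "p \<in> homog ?J e'"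
    have 1: "a \<odot>\<^bsub>E\<^esub> fst p \<in> homog E (e + (e' - s))"
      using bigraded_moduleD(8)[OF E a, of "fst p"] p by (simp add: mem_Times_iff)
    have 2: "\<delta> a \<odot>\<^bsub>F\<^esub> \<phi> (fst p) \<in> homog F ((e + s) + (e' - s))"
      using bigraded_moduleD(8)[OF F graded_derivationD(4)[OF \<delta> a] bigraded_homD(2)[OF \<phi>], of "fst p" "e' - s"] p
      by (simp add: mem_Times_iff)
    have 3: "a \<odot>\<^bsub>F\<^esub> snd p \<in> homog F (e + e')"
      using bigraded_moduleD(8)[OF F a, of "snd p"] p by (simp add: mem_Times_iff)
    have 4: "(e + s) + (e' - s) = e + e'" by (simp add: algebra_simps)
    have "a \<odot>\<^bsub>F\<^esub> snd p \<oplus>\<^bsub>F\<^esub> \<delta> a \<odot>\<^bsub>F\<^esub> \<phi> (fst p) \<in> homog F (e + e')"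
      by (rule bigraded_moduleD(6)[OF F 3 2[unfolded 4]])
    then show "a \<odot>\<^bsub>?J\<^esub> p \<in> homog ?J (e + e')"
      using 1[unfolded add_diff_eq] by (simp only: twisted_sum_simps mem_Times_iff fst_conv snd_conv)
  next
    fix e p assume p: "p \<in> carrier ?J"
    then show "(hcomp E (fst p) (e - s), hcomp F (snd p) e) \<in> homog ?J e"
      using hcomp_props(1)[OF E] hcomp_props(1)[OF F] by (simp add: mem_Times_iff)
    fix q assume "q \<in> carrier ?J"
    then show "(hcomp E (fst (p \<oplus>\<^bsub>?J\<^esub> q)) (e - s), hcomp F (snd (p \<oplus>\<^bsub>?J\<^esub> q)) e) =
      (hcomp E (fst p) (e - s), hcomp F (snd p) e) \<oplus>\<^bsub>?J\<^esub> (hcomp E (fst q) (e - s), hcomp F (snd q) e)"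
      using p hcomp_add[OF E] hcomp_add[OF F] by (simp add: mem_Times_iff)
  next
    fix e e' p assume "p \<in> homog ?J e'"
    then have p: "fst p \<in> homog E (e' - s)" "snd p \<in> homog F e'" by (simp_all add: mem_Times_iff)
    show "(hcomp E (fst p) (e - s), hcomp F (snd p) e) = (if e = e' then p else \<zero>\<^bsub>?J\<^esub>)"
      using hcomp_homog[OF E p(1)] hcomp_homog[OF F p(2)] by (simp add: diff_eq_eq)
  qed
  assume x: "x \<in> carrier E" and y: "y \<in> carrier F"
  obtain A where A: "finite A" "\<forall>e. e \<notin> A \<longrightarrow> (hcomp E x (e - s), hcomp F y e) = \<zero>\<^bsub>?J\<^esub>"
      "(x, y) = finsum ?J (\<lambda>e. (hcomp E x (e - s), hcomp F y e)) A" using sum[OF x y] by blast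
  have "hcomp ?J (finsum ?J (\<lambda>e. (hcomp E x (e - s), hcomp F y e)) A) = (\<lambda>e. (hcomp E x (e - s), hcomp F y e))"
    using A(2) hcomp_props(1)[OF E x] hcomp_props(1)[OF F y] by (intro hcomp_unique[OF bJ A(1)]) simp_all
  then show "hcomp ?J (x, y) e = (hcomp E x (e - s), hcomp F y e)" unfolding A(3)[symmetric] by simp
qed

text \<open>The infinite type \<open>'r + 'e\<close> is equinumerous with its square, so twisted
  sums of modules on \<open>'e\<close> fit into the test type for injectivity.\<close>

lemma ex_inj_pair:
  assumes "infinite (UNIV :: 'r set)"
  shows "\<exists>h :: 'e \<times> 'e \<Rightarrow> 'r + 'e. inj h"
proof -
  have "infinite (UNIV :: ('r + 'e) set)" using assms by (metis finite_Plus_UNIV_iff)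
  then have "\<exists>f. bij_betw f ((UNIV :: ('r + 'e) set) \<times> (UNIV :: ('r + 'e) set)) (UNIV :: ('r + 'e) set)"
    unfolding card_of_ordIso by (rule card_of_Times_same_infinite)
  then obtain f :: "('r + 'e) \<times> ('r + 'e) \<Rightarrow> 'r + 'e" where f: "inj f" by (auto simp: bij_betw_def)
  have "inj (\<lambda>p. f (Inr (fst p), Inr (snd p)))"
    by (rule injI) (auto dest: injD[OF f] intro: prod_eqI)
  then show ?thesis by blast
qed

text \<open>On the submodule of the twisted sum formed by the image of \<open>d\<close> and all of
  \<open>G\<close>, the map \<open>(d x, y) \<mapsto> y - g x\<close> is well defined by
  \<open>ker\<close>, and it is linear because the Leibniz terms of the action and of
  \<open>g\<close> cancel. Injectivity of \<open>G\<close> extends it to a map \<open>K\<close> on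
  the whole twisted sum, and \<open>D x = - K (x, 0)\<close>.\<close>

lemma leibniz_extension:
  fixes R :: "('r, 'r) bigraded" and E :: "('r, 'a) bigraded" and F G :: "('r, 'e) bigraded"
  assumes inf: "infinite (UNIV :: 'r set)" and R: "bigraded_module R R" and \<delta>: "graded_derivation R s \<delta>"
    and E: "bigraded_module R E" and F: "bigraded_module R F" and G: "bigraded_injective R G"
    and \<phi>: "\<phi> \<in> bigraded_hom R F G" and d: "d \<in> bigraded_hom R E F"
    and g: "leibniz_map R s \<delta> (\<lambda>x. \<phi> (d x)) E G g"
    and ker: "\<And>x. x \<in> carrier E \<Longrightarrow> d x = \<zero>\<^bsub>F\<^esub> \<Longrightarrow> g x = \<zero>\<^bsub>G\<^esub>"
  shows "\<exists>D. leibniz_map R s \<delta> \<phi> F G D \<and> (\<forall>x\<in>carrier E. D (d x) = g x)"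
proof -
  obtain h :: "'e \<times> 'e \<Rightarrow> 'r + 'e" where h: "inj h" using ex_inj_pair[OF inf] by blast
  have bG: "bigraded_module R G" using G by (simp add: bigraded_injective_def)
  note mE = bigraded_moduleD(1)[OF E] and mF = bigraded_moduleD(1)[OF F] and mG = bigraded_moduleD(1)[OF bG]
  note \<phi>' = bigraded_homD(1)[OF \<phi>] and d' = bigraded_homD(1)[OF d]
  interpret E: module R E by (rule mE)
  interpret F: module R F by (rule mF)
  interpret G: module R G by (rule mG)
  let ?J = "twisted_sum \<delta> s \<phi> F G"
  have J: "bigraded_module R ?J" by (rule twisted_sum_bigraded(1)[OF F bG \<delta> \<phi>])
  note mJ = bigraded_moduleD(1)[OF J]
  let ?H = "d ` carrier E \<times> carrier G"
  note d_cl = module_hom_closed[OF d'] and g_cl = leibniz_mapD(1)[OF g] and \<delta>_cl = graded_derivationD(1)[OF \<delta>]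
    and \<phi>_cl = module_hom_closed[OF \<phi>']
  have imd: "d x \<oplus>\<^bsub>F\<^esub> d y \<in> d ` carrier E" "a \<odot>\<^bsub>F\<^esub> d x \<in> d ` carrier E"
    if "x \<in> carrier E" "y \<in> carrier E" "a \<in> carrier R" for x y a
    using that by (simp_all add: module_hom_add[OF d', symmetric] module_hom_smult[OF d', symmetric])
  have im0: "\<zero>\<^bsub>F\<^esub> \<in> d ` carrier E" using module_hom_zero[OF mE mF d'] by (metis E.M.zero_closed imageI)
  have H: "submodule ?H R ?J"
  proof (rule submoduleI'[OF mJ])
    show "?H \<subseteq> carrier ?J" using d_cl by auto
    show "\<zero>\<^bsub>?J\<^esub> \<in> ?H" using im0 by simp
    fix p q assume pq: "p \<in> ?H" "q \<in> ?H"
    then show "p \<oplus>\<^bsub>?J\<^esub> q \<in> ?H" using imd(1)[OF _ _ E.R.zero_closed] by (auto simp: mem_Times_iff)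
  next
    fix a p assume "a \<in> carrier R" "p \<in> ?H"
    then show "a \<odot>\<^bsub>?J\<^esub> p \<in> ?H" using imd(2) \<delta>_cl \<phi>_cl d_cl by (auto simp: mem_Times_iff)
  qed
  have comp: "hcomp ?J p e \<in> ?H" if p: "p \<in> ?H" for p e
  proof -
    obtain x y where xy: "x \<in> carrier E" "y \<in> carrier G" "p = (d x, y)" using p by auto
    then show ?thesis
      using twisted_sum_bigraded(2)[OF F bG \<delta> \<phi> d_cl[OF xy(1)] xy(2), of e]
        hcomp_hom[OF E F d xy(1)] hcomp_props(4)[OF E xy(1)] hcomp_props(4)[OF bG xy(2)] by simp
  qed
  define \<gamma> where "\<gamma> = (\<lambda>z. g (inv_into (carrier E) d z))"
  have \<gamma>: "\<gamma> (d x) = g x" if x: "x \<in> carrier E" for x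
  proof -
    let ?y = "inv_into (carrier E) d (d x)"
    have y: "?y \<in> carrier E" "d ?y = d x" using x by (auto intro: inv_into_into f_inv_into_f)
    have "d (?y \<ominus>\<^bsub>E\<^esub> x) = \<zero>\<^bsub>F\<^esub>"
      using module_hom_diff[OF mE mF d' y(1) x] y(2) d_cl[OF x] by (simp add: F.M.minus_eq F.M.r_neg)
    then have "g (?y \<ominus>\<^bsub>E\<^esub> x) = \<zero>\<^bsub>G\<^esub>" using ker y x by simp
    then have "g ?y \<ominus>\<^bsub>G\<^esub> g x = \<zero>\<^bsub>G\<^esub>"
      using additive_minus[OF E.M.abelian_group_axioms G.M.abelian_group_axioms g_cl leibniz_mapD(2)[OF g] y(1) x] by simp
    then show ?thesis unfolding \<gamma>_def using g_cl[OF y(1)] g_cl[OF x] by (rule G.M.diff_zero_eq[rotated 2])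
  qed
  let ?f = "\<lambda>p. snd p \<ominus>\<^bsub>G\<^esub> \<gamma> (fst p)"
  have f: "?f \<in> bigraded_hom R (bigraded_sub ?J ?H) G"
  proof (rule bigraded_homI[OF module_homI])
    fix p assume "p \<in> carrier (bigraded_sub ?J ?H)"
    then obtain x y where xy: "x \<in> carrier E" "y \<in> carrier G" "p = (d x, y)" by auto
    show "?f p \<in> carrier G" using xy \<gamma> g_cl by simp
    { fix q assume "q \<in> carrier (bigraded_sub ?J ?H)"
      then obtain x' y' where q: "x' \<in> carrier E" "y' \<in> carrier G" "q = (d x', y')" by auto
      have "\<gamma> (d x \<oplus>\<^bsub>F\<^esub> d x') = g x \<oplus>\<^bsub>G\<^esub> g x'"
        using \<gamma>[of "x \<oplus>\<^bsub>E\<^esub> x'"] xy q by (simp add: module_hom_add[OF d'] leibniz_mapD(2)[OF g])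
      then show "?f (p \<oplus>\<^bsub>bigraded_sub ?J ?H\<^esub> q) = ?f p \<oplus>\<^bsub>G\<^esub> ?f q"
        using xy q \<gamma> g_cl by (simp add: G.M.minus_eq G.M.minus_add G.M.a_ac) }
    { fix a assume a: "a \<in> carrier R"
      let ?t = "\<delta> a \<odot>\<^bsub>G\<^esub> \<phi> (d x)"
      have t: "?t \<in> carrier G" using a xy \<delta>_cl \<phi>_cl d_cl by simp
      have "\<gamma> (a \<odot>\<^bsub>F\<^esub> d x) = a \<odot>\<^bsub>G\<^esub> g x \<oplus>\<^bsub>G\<^esub> ?t"
        using \<gamma>[of "a \<odot>\<^bsub>E\<^esub> x"] xy a by (simp add: module_hom_smult[OF d'] leibniz_mapD(3)[OF g])
      moreover have "(a \<odot>\<^bsub>G\<^esub> y \<oplus>\<^bsub>G\<^esub> ?t) \<ominus>\<^bsub>G\<^esub> (a \<odot>\<^bsub>G\<^esub> g x \<oplus>\<^bsub>G\<^esub> ?t) = a \<odot>\<^bsub>G\<^esub> y \<ominus>\<^bsub>G\<^esub> a \<odot>\<^bsub>G\<^esub> g x"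
      proof -
        have "(b \<oplus>\<^bsub>G\<^esub> ?t) \<ominus>\<^bsub>G\<^esub> (c \<oplus>\<^bsub>G\<^esub> ?t) = b \<ominus>\<^bsub>G\<^esub> c" if "b \<in> carrier G" "c \<in> carrier G" for b c
        proof -
          have "(b \<oplus>\<^bsub>G\<^esub> ?t) \<ominus>\<^bsub>G\<^esub> (c \<oplus>\<^bsub>G\<^esub> ?t) = b \<oplus>\<^bsub>G\<^esub> ((?t \<oplus>\<^bsub>G\<^esub> \<ominus>\<^bsub>G\<^esub> ?t) \<oplus>\<^bsub>G\<^esub> \<ominus>\<^bsub>G\<^esub> c)"
            unfolding G.M.minus_eq using that t by (simp add: G.M.minus_add G.M.a_ac)
          then show ?thesis using that t by (simp add: G.M.r_neg G.M.minus_eq)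
        qed
        then show ?thesis using a xy g_cl by simp
      qed
      moreover have "a \<odot>\<^bsub>G\<^esub> (y \<ominus>\<^bsub>G\<^esub> g x) = a \<odot>\<^bsub>G\<^esub> y \<ominus>\<^bsub>G\<^esub> a \<odot>\<^bsub>G\<^esub> g x"
        using a xy g_cl by (simp add: G.M.minus_eq G.smult_r_distr G.smult_r_minus)
      ultimately show "?f (a \<odot>\<^bsub>bigraded_sub ?J ?H\<^esub> p) = a \<odot>\<^bsub>G\<^esub> ?f p"
        using xy \<gamma> by simp }
  next
    fix e p assume "p \<in> homog (bigraded_sub ?J ?H) e"
    then obtain x y where xy: "x \<in> carrier E" "y \<in> homog G e" "p = (d x, y)" "d x \<in> homog F (e - s)" by auto
    \<comment> \<open>The preimage \<open>x\<close> need not be homogeneous, but its component of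
      degree \<open>e - s\<close> has the same image under \<open>d\<close>.\<close>
    have "d x = hcomp F (d x) (e - s)" using hcomp_homog[OF F xy(4)] by simp
    then have "d x = d (hcomp E x (e - s))" using hcomp_hom[OF E F d xy(1)] by simp
    then have "\<gamma> (d x) = g (hcomp E x (e - s))" using \<gamma> hcomp_props(4)[OF E xy(1)] by metis
    moreover have "g (hcomp E x (e - s)) \<in> homog G (e - s + s)"
      by (rule leibniz_mapD(4)[OF g hcomp_props(1)[OF E xy(1)]])
    ultimately show "?f p \<in> homog G e"
      using xy(2,3) bigraded_moduleD(7)[OF bG] by simp
  qed
  obtain K where K: "K \<in> bigraded_hom R ?J G" "\<And>p. p \<in> ?H \<Longrightarrow> K p = ?f p"
    using bigraded_injective_extend_sub[OF R G J H comp h f] by blast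
  note K' = bigraded_homD(1)[OF K(1)]
  let ?D = "\<lambda>x. \<ominus>\<^bsub>G\<^esub> K (x, \<zero>\<^bsub>G\<^esub>)"
  have K_cl: "K (x, y) \<in> carrier G" if "x \<in> carrier F" "y \<in> carrier G" for x y
    using module_hom_closed[OF K', of "(x, y)"] that by simp
  \<comment> \<open>With this normalisation, the linearity statement
    \<open>K (a x, t) = a K (x, 0)\<close>, where \<open>t\<close> is the Leibniz term of
    \<open>a\<close> and \<open>x\<close>, becomes the Leibniz rule for
    \<open>- K (x, 0)\<close>.\<close>
  have K0: "K (\<zero>\<^bsub>F\<^esub>, y) = y" if y: "y \<in> carrier G" for y
  proof -
    have "\<gamma> \<zero>\<^bsub>F\<^esub> = g \<zero>\<^bsub>E\<^esub>" using \<gamma>[of "\<zero>\<^bsub>E\<^esub>"] module_hom_zero[OF mE mF d'] by simp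
    moreover have "g \<zero>\<^bsub>E\<^esub> = \<zero>\<^bsub>G\<^esub>" using ker module_hom_zero[OF mE mF d'] by simp
    ultimately show ?thesis using K(2)[of "(\<zero>\<^bsub>F\<^esub>, y)"] y im0 by (simp add: G.M.minus_eq)
  qed
  have "leibniz_map R s \<delta> \<phi> F G ?D"
  proof (rule leibniz_mapI)
    show "?D x \<in> carrier G" if "x \<in> carrier F" for x using K_cl that by simp
    show "?D (x \<oplus>\<^bsub>F\<^esub> y) = ?D x \<oplus>\<^bsub>G\<^esub> ?D y" if "x \<in> carrier F" "y \<in> carrier F" for x y
      using module_hom_add[OF K', of "(x, \<zero>\<^bsub>G\<^esub>)" "(y, \<zero>\<^bsub>G\<^esub>)"] that K_cl by (simp add: G.M.minus_add)
    show "?D (a \<odot>\<^bsub>F\<^esub> x) = a \<odot>\<^bsub>G\<^esub> ?D x \<oplus>\<^bsub>G\<^esub> \<delta> a \<odot>\<^bsub>G\<^esub> \<phi> x" if a: "a \<in> carrier R" and x: "x \<in> carrier F" for a x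
    proof -
      let ?t = "\<delta> a \<odot>\<^bsub>G\<^esub> \<phi> x"
      have t: "?t \<in> carrier G" using a x \<delta>_cl \<phi>_cl by simp
      have "K (a \<odot>\<^bsub>F\<^esub> x, ?t) = a \<odot>\<^bsub>G\<^esub> K (x, \<zero>\<^bsub>G\<^esub>)"
        using module_hom_smult[OF K' a, of "(x, \<zero>\<^bsub>G\<^esub>)"] a x t by simp
      moreover have "K (a \<odot>\<^bsub>F\<^esub> x, ?t) = K (a \<odot>\<^bsub>F\<^esub> x, \<zero>\<^bsub>G\<^esub>) \<oplus>\<^bsub>G\<^esub> ?t"
        using module_hom_add[OF K', of "(a \<odot>\<^bsub>F\<^esub> x, \<zero>\<^bsub>G\<^esub>)" "(\<zero>\<^bsub>F\<^esub>, ?t)"] a x t K0[OF t] by simp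
      ultimately have "K (a \<odot>\<^bsub>F\<^esub> x, \<zero>\<^bsub>G\<^esub>) = a \<odot>\<^bsub>G\<^esub> K (x, \<zero>\<^bsub>G\<^esub>) \<oplus>\<^bsub>G\<^esub> \<ominus>\<^bsub>G\<^esub> ?t"
        using K_cl[of "a \<odot>\<^bsub>F\<^esub> x" "\<zero>\<^bsub>G\<^esub>"] K_cl[of x "\<zero>\<^bsub>G\<^esub>"] a x t
        by (metis F.smult_closed G.M.add.inv_solve_right G.M.zero_closed G.smult_closed)
      then show ?thesis
        using K_cl[of x "\<zero>\<^bsub>G\<^esub>"] a x t by (simp add: G.M.minus_add G.smult_r_minus)
    qed
    show "?D x \<in> homog G (e + s)" if "x \<in> homog F e" for e x
    proof -
      have "K (x, \<zero>\<^bsub>G\<^esub>) \<in> homog G (e + s)"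
        using bigraded_homD(2)[OF K(1), of "(x, \<zero>\<^bsub>G\<^esub>)" "e + s"] that bigraded_moduleD(4)[OF bG] by simp
      then show ?thesis
        using bigraded_moduleD(7)[OF bG bigraded_moduleD(4)[OF bG], of "K (x, \<zero>\<^bsub>G\<^esub>)" "e + s"]
          bigraded_moduleD(5)[OF bG, of "K (x, \<zero>\<^bsub>G\<^esub>)" "e + s"] by (simp add: G.M.minus_eq)
    qed
  qed
  moreover have "?D (d x) = g x" if "x \<in> carrier E" for x
    using K(2)[of "(d x, \<zero>\<^bsub>G\<^esub>)"] \<gamma>[OF that] g_cl[OF that] that by (simp add: G.M.minus_eq)
  ultimately show ?thesis by blast
qed

section \<open>Connections satisfying the Euler identity\<close>

lemma bigraded_resolutionD:
  assumes "bigraded_injective_resolution R M E \<epsilon> d"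
  shows "bigraded_module R M" "bigraded_injective R (E i)" "bigraded_module R (E i)"
    "\<epsilon> \<in> bigraded_hom R M (E 0)" "d i \<in> bigraded_hom R (E i) (E (Suc i))" "inj_on \<epsilon> (carrier M)"
    "x \<in> carrier (E 0) \<Longrightarrow> d 0 x = \<zero>\<^bsub>E 1\<^esub> \<Longrightarrow> x \<in> \<epsilon> ` carrier M"
    "y \<in> carrier M \<Longrightarrow> d 0 (\<epsilon> y) = \<zero>\<^bsub>E 1\<^esub>"
    "x \<in> carrier (E (Suc i)) \<Longrightarrow> d (Suc i) x = \<zero>\<^bsub>E (Suc (Suc i))\<^esub> \<Longrightarrow> x \<in> d i ` carrier (E i)"
    "x \<in> carrier (E i) \<Longrightarrow> d (Suc i) (d i x) = \<zero>\<^bsub>E (Suc (Suc i))\<^esub>"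
proof -
  note a = assms[unfolded bigraded_injective_resolution_def]
  show "bigraded_module R M" "bigraded_injective R (E i)" "\<epsilon> \<in> bigraded_hom R M (E 0)"
    "d i \<in> bigraded_hom R (E i) (E (Suc i))" "inj_on \<epsilon> (carrier M)"
    using a by blast+
  then show "bigraded_module R (E i)" by (simp add: bigraded_injective_def)
  have 1: "\<epsilon> ` carrier M = {x \<in> carrier (E 0). d 0 x = \<zero>\<^bsub>E 1\<^esub>}"
    and 2: "d i ` carrier (E i) = {x \<in> carrier (E (Suc i)). d (Suc i) x = \<zero>\<^bsub>E (Suc (Suc i))\<^esub>}"
    using a unfolding a_kernel_def' by blast+
  show "x \<in> carrier (E 0) \<Longrightarrow> d 0 x = \<zero>\<^bsub>E 1\<^esub> \<Longrightarrow> x \<in> \<epsilon> ` carrier M"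
    "y \<in> carrier M \<Longrightarrow> d 0 (\<epsilon> y) = \<zero>\<^bsub>E 1\<^esub>" using 1 by blast+
  show "x \<in> carrier (E (Suc i)) \<Longrightarrow> d (Suc i) x = \<zero>\<^bsub>E (Suc (Suc i))\<^esub> \<Longrightarrow> x \<in> d i ` carrier (E i)"
    "x \<in> carrier (E i) \<Longrightarrow> d (Suc i) (d i x) = \<zero>\<^bsub>E (Suc (Suc i))\<^esub>" using 2 by blast+
qed

lemma bigraded_hom_id: "(\<lambda>x. x) \<in> bigraded_hom R M M"
  by (intro bigraded_homI module_hom_id)

lemma leibniz_map_comp:
  assumes M: "module R M" and N: "module R N" and \<delta>: "graded_derivation R s \<delta>"
    and D: "leibniz_map R s \<delta> (\<lambda>x. x) M M D" and f: "f \<in> bigraded_hom R M N"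
  shows "leibniz_map R s \<delta> f M N (\<lambda>x. f (D x))"
proof -
  note f' = bigraded_homD(1)[OF f]
  interpret M: module R M by fact
  show ?thesis
    using leibniz_mapD[OF D] module_hom_closed[OF f'] module_hom_add[OF f'] module_hom_smult[OF f']
      bigraded_homD(2)[OF f] graded_derivationD(1)[OF \<delta>]
    by (intro leibniz_mapI) simp_all
qed

text \<open>To extend \<open>d k \<circ> D' k\<close> along \<open>d k\<close>, it must vanish on
  the kernel of \<open>d k\<close>. This condition is part of the invariant \<open>P\<close>, and
  exactness passes it on: a cocycle of the next degree is some \<open>d k y\<close>, and its image
  \<open>d k (D' k y)\<close> is a cocycle again.\<close>

lemma leibniz_lift:
  fixes R :: "('r, 'r) bigraded" and E :: "nat \<Rightarrow> ('r, 'e) bigraded"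
  assumes inf: "infinite (UNIV :: 'r set)" and R: "bigraded_module R R" and \<delta>: "graded_derivation R s \<delta>"
    and res: "bigraded_injective_resolution R M E \<epsilon> d" and D: "leibniz_map R s \<delta> (\<lambda>x. x) M M D"
  shows "\<exists>D'. (\<forall>k. leibniz_map R s \<delta> (\<lambda>x. x) (E k) (E k) (D' k)) \<and> (\<forall>x\<in>carrier M. D' 0 (\<epsilon> x) = \<epsilon> (D x)) \<and>
    (\<forall>k. \<forall>x\<in>carrier (E k). D' (Suc k) (d k x) = d k (D' k x))"
proof -
  note r = bigraded_resolutionD[OF res]
  note mM = bigraded_moduleD(1)[OF r(1)] and mE = bigraded_moduleD(1)[OF r(3)]
    and dh = bigraded_homD(1)[OF r(5)] and eh = bigraded_homD(1)[OF r(4)]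
  interpret M: module R M by (rule mM)
  define P where "P = (\<lambda>k D'. leibniz_map R s \<delta> (\<lambda>x. x) (E k) (E k) D' \<and> (k = 0 \<longrightarrow> (\<forall>x\<in>carrier M. D' (\<epsilon> x) = \<epsilon> (D x))) \<and>
     (\<forall>x\<in>carrier (E k). d k x = \<zero>\<^bsub>E (Suc k)\<^esub> \<longrightarrow> d k (D' x) = \<zero>\<^bsub>E (Suc k)\<^esub>))"
  define Q where "Q = (\<lambda>k D' D''. \<forall>x\<in>carrier (E k). D'' (d k x) = d k (D' x))"
  have "\<exists>D'. \<forall>k. P k (D' k) \<and> Q k (D' k) (D' (Suc k))"
  proof (rule dependent_nat_choice)
    have "\<exists>D'. leibniz_map R s \<delta> (\<lambda>x. x) (E 0) (E 0) D' \<and> (\<forall>x\<in>carrier M. D' (\<epsilon> x) = \<epsilon> (D x))"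
    proof (rule leibniz_extension[OF inf R \<delta> r(1) r(3) r(2) bigraded_hom_id r(4) leibniz_map_comp[OF mM mE \<delta> D r(4)]])
      fix x assume x: "x \<in> carrier M" "\<epsilon> x = \<zero>\<^bsub>E 0\<^esub>"
      then have "x = \<zero>\<^bsub>M\<^esub>" using r(6) module_hom_inj_iff[OF mM mE eh] by blast
      then have "D x = \<zero>\<^bsub>M\<^esub>"
        using additive_zero[OF M.M.abelian_group_axioms M.M.abelian_group_axioms leibniz_mapD(1)[OF D] leibniz_mapD(2)[OF D]] by simp
      then show "\<epsilon> (D x) = \<zero>\<^bsub>E 0\<^esub>" using module_hom_zero[OF mM mE eh] by simp
    qed
    then obtain D' where D': "leibniz_map R s \<delta> (\<lambda>x. x) (E 0) (E 0) D'" "\<forall>x\<in>carrier M. D' (\<epsilon> x) = \<epsilon> (D x)" by blast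
    have "d 0 (D' x) = \<zero>\<^bsub>E (Suc 0)\<^esub>" if x: "x \<in> carrier (E 0)" "d 0 x = \<zero>\<^bsub>E (Suc 0)\<^esub>" for x
    proof -
      obtain y where "y \<in> carrier M" "x = \<epsilon> y" using r(7)[of x] x by auto
      then show ?thesis using D'(2) r(8)[OF leibniz_mapD(1)[OF D]] by simp
    qed
    then show "\<exists>D'. P 0 D'" unfolding P_def using D' by blast
  next
    fix D' k assume P: "P k D'"
    then have D': "leibniz_map R s \<delta> (\<lambda>x. x) (E k) (E k) D'"
      "\<And>x. x \<in> carrier (E k) \<Longrightarrow> d k x = \<zero>\<^bsub>E (Suc k)\<^esub> \<Longrightarrow> d k (D' x) = \<zero>\<^bsub>E (Suc k)\<^esub>"
      unfolding P_def by blast+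
    obtain D'' where D'': "leibniz_map R s \<delta> (\<lambda>x. x) (E (Suc k)) (E (Suc k)) D''"
      "\<forall>x\<in>carrier (E k). D'' (d k x) = d k (D' x)"
      using leibniz_extension[OF inf R \<delta> r(3) r(3) r(2) bigraded_hom_id r(5) leibniz_map_comp[OF mE mE \<delta> D'(1) r(5)] D'(2)]
      by blast
    have "d (Suc k) (D'' x) = \<zero>\<^bsub>E (Suc (Suc k))\<^esub>" if x: "x \<in> carrier (E (Suc k))" "d (Suc k) x = \<zero>\<^bsub>E (Suc (Suc k))\<^esub>" for x
    proof -
      obtain y where "y \<in> carrier (E k)" "x = d k y" using r(9)[OF x] by blast
      then show ?thesis using D''(2) r(10)[OF leibniz_mapD(1)[OF D'(1)]] by simp
    qed
    then show "\<exists>D''. P (Suc k) D'' \<and> Q k D' D''" unfolding P_def Q_def using D'' by blast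
  qed
  then obtain D' where PQ: "\<And>k. P k (D' k)" "\<And>k. Q k (D' k) (D' (Suc k))" by blast
  show ?thesis
  proof (intro exI[of _ D'] conjI allI)
    show "leibniz_map R s \<delta> (\<lambda>x. x) (E k) (E k) (D' k)" for k using PQ(1)[of k] by (simp add: P_def)
    show "\<forall>x\<in>carrier M. D' 0 (\<epsilon> x) = \<epsilon> (D x)" using PQ(1)[of 0] by (simp add: P_def)
    show "\<forall>x\<in>carrier (E k). D' (Suc k) (d k x) = d k (D' k x)" for k using PQ(2)[of k] by (simp add: Q_def)
  qed
qed

text \<open>\<open>h (Suc k)\<close> is an extension of \<open>N (Suc k) - d k \<circ> h k\<close>
  along \<open>d (Suc k)\<close>. The invariant \<open>d N = d h d\<close> makes this difference
  vanish on the image of \<open>d k\<close>, which is the kernel of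
  \<open>d (Suc k)\<close>.\<close>

lemma null_homotopy:
  fixes R :: "('r, 'r) bigraded" and E :: "nat \<Rightarrow> ('r, 'e) bigraded"
  assumes inf: "infinite (UNIV :: 'r set)" and R: "bigraded_module R R"
    and res: "bigraded_injective_resolution R M E \<epsilon> d" and N: "\<And>k. N k \<in> bigraded_hom R (E k) (E k)"
    and chain: "\<And>k x. x \<in> carrier (E k) \<Longrightarrow> N (Suc k) (d k x) = d k (N k x)"
    and zero: "\<And>x. x \<in> carrier M \<Longrightarrow> N 0 (\<epsilon> x) = \<zero>\<^bsub>E 0\<^esub>"
  shows "\<exists>h. (\<forall>k. h k \<in> bigraded_hom R (E (Suc k)) (E k)) \<and> (\<forall>x\<in>carrier (E 0). N 0 x = h 0 (d 0 x)) \<and>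
    (\<forall>k. \<forall>x\<in>carrier (E (Suc k)). N (Suc k) x = d k (h k x) \<oplus>\<^bsub>E (Suc k)\<^esub> h (Suc k) (d (Suc k) x))"
proof -
  note r = bigraded_resolutionD[OF res]
  note mE = bigraded_moduleD(1)[OF r(3)] and dh = bigraded_homD(1)[OF r(5)] and Nh = bigraded_homD(1)[OF N]
  have ext: "\<exists>h\<in>bigraded_hom R (E (Suc k)) (E k). \<forall>x\<in>carrier (E k). h (d k x) = g x"
    if g: "g \<in> bigraded_hom R (E k) (E k)"
      and ker: "\<And>x. x \<in> carrier (E k) \<Longrightarrow> d k x = \<zero>\<^bsub>E (Suc k)\<^esub> \<Longrightarrow> g x = \<zero>\<^bsub>E k\<^esub>" for g k
  proof -
    have z: "(\<lambda>_. \<zero>\<^bsub>E k\<^esub>) \<in> bigraded_hom R F (E k)" for F :: "('r, 'e) bigraded"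
      using module_hom_const_zero[OF mE] bigraded_moduleD(4)[OF r(3)] by (intro bigraded_homI)
    have "leibniz_map R 0 (\<lambda>_. \<zero>\<^bsub>R\<^esub>) (\<lambda>x. \<zero>\<^bsub>E k\<^esub>) (E k) (E k) g"
      using leibniz_zero_iff_hom[OF mE, of "E k" "\<lambda>_. \<zero>\<^bsub>E k\<^esub>"] g module_zero_closed[OF mE] by blast
    from leibniz_extension[OF inf R graded_derivation_zero[OF R] r(3) r(3) r(2) z r(5) this ker]
    obtain h where h: "leibniz_map R 0 (\<lambda>_. \<zero>\<^bsub>R\<^esub>) (\<lambda>_. \<zero>\<^bsub>E k\<^esub>) (E (Suc k)) (E k) h"
      "\<forall>x\<in>carrier (E k). h (d k x) = g x" by blast
    then show ?thesis
      using leibniz_zero_iff_hom[OF mE, of "E (Suc k)" "\<lambda>_. \<zero>\<^bsub>E k\<^esub>"] module_zero_closed[OF mE] by blast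
  qed
  define P where "P = (\<lambda>k h. h \<in> bigraded_hom R (E (Suc k)) (E k) \<and> (k = 0 \<longrightarrow> (\<forall>x\<in>carrier (E 0). N 0 x = h (d 0 x))) \<and>
     (\<forall>x\<in>carrier (E k). d k (N k x) = d k (h (d k x))))"
  define Q where "Q = (\<lambda>k h h'. \<forall>x\<in>carrier (E (Suc k)). N (Suc k) x = d k (h x) \<oplus>\<^bsub>E (Suc k)\<^esub> h' (d (Suc k) x))"
  have "\<exists>h. \<forall>k. P k (h k) \<and> Q k (h k) (h (Suc k))"
  proof (rule dependent_nat_choice)
    have "N 0 x = \<zero>\<^bsub>E 0\<^esub>" if "x \<in> carrier (E 0)" "d 0 x = \<zero>\<^bsub>E (Suc 0)\<^esub>" for x
      using r(7)[of x] that zero by auto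
    from ext[OF N this] obtain h where "h \<in> bigraded_hom R (E (Suc 0)) (E 0)" "\<forall>x\<in>carrier (E 0). h (d 0 x) = N 0 x"
      by blast
    then show "\<exists>h. P 0 h" unfolding P_def by (intro exI[of _ h]) simp
  next
    fix h k assume "P k h"
    then have h: "h \<in> bigraded_hom R (E (Suc k)) (E k)" "\<And>x. x \<in> carrier (E k) \<Longrightarrow> d k (N k x) = d k (h (d k x))"
      unfolding P_def by blast+
    let ?E = "E (Suc k)"
    interpret E: module R ?E by (rule mE)
    note hh = bigraded_homD(1)[OF h(1)]
    let ?g = "\<lambda>x. N (Suc k) x \<ominus>\<^bsub>?E\<^esub> d k (h x)"
    have cl: "N (Suc k) x \<in> carrier ?E" "d k (h x) \<in> carrier ?E" "d (Suc k) x \<in> carrier (E (Suc (Suc k)))"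
      if "x \<in> carrier ?E" for x
      using that module_hom_closed[OF Nh] module_hom_closed[OF dh] module_hom_closed[OF hh] by auto
    have g: "?g \<in> bigraded_hom R ?E ?E"
      using module_hom_minus[OF mE Nh module_hom_comp[OF hh dh]] bigraded_homD(2)[OF N]
        bigraded_homD(2)[OF r(5)] bigraded_homD(2)[OF h(1)] bigraded_moduleD(7)[OF r(3)]
      by (intro bigraded_homI) simp_all
    have "?g x = \<zero>\<^bsub>?E\<^esub>" if x: "x \<in> carrier ?E" "d (Suc k) x = \<zero>\<^bsub>E (Suc (Suc k))\<^esub>" for x
    proof -
      obtain y where y: "y \<in> carrier (E k)" "x = d k y" using r(9)[OF x] by blast
      have "N (Suc k) x = d k (h x)" unfolding y(2) chain[OF y(1)] h(2)[OF y(1)] ..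
      then show ?thesis using cl(2)[OF x(1)] by (simp add: E.M.minus_eq E.M.r_neg)
    qed
    from ext[OF g this] obtain h' where h': "h' \<in> bigraded_hom R (E (Suc (Suc k))) ?E"
      "\<And>x. x \<in> carrier ?E \<Longrightarrow> h' (d (Suc k) x) = ?g x" by blast
    have eq: "N (Suc k) x = d k (h x) \<oplus>\<^bsub>?E\<^esub> h' (d (Suc k) x)" if x: "x \<in> carrier ?E" for x
      unfolding h'(2)[OF x] using cl[OF x] E.M.diff_add_cancel by (simp add: E.M.a_comm)
    have "d (Suc k) (N (Suc k) x) = d (Suc k) (h' (d (Suc k) x))" if x: "x \<in> carrier ?E" for x
    proof -
      have c: "h' (d (Suc k) x) \<in> carrier ?E"
        using module_hom_closed[OF bigraded_homD(1)[OF h'(1)]] cl(3)[OF x] by blast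
      interpret E2: module R "E (Suc (Suc k))" by (rule mE)
      have "d (Suc k) (d k (h x)) = \<zero>\<^bsub>E (Suc (Suc k))\<^esub>"
        using module_hom_closed[OF hh x] by (rule r(10))
      then show ?thesis
        unfolding eq[OF x] using module_hom_add[OF dh cl(2)[OF x] c] module_hom_closed[OF dh c] by simp
    qed
    then show "\<exists>h'. P (Suc k) h' \<and> Q k h h'" unfolding P_def Q_def using h'(1) eq by blast
  qed
  then obtain h where PQ: "\<And>k. P k (h k)" "\<And>k. Q k (h k) (h (Suc k))" by blast
  show ?thesis
  proof (intro exI[of _ h] conjI allI)
    show "h k \<in> bigraded_hom R (E (Suc k)) (E k)" for k using PQ(1)[of k] by (simp add: P_def)
    show "\<forall>x\<in>carrier (E 0). N 0 x = h 0 (d 0 x)" using PQ(1)[of 0] by (simp add: P_def)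
    show "\<forall>x\<in>carrier (E (Suc k)). N (Suc k) x = d k (h k x) \<oplus>\<^bsub>E (Suc k)\<^esub> h (Suc k) (d (Suc k) x)" for k
      using PQ(2)[of k] by (simp add: Q_def)
  qed
qed

text \<open>
  Here \<open>s\<close> is the degree of the derivations \<open>\<delta> i\<close>, and the Euler operator \<open>\<Sum> \<xi> i \<delta> i\<close> acts as the scalar \<open>w e\<close>
  in degree \<open>e\<close>. It is applied to the partial derivatives by the \<open>X\<^sub>i\<close>, with \<open>s = (- 1, 0)\<close> and
  \<open>w (u, v) = u\<close>, and to those by the \<open>Y\<^sub>j\<close>.
\<close>

locale euler_ring =
  fixes R :: "('r, 'r) bigraded" and J :: "'i set" and \<xi> :: "'i \<Rightarrow> 'r" and \<delta> :: "'i \<Rightarrow> 'r \<Rightarrow> 'r"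
    and s :: "int \<times> int" and w :: "int \<times> int \<Rightarrow> 'r"
  assumes R: "bigraded_module R R" and infinite_type: "infinite (UNIV :: 'r set)"
    and smult_R: "\<And>a b. a \<odot>\<^bsub>R\<^esub> b = a \<otimes>\<^bsub>R\<^esub> b"
    and finite_J: "finite J" and \<xi>: "\<And>i. i \<in> J \<Longrightarrow> \<xi> i \<in> homog R (- s)"
    and \<delta>: "\<And>i. i \<in> J \<Longrightarrow> graded_derivation R s (\<delta> i)"
    and w: "\<And>e. w e \<in> homog R 0" "\<And>e e'. w (e + e') = w e \<oplus>\<^bsub>R\<^esub> w e'"
    and euler_R: "\<And>e a. a \<in> homog R e \<Longrightarrow> finsum R (\<lambda>i. \<xi> i \<otimes>\<^bsub>R\<^esub> \<delta> i a) J = w e \<otimes>\<^bsub>R\<^esub> a"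
begin

definition euler_op :: "('r, 'a) bigraded \<Rightarrow> ('i \<Rightarrow> 'a \<Rightarrow> 'a) \<Rightarrow> 'a \<Rightarrow> 'a" where
  "euler_op M D x = finsum M (\<lambda>i. \<xi> i \<odot>\<^bsub>M\<^esub> D i x) J"

definition connection :: "('r, 'a) bigraded \<Rightarrow> ('i \<Rightarrow> 'a \<Rightarrow> 'a) \<Rightarrow> bool" where
  "connection M D \<longleftrightarrow> (\<forall>i\<in>J. leibniz_map R s (\<delta> i) (\<lambda>x. x) M M (D i))"

definition euler_module :: "('r, 'a) bigraded \<Rightarrow> ('i \<Rightarrow> 'a \<Rightarrow> 'a) \<Rightarrow> bool" where
  "euler_module M D \<longleftrightarrow> bigraded_module R M \<and> connection M D \<and>
     (\<forall>e. \<forall>x\<in>homog M e. euler_op M D x = w e \<odot>\<^bsub>M\<^esub> x)"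

lemma \<xi>_carrier: "i \<in> J \<Longrightarrow> \<xi> i \<in> carrier R"
  using \<xi> bigraded_moduleD(5)[OF R] by blast

lemma w_carrier: "w e \<in> carrier R"
  using w(1) bigraded_moduleD(5)[OF R] by blast

lemma connectionD:
  "connection M D \<Longrightarrow> i \<in> J \<Longrightarrow> leibniz_map R s (\<delta> i) (\<lambda>x. x) M M (D i)"
  by (simp add: connection_def)

context
  fixes M :: "('r, 'a) bigraded" and D
  assumes M: "bigraded_module R M" and D: "connection M D"
begin

interpretation R: module R R by (rule bigraded_moduleD[OF R])
interpretation M: module R M by (rule bigraded_moduleD[OF M])

lemma euler_term_closed: "i \<in> J \<Longrightarrow> x \<in> carrier M \<Longrightarrow> \<xi> i \<odot>\<^bsub>M\<^esub> D i x \<in> carrier M"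
  using leibniz_mapD(1)[OF connectionD[OF D]] \<xi>_carrier by simp

lemma euler_op_closed: "x \<in> carrier M \<Longrightarrow> euler_op M D x \<in> carrier M"
  unfolding euler_op_def using euler_term_closed by (intro M.M.finsum_closed) auto

lemma euler_op_add:
  assumes "x \<in> carrier M" "y \<in> carrier M"
  shows "euler_op M D (x \<oplus>\<^bsub>M\<^esub> y) = euler_op M D x \<oplus>\<^bsub>M\<^esub> euler_op M D y"
proof -
  have "euler_op M D (x \<oplus>\<^bsub>M\<^esub> y) = finsum M (\<lambda>i. \<xi> i \<odot>\<^bsub>M\<^esub> D i x \<oplus>\<^bsub>M\<^esub> \<xi> i \<odot>\<^bsub>M\<^esub> D i y) J"
    unfolding euler_op_def
    using assms leibniz_mapD(1,2)[OF connectionD[OF D]] \<xi>_carrier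
    by (intro M.M.finsum_cong') (auto simp: M.smult_r_distr)
  also have "\<dots> = euler_op M D x \<oplus>\<^bsub>M\<^esub> euler_op M D y"
    unfolding euler_op_def using assms euler_term_closed by (intro M.M.finsum_addf) auto
  finally show ?thesis .
qed

lemma euler_op_homog: "x \<in> homog M e \<Longrightarrow> euler_op M D x \<in> homog M e"
  unfolding euler_op_def
proof (rule homog_finsum[OF M finite_J])
  fix i assume "i \<in> J" "x \<in> homog M e"
  then show "\<xi> i \<odot>\<^bsub>M\<^esub> D i x \<in> homog M e"
    using bigraded_moduleD(8)[OF M \<xi>[of i] leibniz_mapD(4)[OF connectionD[OF D, of i], of x e]] by simp
qed

text \<open>The Leibniz terms add up to the Euler operator of \<open>R\<close> at \<open>a\<close>,
  which \<open>euler_R\<close> evaluates.\<close>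

lemma euler_op_smult:
  assumes a: "a \<in> homog R e" and x: "x \<in> carrier M"
  shows "euler_op M D (a \<odot>\<^bsub>M\<^esub> x) = a \<odot>\<^bsub>M\<^esub> euler_op M D x \<oplus>\<^bsub>M\<^esub> (w e \<otimes>\<^bsub>R\<^esub> a) \<odot>\<^bsub>M\<^esub> x"
proof -
  have aR: "a \<in> carrier R" using a bigraded_moduleD(5)[OF R] by blast
  have Dx: "D i x \<in> carrier M" "\<delta> i a \<in> carrier R" "\<xi> i \<in> carrier R" if "i \<in> J" for i
    using that x aR leibniz_mapD(1)[OF connectionD[OF D]] graded_derivationD(1)[OF \<delta>] \<xi>_carrier by auto
  have "euler_op M D (a \<odot>\<^bsub>M\<^esub> x) =
      finsum M (\<lambda>i. a \<odot>\<^bsub>M\<^esub> (\<xi> i \<odot>\<^bsub>M\<^esub> D i x) \<oplus>\<^bsub>M\<^esub> (\<xi> i \<otimes>\<^bsub>R\<^esub> \<delta> i a) \<odot>\<^bsub>M\<^esub> x) J"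
    unfolding euler_op_def
  proof (rule M.M.finsum_cong')
    fix i assume i: "i \<in> J"
    have "\<xi> i \<odot>\<^bsub>M\<^esub> D i (a \<odot>\<^bsub>M\<^esub> x) = \<xi> i \<odot>\<^bsub>M\<^esub> (a \<odot>\<^bsub>M\<^esub> D i x \<oplus>\<^bsub>M\<^esub> \<delta> i a \<odot>\<^bsub>M\<^esub> x)"
      using leibniz_mapD(3)[OF connectionD[OF D i] aR x] by simp
    also have "\<dots> = (\<xi> i \<otimes>\<^bsub>R\<^esub> a) \<odot>\<^bsub>M\<^esub> D i x \<oplus>\<^bsub>M\<^esub> (\<xi> i \<otimes>\<^bsub>R\<^esub> \<delta> i a) \<odot>\<^bsub>M\<^esub> x"
      using Dx[OF i] aR x by (simp add: M.smult_r_distr M.smult_assoc1)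
    also have "(\<xi> i \<otimes>\<^bsub>R\<^esub> a) \<odot>\<^bsub>M\<^esub> D i x = a \<odot>\<^bsub>M\<^esub> (\<xi> i \<odot>\<^bsub>M\<^esub> D i x)"
      using Dx[OF i] aR R.R.m_comm[of "\<xi> i" a] by (simp add: M.smult_assoc1)
    finally show "\<xi> i \<odot>\<^bsub>M\<^esub> D i (a \<odot>\<^bsub>M\<^esub> x) = a \<odot>\<^bsub>M\<^esub> (\<xi> i \<odot>\<^bsub>M\<^esub> D i x) \<oplus>\<^bsub>M\<^esub> (\<xi> i \<otimes>\<^bsub>R\<^esub> \<delta> i a) \<odot>\<^bsub>M\<^esub> x" .
  qed (use Dx aR x in auto)
  also have "\<dots> = finsum M (\<lambda>i. a \<odot>\<^bsub>M\<^esub> (\<xi> i \<odot>\<^bsub>M\<^esub> D i x)) J \<oplus>\<^bsub>M\<^esub> finsum M (\<lambda>i. (\<xi> i \<otimes>\<^bsub>R\<^esub> \<delta> i a) \<odot>\<^bsub>M\<^esub> x) J"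
    using Dx aR x by (intro M.M.finsum_addf) auto
  also have "finsum M (\<lambda>i. a \<odot>\<^bsub>M\<^esub> (\<xi> i \<odot>\<^bsub>M\<^esub> D i x)) J = a \<odot>\<^bsub>M\<^esub> euler_op M D x"
    unfolding euler_op_def using Dx by (intro M.finsum_smult_ldistr[symmetric] finite_J aR) auto
  also have "finsum M (\<lambda>i. (\<xi> i \<otimes>\<^bsub>R\<^esub> \<delta> i a) \<odot>\<^bsub>M\<^esub> x) J = finsum R (\<lambda>i. \<xi> i \<otimes>\<^bsub>R\<^esub> \<delta> i a) J \<odot>\<^bsub>M\<^esub> x"
    using Dx x M.smult_l_distr
    by (intro additive_finsum[symmetric, OF R.R.abelian_group_axioms M.M.abelian_group_axioms _ _ finite_J]) auto
  finally show ?thesis using euler_R[OF a] by simp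
qed

lemma euler_defect:
  obtains N where "N \<in> bigraded_hom R M M"
    "\<And>e x. x \<in> homog M e \<Longrightarrow> N x = euler_op M D x \<ominus>\<^bsub>M\<^esub> w e \<odot>\<^bsub>M\<^esub> x"
proof -
  obtain W where W: "\<And>x. x \<in> carrier M \<Longrightarrow> W x \<in> carrier M"
    "\<And>x y. x \<in> carrier M \<Longrightarrow> y \<in> carrier M \<Longrightarrow> W (x \<oplus>\<^bsub>M\<^esub> y) = W x \<oplus>\<^bsub>M\<^esub> W y"
    "\<And>e x. x \<in> homog M e \<Longrightarrow> W x = w e \<odot>\<^bsub>M\<^esub> x"
    using weight_operator[OF M, of w] w_carrier by blast
  \<comment> \<open>Additivity of \<open>w\<close> gives the weight operator the same Leibniz term
    as the Euler operator.\<close>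
  have Wsmult: "W (a \<odot>\<^bsub>M\<^esub> x) = a \<odot>\<^bsub>M\<^esub> W x \<oplus>\<^bsub>M\<^esub> (w e \<otimes>\<^bsub>R\<^esub> a) \<odot>\<^bsub>M\<^esub> x"
    if a: "a \<in> homog R e" and x: "x \<in> carrier M" for a e x
    using M x
  proof (rule bigraded_induct)
    have aR: "a \<in> carrier R" using a bigraded_moduleD(5)[OF R] by blast
    fix e' x assume x: "x \<in> homog M e'"
    then have xM: "x \<in> carrier M" using bigraded_moduleD(5)[OF M] by blast
    have "W (a \<odot>\<^bsub>M\<^esub> x) = (w e \<oplus>\<^bsub>R\<^esub> w e') \<odot>\<^bsub>M\<^esub> (a \<odot>\<^bsub>M\<^esub> x)"
      using W(3)[OF bigraded_moduleD(8)[OF M a x]] w(2) by simp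
    also have "\<dots> = (w e \<otimes>\<^bsub>R\<^esub> a) \<odot>\<^bsub>M\<^esub> x \<oplus>\<^bsub>M\<^esub> (w e' \<otimes>\<^bsub>R\<^esub> a) \<odot>\<^bsub>M\<^esub> x"
      using aR xM w_carrier by (simp add: M.smult_l_distr M.smult_assoc1)
    also have "(w e' \<otimes>\<^bsub>R\<^esub> a) \<odot>\<^bsub>M\<^esub> x = a \<odot>\<^bsub>M\<^esub> W x"
      using aR xM w_carrier W(3)[OF x] R.R.m_comm[of "w e'" a] by (simp add: M.smult_assoc1)
    finally show "W (a \<odot>\<^bsub>M\<^esub> x) = a \<odot>\<^bsub>M\<^esub> W x \<oplus>\<^bsub>M\<^esub> (w e \<otimes>\<^bsub>R\<^esub> a) \<odot>\<^bsub>M\<^esub> x"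
      using aR xM w_carrier W(1) by (simp add: M.M.a_comm)
  next
    have aR: "a \<in> carrier R" using a bigraded_moduleD(5)[OF R] by blast
    fix x y assume xy: "x \<in> carrier M" "y \<in> carrier M"
      "W (a \<odot>\<^bsub>M\<^esub> x) = a \<odot>\<^bsub>M\<^esub> W x \<oplus>\<^bsub>M\<^esub> (w e \<otimes>\<^bsub>R\<^esub> a) \<odot>\<^bsub>M\<^esub> x"
      "W (a \<odot>\<^bsub>M\<^esub> y) = a \<odot>\<^bsub>M\<^esub> W y \<oplus>\<^bsub>M\<^esub> (w e \<otimes>\<^bsub>R\<^esub> a) \<odot>\<^bsub>M\<^esub> y"
    then show "W (a \<odot>\<^bsub>M\<^esub> (x \<oplus>\<^bsub>M\<^esub> y)) = a \<odot>\<^bsub>M\<^esub> W (x \<oplus>\<^bsub>M\<^esub> y) \<oplus>\<^bsub>M\<^esub> (w e \<otimes>\<^bsub>R\<^esub> a) \<odot>\<^bsub>M\<^esub> (x \<oplus>\<^bsub>M\<^esub> y)"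
      using aR w_carrier W(1,2) by (simp add: M.smult_r_distr M.M.a_ac)
  qed
  let ?N = "\<lambda>x. euler_op M D x \<ominus>\<^bsub>M\<^esub> W x"
  have N_cl: "?N x \<in> carrier M" if "x \<in> carrier M" for x using that euler_op_closed W(1) by simp
  have N_add: "?N (x \<oplus>\<^bsub>M\<^esub> y) = ?N x \<oplus>\<^bsub>M\<^esub> ?N y" if "x \<in> carrier M" "y \<in> carrier M" for x y
    using that euler_op_closed W(1,2) euler_op_add by (simp add: M.M.minus_eq M.M.minus_add M.M.a_ac)
  \<comment> \<open>The Leibniz terms are known for homogeneous \<open>a\<close> only; additivity
    extends the linearity to all \<open>a\<close>.\<close>
  have N_smult: "?N (a \<odot>\<^bsub>M\<^esub> x) = a \<odot>\<^bsub>M\<^esub> ?N x" if a: "a \<in> carrier R" and x: "x \<in> carrier M" for a x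
    using R a
  proof (rule bigraded_induct)
    fix e a assume a: "a \<in> homog R e"
    then have aR: "a \<in> carrier R" using bigraded_moduleD(5)[OF R] by blast
    let ?t = "(w e \<otimes>\<^bsub>R\<^esub> a) \<odot>\<^bsub>M\<^esub> x" and ?y = "a \<odot>\<^bsub>M\<^esub> euler_op M D x" and ?z = "a \<odot>\<^bsub>M\<^esub> W x"
    have cl: "?t \<in> carrier M" "?y \<in> carrier M" "?z \<in> carrier M"
      using aR x w_carrier euler_op_closed W(1) by auto
    have "?N (a \<odot>\<^bsub>M\<^esub> x) = (?y \<oplus>\<^bsub>M\<^esub> ?t) \<ominus>\<^bsub>M\<^esub> (?z \<oplus>\<^bsub>M\<^esub> ?t)"
      using euler_op_smult[OF a x] Wsmult[OF a x] by simp
    also have "\<dots> = ?y \<oplus>\<^bsub>M\<^esub> ((?t \<oplus>\<^bsub>M\<^esub> \<ominus>\<^bsub>M\<^esub> ?t) \<oplus>\<^bsub>M\<^esub> \<ominus>\<^bsub>M\<^esub> ?z)"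
      unfolding M.M.minus_eq using cl by (simp only: M.M.minus_add M.M.a_ac M.M.add.m_closed M.M.a_inv_closed)
    also have "\<dots> = a \<odot>\<^bsub>M\<^esub> ?N x"
      using cl aR x euler_op_closed W(1)
      by (simp add: M.M.r_neg M.M.minus_eq M.smult_r_distr M.smult_r_minus)
    finally show "?N (a \<odot>\<^bsub>M\<^esub> x) = a \<odot>\<^bsub>M\<^esub> ?N x" .
  next
    fix a b assume "a \<in> carrier R" "b \<in> carrier R" "?N (a \<odot>\<^bsub>M\<^esub> x) = a \<odot>\<^bsub>M\<^esub> ?N x" "?N (b \<odot>\<^bsub>M\<^esub> x) = b \<odot>\<^bsub>M\<^esub> ?N x"
    then show "?N ((a \<oplus>\<^bsub>R\<^esub> b) \<odot>\<^bsub>M\<^esub> x) = (a \<oplus>\<^bsub>R\<^esub> b) \<odot>\<^bsub>M\<^esub> ?N x"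
      using N_add[of "a \<odot>\<^bsub>M\<^esub> x" "b \<odot>\<^bsub>M\<^esub> x"] x N_cl[OF x] by (simp add: M.smult_l_distr)
  qed
  have N: "?N x = euler_op M D x \<ominus>\<^bsub>M\<^esub> w e \<odot>\<^bsub>M\<^esub> x" if "x \<in> homog M e" for e x
    using W(3)[OF that] by simp
  show thesis
  proof (rule that[OF bigraded_homI[OF module_homI]])
    fix e x assume x: "x \<in> homog M e"
    have "w e \<odot>\<^bsub>M\<^esub> x \<in> homog M e" using bigraded_moduleD(8)[OF M w(1) x, of e] by simp
    then show "?N x \<in> homog M e"
      unfolding N[OF x] by (rule bigraded_moduleD(7)[OF M euler_op_homog[OF x]])
  qed (use N_cl N_add N_smult N in blast)+
qed

end

text \<open>
  The Leibniz terms of \<open>\<Sum> \<xi> i D i\<close> and of the weight operator cancel, so their difference is linear.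
  As it vanishes on \<open>M\<close>, it is null-homotopic on a resolution.
\<close>

theorem euler_resolution:
  fixes E :: "nat \<Rightarrow> ('r, 'e) bigraded"
  assumes M: "euler_module M D" and res: "bigraded_injective_resolution R M E \<epsilon> d"
  obtains D' h where "\<And>k. connection (E k) (D' k)"
    "\<And>k i x. i \<in> J \<Longrightarrow> x \<in> carrier (E k) \<Longrightarrow> D' (Suc k) i (d k x) = d k (D' k i x)"
    "\<And>k. h k \<in> bigraded_hom R (E (Suc k)) (E k)"
    "\<And>e x. x \<in> homog (E 0) e \<Longrightarrow> euler_op (E 0) (D' 0) x \<ominus>\<^bsub>E 0\<^esub> w e \<odot>\<^bsub>E 0\<^esub> x = h 0 (d 0 x)"
    "\<And>k e x. x \<in> homog (E (Suc k)) e \<Longrightarrow>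
       euler_op (E (Suc k)) (D' (Suc k)) x \<ominus>\<^bsub>E (Suc k)\<^esub> w e \<odot>\<^bsub>E (Suc k)\<^esub> x =
       d k (h k x) \<oplus>\<^bsub>E (Suc k)\<^esub> h (Suc k) (d (Suc k) x)"
proof -
  note r = bigraded_resolutionD[OF res]
  note mE = bigraded_moduleD(1)[OF r(3)] and dh = bigraded_homD(1)[OF r(5)]
    and mM = bigraded_moduleD(1)[OF r(1)] and eh = bigraded_homD(1)[OF r(4)]
  have D: "connection M D" and euler: "\<And>e x. x \<in> homog M e \<Longrightarrow> euler_op M D x = w e \<odot>\<^bsub>M\<^esub> x"
    using M by (auto simp: euler_module_def)
  have "\<forall>i\<in>J. \<exists>D'. (\<forall>k. leibniz_map R s (\<delta> i) (\<lambda>x. x) (E k) (E k) (D' k)) \<and> (\<forall>x\<in>carrier M. D' 0 (\<epsilon> x) = \<epsilon> (D i x)) \<and>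
    (\<forall>k. \<forall>x\<in>carrier (E k). D' (Suc k) (d k x) = d k (D' k x))"
    using leibniz_lift[OF infinite_type R \<delta> res connectionD[OF D]] by blast
  from bchoice[OF this] obtain D' where D':
    "\<And>i k. i \<in> J \<Longrightarrow> leibniz_map R s (\<delta> i) (\<lambda>x. x) (E k) (E k) (D' i k)"
    "\<And>i x. i \<in> J \<Longrightarrow> x \<in> carrier M \<Longrightarrow> D' i 0 (\<epsilon> x) = \<epsilon> (D i x)"
    "\<And>i k x. i \<in> J \<Longrightarrow> x \<in> carrier (E k) \<Longrightarrow> D' i (Suc k) (d k x) = d k (D' i k x)" by blast
  let ?D = "\<lambda>k i. D' i k"
  have conn: "connection (E k) (?D k)" for k using D'(1) by (simp add: connection_def)
  have "\<forall>k. \<exists>N. N \<in> bigraded_hom R (E k) (E k) \<and>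
      (\<forall>e. \<forall>x\<in>homog (E k) e. N x = euler_op (E k) (?D k) x \<ominus>\<^bsub>E k\<^esub> w e \<odot>\<^bsub>E k\<^esub> x)"
    using euler_defect[OF r(3) conn] by metis
  then obtain N where N: "\<And>k. N k \<in> bigraded_hom R (E k) (E k)"
    "\<And>k e x. x \<in> homog (E k) e \<Longrightarrow> N k x = euler_op (E k) (?D k) x \<ominus>\<^bsub>E k\<^esub> w e \<odot>\<^bsub>E k\<^esub> x" by metis
  note Nh = bigraded_homD(1)[OF N(1)]
  \<comment> \<open>A linear map that intertwines the operators intertwines the Euler operators.
    This is applied to the differentials and to \<open>\<epsilon>\<close>.\<close>
  have push: "euler_op F D2 (f x) = f (euler_op G D1 x)"
    if G: "module R G" and F: "module R F" and f: "f \<in> module_hom R G F" and x: "x \<in> carrier G"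
      and D1: "\<And>i. i \<in> J \<Longrightarrow> D1 i x \<in> carrier G" and c: "\<And>i. i \<in> J \<Longrightarrow> D2 i (f x) = f (D1 i x)"
    for F :: "('r, 'e) bigraded" and G :: "('r, 'g) bigraded" and f x D1 D2
  proof -
    interpret F: module R F by (rule F)
    interpret G: module R G by (rule G)
    have "f (euler_op G D1 x) = finsum F (\<lambda>i. f (\<xi> i \<odot>\<^bsub>G\<^esub> D1 i x)) J"
      unfolding euler_op_def using D1 \<xi>_carrier module_hom_closed[OF f] module_hom_add[OF f]
      by (intro additive_finsum[OF G.M.abelian_group_axioms F.M.abelian_group_axioms _ _ finite_J]) auto
    also have "\<dots> = euler_op F D2 (f x)"
      unfolding euler_op_def using D1 \<xi>_carrier module_hom_closed[OF f] module_hom_smult[OF f] c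
      by (intro F.M.finsum_cong') auto
    finally show ?thesis by simp
  qed
  have chain: "N (Suc k) (d k x) = d k (N k x)" if x: "x \<in> carrier (E k)" for k x
    using r(3) x
  proof (rule bigraded_induct)
    fix e x assume x: "x \<in> homog (E k) e"
    then have xE: "x \<in> carrier (E k)" using bigraded_moduleD(5)[OF r(3)] by blast
    have wx: "w e \<odot>\<^bsub>E k\<^esub> x \<in> carrier (E k)" using module.smult_closed[OF mE w_carrier xE] .
    have "euler_op (E (Suc k)) (?D (Suc k)) (d k x) = d k (euler_op (E k) (?D k) x)"
      using leibniz_mapD(1)[OF D'(1)] D'(3) xE by (intro push[OF mE mE dh]) auto
    then show "N (Suc k) (d k x) = d k (N k x)"
      unfolding N(2)[OF x] N(2)[OF bigraded_homD(2)[OF r(5) x]]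
        module_hom_diff[OF mE mE dh euler_op_closed[OF r(3) conn xE] wx]
      using module_hom_smult[OF dh w_carrier xE] by simp
  next
    fix x y assume "x \<in> carrier (E k)" "y \<in> carrier (E k)" "N (Suc k) (d k x) = d k (N k x)" "N (Suc k) (d k y) = d k (N k y)"
    then show "N (Suc k) (d k (x \<oplus>\<^bsub>E k\<^esub> y)) = d k (N k (x \<oplus>\<^bsub>E k\<^esub> y))"
      using module_hom_closed[OF dh] module_hom_closed[OF Nh] by (simp add: module_hom_add[OF dh] module_hom_add[OF Nh])
  qed
  interpret E0: module R "E 0" by (rule mE)
  have zero: "N 0 (\<epsilon> x) = \<zero>\<^bsub>E 0\<^esub>" if x: "x \<in> carrier M" for x
    using r(1) x
  proof (rule bigraded_induct)
    fix e x assume x: "x \<in> homog M e"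
    then have xM: "x \<in> carrier M" using bigraded_moduleD(5)[OF r(1)] by blast
    have "euler_op (E 0) (?D 0) (\<epsilon> x) = \<epsilon> (euler_op M D x)"
      using leibniz_mapD(1)[OF connectionD[OF D]] D'(2) xM by (intro push[OF mM mE eh]) auto
    also have "\<dots> = w e \<odot>\<^bsub>E 0\<^esub> \<epsilon> x" unfolding euler[OF x] by (rule module_hom_smult[OF eh w_carrier xM])
    finally show "N 0 (\<epsilon> x) = \<zero>\<^bsub>E 0\<^esub>"
      unfolding N(2)[OF bigraded_homD(2)[OF r(4) x]]
      using w_carrier module_hom_closed[OF eh xM] by (simp add: E0.M.minus_eq E0.M.r_neg)
  next
    fix x y assume "x \<in> carrier M" "y \<in> carrier M" "N 0 (\<epsilon> x) = \<zero>\<^bsub>E 0\<^esub>" "N 0 (\<epsilon> y) = \<zero>\<^bsub>E 0\<^esub>"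
    then show "N 0 (\<epsilon> (x \<oplus>\<^bsub>M\<^esub> y)) = \<zero>\<^bsub>E 0\<^esub>"
      using module_hom_closed[OF eh] by (simp add: module_hom_add[OF eh] module_hom_add[OF Nh])
  qed
  from null_homotopy[OF infinite_type R res N(1) chain zero] obtain h where h:
    "\<forall>k. h k \<in> bigraded_hom R (E (Suc k)) (E k)" "\<forall>x\<in>carrier (E 0). N 0 x = h 0 (d 0 x)"
    "\<forall>k. \<forall>x\<in>carrier (E (Suc k)). N (Suc k) x = d k (h k x) \<oplus>\<^bsub>E (Suc k)\<^esub> h (Suc k) (d (Suc k) x)" by blast
  have hE: "x \<in> carrier (E k)" if "x \<in> homog (E k) e" for k e x using bigraded_moduleD(5)[OF r(3) that] .
  show thesis
  proof (rule that[of ?D h])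
    show "euler_op (E 0) (?D 0) x \<ominus>\<^bsub>E 0\<^esub> w e \<odot>\<^bsub>E 0\<^esub> x = h 0 (d 0 x)" if "x \<in> homog (E 0) e" for e x
      using h(2) hE[OF that] N(2)[OF that] by simp
    show "euler_op (E (Suc k)) (?D (Suc k)) x \<ominus>\<^bsub>E (Suc k)\<^esub> w e \<odot>\<^bsub>E (Suc k)\<^esub> x =
        d k (h k x) \<oplus>\<^bsub>E (Suc k)\<^esub> h (Suc k) (d (Suc k) x)" if "x \<in> homog (E (Suc k)) e" for k e x
      using h(3) hE[OF that] N(2)[OF that] by simp
  qed (use conn D'(3) h(1) in blast)+
qed

end

section \<open>Subquotients\<close>

text \<open>The modules of the long exact sequence are iterated quotients, of several types. This
  describes each of them as the subquotient \<open>Z / B\<close> of one module \<open>E\<close>,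
  where the operators act, with homogeneous elements lifting to homogeneous ones.\<close>

definition presentation ::
  "('r, 'r) bigraded \<Rightarrow> ('r, 'e) bigraded \<Rightarrow> 'e set \<Rightarrow> 'e set \<Rightarrow> ('e \<Rightarrow> 'q) \<Rightarrow> ('r, 'q) bigraded \<Rightarrow> bool" where
  "presentation R E Z B q Q \<longleftrightarrow> submodule Z R E \<and> submodule B R E \<and> B \<subseteq> Z \<and> carrier Q = q ` Z \<and>
     (\<forall>x\<in>Z. \<forall>y\<in>Z. q (x \<oplus>\<^bsub>E\<^esub> y) = q x \<oplus>\<^bsub>Q\<^esub> q y) \<and>
     (\<forall>a\<in>carrier R. \<forall>x\<in>Z. q (a \<odot>\<^bsub>E\<^esub> x) = a \<odot>\<^bsub>Q\<^esub> q x) \<and>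
     (\<forall>x\<in>Z. q x = \<zero>\<^bsub>Q\<^esub> \<longleftrightarrow> x \<in> B) \<and> (\<forall>e. homog Q e = q ` (Z \<inter> homog E e))"

lemma presentationD:
  assumes "presentation R E Z B q Q"
  shows "submodule Z R E" "submodule B R E" "B \<subseteq> Z" "carrier Q = q ` Z"
    "x \<in> Z \<Longrightarrow> y \<in> Z \<Longrightarrow> q (x \<oplus>\<^bsub>E\<^esub> y) = q x \<oplus>\<^bsub>Q\<^esub> q y"
    "a \<in> carrier R \<Longrightarrow> x \<in> Z \<Longrightarrow> q (a \<odot>\<^bsub>E\<^esub> x) = a \<odot>\<^bsub>Q\<^esub> q x"
    "x \<in> Z \<Longrightarrow> q x = \<zero>\<^bsub>Q\<^esub> \<longleftrightarrow> x \<in> B" "homog Q e = q ` (Z \<inter> homog E e)"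
  using assms by (simp_all only: presentation_def)

lemma presentationI:
  assumes "submodule Z R E" "submodule B R E" "B \<subseteq> Z" "carrier Q = q ` Z"
    "\<And>x y. x \<in> Z \<Longrightarrow> y \<in> Z \<Longrightarrow> q (x \<oplus>\<^bsub>E\<^esub> y) = q x \<oplus>\<^bsub>Q\<^esub> q y"
    "\<And>a x. a \<in> carrier R \<Longrightarrow> x \<in> Z \<Longrightarrow> q (a \<odot>\<^bsub>E\<^esub> x) = a \<odot>\<^bsub>Q\<^esub> q x"
    "\<And>x. x \<in> Z \<Longrightarrow> q x = \<zero>\<^bsub>Q\<^esub> \<longleftrightarrow> x \<in> B" "\<And>e. homog Q e = q ` (Z \<inter> homog E e)"
  shows "presentation R E Z B q Q"
  unfolding presentation_def by (intro conjI ballI allI assms)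

lemma zero_submodule:
  assumes "module R M"
  shows "submodule {\<zero>\<^bsub>M\<^esub>} R M"
proof -
  interpret M: module R M by fact
  show ?thesis by (rule submoduleI'[OF assms]) simp_all
qed

lemma presentation_id:
  assumes "bigraded_module R E"
  shows "presentation R E (carrier E) {\<zero>\<^bsub>E\<^esub>} (\<lambda>x. x) E"
proof -
  note E = bigraded_moduleD(1)[OF assms]
  interpret E: module R E by (rule E)
  show ?thesis
    by (rule presentationI[OF E.carrier_is_submodule zero_submodule[OF E]])
      (simp_all add: Int_absorb1 bigraded_moduleD(3)[OF assms])
qed

context
  fixes R :: "('r, 'r) bigraded" and E :: "('r, 'e) bigraded" and Z B and q :: "'e \<Rightarrow> 'q" and Q
  assumes E: "module R E" and P: "presentation R E Z B q Q"
begin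

interpretation E: module R E by (rule E)

lemma presentation_carrier: "x \<in> Z \<Longrightarrow> x \<in> carrier E"
  using submodule_simps(1)[OF E presentationD(1)[OF P]] by blast

lemma presentation_zero: "q \<zero>\<^bsub>E\<^esub> = \<zero>\<^bsub>Q\<^esub>"
  using presentationD(3)[OF P] presentationD(7)[OF P] submodule_simps(2)[OF E presentationD(2)[OF P]] by blast

lemma presentation_module: "module R Q"
proof (rule surj_image_module[OF submodule_is_module'[OF E presentationD(1)[OF P]], where q = q])
qed (simp_all add: presentationD[OF P] presentation_zero)

interpretation Q: module R Q by (rule presentation_module)

lemma presentation_closed: "z \<in> Z \<Longrightarrow> q z \<in> carrier Q"
  by (simp add: presentationD(4)[OF P])

lemma presentation_diff:
  assumes "x \<in> Z" "y \<in> Z"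
  shows "q (x \<ominus>\<^bsub>E\<^esub> y) = q x \<ominus>\<^bsub>Q\<^esub> q y"
proof -
  have d: "x \<ominus>\<^bsub>E\<^esub> y \<in> Z" using submodule_simps(4)[OF E presentationD(1)[OF P]] assms by blast
  have "q (x \<ominus>\<^bsub>E\<^esub> y) \<oplus>\<^bsub>Q\<^esub> q y = q x"
    using presentationD(5)[OF P d assms(2)] E.M.diff_add_cancel presentation_carrier assms by simp
  then show ?thesis
    using presentation_closed d assms by (metis Q.M.minus_eq Q.M.add.inv_solve_right)
qed

lemma presentation_eq_iff:
  assumes "x \<in> Z" "y \<in> Z"
  shows "q x = q y \<longleftrightarrow> x \<ominus>\<^bsub>E\<^esub> y \<in> B"
proof -
  have d: "x \<ominus>\<^bsub>E\<^esub> y \<in> Z" using submodule_simps(4)[OF E presentationD(1)[OF P]] assms by blast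
  have "q x = q y \<longleftrightarrow> q x \<ominus>\<^bsub>Q\<^esub> q y = \<zero>\<^bsub>Q\<^esub>"
    using Q.M.diff_zero_eq presentation_closed assms by (auto simp: Q.M.minus_eq Q.M.r_neg)
  then show ?thesis using presentationD(7)[OF P d] presentation_diff[OF assms] by simp
qed

lemma presentation_mem_image:
  assumes S: "submodule S R E" "B \<subseteq> S" "S \<subseteq> Z" and z: "z \<in> Z"
  shows "q z \<in> q ` S \<longleftrightarrow> z \<in> S"
proof
  assume "q z \<in> q ` S"
  then obtain y where y: "y \<in> S" "q z = q y" by blast
  then have "z \<ominus>\<^bsub>E\<^esub> y \<in> S" using presentation_eq_iff[OF z] S by blast
  then have "(z \<ominus>\<^bsub>E\<^esub> y) \<oplus>\<^bsub>E\<^esub> y \<in> S" using submodule_simps(3)[OF E S(1)] y(1) by blast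
  then show "z \<in> S" using E.M.diff_add_cancel presentation_carrier z y(1) S(3) by auto
qed blast

lemma presentation_image_submodule:
  assumes S: "submodule S R E" "S \<subseteq> Z"
  shows "submodule (q ` S) R Q"
proof (rule submoduleI'[OF presentation_module])
  note s = submodule_simps[OF E S(1)]
  show "\<zero>\<^bsub>Q\<^esub> \<in> q ` S" using presentation_zero s(2) by (metis imageI)
  show "x \<oplus>\<^bsub>Q\<^esub> y \<in> q ` S" if xy: "x \<in> q ` S" "y \<in> q ` S" for x y
  proof -
    obtain x' y' where "x' \<in> S" "y' \<in> S" "x = q x'" "y = q y'" using xy by blast
    then show ?thesis using presentationD(5)[OF P, of x' y'] s(3)[of x' y'] S(2) by (metis imageI subsetD)
  qed
  show "a \<odot>\<^bsub>Q\<^esub> x \<in> q ` S" if a: "a \<in> carrier R" and x: "x \<in> q ` S" for a x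
  proof -
    obtain x' where "x' \<in> S" "x = q x'" using x by blast
    then show ?thesis using presentationD(6)[OF P a, of x'] s(5)[OF a, of x'] S(2) by (metis imageI subsetD)
  qed
qed (use presentation_closed S(2) in auto)

lemma presentation_sub:
  assumes S: "submodule S R E" "B \<subseteq> S" "S \<subseteq> Z"
  shows "presentation R E S B q (bigraded_sub Q (q ` S))"
proof (rule presentationI[OF S(1) presentationD(2)[OF P] S(2)])
  fix e
  show "homog (bigraded_sub Q (q ` S)) e = q ` (S \<inter> homog E e)"
    using presentationD(8)[OF P, of e] presentation_mem_image[OF S] S(3) by auto
qed (use presentationD(5-7)[OF P] S(3) in \<open>auto simp: subset_eq\<close>)

lemma coset_eq_iff:
  assumes S: "submodule S R E" "B \<subseteq> S" "S \<subseteq> Z" and xy: "x \<in> Z" "y \<in> Z"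
  shows "q ` S +>\<^bsub>Q\<^esub> q x = q ` S +>\<^bsub>Q\<^esub> q y \<longleftrightarrow> x \<ominus>\<^bsub>E\<^esub> y \<in> S"
    "q x \<in> q ` S +>\<^bsub>Q\<^esub> q y \<longleftrightarrow> x \<ominus>\<^bsub>E\<^esub> y \<in> S"
proof -
  interpret A: abelian_subgroup "q ` S" Q
    using submodule.axioms(1)[OF presentation_image_submodule[OF S(1,3)]] additive_subgroupI
    by (intro abelian_subgroupI3 Q.M.abelian_group_axioms) blast
  have d: "x \<ominus>\<^bsub>E\<^esub> y \<in> Z" using submodule_simps(4)[OF E presentationD(1)[OF P]] xy by blast
  have "q x \<in> q ` S +>\<^bsub>Q\<^esub> q y \<longleftrightarrow> q x \<oplus>\<^bsub>Q\<^esub> \<ominus>\<^bsub>Q\<^esub> q y \<in> q ` S"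
    by (rule A.a_rcos_module) (use presentation_closed xy Q.M.abelian_group_axioms in auto)
  also have "\<dots> \<longleftrightarrow> q (x \<ominus>\<^bsub>E\<^esub> y) \<in> q ` S" using presentation_diff[OF xy] by (simp add: Q.M.minus_eq)
  finally show 1: "q x \<in> q ` S +>\<^bsub>Q\<^esub> q y \<longleftrightarrow> x \<ominus>\<^bsub>E\<^esub> y \<in> S" using presentation_mem_image[OF S d] by simp
  show "q ` S +>\<^bsub>Q\<^esub> q x = q ` S +>\<^bsub>Q\<^esub> q y \<longleftrightarrow> x \<ominus>\<^bsub>E\<^esub> y \<in> S"
    using 1 A.a_rcos_self[of "q x"] A.a_repr_independence'[of "q x" "q y"] presentation_closed xy by metis
qed

text \<open>By the third isomorphism theorem the quotient of \<open>Z / B\<close> by the image of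
  \<open>S\<close> is \<open>Z / S\<close>, so iterated quotients do not leave this
  description.\<close>

lemma presentation_quot:
  assumes S: "submodule S R E" "B \<subseteq> S" "S \<subseteq> Z"
  shows "presentation R E Z S (\<lambda>z. q ` S +>\<^bsub>Q\<^esub> q z) (bigraded_quot Q (q ` S))"
proof -
  interpret A: abelian_subgroup "q ` S" Q
    using submodule.axioms(1)[OF presentation_image_submodule[OF S(1,3)]] additive_subgroupI
    by (intro abelian_subgroupI3 Q.M.abelian_group_axioms) blast
  note s = submodule_simps[OF E presentationD(1)[OF P]]
  show ?thesis
  proof (rule presentationI[OF presentationD(1)[OF P] S(1,3)])
    show "carrier (bigraded_quot Q (q ` S)) = (\<lambda>z. q ` S +>\<^bsub>Q\<^esub> q z) ` Z"
      by (auto simp: bigraded_quot_def A_RCOSETS_def' presentationD(4)[OF P])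
    show "homog (bigraded_quot Q (q ` S)) e = (\<lambda>z. q ` S +>\<^bsub>Q\<^esub> q z) ` (Z \<inter> homog E e)" for e
      by (auto simp: bigraded_quot_def presentationD(8)[OF P])
    fix x assume x: "x \<in> Z"
    have "q ` S = q ` S +>\<^bsub>Q\<^esub> q \<zero>\<^bsub>E\<^esub>"
      unfolding presentation_zero by (rule Q.M.a_coset_add_zero[OF A.a_subset, symmetric])
    then have "q ` S +>\<^bsub>Q\<^esub> q x = q ` S \<longleftrightarrow> x \<ominus>\<^bsub>E\<^esub> \<zero>\<^bsub>E\<^esub> \<in> S"
      using coset_eq_iff(1)[OF S x s(2)] by simp
    then show "q ` S +>\<^bsub>Q\<^esub> q x = \<zero>\<^bsub>bigraded_quot Q (q ` S)\<^esub> \<longleftrightarrow> x \<in> S"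
      using presentation_carrier[OF x] E.M.diff_add_cancel[of x "\<zero>\<^bsub>E\<^esub>"] by (simp add: bigraded_quot_def)
    { fix y assume y: "y \<in> Z"
      show "q ` S +>\<^bsub>Q\<^esub> q (x \<oplus>\<^bsub>E\<^esub> y) = (q ` S +>\<^bsub>Q\<^esub> q x) \<oplus>\<^bsub>bigraded_quot Q (q ` S)\<^esub> (q ` S +>\<^bsub>Q\<^esub> q y)"
        using A.a_rcos_sum[OF presentation_closed[OF x] presentation_closed[OF y]] presentationD(5)[OF P x y]
        by (simp add: bigraded_quot_def) }
    { fix a assume a: "a \<in> carrier R"
      \<comment> \<open>The scalar multiplication of a quotient is a union over all representatives
        \<open>k\<close>; it is one coset because each \<open>k\<close> gives the same one.\<close>
      have "q ` S +>\<^bsub>Q\<^esub> (a \<odot>\<^bsub>Q\<^esub> k) = q ` S +>\<^bsub>Q\<^esub> (a \<odot>\<^bsub>Q\<^esub> q x)" if k: "k \<in> q ` S +>\<^bsub>Q\<^esub> q x" for k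
      proof -
        have "k \<in> carrier Q" using k A.a_elemrcos_carrier[OF presentation_closed[OF x]] by blast
        then obtain y where y: "y \<in> Z" "k = q y" using presentationD(4)[OF P] by blast
        have "y \<ominus>\<^bsub>E\<^esub> x \<in> S" using k coset_eq_iff(2)[OF S y(1) x] y(2) by simp
        then have "a \<odot>\<^bsub>E\<^esub> (y \<ominus>\<^bsub>E\<^esub> x) \<in> S" by (rule submodule_simps(5)[OF E S(1) a])
        then have "a \<odot>\<^bsub>E\<^esub> y \<ominus>\<^bsub>E\<^esub> a \<odot>\<^bsub>E\<^esub> x \<in> S"
          using a presentation_carrier x y(1) by (simp add: E.M.minus_eq E.smult_r_distr E.smult_r_minus)
        then have "q ` S +>\<^bsub>Q\<^esub> q (a \<odot>\<^bsub>E\<^esub> y) = q ` S +>\<^bsub>Q\<^esub> q (a \<odot>\<^bsub>E\<^esub> x)"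
          using coset_eq_iff(1)[OF S s(5)[OF a y(1)] s(5)[OF a x]] by blast
        then show ?thesis using presentationD(6)[OF P a] x y by simp
      qed
      moreover have "q x \<in> q ` S +>\<^bsub>Q\<^esub> q x" by (rule A.a_rcos_self[OF presentation_closed[OF x]])
      ultimately have "(\<Union>k\<in>q ` S +>\<^bsub>Q\<^esub> q x. q ` S +>\<^bsub>Q\<^esub> (a \<odot>\<^bsub>Q\<^esub> k)) = q ` S +>\<^bsub>Q\<^esub> (a \<odot>\<^bsub>Q\<^esub> q x)"
        by (intro SUP_eq_const) blast+
      then show "q ` S +>\<^bsub>Q\<^esub> q (a \<odot>\<^bsub>E\<^esub> x) = a \<odot>\<^bsub>bigraded_quot Q (q ` S)\<^esub> (q ` S +>\<^bsub>Q\<^esub> q x)"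
        using presentationD(6)[OF P a x] by (simp add: bigraded_quot_def) }
  qed
qed

text \<open>Maps out of quotients are defined as unions over representatives. Such a union collapses
  to the common value once a change of representative by \<open>S\<close> does not affect
  it.\<close>

lemma UN_coset:
  assumes S: "submodule S R E" "B \<subseteq> S" "S \<subseteq> Z" and z: "z \<in> Z"
    and \<psi>: "\<And>y. y \<in> Z \<Longrightarrow> y \<ominus>\<^bsub>E\<^esub> z \<in> S \<Longrightarrow> \<psi> (q y) = C"
  shows "(\<Union>k\<in>q ` S +>\<^bsub>Q\<^esub> q z. \<psi> k) = C"
proof -
  interpret A: abelian_subgroup "q ` S" Q
    using submodule.axioms(1)[OF presentation_image_submodule[OF S(1,3)]] additive_subgroupI
    by (intro abelian_subgroupI3 Q.M.abelian_group_axioms) blast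
  have "\<psi> k = C" if k: "k \<in> q ` S +>\<^bsub>Q\<^esub> q z" for k
  proof -
    have "k \<in> carrier Q" using k A.a_elemrcos_carrier[OF presentation_closed[OF z]] by blast
    then obtain y where y: "y \<in> Z" "k = q y" using presentationD(4)[OF P] by blast
    then show ?thesis using k coset_eq_iff(2)[OF S y(1) z] \<psi> by simp
  qed
  moreover have "q z \<in> q ` S +>\<^bsub>Q\<^esub> q z" by (rule A.a_rcos_self[OF presentation_closed[OF z]])
  ultimately show ?thesis by (intro SUP_eq_const) blast+
qed

end

text \<open>As \<open>F\<close> respects the submodules, another representative changes
  \<open>F z\<close> by an element of \<open>S2\<close> only, so the union in
  \<open>coset_map\<close> is the class of \<open>F z\<close>.\<close>

lemma coset_map_presentation:
  assumes E1: "module R E1" and P1: "presentation R E1 Z1 B1 q1 Q1"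
    and S1: "submodule S1 R E1" "B1 \<subseteq> S1" "S1 \<subseteq> Z1"
    and E2: "module R E2" and P2: "presentation R E2 Z2 B2 q2 Q2"
    and S2: "submodule S2 R E2" "B2 \<subseteq> S2" "S2 \<subseteq> Z2"
    and F: "F \<in> module_hom R E1 E2" and FZ: "\<And>z. z \<in> Z1 \<Longrightarrow> F z \<in> Z2" and FS: "\<And>z. z \<in> S1 \<Longrightarrow> F z \<in> S2"
    and \<phi>: "\<And>z. z \<in> Z1 \<Longrightarrow> \<phi> (q1 z) = q2 (F z)" and z: "z \<in> Z1"
  shows "coset_map Q2 (q2 ` S2) \<phi> (q1 ` S1 +>\<^bsub>Q1\<^esub> q1 z) = q2 ` S2 +>\<^bsub>Q2\<^esub> q2 (F z)"
  unfolding coset_map_def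
proof (rule UN_coset[OF E1 P1 S1 z])
  fix y assume y: "y \<in> Z1" "y \<ominus>\<^bsub>E1\<^esub> z \<in> S1"
  have "F y \<ominus>\<^bsub>E2\<^esub> F z \<in> S2"
    using FS[OF y(2)] module_hom_diff[OF E1 E2 F] presentation_carrier[OF E1 P1] y(1) z by simp
  then show "q2 ` S2 +>\<^bsub>Q2\<^esub> \<phi> (q1 y) = q2 ` S2 +>\<^bsub>Q2\<^esub> q2 (F z)"
    using coset_eq_iff(1)[OF E2 P2 S2 FZ[OF y(1)] FZ[OF z]] \<phi>[OF y(1)] by simp
qed

section \<open>Sums, images and preimages of submodules\<close>

lemma a_r_coset_bigraded_sub [simp]: "S +>\<^bsub>bigraded_sub M A\<^esub> x = S +>\<^bsub>M\<^esub> x"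
  by (simp add: a_r_coset_def')

lemma set_add_submodule:
  assumes M: "module R M" and A: "submodule A R M" and B: "submodule B R M"
  shows "submodule (A <+>\<^bsub>M\<^esub> B) R M" "A \<subseteq> A <+>\<^bsub>M\<^esub> B" "B \<subseteq> A <+>\<^bsub>M\<^esub> B"
proof -
  interpret M: module R M by (rule M)
  note a = submodule_simps[OF M A] and b = submodule_simps[OF M B]
  have mem: "x \<in> A <+>\<^bsub>M\<^esub> B \<longleftrightarrow> (\<exists>y\<in>A. \<exists>z\<in>B. x = y \<oplus>\<^bsub>M\<^esub> z)" for x by (auto simp: set_add_def')
  have AM: "x \<in> carrier M" if "x \<in> A" for x using that a(1) by blast
  have BM: "x \<in> carrier M" if "x \<in> B" for x using that b(1) by blast
  show "submodule (A <+>\<^bsub>M\<^esub> B) R M"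
  proof (rule submoduleI'[OF M])
    show "A <+>\<^bsub>M\<^esub> B \<subseteq> carrier M" using AM BM by (auto simp: mem)
    show "\<zero>\<^bsub>M\<^esub> \<in> A <+>\<^bsub>M\<^esub> B" unfolding mem using a(2) b(2) by (metis M.M.l_zero M.M.zero_closed)
    fix x y assume "x \<in> A <+>\<^bsub>M\<^esub> B" "y \<in> A <+>\<^bsub>M\<^esub> B"
    then obtain x1 x2 y1 y2 where *: "x1 \<in> A" "y1 \<in> A" "x2 \<in> B" "y2 \<in> B" "x = x1 \<oplus>\<^bsub>M\<^esub> x2" "y = y1 \<oplus>\<^bsub>M\<^esub> y2"
      unfolding mem by blast
    then have "x \<oplus>\<^bsub>M\<^esub> y = (x1 \<oplus>\<^bsub>M\<^esub> y1) \<oplus>\<^bsub>M\<^esub> (x2 \<oplus>\<^bsub>M\<^esub> y2)" using AM BM by (simp add: M.M.a_ac)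
    then show "x \<oplus>\<^bsub>M\<^esub> y \<in> A <+>\<^bsub>M\<^esub> B" unfolding mem using * a(3) b(3) by blast
  next
    fix c x assume c: "c \<in> carrier R" and "x \<in> A <+>\<^bsub>M\<^esub> B"
    then obtain x1 x2 where *: "x1 \<in> A" "x2 \<in> B" "x = x1 \<oplus>\<^bsub>M\<^esub> x2" unfolding mem by blast
    then have "c \<odot>\<^bsub>M\<^esub> x = c \<odot>\<^bsub>M\<^esub> x1 \<oplus>\<^bsub>M\<^esub> c \<odot>\<^bsub>M\<^esub> x2" using AM BM c by (simp add: M.smult_r_distr)
    then show "c \<odot>\<^bsub>M\<^esub> x \<in> A <+>\<^bsub>M\<^esub> B" unfolding mem using * c a(5) b(5) by blast
  qed
  show "A \<subseteq> A <+>\<^bsub>M\<^esub> B"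
  proof
    fix x assume "x \<in> A"
    then show "x \<in> A <+>\<^bsub>M\<^esub> B" unfolding mem using b(2) AM by (intro bexI[of _ x] bexI[of _ "\<zero>\<^bsub>M\<^esub>"]) auto
  qed
  show "B \<subseteq> A <+>\<^bsub>M\<^esub> B"
  proof
    fix x assume "x \<in> B"
    then show "x \<in> A <+>\<^bsub>M\<^esub> B" unfolding mem using a(2) BM by (intro bexI[of _ "\<zero>\<^bsub>M\<^esub>"] bexI[of _ x]) auto
  qed
qed

lemma set_addE:
  assumes "x \<in> A <+>\<^bsub>M\<^esub> B"
  obtains a b where "a \<in> A" "b \<in> B" "x = a \<oplus>\<^bsub>M\<^esub> b"
  using assms by (auto simp: set_add_def')

lemma set_addI: "a \<in> A \<Longrightarrow> b \<in> B \<Longrightarrow> a \<oplus>\<^bsub>M\<^esub> b \<in> A <+>\<^bsub>M\<^esub> B"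
  by (auto simp: set_add_def')

lemma submodule_image:
  assumes "module R M" "module R N" "f \<in> module_hom R M N" "submodule A R M"
  shows "submodule (f ` A) R N"
proof -
  note a = submodule_simps[OF assms(1,4)]
  have "f \<in> module_hom R (M\<lparr>carrier := A\<rparr>) N"
    using a(1) module_hom_closed[OF assms(3)] module_hom_add[OF assms(3)] module_hom_smult[OF assms(3)]
    by (intro module_homI) (auto simp: subset_eq)
  from image_submodule[OF submodule_is_module'[OF assms(1,4)] assms(2) this] show ?thesis by simp
qed

lemma submodule_vimage:
  assumes "module R M" "module R N" "f \<in> module_hom R M N" "submodule A R M" "submodule B R N"
  shows "submodule {x \<in> A. f x \<in> B} R M"
proof -
  note a = submodule_simps[OF assms(1,4)] and b = submodule_simps[OF assms(2,5)]
  show ?thesis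
  proof (rule submoduleI'[OF assms(1)])
    show "\<zero>\<^bsub>M\<^esub> \<in> {x \<in> A. f x \<in> B}" using a(2) b(2) module_hom_zero[OF assms(1-3)] by simp
  qed (use a b module_hom_add[OF assms(3)] module_hom_smult[OF assms(3)] in \<open>auto simp: subset_eq\<close>)
qed

lemma presentation_iso:
  assumes E: "bigraded_module R E" and P: "presentation R E Z B q Q" and Q: "bigraded_module R Q"
    and N: "bigraded_module R N" and f: "f \<in> bigraded_hom R Q N" "bij_betw f (carrier Q) (carrier N)"
  shows "presentation R E Z B (\<lambda>z. f (q z)) N"
proof -
  note mE = bigraded_moduleD(1)[OF E] and mQ = bigraded_moduleD(1)[OF Q] and mN = bigraded_moduleD(1)[OF N]
    and fh = bigraded_homD(1)[OF f(1)]
  have cl: "q z \<in> carrier Q" if "z \<in> Z" for z using presentation_closed[OF mE P that] .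
  have inj: "inj_on f (carrier Q)" and im: "f ` carrier Q = carrier N" using f(2) by (auto simp: bij_betw_def)
  show ?thesis
  proof (rule presentationI[OF presentationD(1-3)[OF P]])
    show "carrier N = (\<lambda>z. f (q z)) ` Z" using im presentationD(4)[OF P] by (simp add: image_image)
    show "f (q (x \<oplus>\<^bsub>E\<^esub> y)) = f (q x) \<oplus>\<^bsub>N\<^esub> f (q y)" if "x \<in> Z" "y \<in> Z" for x y
      using presentationD(5)[OF P that] module_hom_add[OF fh] cl that by simp
    show "f (q (a \<odot>\<^bsub>E\<^esub> x)) = a \<odot>\<^bsub>N\<^esub> f (q x)" if "a \<in> carrier R" "x \<in> Z" for a x
      using presentationD(6)[OF P that] module_hom_smult[OF fh that(1)] cl that by simp
    show "f (q x) = \<zero>\<^bsub>N\<^esub> \<longleftrightarrow> x \<in> B" if x: "x \<in> Z" for x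
      using presentationD(7)[OF P x] module_hom_zero[OF mQ mN fh]
        inj_on_eq_iff[OF inj cl[OF x] module_zero_closed[OF mQ]] by simp
    fix e
    \<comment> \<open>Preservation of degrees by \<open>f\<close> is given in one direction only.
      For the other, the component of degree \<open>e\<close> of any preimage of the homogeneous
      \<open>y\<close> is again a preimage.\<close>
    have "homog N e \<subseteq> f ` homog Q e"
    proof
      fix y assume y: "y \<in> homog N e"
      then have "y \<in> f ` carrier Q" using bigraded_moduleD(5)[OF N] im by blast
      then obtain x where x: "x \<in> carrier Q" "y = f x" by blast
      have "y = hcomp N (f x) e" using hcomp_homog[OF N y] x(2) by simp
      also have "\<dots> = f (hcomp Q x e)" by (rule hcomp_hom[OF Q N f(1) x(1)])
      finally show "y \<in> f ` homog Q e" using hcomp_props(1)[OF Q x(1)] by blast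
    qed
    then have "homog N e = f ` homog Q e" using bigraded_homD(2)[OF f(1)] by blast
    then show "homog N e = (\<lambda>z. f (q z)) ` (Z \<inter> homog E e)"
      unfolding presentationD(8)[OF P] by (simp add: image_image)
  qed
qed

section \<open>Sections with supports\<close>

definition section_set :: "('r, 'r) bigraded \<Rightarrow> 'r set set \<Rightarrow> ('r, 'e) bigraded \<Rightarrow> 'e set" where
  "section_set R Y E = {x \<in> carrier E. elt_supp R E x \<subseteq> Y}"

lemma elt_supp_subsetI:
  assumes "\<And>p t. primeideal p R \<Longrightarrow> t \<in> carrier R - p \<Longrightarrow> t \<odot>\<^bsub>E\<^esub> x = \<zero>\<^bsub>E\<^esub> \<Longrightarrow>
    \<exists>u\<in>carrier R - p. u \<odot>\<^bsub>F\<^esub> y = \<zero>\<^bsub>F\<^esub>"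
  shows "elt_supp R F y \<subseteq> elt_supp R E x"
  using assms unfolding elt_supp_def Spec_def by blast

lemma primeideal_mult_closed:
  "primeideal p R \<Longrightarrow> a \<in> carrier R - p \<Longrightarrow> b \<in> carrier R - p \<Longrightarrow> cring R \<Longrightarrow> a \<otimes>\<^bsub>R\<^esub> b \<in> carrier R - p"
  using primeideal.I_prime[of p R a b] by (auto simp: cring_def ring_def monoid.m_closed)

lemma section_set_hom:
  assumes E: "module R E" and F: "module R F" and f: "f \<in> module_hom R E F" and x: "x \<in> section_set R Y E"
  shows "f x \<in> section_set R Y F"
proof -
  have xE: "x \<in> carrier E" using x by (simp add: section_set_def)
  have "elt_supp R F (f x) \<subseteq> elt_supp R E x"
  proof (rule elt_supp_subsetI)
    fix p t assume t: "t \<in> carrier R - p" "t \<odot>\<^bsub>E\<^esub> x = \<zero>\<^bsub>E\<^esub>"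
    then have "t \<odot>\<^bsub>F\<^esub> f x = \<zero>\<^bsub>F\<^esub>"
      using module_hom_smult[OF f _ xE, of t] module_hom_zero[OF E F f] by simp
    then show "\<exists>u\<in>carrier R - p. u \<odot>\<^bsub>F\<^esub> f x = \<zero>\<^bsub>F\<^esub>" using t(1) by blast
  qed
  then show ?thesis using x module_hom_closed[OF f xE] by (auto simp: section_set_def)
qed

lemma section_set_submodule:
  assumes E: "module R E"
  shows "submodule (section_set R Y E) R E"
proof -
  interpret E: module R E by (rule E)
  show ?thesis
  proof (rule submoduleI'[OF E])
    show "section_set R Y E \<subseteq> carrier E" by (auto simp: section_set_def)
    have "elt_supp R E \<zero>\<^bsub>E\<^esub> = {}"
    proof -
      have "\<exists>s\<in>carrier R - p. s \<odot>\<^bsub>E\<^esub> \<zero>\<^bsub>E\<^esub> = \<zero>\<^bsub>E\<^esub>" if p: "primeideal p R" for p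
      proof -
        have "p \<subseteq> carrier R" "p \<noteq> carrier R"
          using primeideal.I_notcarr[OF p] ideal.Icarr[OF primeideal.axioms(1)[OF p]] by auto
        then show ?thesis by auto
      qed
      then show ?thesis unfolding elt_supp_def Spec_def by blast
    qed
    then show "\<zero>\<^bsub>E\<^esub> \<in> section_set R Y E" by (simp add: section_set_def)
    fix x y assume xy: "x \<in> section_set R Y E" "y \<in> section_set R Y E"
    then have c: "x \<in> carrier E" "y \<in> carrier E" by (auto simp: section_set_def)
    \<comment> \<open>If \<open>t\<close> kills \<open>x\<close> and \<open>u\<close> kills
      \<open>y\<close>, both outside the prime \<open>p\<close>, then \<open>t u\<close> is outside
      \<open>p\<close> and kills the sum.\<close>
    have "p \<in> elt_supp R E x \<or> p \<in> elt_supp R E y" if p: "p \<in> elt_supp R E (x \<oplus>\<^bsub>E\<^esub> y)" for p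
    proof (rule ccontr)
      have pp: "primeideal p R" using p by (simp add: elt_supp_def Spec_def)
      assume "\<not> (p \<in> elt_supp R E x \<or> p \<in> elt_supp R E y)"
      then obtain t u where t: "t \<in> carrier R - p" "t \<odot>\<^bsub>E\<^esub> x = \<zero>\<^bsub>E\<^esub>" and u: "u \<in> carrier R - p" "u \<odot>\<^bsub>E\<^esub> y = \<zero>\<^bsub>E\<^esub>"
        using pp by (auto simp: elt_supp_def Spec_def)
      have "(t \<otimes>\<^bsub>R\<^esub> u) \<odot>\<^bsub>E\<^esub> (x \<oplus>\<^bsub>E\<^esub> y) = u \<odot>\<^bsub>E\<^esub> (t \<odot>\<^bsub>E\<^esub> x) \<oplus>\<^bsub>E\<^esub> t \<odot>\<^bsub>E\<^esub> (u \<odot>\<^bsub>E\<^esub> y)"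
        using t(1) u(1) c E.R.m_comm[of t u] by (simp add: E.smult_r_distr E.smult_assoc1[symmetric])
      also have "\<dots> = \<zero>\<^bsub>E\<^esub>" using t u by simp
      finally show False
        using p primeideal_mult_closed[OF pp t(1) u(1) E.R.is_cring] by (simp add: elt_supp_def)
    qed
    then show "x \<oplus>\<^bsub>E\<^esub> y \<in> section_set R Y E" using xy c by (auto simp: section_set_def)
  next
    fix a x assume "a \<in> carrier R" "x \<in> section_set R Y E"
    then show "a \<odot>\<^bsub>E\<^esub> x \<in> section_set R Y E"
      using section_set_hom[OF E E module_hom_smult_const[OF E]] by blast
  qed
qed

lemma section_set_leibniz:
  assumes E: "module R E" and \<delta>: "graded_derivation R s \<delta>" and D: "leibniz_map R s \<delta> (\<lambda>x. x) E E D"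
    and x: "x \<in> section_set R Y E"
  shows "D x \<in> section_set R Y E"
proof -
  interpret E: module R E by (rule E)
  have xE: "x \<in> carrier E" using x by (simp add: section_set_def)
  note DxE = leibniz_mapD(1)[OF D xE]
  have "elt_supp R E (D x) \<subseteq> elt_supp R E x"
  proof (rule elt_supp_subsetI)
    fix p t assume p: "primeideal p R" and t: "t \<in> carrier R - p" "t \<odot>\<^bsub>E\<^esub> x = \<zero>\<^bsub>E\<^esub>"
    \<comment> \<open>Multiplying \<open>0 = D (t x) = t D x + \<delta> t x\<close> by \<open>t\<close> gives \<open>t\<^sup>2 D x = 0\<close>.\<close>
    have "t \<odot>\<^bsub>E\<^esub> D x \<oplus>\<^bsub>E\<^esub> \<delta> t \<odot>\<^bsub>E\<^esub> x = D \<zero>\<^bsub>E\<^esub>" using leibniz_mapD(3)[OF D _ xE, of t] t by simp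
    also have "\<dots> = \<zero>\<^bsub>E\<^esub>"
      using additive_zero[OF E.M.abelian_group_axioms E.M.abelian_group_axioms leibniz_mapD(1)[OF D] leibniz_mapD(2)[OF D]] by simp
    finally have "t \<odot>\<^bsub>E\<^esub> (t \<odot>\<^bsub>E\<^esub> D x \<oplus>\<^bsub>E\<^esub> \<delta> t \<odot>\<^bsub>E\<^esub> x) = \<zero>\<^bsub>E\<^esub>" using t(1) by simp
    moreover have "t \<odot>\<^bsub>E\<^esub> (\<delta> t \<odot>\<^bsub>E\<^esub> x) = \<delta> t \<odot>\<^bsub>E\<^esub> (t \<odot>\<^bsub>E\<^esub> x)"
      using t(1) xE graded_derivationD(1)[OF \<delta>, of t] E.R.m_comm[of t "\<delta> t"] by (simp add: E.smult_assoc1[symmetric])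
    ultimately have "(t \<otimes>\<^bsub>R\<^esub> t) \<odot>\<^bsub>E\<^esub> D x = \<zero>\<^bsub>E\<^esub>"
      using t xE DxE graded_derivationD(1)[OF \<delta>, of t] by (simp add: E.smult_r_distr E.smult_assoc1)
    then show "\<exists>u\<in>carrier R - p. u \<odot>\<^bsub>E\<^esub> D x = \<zero>\<^bsub>E\<^esub>"
      using primeideal_mult_closed[OF p t(1) t(1) E.R.is_cring] by blast
  qed
  then show ?thesis using x DxE by (auto simp: section_set_def)
qed

lemma sections_supp_eq: "sections_supp R Y E = bigraded_sub E (section_set R Y E)"
  by (simp add: sections_supp_def section_set_def)

section \<open>Lyubeznik functors preserve the Euler identity\<close>

text \<open>The data that \<open>euler_resolution\<close> provides. A single module with zero
  differentials is also an instance, which serves for isomorphisms.\<close>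

locale euler_complex = euler_ring R J \<xi> \<delta> s w
  for R :: "('r, 'r) bigraded" and J :: "'i set" and \<xi> \<delta> s w +
  fixes E :: "nat \<Rightarrow> ('r, 'e) bigraded" and d :: "nat \<Rightarrow> 'e \<Rightarrow> 'e" and D :: "nat \<Rightarrow> 'i \<Rightarrow> 'e \<Rightarrow> 'e"
    and h :: "nat \<Rightarrow> 'e \<Rightarrow> 'e"
  assumes E: "\<And>k. bigraded_module R (E k)" and d: "\<And>k. d k \<in> module_hom R (E k) (E (Suc k))"
    and dd: "\<And>k x. x \<in> carrier (E k) \<Longrightarrow> d (Suc k) (d k x) = \<zero>\<^bsub>E (Suc (Suc k))\<^esub>"
    and D: "\<And>k. connection (E k) (D k)"
    and Dd: "\<And>k i x. i \<in> J \<Longrightarrow> x \<in> carrier (E k) \<Longrightarrow> D (Suc k) i (d k x) = d k (D k i x)"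
    and h: "\<And>k. h k \<in> module_hom R (E (Suc k)) (E k)"
    and defect_0: "\<And>e x. x \<in> homog (E 0) e \<Longrightarrow> euler_op (E 0) (D 0) x \<ominus>\<^bsub>E 0\<^esub> w e \<odot>\<^bsub>E 0\<^esub> x = h 0 (d 0 x)"
    and defect_Suc: "\<And>k e x. x \<in> homog (E (Suc k)) e \<Longrightarrow>
       euler_op (E (Suc k)) (D (Suc k)) x \<ominus>\<^bsub>E (Suc k)\<^esub> w e \<odot>\<^bsub>E (Suc k)\<^esub> x =
       d k (h k x) \<oplus>\<^bsub>E (Suc k)\<^esub> h (Suc k) (d (Suc k) x)"
begin

lemma mE: "module R (E k)"
  by (rule bigraded_moduleD[OF E])

text \<open>
  \<open>Q\<close> is the subquotient \<open>Z / B\<close> of the complex in degree \<open>k\<close>. The connection descends to it, and the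
  Euler identity, which holds on \<open>E k\<close> only up to homotopy, holds exactly.
\<close>

definition euler_presentation :: "nat \<Rightarrow> 'e set \<Rightarrow> 'e set \<Rightarrow> ('e \<Rightarrow> 'q) \<Rightarrow> ('r, 'q) bigraded \<Rightarrow> bool" where
  "euler_presentation k Z B q Q \<longleftrightarrow> presentation R (E k) Z B q Q \<and>
     (\<forall>i\<in>J. \<forall>z\<in>Z. D k i z \<in> Z) \<and> (\<forall>i\<in>J. \<forall>z\<in>B. D k i z \<in> B) \<and>
     (\<forall>e. \<forall>z\<in>Z \<inter> homog (E k) e. euler_op (E k) (D k) z \<ominus>\<^bsub>E k\<^esub> w e \<odot>\<^bsub>E k\<^esub> z \<in> B)"

lemma D_closed: "i \<in> J \<Longrightarrow> x \<in> carrier (E k) \<Longrightarrow> D k i x \<in> carrier (E k)"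
  by (rule leibniz_mapD(1)[OF connectionD[OF D]])

lemma D_add: "i \<in> J \<Longrightarrow> x \<in> carrier (E k) \<Longrightarrow> y \<in> carrier (E k) \<Longrightarrow> D k i (x \<oplus>\<^bsub>E k\<^esub> y) = D k i x \<oplus>\<^bsub>E k\<^esub> D k i y"
  by (rule leibniz_mapD(2)[OF connectionD[OF D]])

lemma D_zero: "i \<in> J \<Longrightarrow> D k i \<zero>\<^bsub>E k\<^esub> = \<zero>\<^bsub>E k\<^esub>"
  by (intro additive_zero module_abelian_group[OF mE] D_closed D_add module_zero_closed[OF mE])

lemma D_diff:
  "i \<in> J \<Longrightarrow> x \<in> carrier (E k) \<Longrightarrow> y \<in> carrier (E k) \<Longrightarrow> D k i (x \<ominus>\<^bsub>E k\<^esub> y) = D k i x \<ominus>\<^bsub>E k\<^esub> D k i y"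
  by (intro additive_minus module_abelian_group[OF mE] D_closed D_add)

lemma euler_module_of_presentation:
  fixes N :: "('r, 'u) bigraded"
  assumes g: "euler_presentation k Z B q Q" and iso: "bigraded_iso R Q N"
  shows "\<exists>D'. euler_module N D'"
proof -
  obtain f where f: "f \<in> bigraded_hom R Q N" "bij_betw f (carrier Q) (carrier N)"
    and Q: "bigraded_module R Q" and N: "bigraded_module R N"
    using iso unfolding bigraded_iso_def by blast
  let ?q = "\<lambda>z. f (q z)"
  have P: "presentation R (E k) Z B ?q N"
    using presentation_iso[OF E _ Q N f] g unfolding euler_presentation_def by blast
  have DZ: "\<And>i z. i \<in> J \<Longrightarrow> z \<in> Z \<Longrightarrow> D k i z \<in> Z" and DB: "\<And>i z. i \<in> J \<Longrightarrow> z \<in> B \<Longrightarrow> D k i z \<in> B"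
    and defect: "\<And>e z. z \<in> Z \<Longrightarrow> z \<in> homog (E k) e \<Longrightarrow> euler_op (E k) (D k) z \<ominus>\<^bsub>E k\<^esub> w e \<odot>\<^bsub>E k\<^esub> z \<in> B"
    using g unfolding euler_presentation_def by blast+
  interpret E: module R "E k" by (rule mE)
  interpret N: module R N by (rule bigraded_moduleD[OF N])
  note s = submodule_simps[OF mE presentationD(1)[OF P]] and ZE = presentation_carrier[OF mE P]
  note qcl = presentation_closed[OF mE P]
  \<comment> \<open>The operator is computed at a chosen representative in \<open>Z\<close>;
    stability of \<open>B\<close> makes the class independent of the choice.\<close>
  define D' where "D' = (\<lambda>i y. ?q (D k i (inv_into Z ?q y)))"
  have D': "D' i (?q z) = ?q (D k i z)" if i: "i \<in> J" and z: "z \<in> Z" for i z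
  proof -
    let ?y = "inv_into Z ?q (?q z)"
    have y: "?y \<in> Z" "?q ?y = ?q z" using z by (auto intro: inv_into_into f_inv_into_f[of "?q z" ?q Z])
    then have "?y \<ominus>\<^bsub>E k\<^esub> z \<in> B" using presentation_eq_iff[OF mE P y(1) z] by simp
    then have "D k i ?y \<ominus>\<^bsub>E k\<^esub> D k i z \<in> B" using DB[OF i] D_diff[OF i ZE[OF y(1)] ZE[OF z]] by metis
    then show ?thesis unfolding D'_def using presentation_eq_iff[OF mE P DZ[OF i y(1)] DZ[OF i z]] by simp
  qed
  have "leibniz_map R s (\<delta> i) (\<lambda>x. x) N N (D' i)" if i: "i \<in> J" for i
  proof (rule leibniz_mapI)
    note Di = connectionD[OF D i]
    fix x assume "x \<in> carrier N"
    then obtain z where z: "z \<in> Z" "x = ?q z" using presentationD(4)[OF P] by blast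
    show "D' i x \<in> carrier N" using D'[OF i z(1)] qcl[OF DZ[OF i z(1)]] z(2) by simp
    { fix y assume "y \<in> carrier N"
      then obtain z' where z': "z' \<in> Z" "y = ?q z'" using presentationD(4)[OF P] by blast
      have "x \<oplus>\<^bsub>N\<^esub> y = ?q (z \<oplus>\<^bsub>E k\<^esub> z')" using presentationD(5)[OF P z(1) z'(1)] z(2) z'(2) by simp
      then have "D' i (x \<oplus>\<^bsub>N\<^esub> y) = ?q (D k i z \<oplus>\<^bsub>E k\<^esub> D k i z')"
        using D'[OF i s(3)[OF z(1) z'(1)]] D_add[OF i ZE[OF z(1)] ZE[OF z'(1)]] by simp
      then show "D' i (x \<oplus>\<^bsub>N\<^esub> y) = D' i x \<oplus>\<^bsub>N\<^esub> D' i y"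
        using presentationD(5)[OF P DZ[OF i z(1)] DZ[OF i z'(1)]] D'[OF i z(1)] D'[OF i z'(1)] z(2) z'(2) by simp }
    { fix a assume a: "a \<in> carrier R"
      note da = graded_derivationD(1)[OF \<delta>[OF i] a]
      have "a \<odot>\<^bsub>N\<^esub> x = ?q (a \<odot>\<^bsub>E k\<^esub> z)" using presentationD(6)[OF P a z(1)] z(2) by simp
      then have "D' i (a \<odot>\<^bsub>N\<^esub> x) = ?q (a \<odot>\<^bsub>E k\<^esub> D k i z \<oplus>\<^bsub>E k\<^esub> \<delta> i a \<odot>\<^bsub>E k\<^esub> z)"
        using D'[OF i s(5)[OF a z(1)]] leibniz_mapD(3)[OF Di a ZE[OF z(1)]] by simp
      then show "D' i (a \<odot>\<^bsub>N\<^esub> x) = a \<odot>\<^bsub>N\<^esub> D' i x \<oplus>\<^bsub>N\<^esub> \<delta> i a \<odot>\<^bsub>N\<^esub> x"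
        using presentationD(5)[OF P s(5)[OF a DZ[OF i z(1)]] s(5)[OF da z(1)]]
          presentationD(6)[OF P a DZ[OF i z(1)]] presentationD(6)[OF P da z(1)] D'[OF i z(1)] z(2) by simp }
  next
    fix e x assume "x \<in> homog N e"
    then obtain z where z: "z \<in> Z" "z \<in> homog (E k) e" "x = ?q z" unfolding presentationD(8)[OF P] by blast
    have "D k i z \<in> Z \<inter> homog (E k) (e + s)" using leibniz_mapD(4)[OF connectionD[OF D i] z(2)] DZ[OF i z(1)] by blast
    then show "D' i x \<in> homog N (e + s)" unfolding presentationD(8)[OF P] z(3) D'[OF i z(1)] by blast
  qed
  then have conn: "connection N D'" by (simp add: connection_def)
  have "euler_op N D' x = w e \<odot>\<^bsub>N\<^esub> x" if x: "x \<in> homog N e" for e x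
  proof -
    obtain z where z: "z \<in> Z" "z \<in> homog (E k) e" "x = ?q z" using x unfolding presentationD(8)[OF P] by blast
    have t: "\<xi> i \<odot>\<^bsub>E k\<^esub> D k i z \<in> Z" if "i \<in> J" for i using s(5)[OF \<xi>_carrier[OF that] DZ[OF that z(1)]] .
    \<comment> \<open>The quotient map is additive on \<open>Z\<close> only, so the induction also
      keeps the partial sums inside \<open>Z\<close>.\<close>
    have "?q (finsum (E k) (\<lambda>i. \<xi> i \<odot>\<^bsub>E k\<^esub> D k i z) A) = finsum N (\<lambda>i. \<xi> i \<odot>\<^bsub>N\<^esub> D' i x) A \<and>
        finsum (E k) (\<lambda>i. \<xi> i \<odot>\<^bsub>E k\<^esub> D k i z) A \<in> Z" if "finite A" "A \<subseteq> J" for A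
      using that
    proof (induction A rule: finite_induct)
      case empty
      then show ?case using presentation_zero[OF mE P] s(2) by simp
    next
      case (insert i A)
      then have i: "i \<in> J" and A: "A \<subseteq> J" by auto
      have 1: "finsum (E k) (\<lambda>i. \<xi> i \<odot>\<^bsub>E k\<^esub> D k i z) (insert i A) =
          \<xi> i \<odot>\<^bsub>E k\<^esub> D k i z \<oplus>\<^bsub>E k\<^esub> finsum (E k) (\<lambda>i. \<xi> i \<odot>\<^bsub>E k\<^esub> D k i z) A"
        using insert.hyps A t i ZE by (intro E.M.finsum_insert) auto
      have "D' i x \<in> carrier N" if "i \<in> J" for i
        using D'[OF that z(1)] qcl[OF DZ[OF that z(1)]] z(3) by simp
      then have 2: "finsum N (\<lambda>i. \<xi> i \<odot>\<^bsub>N\<^esub> D' i x) (insert i A) =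
          \<xi> i \<odot>\<^bsub>N\<^esub> D' i x \<oplus>\<^bsub>N\<^esub> finsum N (\<lambda>i. \<xi> i \<odot>\<^bsub>N\<^esub> D' i x) A"
        using insert.hyps A i \<xi>_carrier by (intro N.M.finsum_insert) auto
      have IH: "?q (finsum (E k) (\<lambda>i. \<xi> i \<odot>\<^bsub>E k\<^esub> D k i z) A) = finsum N (\<lambda>i. \<xi> i \<odot>\<^bsub>N\<^esub> D' i x) A"
        "finsum (E k) (\<lambda>i. \<xi> i \<odot>\<^bsub>E k\<^esub> D k i z) A \<in> Z" using insert.IH[OF A] by blast+
      have "?q (\<xi> i \<odot>\<^bsub>E k\<^esub> D k i z) = \<xi> i \<odot>\<^bsub>N\<^esub> D' i x"
        using presentationD(6)[OF P \<xi>_carrier[OF i] DZ[OF i z(1)]] D'[OF i z(1)] z(3) by simp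
      then show ?case
        unfolding 1 2 using presentationD(5)[OF P t[OF i] IH(2)] IH(1) s(3)[OF t[OF i] IH(2)] by simp
    qed
    from this[OF finite_J order_refl] have 1: "?q (euler_op (E k) (D k) z) = euler_op N D' x"
      and 2: "euler_op (E k) (D k) z \<in> Z" unfolding euler_op_def by blast+
    have "?q (euler_op (E k) (D k) z) = ?q (w e \<odot>\<^bsub>E k\<^esub> z)"
      using presentation_eq_iff[OF mE P 2 s(5)[OF w_carrier z(1)]] defect[OF z(1,2)] by blast
    then show ?thesis using 1 presentationD(6)[OF P w_carrier z(1)] z(3) by simp
  qed
  then have "euler_module N D'" using N conn by (simp add: euler_module_def)
  then show ?thesis by blast
qed

text \<open>The kernel is \<open>{z \<in> Z1. F z \<in> B2}\<close> over \<open>B1\<close>, the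
  image is \<open>B2 + F Z1\<close> over \<open>B2\<close>, and the cokernel is \<open>Z2\<close>
  over \<open>B2 + F Z1\<close>. As \<open>F\<close> commutes with the operators, these submodules
  are stable under them, and the Euler defect stays in the denominator, which is \<open>B1\<close>
  or contains \<open>B2\<close>.\<close>

lemma euler_module_of_arrow:
  fixes N :: "('r, 'u) bigraded"
  assumes A: "euler_presentation k Z1 B1 q1 A" and A': "euler_presentation l Z2 B2 q2 A'"
    and F: "F \<in> module_hom R (E k) (E l)" and FD: "\<And>i x. i \<in> J \<Longrightarrow> x \<in> carrier (E k) \<Longrightarrow> D l i (F x) = F (D k i x)"
    and FZ: "\<And>z. z \<in> Z1 \<Longrightarrow> F z \<in> Z2" and FB: "\<And>z. z \<in> B1 \<Longrightarrow> F z \<in> B2"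
    and f: "\<And>z. z \<in> Z1 \<Longrightarrow> f (q1 z) = q2 (F z)" and N: "arrow_part_value R \<pi> A A' f N"
  shows "\<exists>D'. euler_module N D'"
proof -
  note a = A[unfolded euler_presentation_def] and a' = A'[unfolded euler_presentation_def]
  have P1: "presentation R (E k) Z1 B1 q1 A" and P2: "presentation R (E l) Z2 B2 q2 A'" using a a' by blast+
  note p1 = presentationD[OF P1] and p2 = presentationD[OF P2]
  note ZE1 = presentation_carrier[OF mE P1] and ZE2 = presentation_carrier[OF mE P2]
  let ?K = "{z \<in> Z1. F z \<in> B2}" and ?I = "B2 <+>\<^bsub>E l\<^esub> F ` Z1"
  note I = set_add_submodule[OF mE p2(2) submodule_image[OF mE mE F p1(1)]]
  have IZ: "?I \<subseteq> Z2"
    using submodule_simps(3)[OF mE p2(1)] p2(3) FZ by (auto elim!: set_addE)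
  have DI: "D l i x \<in> ?I" if i: "i \<in> J" and x: "x \<in> ?I" for i x
  proof -
    obtain b z where b: "b \<in> B2" "z \<in> Z1" "x = b \<oplus>\<^bsub>E l\<^esub> F z" using x by (auto elim!: set_addE)
    then have "D l i x = D l i b \<oplus>\<^bsub>E l\<^esub> F (D k i z)"
      using D_add[OF i, of b l "F z"] FD[OF i ZE1[OF b(2)]] ZE2 FZ p2(3) by (simp add: subset_eq)
    then show ?thesis using b a a' i by (auto intro!: set_addI)
  qed
  have im: "f ` carrier A = q2 ` ?I"
  proof -
    have "q2 (b \<oplus>\<^bsub>E l\<^esub> F z) = f (q1 z)" if "b \<in> B2" "z \<in> Z1" for b z
    proof -
      have "q2 b = \<zero>\<^bsub>A'\<^esub>" "b \<in> Z2" using p2(3,7) that(1) by blast+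
      then have "q2 (b \<oplus>\<^bsub>E l\<^esub> F z) = \<zero>\<^bsub>A'\<^esub> \<oplus>\<^bsub>A'\<^esub> q2 (F z)" using p2(5)[of b "F z"] FZ[OF that(2)] by simp
      also have "\<dots> = q2 (F z)"
        using presentation_closed[OF mE P2 FZ[OF that(2)]] presentation_module[OF mE P2]
        by (simp add: module_def abelian_group_def abelian_monoid.l_zero)
      finally show ?thesis using f[OF that(2)] by simp
    qed
    moreover have "\<zero>\<^bsub>E l\<^esub> \<in> B2" using submodule_simps(2)[OF mE p2(2)] .
    ultimately show ?thesis unfolding p1(4) by (force elim!: set_addE intro: set_addI)
  qed
  show ?thesis
  proof (cases \<pi>)
    case Kernel
    have K: "a_kernel A A' f = q1 ` ?K"
      unfolding a_kernel_def' p1(4) using f p2(7) FZ by auto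
    have "euler_presentation k ?K B1 q1 (bigraded_kernel A A' f)"
      unfolding euler_presentation_def bigraded_kernel_def K
    proof (intro conjI ballI allI)
      show "presentation R (E k) ?K B1 q1 (bigraded_sub A (q1 ` ?K))"
        using FB p1(3) by (intro presentation_sub[OF mE P1] submodule_vimage[OF mE mE F p1(1) p2(2)]) auto
      fix i z assume i: "i \<in> J" and z: "z \<in> ?K"
      have "D l i (F z) \<in> B2" using a' i z by blast
      then have "F (D k i z) \<in> B2" using FD[OF i ZE1, of z] z by simp
      then show "D k i z \<in> ?K" using a i z by blast
    qed (use a in auto)
    then show ?thesis
      using euler_module_of_presentation N Kernel unfolding arrow_part_value_def by simp
  next
    case Image
    have "euler_presentation l ?I B2 q2 (bigraded_image A A' f)"
      unfolding euler_presentation_def bigraded_image_def im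
    proof (intro conjI ballI allI)
      show "presentation R (E l) ?I B2 q2 (bigraded_sub A' (q2 ` ?I))"
        by (rule presentation_sub[OF mE P2 I(1,2) IZ])
    qed (use a' DI IZ in auto)
    then show ?thesis
      using euler_module_of_presentation N Image unfolding arrow_part_value_def by simp
  next
    case Cokernel
    have "euler_presentation l Z2 ?I (\<lambda>z. q2 ` ?I +>\<^bsub>A'\<^esub> q2 z) (bigraded_cokernel A A' f)"
      unfolding euler_presentation_def bigraded_cokernel_def im
    proof (intro conjI ballI allI)
      show "presentation R (E l) Z2 ?I (\<lambda>z. q2 ` ?I +>\<^bsub>A'\<^esub> q2 z) (bigraded_quot A' (q2 ` ?I))"
        by (rule presentation_quot[OF mE P2 I(1,2) IZ])
    qed (use a' DI I(2) in auto)
    then show ?thesis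
      using euler_module_of_presentation N Cokernel unfolding arrow_part_value_def by simp
  qed
qed

end

lemma set_add_image:
  assumes "z \<in> A" "\<And>a b. a \<in> A \<Longrightarrow> b \<in> S \<Longrightarrow> f (a \<oplus>\<^bsub>M\<^esub> b) = f b"
  shows "f ` (A <+>\<^bsub>M\<^esub> S) = f ` S"
proof
  show "f ` S \<subseteq> f ` (A <+>\<^bsub>M\<^esub> S)"
    using assms(2)[OF assms(1)] set_addI[OF assms(1)] by (metis image_eqI image_subsetI)
qed (use assms(2) in \<open>auto elim!: set_addE\<close>)

section \<open>Cohomology of quotients of subcomplexes\<close>

context euler_complex
begin

text \<open>Stability under the homotopy \<open>h\<close> is included so that the defect
  \<open>d h + h d\<close> can be computed inside the subcomplex.\<close>

definition subcomplex :: "(nat \<Rightarrow> 'e set) \<Rightarrow> bool" where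
  "subcomplex Z \<longleftrightarrow> (\<forall>k. submodule (Z k) R (E k) \<and> (\<forall>x\<in>Z k. d k x \<in> Z (Suc k)) \<and>
     (\<forall>x\<in>Z (Suc k). h k x \<in> Z k) \<and> (\<forall>i\<in>J. \<forall>x\<in>Z k. D k i x \<in> Z k))"

lemma subcomplexD:
  assumes "subcomplex Z"
  shows "submodule (Z k) R (E k)" "x \<in> Z k \<Longrightarrow> d k x \<in> Z (Suc k)" "x \<in> Z (Suc k) \<Longrightarrow> h k x \<in> Z k"
    "i \<in> J \<Longrightarrow> x \<in> Z k \<Longrightarrow> D k i x \<in> Z k" "x \<in> Z k \<Longrightarrow> x \<in> carrier (E k)"
proof -
  show "submodule (Z k) R (E k)" "x \<in> Z k \<Longrightarrow> d k x \<in> Z (Suc k)" "x \<in> Z (Suc k) \<Longrightarrow> h k x \<in> Z k"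
    "i \<in> J \<Longrightarrow> x \<in> Z k \<Longrightarrow> D k i x \<in> Z k"
    using assms unfolding subcomplex_def by blast+
  then show "x \<in> Z k \<Longrightarrow> x \<in> carrier (E k)" using submodule_simps(1)[OF mE] by blast
qed

text \<open>Cocycles and boundaries of the quotient complex \<open>Z / B\<close> are taken as
  preimages in \<open>E k\<close>, which is why \<open>boundaries\<close> contains
  \<open>B k\<close>; in degree zero no differential arrives.\<close>

definition cocycles :: "(nat \<Rightarrow> 'e set) \<Rightarrow> (nat \<Rightarrow> 'e set) \<Rightarrow> nat \<Rightarrow> 'e set" where
  "cocycles Z B k = {z \<in> Z k. d k z \<in> B (Suc k)}"

definition boundaries :: "(nat \<Rightarrow> 'e set) \<Rightarrow> (nat \<Rightarrow> 'e set) \<Rightarrow> nat \<Rightarrow> 'e set" where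
  "boundaries Z B k = B k <+>\<^bsub>E k\<^esub> (case k of 0 \<Rightarrow> {\<zero>\<^bsub>E k\<^esub>} | Suc j \<Rightarrow> d j ` Z j)"

context
  fixes Z B
  assumes Z: "subcomplex Z" and B: "subcomplex B" and BZ: "\<And>k. B k \<subseteq> Z k"
begin

lemma boundaries_props:
  "submodule (boundaries Z B k) R (E k)" "B k \<subseteq> boundaries Z B k" "boundaries Z B k \<subseteq> cocycles Z B k"
proof -
  let ?S = "case k of 0 \<Rightarrow> {\<zero>\<^bsub>E k\<^esub>} | Suc j \<Rightarrow> d j ` Z j"
  have S: "submodule ?S R (E k)"
    using zero_submodule[OF mE] submodule_image[OF mE mE d subcomplexD(1)[OF Z]] by (auto split: nat.split)
  note b = set_add_submodule[OF mE subcomplexD(1)[OF B] S]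
  show "submodule (boundaries Z B k) R (E k)" "B k \<subseteq> boundaries Z B k"
    unfolding boundaries_def using b by blast+
  have c: "submodule (cocycles Z B k) R (E k)"
    unfolding cocycles_def by (rule submodule_vimage[OF mE mE d subcomplexD(1)[OF Z] subcomplexD(1)[OF B]])
  note c' = submodule_simps[OF mE c]
  have 1: "B k \<subseteq> cocycles Z B k" unfolding cocycles_def using BZ subcomplexD(2)[OF B] by blast
  have 2: "?S \<subseteq> cocycles Z B k"
  proof (cases k)
    case 0
    then show ?thesis using c'(2) by simp
  next
    case (Suc j)
    have "\<zero>\<^bsub>E (Suc (Suc j))\<^esub> \<in> B (Suc (Suc j))" using submodule_simps(2)[OF mE subcomplexD(1)[OF B]] .
    then show ?thesis
      unfolding Suc cocycles_def using subcomplexD(2,5)[OF Z] dd by auto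
  qed
  show "boundaries Z B k \<subseteq> cocycles Z B k"
    unfolding boundaries_def using 1 2 c'(3) by (auto elim!: set_addE)
qed

lemma boundaries_D: "i \<in> J \<Longrightarrow> x \<in> boundaries Z B k \<Longrightarrow> D k i x \<in> boundaries Z B k"
proof -
  assume i: "i \<in> J" and x: "x \<in> boundaries Z B k"
  then obtain b c where bc: "b \<in> B k" "c \<in> (case k of 0 \<Rightarrow> {\<zero>\<^bsub>E k\<^esub>} | Suc j \<Rightarrow> d j ` Z j)" "x = b \<oplus>\<^bsub>E k\<^esub> c"
    unfolding boundaries_def by (auto elim!: set_addE)
  have c: "c \<in> carrier (E k) \<and> D k i c \<in> (case k of 0 \<Rightarrow> {\<zero>\<^bsub>E k\<^esub>} | Suc j \<Rightarrow> d j ` Z j)"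
  proof (cases k)
    case 0
    then show ?thesis using bc(2) D_zero[OF i] module_zero_closed[OF mE] by simp
  next
    case (Suc j)
    then obtain z where "z \<in> Z j" "c = d j z" using bc(2) by auto
    then show ?thesis
      unfolding Suc using Dd[OF i subcomplexD(5)[OF Z]] subcomplexD(4)[OF Z i] module_hom_closed[OF d subcomplexD(5)[OF Z]]
      by auto
  qed
  then have "D k i x = D k i b \<oplus>\<^bsub>E k\<^esub> D k i c" using D_add[OF i subcomplexD(5)[OF B bc(1)]] bc(3) by blast
  then show ?thesis
    unfolding boundaries_def using c subcomplexD(4)[OF B i bc(1)] set_addI by metis
qed

text \<open>The Euler defect of a homogeneous cocycle \<open>z\<close> of \<open>Z / B\<close> is
  \<open>d (h z) + h (d z)\<close>. Here \<open>d z\<close> lies in \<open>B\<close>, hence so does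
  \<open>h (d z)\<close>, and \<open>d (h z)\<close> lies in the image of \<open>Z\<close> under
  \<open>d\<close>. Thus the defect is a boundary. In degree zero only \<open>h (d z)\<close>
  occurs.\<close>

lemma cohomology_presentation:
  fixes K :: "nat \<Rightarrow> ('r, 'q) bigraded"
  assumes P: "\<And>k. presentation R (E k) (Z k) (B k) (q k) (K k)"
    and dK: "\<And>k z. z \<in> Z k \<Longrightarrow> dK k (q k z) = q (Suc k) (d k z)"
  shows "coboundaries K dK k = q k ` boundaries Z B k"
    "euler_presentation k (cocycles Z B k) (boundaries Z B k)
       (\<lambda>z. q k ` boundaries Z B k +>\<^bsub>K k\<^esub> q k z) (cohomology K dK k)"
proof -
  note b = boundaries_props[of k]
  have cZ: "cocycles Z B k \<subseteq> Z k" by (auto simp: cocycles_def)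
  have c: "submodule (cocycles Z B k) R (E k)"
    unfolding cocycles_def by (rule submodule_vimage[OF mE mE d subcomplexD(1)[OF Z] subcomplexD(1)[OF B]])
  show cob: "coboundaries K dK k = q k ` boundaries Z B k"
  proof -
    \<comment> \<open>The summand \<open>B k\<close> of \<open>boundaries\<close> does not change
      the image, because \<open>q k\<close> kills it.\<close>
    have q0: "q k (y \<oplus>\<^bsub>E k\<^esub> x) = q k x" if y: "y \<in> B k" and x: "x \<in> Z k" for x y
    proof -
      have "q k y = \<zero>\<^bsub>K k\<^esub>" "y \<in> Z k" using presentationD(7)[OF P, of y k] y BZ by blast+
      then show ?thesis
        using presentationD(5)[OF P _ x] presentation_closed[OF mE P x] presentation_module[OF mE P, of k]
        by (simp add: module_def abelian_group_def abelian_monoid.l_zero)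
    qed
    show ?thesis
    proof (cases k)
      case 0
      have "q 0 (y \<oplus>\<^bsub>E 0\<^esub> \<zero>\<^bsub>E 0\<^esub>) = q 0 \<zero>\<^bsub>E 0\<^esub>" if "y \<in> B 0" for y
        using q0[unfolded 0, OF that submodule_simps(2)[OF mE subcomplexD(1)[OF Z]]] .
      moreover have "\<zero>\<^bsub>E 0\<^esub> \<in> B 0" using submodule_simps(2)[OF mE subcomplexD(1)[OF B]] .
      ultimately have "q 0 ` (B 0 <+>\<^bsub>E 0\<^esub> {\<zero>\<^bsub>E 0\<^esub>}) = q 0 ` {\<zero>\<^bsub>E 0\<^esub>}" by (intro set_add_image) auto
      then show ?thesis
        unfolding 0 coboundaries_def boundaries_def using presentation_zero[OF mE P] by simp
    next
      case (Suc j)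
      have "dK j ` carrier (K j) = (\<lambda>z. q (Suc j) (d j z)) ` Z j"
        using presentationD(4)[OF P] dK by (simp add: image_image)
      also have "\<dots> = q (Suc j) ` boundaries Z B (Suc j)"
      proof -
        have "q (Suc j) (y \<oplus>\<^bsub>E (Suc j)\<^esub> d j z) = q (Suc j) (d j z)" if "y \<in> B (Suc j)" "z \<in> Z j" for y z
          using q0[unfolded Suc, OF that(1) subcomplexD(2)[OF Z that(2)]] .
        moreover have "\<zero>\<^bsub>E (Suc j)\<^esub> \<in> B (Suc j)" using submodule_simps(2)[OF mE subcomplexD(1)[OF B]] .
        ultimately have "q (Suc j) ` (B (Suc j) <+>\<^bsub>E (Suc j)\<^esub> d j ` Z j) = q (Suc j) ` d j ` Z j"
          by (intro set_add_image) auto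
        then show ?thesis unfolding boundaries_def by (simp add: image_image)
      qed
      finally show ?thesis unfolding Suc coboundaries_def by simp
    qed
  qed
  have ker: "a_kernel (K k) (K (Suc k)) (dK k) = q k ` cocycles Z B k"
    unfolding a_kernel_def' presentationD(4)[OF P] cocycles_def
    using dK presentationD(7)[OF P] subcomplexD(2)[OF Z] by auto
  have "presentation R (E k) (cocycles Z B k) (B k) (q k) (bigraded_sub (K k) (q k ` cocycles Z B k))"
    using b by (intro presentation_sub[OF mE P c _ cZ]) blast
  from presentation_quot[OF mE this b(1,2,3)]
  have pres: "presentation R (E k) (cocycles Z B k) (boundaries Z B k)
      (\<lambda>z. q k ` boundaries Z B k +>\<^bsub>K k\<^esub> q k z) (cohomology K dK k)"
    unfolding cohomology_def bigraded_kernel_def ker cob by simp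
  show "euler_presentation k (cocycles Z B k) (boundaries Z B k)
       (\<lambda>z. q k ` boundaries Z B k +>\<^bsub>K k\<^esub> q k z) (cohomology K dK k)"
    unfolding euler_presentation_def
  proof (intro conjI ballI allI pres)
    fix i z assume i: "i \<in> J" and z: "z \<in> cocycles Z B k"
    have "d k (D k i z) = D (Suc k) i (d k z)"
      using z Dd[OF i subcomplexD(5)[OF Z], of z k] unfolding cocycles_def by simp
    then show "D k i z \<in> cocycles Z B k"
      using z subcomplexD(4)[OF Z i, of z k] subcomplexD(4)[OF B i, of "d k z" "Suc k"] unfolding cocycles_def by simp
  next
    fix e z assume z: "z \<in> cocycles Z B k \<inter> homog (E k) e"
    then have zZ: "z \<in> Z k" and dz: "d k z \<in> B (Suc k)" and ze: "z \<in> homog (E k) e" by (auto simp: cocycles_def)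
    have hB: "h k (d k z) \<in> B k" using subcomplexD(3)[OF B dz] .
    show "euler_op (E k) (D k) z \<ominus>\<^bsub>E k\<^esub> w e \<odot>\<^bsub>E k\<^esub> z \<in> boundaries Z B k"
    proof (cases k)
      case 0
      then show ?thesis using defect_0[of z e] ze hB b(2) by auto
    next
      case (Suc j)
      interpret Ek: module R "E k" by (rule mE)
      have 1: "d j (h j z) \<in> d j ` Z j" using subcomplexD(3)[OF Z, of z j] zZ Suc by blast
      have "h k (d k z) \<oplus>\<^bsub>E k\<^esub> d j (h j z) \<in> boundaries Z B k"
        unfolding boundaries_def using 1 hB Suc by (intro set_addI) simp_all
      moreover have "h k (d k z) \<in> carrier (E k)" "d j (h j z) \<in> carrier (E k)"
        using subcomplexD(5)[OF B hB] module_hom_closed[OF d subcomplexD(5)[OF Z subcomplexD(3)[OF Z, of z j]]] zZ Suc by auto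
      ultimately show ?thesis using defect_Suc[of z j e] ze Suc Ek.M.a_comm by simp
    qed
  qed (use boundaries_D in blast)
qed

end

section \<open>Complexes of sections with support and the long exact sequence\<close>

abbreviation \<Gamma> :: "'r set set \<Rightarrow> nat \<Rightarrow> 'e set" where
  "\<Gamma> Y \<equiv> (\<lambda>k. section_set R Y (E k))"

lemma subcomplex_sections: "subcomplex (\<Gamma> Y)"
  unfolding subcomplex_def
  using section_set_submodule[OF mE] section_set_hom[OF mE mE d] section_set_hom[OF mE mE h]
    section_set_leibniz[OF mE \<delta> connectionD[OF D]] by blast

lemma subcomplex_zero: "subcomplex (\<lambda>k. {\<zero>\<^bsub>E k\<^esub>})"
  unfolding subcomplex_def
  using zero_submodule[OF mE] module_hom_zero[OF mE mE d] module_hom_zero[OF mE mE h] D_zero by auto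

lemma presentation_sections: "presentation R (E k) (\<Gamma> Y k) {\<zero>\<^bsub>E k\<^esub>} (\<lambda>x. x) (supp_complex R Y E k)"
proof -
  have "{\<zero>\<^bsub>E k\<^esub>} \<subseteq> \<Gamma> Y k" using submodule_simps(2)[OF mE section_set_submodule[OF mE]] by blast
  moreover have "\<Gamma> Y k \<subseteq> carrier (E k)" using submodule_simps(1)[OF mE section_set_submodule[OF mE]] .
  ultimately show ?thesis
    using presentation_sub[OF mE presentation_id[OF E] section_set_submodule[OF mE]]
    by (simp add: supp_complex_def sections_supp_eq)
qed

lemma section_set_mono: "Y' \<subseteq> Y'' \<Longrightarrow> \<Gamma> Y' k \<subseteq> \<Gamma> Y'' k"
  by (auto simp: section_set_def)

lemma presentation_lc:
  assumes "Y' \<subseteq> Y''"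
  shows "presentation R (E k) (\<Gamma> Y'' k) (\<Gamma> Y' k) (\<lambda>x. \<Gamma> Y' k +>\<^bsub>E k\<^esub> x) (lc_complex R Y' Y'' E k)"
proof -
  have "{\<zero>\<^bsub>E k\<^esub>} \<subseteq> \<Gamma> Y' k" using submodule_simps(2)[OF mE section_set_submodule[OF mE]] by blast
  from presentation_quot[OF mE presentation_sections section_set_submodule[OF mE] this section_set_mono[OF assms]]
  show ?thesis by (simp add: supp_complex_def lc_complex_def sections_supp_eq)
qed

lemma lc_diff_coset:
  assumes "Y' \<subseteq> Y''" "z \<in> \<Gamma> Y'' k"
  shows "lc_diff R Y' E d k (\<Gamma> Y' k +>\<^bsub>E k\<^esub> z) = \<Gamma> Y' (Suc k) +>\<^bsub>E (Suc k)\<^esub> d k z"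
proof -
  note g = submodule_simps[OF mE section_set_submodule[OF mE]]
  have "coset_map (E (Suc k)) ((\<lambda>x. x) ` \<Gamma> Y' (Suc k)) (d k)
      ((\<lambda>x. x) ` \<Gamma> Y' k +>\<^bsub>supp_complex R Y'' E k\<^esub> z) = (\<lambda>x. x) ` \<Gamma> Y' (Suc k) +>\<^bsub>E (Suc k)\<^esub> d k z"
  proof (rule coset_map_presentation[OF mE presentation_sections section_set_submodule[OF mE] _ section_set_mono[OF assms(1)]
        mE presentation_id[OF E] section_set_submodule[OF mE] _ g(1) d])
    show "{\<zero>\<^bsub>E k\<^esub>} \<subseteq> \<Gamma> Y' k" "{\<zero>\<^bsub>E (Suc k)\<^esub>} \<subseteq> \<Gamma> Y' (Suc k)" using g(2) by auto
  qed (use assms(2) subcomplexD(2)[OF subcomplex_sections] module_hom_closed[OF d]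
      subcomplexD(5)[OF subcomplex_sections] in auto)
  then show ?thesis by (simp add: lc_diff_def supp_complex_def sections_supp_eq)
qed

text \<open>\<open>H_closed\<close> is the cohomology of \<open>\<Gamma> Y\<close> modulo zero and
  \<open>H_lc\<close> that of \<open>\<Gamma> Y''\<close> modulo \<open>\<Gamma> Y'\<close>. The
  first two arrows of the long exact sequence are induced by the identity of \<open>E i\<close>, and
  the connecting one by \<open>d i\<close>.\<close>

lemma euler_module_of_resolution_value:
  fixes N :: "('r, 'u) bigraded"
  assumes t: "valid_step R t" and N: "resolution_value R t E d N"
  shows "\<exists>D'. euler_module N D'"
proof -
  obtain Y' Y'' where Y: "Y' \<subseteq> Y''" and t': "(\<exists>i. t = Coh i Y' Y'') \<or> (\<exists>\<pi> \<alpha>. t = Part \<pi> \<alpha> Y' Y'')"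
    using t by (cases t) auto
  let ?Z = "\<lambda>k. {\<zero>\<^bsub>E k\<^esub>}"
  have z\<Gamma>: "?Z k \<subseteq> \<Gamma> V k" for V k
    using submodule_simps(2)[OF mE section_set_submodule[OF mE]] by blast
  note sc = subcomplex_sections subcomplex_zero z\<Gamma>
  note lc = subcomplex_sections subcomplex_sections section_set_mono[OF Y]
  let ?bs = "\<lambda>V. boundaries (\<Gamma> V) ?Z" and ?cs = "\<lambda>V. cocycles (\<Gamma> V) ?Z"
    and ?bl = "boundaries (\<Gamma> Y'') (\<Gamma> Y')" and ?cl = "cocycles (\<Gamma> Y'') (\<Gamma> Y')"
  let ?ql = "\<lambda>k x. \<Gamma> Y' k +>\<^bsub>E k\<^esub> x"
  note hs = cohomology_presentation[where dK = d, OF sc presentation_sections refl]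
  note hl = cohomology_presentation[where dK = "lc_diff R Y' E d" and K = "lc_complex R Y' Y'' E" and q = ?ql, OF lc presentation_lc[OF Y] lc_diff_coset[OF Y]]
  note bsp = boundaries_props[OF sc] and blp = boundaries_props[OF lc]
  have cobl: "coboundaries (lc_complex R Y' Y'' E) (lc_diff R Y' E d) k = ?ql k ` ?bl k" for k
    by (rule hl(1))
  have bs_mono: "?bs Y' k \<subseteq> ?bs Y'' k" for k
    unfolding boundaries_def using section_set_mono[OF Y] by (auto simp: set_add_def' split: nat.split)
  have bs_bl: "?bs Y'' k \<subseteq> ?bl k" for k
    unfolding boundaries_def using z\<Gamma>[of k Y'] by (auto simp: set_add_def' split: nat.split)
  have cZ: "cocycles Z B k \<subseteq> Z k" for Z B k by (auto simp: cocycles_def)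
  have bs\<Gamma>: "?bs V k \<subseteq> \<Gamma> V k" for V k by (rule order_trans[OF bsp(3) cZ])
  have bl\<Gamma>: "?bl k \<subseteq> \<Gamma> Y'' k" for k by (rule order_trans[OF blp(3) cZ])
  have cs\<Gamma>: "z \<in> \<Gamma> V k" if "z \<in> ?cs V k" for V k z using that by (simp add: cocycles_def)
  have cl\<Gamma>: "z \<in> \<Gamma> Y'' k" if "z \<in> ?cl k" for k z using that by (simp add: cocycles_def)
  have \<Gamma>m: "z \<in> \<Gamma> Y'' k" if "z \<in> \<Gamma> Y' k" for k z using section_set_mono[OF Y] that by blast
  have c\<Gamma>: "x \<in> carrier (E k)" if "x \<in> \<Gamma> V k" for x V k using subcomplexD(5)[OF subcomplex_sections that] .
  have supp: "S +>\<^bsub>supp_complex R V E k\<^esub> x = S +>\<^bsub>E k\<^esub> x" for S V k x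
    by (simp add: supp_complex_def sections_supp_eq)
  have Hs: "euler_presentation k (?cs V k) (?bs V k) (\<lambda>z. ?bs V k +>\<^bsub>E k\<^esub> z) (H_closed R V E d k)" for V k
    using hs(2)[of k V] by (simp add: H_closed_def supp)
  have Hl: "euler_presentation k (?cl k) (?bl k) (\<lambda>z. ?ql k ` ?bl k +>\<^bsub>lc_complex R Y' Y'' E k\<^esub> ?ql k z) (H_lc R Y' Y'' E d k)" for k
    using hl(2)[of k] by (simp add: H_lc_def)
  show ?thesis
  proof (cases t)
    case (Coh i Y1 Y2)
    then have "bigraded_iso R (H_lc R Y' Y'' E d i) N" using N t' by auto
    then show ?thesis by (rule euler_module_of_presentation[OF Hl])
  next
    case (Part \<pi> \<alpha> Y1 Y2)
    then have tY: "t = Part \<pi> \<alpha> Y' Y''" using t' by auto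
    show ?thesis
    proof (cases \<alpha>)
      case (Incl i)
      have f: "les_incl R Y'' E d i (?bs Y' i +>\<^bsub>E i\<^esub> z) = ?bs Y'' i +>\<^bsub>E i\<^esub> z" if z: "z \<in> ?cs Y' i" for z
      proof -
        have "coset_map (supp_complex R Y'' E i) ((\<lambda>x. x) ` ?bs Y'' i) (\<lambda>x. x)
           ((\<lambda>x. x) ` ?bs Y' i +>\<^bsub>supp_complex R Y' E i\<^esub> z) = (\<lambda>x. x) ` ?bs Y'' i +>\<^bsub>supp_complex R Y'' E i\<^esub> z"
          by (rule coset_map_presentation[OF mE presentation_sections[of i Y'] bsp(1)[of Y' i] bsp(2) bs\<Gamma>
                mE presentation_sections[of i Y''] bsp(1)[of Y'' i] bsp(2) bs\<Gamma> module_hom_id[of R "E i"]])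
            (use cs\<Gamma>[OF z] \<Gamma>m bs_mono in auto)
        then show ?thesis unfolding les_incl_def hs(1) by (simp add: supp)
      qed
      have "arrow_part_value R \<pi> (H_closed R Y' E d i) (H_closed R Y'' E d i) (les_incl R Y'' E d i) N"
        using N unfolding tY Incl by simp
      then show ?thesis
        using section_set_mono[OF Y] bs_mono f
        by (intro euler_module_of_arrow[OF Hs Hs module_hom_id, where f = "les_incl R Y'' E d i"]) (auto simp: cocycles_def)
    next
      case (Restr i)
      have f: "les_restr R Y' Y'' E d i (?bs Y'' i +>\<^bsub>E i\<^esub> z) = ?ql i ` ?bl i +>\<^bsub>lc_complex R Y' Y'' E i\<^esub> ?ql i z"
        if z: "z \<in> ?cs Y'' i" for z
      proof -
        have "coset_map (lc_complex R Y' Y'' E i) (?ql i ` ?bl i) (?ql i)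
           ((\<lambda>x. x) ` ?bs Y'' i +>\<^bsub>supp_complex R Y'' E i\<^esub> z) = ?ql i ` ?bl i +>\<^bsub>lc_complex R Y' Y'' E i\<^esub> ?ql i z"
          by (rule coset_map_presentation[OF mE presentation_sections[of i Y''] bsp(1)[of Y'' i] bsp(2) bs\<Gamma>
                mE presentation_lc[OF Y, of i] blp(1)[of i] blp(2) bl\<Gamma> module_hom_id[of R "E i"]])
            (use cs\<Gamma>[OF z] bs_bl in auto)
        then show ?thesis unfolding les_restr_def cobl by (simp add: supp sections_supp_eq)
      qed
      have "arrow_part_value R \<pi> (H_closed R Y'' E d i) (H_lc R Y' Y'' E d i) (les_restr R Y' Y'' E d i) N"
        using N unfolding tY Restr by simp
      then show ?thesis
        using bs_bl f z\<Gamma>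
        by (intro euler_module_of_arrow[OF Hs Hl module_hom_id, where f = "les_restr R Y' Y'' E d i"]) (auto simp: cocycles_def)
    next
      case (Conn i)
      \<comment> \<open>An element of \<open>?bl i\<close> is a section with support in
        \<open>Y'\<close> plus a coboundary. Applying \<open>d i\<close> kills the coboundary, and
        what is left is a coboundary of sections with support in \<open>Y'\<close>.\<close>
      have d\<Gamma>: "d i x \<in> ?bs Y' (Suc i)" if x: "x \<in> ?bl i" for x
      proof -
        obtain b c where bc: "b \<in> \<Gamma> Y' i" "c \<in> (case i of 0 \<Rightarrow> {\<zero>\<^bsub>E i\<^esub>} | Suc j \<Rightarrow> d j ` \<Gamma> Y'' j)" "x = b \<oplus>\<^bsub>E i\<^esub> c"
          using x unfolding boundaries_def by (auto elim!: set_addE)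
        have "c \<in> carrier (E i) \<and> d i c = \<zero>\<^bsub>E (Suc i)\<^esub>"
        proof (cases i)
          case 0
          then show ?thesis using bc(2) module_zero_closed[OF mE] module_hom_zero[OF mE mE d] by simp
        next
          case (Suc j)
          then show ?thesis using bc(2) dd[OF c\<Gamma>] module_hom_closed[OF d c\<Gamma>] by auto
        qed
        then have "d i x = \<zero>\<^bsub>E (Suc i)\<^esub> \<oplus>\<^bsub>E (Suc i)\<^esub> d i b"
          using module_hom_add[OF d c\<Gamma>[OF bc(1)]] module_hom_closed[OF d c\<Gamma>[OF bc(1)]] bc(3) mE[of "Suc i"]
          by (simp add: module_def abelian_group_def abelian_monoid.r_zero abelian_monoid.l_zero)
        then show ?thesis unfolding boundaries_def using bc(1) by (auto intro!: set_addI)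
      qed
      have f: "les_conn R Y' E d i (?ql i ` ?bl i +>\<^bsub>lc_complex R Y' Y'' E i\<^esub> ?ql i z) = ?bs Y' (Suc i) +>\<^bsub>E (Suc i)\<^esub> d i z"
        if z: "z \<in> ?cl i" for z
      proof -
        let ?sub = "\<lambda>M A. bigraded_sub M A"
        have cl: "submodule (?cl i) R (E i)"
          unfolding cocycles_def by (rule submodule_vimage[OF mE mE d section_set_submodule[OF mE] section_set_submodule[OF mE]])
        have G: "\<Gamma> Y' i \<subseteq> ?cl i" using blp(2,3) by blast
        \<comment> \<open>The cosets are formed inside the cocycles, because \<open>d i y\<close>
          has support in \<open>Y'\<close> exactly for the cocycles \<open>y\<close> of the quotient
          complex.\<close>
        have P1: "presentation R (E i) (?cl i) (\<Gamma> Y' i) (?ql i) (?sub (lc_complex R Y' Y'' E i) (?ql i ` ?cl i))"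
          by (rule presentation_sub[OF mE presentation_lc[OF Y] cl G cZ])
        have P0: "presentation R (E i) (?cl i) (?Z i) (\<lambda>x. x) (?sub (supp_complex R Y'' E i) ((\<lambda>x. x) ` ?cl i))"
          using z\<Gamma>[of i Y'] G by (intro presentation_sub[OF mE presentation_sections cl _ cZ]) blast
        \<comment> \<open>\<open>les_conn\<close> is a union of unions. The inner one, over the
          sections in a coset of \<open>\<Gamma> Y' i\<close>, collapses in the evaluation of this
          map; the outer one, over the cosets in a cohomology class, collapses afterwards.\<close>
        let ?\<psi> = "coset_map (supp_complex R Y' E (Suc i)) (?bs Y' (Suc i)) (d i)"
        have \<psi>: "?\<psi> (?ql i y) = ?bs Y' (Suc i) +>\<^bsub>E (Suc i)\<^esub> d i y" if y: "y \<in> ?cl i" for y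
        proof -
          have "coset_map (supp_complex R Y' E (Suc i)) ((\<lambda>x. x) ` ?bs Y' (Suc i)) (d i)
            ((\<lambda>x. x) ` \<Gamma> Y' i +>\<^bsub>?sub (supp_complex R Y'' E i) ((\<lambda>x. x) ` ?cl i)\<^esub> y) =
            (\<lambda>x. x) ` ?bs Y' (Suc i) +>\<^bsub>supp_complex R Y' E (Suc i)\<^esub> d i y"
            by (rule coset_map_presentation[OF mE P0 section_set_submodule[OF mE] z\<Gamma> G
                  mE presentation_sections[of "Suc i" Y'] bsp(1)[of Y' "Suc i"] bsp(2) bs\<Gamma> d])
              (use y d\<Gamma> blp(2) in \<open>auto simp: cocycles_def\<close>)
          then show ?thesis by (simp add: supp)
        qed
        have "(\<Union>K\<in>?ql i ` ?bl i +>\<^bsub>?sub (lc_complex R Y' Y'' E i) (?ql i ` ?cl i)\<^esub> ?ql i z. ?\<psi> K) =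
            ?bs Y' (Suc i) +>\<^bsub>E (Suc i)\<^esub> d i z"
        proof (rule UN_coset[OF mE P1 blp z])
          fix y assume y: "y \<in> ?cl i" "y \<ominus>\<^bsub>E i\<^esub> z \<in> ?bl i"
          have dG: "d i y \<in> \<Gamma> Y' (Suc i)" "d i z \<in> \<Gamma> Y' (Suc i)" using y(1) z by (auto simp: cocycles_def)
          have "y \<in> carrier (E i)" "z \<in> carrier (E i)" using c\<Gamma>[OF cl\<Gamma>] y(1) z by blast+
          then have "d i y \<ominus>\<^bsub>E (Suc i)\<^esub> d i z \<in> ?bs Y' (Suc i)"
            using d\<Gamma>[OF y(2)] module_hom_diff[OF mE mE d] by simp
          then have "?bs Y' (Suc i) +>\<^bsub>E (Suc i)\<^esub> d i y = ?bs Y' (Suc i) +>\<^bsub>E (Suc i)\<^esub> d i z"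
            using coset_eq_iff(1)[OF mE presentation_sections[of "Suc i" Y'] bsp(1)[of Y' "Suc i"] bsp(2) bs\<Gamma> dG]
            by (simp add: supp)
          then show "?\<psi> (?ql i y) = ?bs Y' (Suc i) +>\<^bsub>E (Suc i)\<^esub> d i z" using \<psi>[OF y(1)] by simp
        qed
        then show ?thesis unfolding les_conn_def hs(1) by simp
      qed
      have cc: "d i z \<in> ?cs Y' (Suc i)" if "z \<in> ?cl i" for z
        using that dd[OF c\<Gamma>] by (auto simp: cocycles_def)
      have "arrow_part_value R \<pi> (H_lc R Y' Y'' E d i) (H_closed R Y' E d (Suc i)) (les_conn R Y' E d i) N"
        using N unfolding tY Conn by simp
      then show ?thesis
        using Dd cc d\<Gamma> f
        by (intro euler_module_of_arrow[OF Hl Hs d, where f = "les_conn R Y' E d i"]) blast+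
    qed
  qed
qed

end

section \<open>Isomorphic copies and single factors\<close>

context euler_ring
begin

text \<open>\<open>M\<close> is the subquotient \<open>M / 0\<close> of a complex with zero
  differentials and zero homotopy, whose Euler defect vanishes. So the passage to an isomorphic copy
  is a case of \<open>euler_module_of_presentation\<close>.\<close>

lemma euler_module_iso:
  assumes M: "euler_module M D" and iso: "bigraded_iso R M N"
  shows "\<exists>D'. euler_module N D'"
proof -
  have bM: "bigraded_module R M" and D: "connection M D" and e: "\<And>e x. x \<in> homog M e \<Longrightarrow> euler_op M D x = w e \<odot>\<^bsub>M\<^esub> x"
    using M unfolding euler_module_def by blast+
  interpret M: module R M by (rule bigraded_moduleD[OF bM])
  have z: "euler_op M D x \<ominus>\<^bsub>M\<^esub> w e \<odot>\<^bsub>M\<^esub> x = \<zero>\<^bsub>M\<^esub>" if "x \<in> homog M e" for e x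
    using e[OF that] w_carrier bigraded_moduleD(5)[OF bM that] by (simp add: M.M.minus_eq M.M.r_neg)
  have D0: "D i \<zero>\<^bsub>M\<^esub> = \<zero>\<^bsub>M\<^esub>" if "i \<in> J" for i
    using leibniz_mapD(1,2)[OF connectionD[OF D that]]
    by (intro additive_zero[OF M.M.abelian_group_axioms M.M.abelian_group_axioms]) simp_all
  interpret C: euler_complex R J \<xi> \<delta> s w "\<lambda>_. M" "\<lambda>_ _. \<zero>\<^bsub>M\<^esub>" "\<lambda>_. D" "\<lambda>_ _. \<zero>\<^bsub>M\<^esub>"
    by unfold_locales (simp_all add: bM D D0 z module_hom_const_zero M.module_axioms)
  have "C.euler_presentation 0 (carrier M) {\<zero>\<^bsub>M\<^esub>} (\<lambda>x. x) M"
    unfolding C.euler_presentation_def using presentation_id[OF bM] C.D_closed D0 z by simp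
  then show ?thesis by (rule C.euler_module_of_presentation[OF _ iso])
qed

lemma euler_module_of_step_value:
  fixes M N :: "('r, 'u) bigraded"
  assumes M: "euler_module M D" and t: "valid_step R t" and N: "step_value R t M N"
  shows "\<exists>D'. euler_module N D'"
proof -
  obtain E :: "nat \<Rightarrow> ('r, 'u) bigraded" and \<epsilon> d where res: "bigraded_injective_resolution R M E \<epsilon> d" and v: "resolution_value R t E d N"
    using N unfolding step_value_def by blast
  note r = bigraded_resolutionD[OF res]
  obtain D' h where D': "\<And>k. connection (E k) (D' k)"
    "\<And>k i x. i \<in> J \<Longrightarrow> x \<in> carrier (E k) \<Longrightarrow> D' (Suc k) i (d k x) = d k (D' k i x)"
    "\<And>k. h k \<in> bigraded_hom R (E (Suc k)) (E k)"
    "\<And>e x. x \<in> homog (E 0) e \<Longrightarrow> euler_op (E 0) (D' 0) x \<ominus>\<^bsub>E 0\<^esub> w e \<odot>\<^bsub>E 0\<^esub> x = h 0 (d 0 x)"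
    "\<And>k e x. x \<in> homog (E (Suc k)) e \<Longrightarrow>
       euler_op (E (Suc k)) (D' (Suc k)) x \<ominus>\<^bsub>E (Suc k)\<^esub> w e \<odot>\<^bsub>E (Suc k)\<^esub> x =
       d k (h k x) \<oplus>\<^bsub>E (Suc k)\<^esub> h (Suc k) (d (Suc k) x)"
    using euler_resolution[OF M res] by blast
  interpret C: euler_complex R J \<xi> \<delta> s w E d D' h
    using r(3,10) D' bigraded_homD(1)[OF r(5)] bigraded_homD(1)[OF D'(3)]
    by unfold_locales blast+
  show ?thesis by (rule C.euler_module_of_resolution_value[OF t v])
qed

end

section \<open>Partial derivatives on the polynomial ring\<close>

lemma finite_submultisets: "finite {\<nu>. \<nu> \<subseteq># (\<mu> :: 'v multiset)}"
proof -
  have "{\<nu>. \<nu> \<subseteq># \<mu>} \<subseteq> {\<nu>. set_mset \<nu> \<subseteq> set_mset \<mu> \<and> size \<nu> \<le> size \<mu>}"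
    using set_mset_mono size_mset_mono by blast
  moreover have "finite {\<nu>. set_mset \<nu> \<subseteq> set_mset \<mu> \<and> size \<nu> \<le> size \<mu>}"
  proof -
    have "{\<nu>. set_mset \<nu> \<subseteq> set_mset \<mu> \<and> size \<nu> \<le> size \<mu>} \<subseteq> mset ` {xs. set xs \<subseteq> set_mset \<mu> \<and> length xs \<le> size \<mu>}"
    proof
      fix \<nu> assume "\<nu> \<in> {\<nu>. set_mset \<nu> \<subseteq> set_mset \<mu> \<and> size \<nu> \<le> size \<mu>}"
      moreover obtain xs where "mset xs = \<nu>" using ex_mset by blast
      ultimately show "\<nu> \<in> mset ` {xs. set xs \<subseteq> set_mset \<mu> \<and> length xs \<le> size \<mu>}" by auto
    qed
    then show ?thesis by (rule finite_subset) (simp add: finite_lists_length_le)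
  qed
  ultimately show ?thesis by (rule finite_subset)
qed

definition partial_derivative :: "('c, 'x) ring_scheme \<Rightarrow> 'v \<Rightarrow> ('v multiset \<Rightarrow> 'c) \<Rightarrow> 'v multiset \<Rightarrow> 'c" where
  "partial_derivative C v p = (\<lambda>\<mu>. [Suc (count \<mu> v)] \<cdot>\<^bsub>C\<^esub> p (add_mset v \<mu>))"

section \<open>Products and derivatives of polynomials\<close>

context cring
begin

lemma nat_pow_finsum:
  assumes "finite A" "g \<in> A \<rightarrow> carrier R"
  shows "[(k::nat)] \<cdot> finsum R g A = finsum R (\<lambda>i. [k] \<cdot> g i) A"
  using assms
  by (intro additive_finsum[OF abelian_group_axioms abelian_group_axioms]) (auto simp: add.nat_pow_distrib)

lemma finsum_support_singleton:
  assumes "finite A" "a \<in> A" "f a \<in> carrier R" "\<And>x. x \<in> A \<Longrightarrow> x \<noteq> a \<Longrightarrow> f x = \<zero>"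
  shows "finsum R f A = f a"
proof -
  have "finsum R f A = finsum R f {a}"
  proof (rule add.finprod_mono_neutral_cong_right)
    show "f \<in> A \<rightarrow> carrier R"
    proof
      fix x assume "x \<in> A"
      then show "f x \<in> carrier R" using assms(3,4) by (cases "x = a") simp_all
    qed
  qed (use assms in auto)
  then show ?thesis using assms(3) by simp
qed

lemma mpoly_mult_const:
  assumes "c \<in> carrier R" "\<And>\<mu>. q \<mu> \<in> carrier R"
  shows "mpoly_mult R (indexed_const c) q \<mu> = c \<otimes> q \<mu>"
  unfolding mpoly_mult_def
  using assms by (subst finsum_support_singleton[where a = "{#}"]) (auto simp: indexed_const_def finite_submultisets)

lemma mpoly_mult_var:
  assumes "\<And>\<mu>. q \<mu> \<in> carrier R"
  shows "mpoly_mult R (indexed_var v) q \<mu> = (if v \<in># \<mu> then q (\<mu> - {#v#}) else \<zero>)"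
proof -
  have var: "indexed_var v \<nu> = (if \<nu> = {#v#} then \<one> else \<zero>)" for \<nu>
    by (auto simp: indexed_var_def indexed_pmult_def indexed_const_def diff_single_eq_union)
  show ?thesis
  proof (cases "v \<in># \<mu>")
    case True
    then have "finsum R (\<lambda>\<nu>. indexed_var v \<nu> \<otimes> q (\<mu> - \<nu>)) {\<nu>. \<nu> \<subseteq># \<mu>} = indexed_var v {#v#} \<otimes> q (\<mu> - {#v#})"
      using assms by (intro finsum_support_singleton) (auto simp: var finite_submultisets)
    then show ?thesis unfolding mpoly_mult_def using True assms by (simp add: var)
  next
    case False
    then have "finsum R (\<lambda>\<nu>. indexed_var v \<nu> \<otimes> q (\<mu> - \<nu>)) {\<nu>. \<nu> \<subseteq># \<mu>} = finsum R (\<lambda>\<nu>. \<zero>) {\<nu>. \<nu> \<subseteq># \<mu>}"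
      using assms by (intro add.finprod_cong') (auto simp: var mset_subset_eq_single)
    then show ?thesis unfolding mpoly_mult_def using False by simp
  qed
qed

text \<open>The exponent of \<open>v\<close> in \<open>add_mset v \<mu>\<close> is the sum of its
  exponents in the two monomials of each term, which splits the convolution into two sums. In the
  first, a term with nonzero multiplicity has its left monomial inside \<open>\<mu>\<close>; in the
  second, its left monomial contains \<open>v\<close>. These are the terms of the two products on
  the right.\<close>

lemma partial_derivative_mult:
  assumes p: "\<And>\<mu>. p \<mu> \<in> carrier R" and q: "\<And>\<mu>. q \<mu> \<in> carrier R"
  shows "partial_derivative R v (mpoly_mult R p q) \<mu> =
    mpoly_mult R p (partial_derivative R v q) \<mu> \<oplus> mpoly_mult R (partial_derivative R v p) q \<mu>"
proof -
  let ?\<mu> = "add_mset v \<mu>"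
  let ?S = "{\<nu>. \<nu> \<subseteq># \<mu>}" and ?S' = "{\<nu>. \<nu> \<subseteq># ?\<mu>}"
  let ?t = "\<lambda>\<nu>. p \<nu> \<otimes> q (?\<mu> - \<nu>)"
  have t: "?t \<nu> \<in> carrier R" for \<nu> using p q by simp
  have fS: "finite ?S" "finite ?S'" by (rule finite_submultisets)+
  have "partial_derivative R v (mpoly_mult R p q) \<mu> = finsum R (\<lambda>\<nu>. [Suc (count \<mu> v)] \<cdot> ?t \<nu>) ?S'"
    unfolding partial_derivative_def mpoly_mult_def using t fS by (intro nat_pow_finsum) auto
  also have "\<dots> = finsum R (\<lambda>\<nu>. [count (?\<mu> - \<nu>) v] \<cdot> ?t \<nu> \<oplus> [count \<nu> v] \<cdot> ?t \<nu>) ?S'"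
  proof (rule add.finprod_cong')
    fix \<nu> assume "\<nu> \<in> ?S'"
    then have "count \<nu> v \<le> count ?\<mu> v" by (intro mset_subset_eq_count) simp
    then have "count (?\<mu> - \<nu>) v + count \<nu> v = Suc (count \<mu> v)" by simp
    then show "[Suc (count \<mu> v)] \<cdot> ?t \<nu> = [count (?\<mu> - \<nu>) v] \<cdot> ?t \<nu> \<oplus> [count \<nu> v] \<cdot> ?t \<nu>"
      using add.nat_pow_mult[OF t[of \<nu>], of "count (?\<mu> - \<nu>) v" "count \<nu> v"] by metis
  qed (use t in auto)
  also have "\<dots> = finsum R (\<lambda>\<nu>. [count (?\<mu> - \<nu>) v] \<cdot> ?t \<nu>) ?S' \<oplus> finsum R (\<lambda>\<nu>. [count \<nu> v] \<cdot> ?t \<nu>) ?S'"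
    using t by (intro finsum_addf) auto
  also have "finsum R (\<lambda>\<nu>. [count (?\<mu> - \<nu>) v] \<cdot> ?t \<nu>) ?S' = mpoly_mult R p (partial_derivative R v q) \<mu>"
    unfolding mpoly_mult_def
  proof (rule add.finprod_mono_neutral_cong_right[OF fS(2)])
    show "?S \<subseteq> ?S'" by (auto intro: subset_mset.order_trans)
    show "[count (?\<mu> - \<nu>) v] \<cdot> ?t \<nu> = \<zero>" if \<nu>: "\<nu> \<in> ?S' - ?S" for \<nu>
    proof -
      have "count (?\<mu> - \<nu>) v = 0"
      proof (rule ccontr)
        assume "count (?\<mu> - \<nu>) v \<noteq> 0"
        then have "count \<nu> a \<le> count \<mu> a" for a
          using \<nu> mset_subset_eq_count[of \<nu> ?\<mu> a] by (cases "a = v") auto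
        then show False using \<nu> by (simp add: subseteq_mset_def)
      qed
      then show "[count (?\<mu> - \<nu>) v] \<cdot> ?t \<nu> = \<zero>" by simp
    qed
    fix \<nu> assume "\<nu> \<in> ?S"
    then have 1: "?\<mu> - \<nu> = add_mset v (\<mu> - \<nu>)" using mset_subset_eq_count[of \<nu> \<mu>] by (auto simp: multiset_eq_iff Suc_diff_le)
    show "[count (?\<mu> - \<nu>) v] \<cdot> ?t \<nu> = p \<nu> \<otimes> partial_derivative R v q (\<mu> - \<nu>)"
      unfolding 1 partial_derivative_def using add_pow_rdistr[OF p q] by (simp del: add.nat_pow_Suc)
  qed (use t in auto)
  also have "finsum R (\<lambda>\<nu>. [count \<nu> v] \<cdot> ?t \<nu>) ?S' = finsum R (\<lambda>\<nu>. [count \<nu> v] \<cdot> ?t \<nu>) (add_mset v ` ?S)"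
  proof (rule add.finprod_mono_neutral_cong_right[OF fS(2)])
    show "add_mset v ` ?S \<subseteq> ?S'" by auto
    show "[count \<nu> v] \<cdot> ?t \<nu> = \<zero>" if \<nu>: "\<nu> \<in> ?S' - add_mset v ` ?S" for \<nu>
    proof -
      have "v \<notin># \<nu>"
      proof
        assume "v \<in># \<nu>"
        then have 1: "\<nu> = add_mset v (\<nu> - {#v#})" by simp
        then have "\<nu> - {#v#} \<subseteq># \<mu>" using \<nu> by (metis (mono_tags) DiffD1 mem_Collect_eq mset_subset_eq_add_mset_cancel)
        then show False using 1 \<nu> by blast
      qed
      then have "count \<nu> v = 0" by (simp add: not_in_iff)
      then show "[count \<nu> v] \<cdot> ?t \<nu> = \<zero>" by simp
    qed
  qed (use t in auto)
  also have "\<dots> = finsum R (\<lambda>\<nu>. [count (add_mset v \<nu>) v] \<cdot> ?t (add_mset v \<nu>)) ?S"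
    using t by (intro finsum_reindex) (auto simp: inj_on_def)
  also have "\<dots> = mpoly_mult R (partial_derivative R v p) q \<mu>"
    unfolding mpoly_mult_def partial_derivative_def
    using t p q add_pow_ldistr[OF p q] by (intro add.finprod_cong') (auto simp del: add.nat_pow_Suc)
  finally show ?thesis .
qed

text \<open>Polynomials are generated from constants by sums and by multiplication with a variable,
  so closure under the derivative follows from the product rule for a single variable.\<close>

lemma partial_derivative_pset:
  assumes "p \<in> indexed_pset I (carrier R)"
  shows "partial_derivative R v p \<in> indexed_pset I (carrier R)"
  using assms
proof (induction rule: indexed_pset.induct)
  case (indexed_const k)
  have "partial_derivative R v (indexed_const k) = indexed_const \<zero>"
    by (auto simp: partial_derivative_def indexed_const_def)
  then show ?case by (simp add: indexed_pset.indexed_const)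
next
  case (indexed_padd P Q)
  have "P \<mu> \<in> carrier R" "Q \<mu> \<in> carrier R" for \<mu>
    using indexed_padd.hyps indexed_pset_in_carrier[of "carrier R"] carrier_coeffE by blast+
  then have "partial_derivative R v (indexed_padd P Q) =
      indexed_padd (partial_derivative R v P) (partial_derivative R v Q)"
    by (simp add: partial_derivative_def indexed_padd_def add.nat_pow_distrib a_ac)
  then show ?case using indexed_padd.IH by (simp add: indexed_pset.indexed_padd)
next
  case (indexed_pmult P i)
  have P: "P \<mu> \<in> carrier R" for \<mu>
    using indexed_pmult.hyps indexed_pset_in_carrier[of "carrier R"] carrier_coeffE by blast
  have D: "indexed_pmult (partial_derivative R v P) i \<in> indexed_pset I (carrier R)"
    using indexed_pmult by (intro indexed_pset.indexed_pmult)
  show ?case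
  proof (cases "i = v")
    case False
    then have "partial_derivative R v (indexed_pmult P i) = indexed_pmult (partial_derivative R v P) i"
      by (auto simp: partial_derivative_def indexed_pmult_def fun_eq_iff add_mset_remove_trivial_If)
    then show ?thesis using D by simp
  next
    case True
    have "partial_derivative R v (indexed_pmult P i) = indexed_padd (indexed_pmult (partial_derivative R v P) i) P"
    proof
      fix \<mu>
      show "partial_derivative R v (indexed_pmult P i) \<mu> = indexed_padd (indexed_pmult (partial_derivative R v P) i) P \<mu>"
      proof (cases "v \<in># \<mu>")
        case v: True
        then obtain c where "count \<mu> v = Suc c" using not0_implies_Suc[of "count \<mu> v"] by auto
        then show ?thesis
          using v P by (simp add: partial_derivative_def indexed_pmult_def indexed_padd_def True)
      next
        case False
        then show ?thesis
          using P count_eq_zero_iff[of \<mu> v] by (simp add: partial_derivative_def indexed_pmult_def indexed_padd_def True)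
      qed
    qed
    then show ?thesis using D indexed_pmult.hyps by (simp add: indexed_pset.indexed_padd)
  qed
qed

text \<open>Serves to read the degree of a monomial off its exponents at the listed
  variables.\<close>

lemma indexed_pset_support:
  assumes "p \<in> indexed_pset I (carrier R)" "p \<mu> \<noteq> \<zero>"
  shows "set_mset \<mu> \<subseteq> I"
  using assms
proof (induction arbitrary: \<mu> rule: indexed_pset.induct)
  case (indexed_const k)
  then show ?case by (auto simp: indexed_const_def split: if_splits)
next
  case (indexed_padd P Q)
  then have "P \<mu> \<noteq> \<zero> \<or> Q \<mu> \<noteq> \<zero>" by (auto simp: indexed_padd_def)
  then show ?case using indexed_padd.IH by blast
next
  case (indexed_pmult P i)
  then have "i \<in># \<mu>" "P (\<mu> - {#i#}) \<noteq> \<zero>" by (auto simp: indexed_pmult_def split: if_splits)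
  then have "set_mset (\<mu> - {#i#}) \<subseteq> I" "\<mu> = add_mset i (\<mu> - {#i#})" using indexed_pmult.IH by auto
  then show ?case using indexed_pmult.hyps by (metis insert_subset set_mset_add_mset_insert)
qed

end

section \<open>The bigraded polynomial ring\<close>

lemma bideg_add: "bideg (\<mu> + \<nu>) = bideg \<mu> + bideg \<nu>"
  by (simp add: bideg_def)

lemma bideg_add_mset: "bideg (add_mset v \<mu>) = bideg {#v#} + bideg \<mu>"
  using bideg_add[of "{#v#}" \<mu>] by simp

lemma bipoly_ring_simps [simp]:
  "carrier (bipoly_ring C n m) = mpoly_carrier C n m"
  "p \<otimes>\<^bsub>bipoly_ring C n m\<^esub> q = mpoly_mult C p q"
  "p \<odot>\<^bsub>bipoly_ring C n m\<^esub> q = mpoly_mult C p q"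
  "p \<oplus>\<^bsub>bipoly_ring C n m\<^esub> q = ring.indexed_padd C p q"
  "\<one>\<^bsub>bipoly_ring C n m\<^esub> = ring.indexed_const C \<one>\<^bsub>C\<^esub>"
  "\<zero>\<^bsub>bipoly_ring C n m\<^esub> = ring.indexed_const C \<zero>\<^bsub>C\<^esub>"
  "homog (bipoly_ring C n m) e = {p \<in> mpoly_carrier C n m. \<forall>\<mu>. p \<mu> \<noteq> \<zero>\<^bsub>C\<^esub> \<longrightarrow> bideg \<mu> = e}"
  by (simp_all add: bipoly_ring_def)

abbreviation variables :: "nat \<Rightarrow> nat \<Rightarrow> (nat + nat) set" where
  "variables n m \<equiv> Inl ` {1..n} \<union> Inr ` {1..m}"

context cring
begin

lemma mpoly_carrier_coeff: "p \<in> mpoly_carrier R n m \<Longrightarrow> p \<mu> \<in> carrier R"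
  unfolding mpoly_carrier_def using indexed_pset_in_carrier[of "carrier R"] carrier_coeffE by blast

lemma mpoly_carrier_support: "p \<in> mpoly_carrier R n m \<Longrightarrow> p \<mu> \<noteq> \<zero> \<Longrightarrow> set_mset \<mu> \<subseteq> variables n m"
  unfolding mpoly_carrier_def by (rule indexed_pset_support)

lemma indexed_const_homog: "c \<in> carrier R \<Longrightarrow> indexed_const c \<in> homog (bipoly_ring R n m) 0"
  by (auto simp: mpoly_carrier_def indexed_pset.indexed_const)
    (auto simp: indexed_const_def bideg_def zero_prod_def split: if_splits)

lemma indexed_var_eq: "indexed_var v \<mu> = (if \<mu> = {#v#} then \<one> else \<zero>)"
  by (auto simp: indexed_var_def indexed_pmult_def indexed_const_def diff_single_eq_union)

lemma indexed_var_homog: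
  assumes "v \<in> variables n m"
  shows "indexed_var v \<in> homog (bipoly_ring R n m) (bideg {#v#})"
proof -
  have "indexed_var v \<in> mpoly_carrier R n m"
    unfolding mpoly_carrier_def indexed_var_def
    using assms by (intro indexed_pset.indexed_pmult indexed_pset.indexed_const) simp_all
  then show ?thesis by (simp add: indexed_var_eq)
qed

lemma partial_derivative_derivation:
  assumes "bideg {#v#} = - s"
  shows "graded_derivation (bipoly_ring R n m) s (partial_derivative R v)"
  unfolding graded_derivation_def
proof (intro conjI ballI allI)
  fix p assume p: "p \<in> carrier (bipoly_ring R n m)"
  then show "partial_derivative R v p \<in> carrier (bipoly_ring R n m)"
    by (simp add: mpoly_carrier_def partial_derivative_pset)
  note pc = mpoly_carrier_coeff[of p n m]
  fix q assume q: "q \<in> carrier (bipoly_ring R n m)"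
  note qc = mpoly_carrier_coeff[of q n m]
  show "partial_derivative R v (p \<oplus>\<^bsub>bipoly_ring R n m\<^esub> q) =
      partial_derivative R v p \<oplus>\<^bsub>bipoly_ring R n m\<^esub> partial_derivative R v q"
    using p q pc qc by (simp add: partial_derivative_def indexed_padd_def add.nat_pow_distrib a_ac)
  show "partial_derivative R v (p \<otimes>\<^bsub>bipoly_ring R n m\<^esub> q) =
      p \<otimes>\<^bsub>bipoly_ring R n m\<^esub> partial_derivative R v q \<oplus>\<^bsub>bipoly_ring R n m\<^esub>
      partial_derivative R v p \<otimes>\<^bsub>bipoly_ring R n m\<^esub> q"
    using p q pc qc partial_derivative_mult[of p q v] by (simp add: indexed_padd_def fun_eq_iff)
next
  fix e p assume p: "p \<in> homog (bipoly_ring R n m) e"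
  have "bideg \<mu> = e + s" if "partial_derivative R v p \<mu> \<noteq> \<zero>" for \<mu>
  proof -
    have "p (add_mset v \<mu>) \<noteq> \<zero>"
    proof
      assume "p (add_mset v \<mu>) = \<zero>"
      then have "partial_derivative R v p \<mu> = \<zero>" unfolding partial_derivative_def by (simp only: add.nat_pow_one)
      then show False using that by simp
    qed
    then have "bideg (add_mset v \<mu>) = e" using p by simp
    then show ?thesis using bideg_add_mset[of v \<mu>] assms by (simp add: algebra_simps)
  qed
  then show "partial_derivative R v p \<in> homog (bipoly_ring R n m) (e + s)"
    using p by (simp add: mpoly_carrier_def partial_derivative_pset)
qed

lemma partial_derivative_const: "partial_derivative R v (indexed_const c) = indexed_const \<zero>"
  by (auto simp: partial_derivative_def indexed_const_def)

lemma partial_derivative_var: "partial_derivative R v (indexed_var v) = indexed_const \<one>"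
proof
  fix \<mu>
  show "partial_derivative R v (indexed_var v) \<mu> = indexed_const \<one> \<mu>"
    by (cases "\<mu> = {#}") (simp_all add: partial_derivative_def indexed_var_eq indexed_const_def)
qed

text \<open>The derivative by \<open>v\<close> followed by multiplication with \<open>v\<close>
  multiplies the coefficient of \<open>\<mu>\<close> by the exponent of \<open>v\<close> in
  \<open>\<mu>\<close>. The condition on \<open>k\<close> is asked only where \<open>p \<mu>\<close>
  is nonzero, since the degree of a homogeneous \<open>p\<close> is the degree of those monomials
  only.\<close>

lemma euler_identity:
  assumes "finite J" "p \<in> mpoly_carrier R n m" "p \<mu> \<noteq> \<zero> \<Longrightarrow> k = (\<Sum>v\<in>J. int (count \<mu> v))"
  shows "finsum R (\<lambda>v. mpoly_mult R (indexed_var v) (partial_derivative R v p) \<mu>) J = [(k::int)] \<cdot> p \<mu>"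
proof -
  note pc = mpoly_carrier_coeff[OF assms(2)]
  have 1: "mpoly_mult R (indexed_var v) (partial_derivative R v p) \<mu> = [int (count \<mu> v)] \<cdot> p \<mu>" for v
  proof -
    have "partial_derivative R v p \<mu>' \<in> carrier R" for \<mu>'
      unfolding partial_derivative_def by (rule add.nat_pow_closed[OF pc])
    note eq = mpoly_mult_var[of "partial_derivative R v p", OF this, of v \<mu>]
    show ?thesis
    proof (cases "v \<in># \<mu>")
      case True
      then obtain c where c: "count \<mu> v = Suc c" using not0_implies_Suc[of "count \<mu> v"] by auto
      then have "[int (count \<mu> v)] \<cdot> p \<mu> = [Suc c] \<cdot> p \<mu>" by (simp only: add_pow_int_ge nat_int of_nat_0_le_iff)
      then show ?thesis using eq True c by (simp add: partial_derivative_def)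
    next
      case False
      then have "count \<mu> v = 0" by (simp add: not_in_iff)
      then show ?thesis using eq False by (simp add: add_pow_int_ge)
    qed
  qed
  have 2: "finsum R (\<lambda>v. [int (count \<mu> v)] \<cdot> p \<mu>) A = [(\<Sum>v\<in>A. int (count \<mu> v))] \<cdot> p \<mu>" if "finite A" for A
    using that
  proof (induction A rule: finite_induct)
    case empty
    then show ?case by (simp add: add_pow_int_ge)
  next
    case (insert a A)
    then show ?case using pc add.int_pow_mult[of "p \<mu>"] by (simp add: add.int_pow_closed)
  qed
  show ?thesis
  proof (cases "p \<mu> = \<zero>")
    case True
    then show ?thesis unfolding 1 by (simp add: add.int_pow_one)
  next
    case False
    then show ?thesis unfolding 1 using 2[OF assms(1)] assms(3) by simp
  qed
qed

text \<open>Stated for a set \<open>J\<close> of variables of one degree \<open>- s\<close> and a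
  weight \<open>wt\<close> that counts them, so that it serves both groups of variables. The
  function type of the polynomials is infinite because it contains the constant functions.\<close>

lemma bipoly_ring_euler:
  fixes J :: "(nat + nat) set" and wt :: "int \<times> int \<Rightarrow> int"
  assumes R: "bigraded_module (bipoly_ring R n m) (bipoly_ring R n m)" and inf: "infinite (UNIV :: 'a set)"
    and J: "J \<subseteq> variables n m" and s: "\<And>v. v \<in> J \<Longrightarrow> bideg {#v#} = - s"
    and wt: "\<And>e e'. wt (e + e') = wt e + wt e'"
      "\<And>\<mu>. set_mset \<mu> \<subseteq> variables n m \<Longrightarrow> wt (bideg \<mu>) = (\<Sum>v\<in>J. int (count \<mu> v))"
  shows "euler_ring (bipoly_ring R n m) J indexed_var (partial_derivative R) s
    (\<lambda>e. indexed_const ([wt e] \<cdot> \<one>))"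
proof
  let ?R = "bipoly_ring R n m"
  interpret P: module ?R ?R by (rule bigraded_moduleD[OF R])
  show "bigraded_module ?R ?R" by fact
  have "inj (\<lambda>c :: 'a. \<lambda>_ :: (nat + nat) multiset. c)" by (auto simp: inj_def fun_eq_iff)
  then show "infinite (UNIV :: ((nat + nat) multiset \<Rightarrow> 'a) set)"
    using inf by (metis finite_imageD finite_subset subset_UNIV)
  show fJ: "finite J" using J by (rule finite_subset) simp
  show "indexed_var v \<in> homog ?R (- s)" if "v \<in> J" for v
    using indexed_var_homog[of v n m] s[OF that] J that by (metis subsetD)
  show "graded_derivation ?R s (partial_derivative R v)" if "v \<in> J" for v
    by (rule partial_derivative_derivation[OF s[OF that]])
  show "indexed_const ([wt e] \<cdot> \<one>) \<in> homog ?R 0" for e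
    by (rule indexed_const_homog) simp
  show "indexed_const ([wt (e + e')] \<cdot> \<one>) = indexed_const ([wt e] \<cdot> \<one>) \<oplus>\<^bsub>?R\<^esub> indexed_const ([wt e'] \<cdot> \<one>)" for e e'
    using wt(1) add.int_pow_mult[of \<one> "wt e" "wt e'"] by (simp add: indexed_padd_const)
  fix e p assume p: "p \<in> homog ?R e"
  then have pc: "p \<in> mpoly_carrier R n m" by simp
  show "finsum ?R (\<lambda>v. indexed_var v \<otimes>\<^bsub>?R\<^esub> partial_derivative R v p) J = indexed_const ([wt e] \<cdot> \<one>) \<otimes>\<^bsub>?R\<^esub> p"
  proof
    fix \<mu>
    have t: "indexed_var v \<otimes>\<^bsub>?R\<^esub> partial_derivative R v p \<in> carrier ?R" if "v \<in> J" for v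
    proof (rule P.R.m_closed)
      show "indexed_var v \<in> carrier ?R" using indexed_var_homog[of v n m] J that by auto
      show "partial_derivative R v p \<in> carrier ?R" using pc by (simp add: mpoly_carrier_def partial_derivative_pset)
    qed
    have "finsum ?R (\<lambda>v. indexed_var v \<otimes>\<^bsub>?R\<^esub> partial_derivative R v p) J \<mu> =
        finsum R (\<lambda>v. (indexed_var v \<otimes>\<^bsub>?R\<^esub> partial_derivative R v p) \<mu>) J"
      using t by (intro additive_finsum[OF P.R.abelian_group_axioms abelian_group_axioms _ _ fJ, where f = "\<lambda>p. p \<mu>"])
        (simp_all add: mpoly_carrier_coeff indexed_padd_def Pi_iff)
    also have "\<dots> = [wt e] \<cdot> p \<mu>"
    proof -
      have "wt e = (\<Sum>v\<in>J. int (count \<mu> v))" if "p \<mu> \<noteq> \<zero>"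
        using wt(2)[OF mpoly_carrier_support[OF pc that]] p that by simp
      then show ?thesis using euler_identity[OF fJ pc, of \<mu> "wt e"] by simp
    qed
    also have "\<dots> = (indexed_const ([wt e] \<cdot> \<one>) \<otimes>\<^bsub>?R\<^esub> p) \<mu>"
      using mpoly_carrier_coeff[OF pc] by (simp add: mpoly_mult_const add_pow_ldistr_int)
    finally show "finsum ?R (\<lambda>v. indexed_var v \<otimes>\<^bsub>?R\<^esub> partial_derivative R v p) J \<mu> =
        (indexed_const ([wt e] \<cdot> \<one>) \<otimes>\<^bsub>?R\<^esub> p) \<mu>" .
  qed
qed simp

end

section \<open>Homogeneous components of Euler modules\<close>

text \<open>Up to the unit \<open>c\<close>, this says that \<open>N\<close> is a direct summand of
  the power of \<open>A\<close> over \<open>J\<close>. The unit is kept because the Euler identities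
  produce a nonzero integer in place of \<open>1\<close>.\<close>

definition factors_through :: "('c, 'x) ring_scheme \<Rightarrow> ('c, 'a) module \<Rightarrow> ('c, 'a) module \<Rightarrow> 'i set \<Rightarrow> bool" where
  "factors_through C N A J \<longleftrightarrow> module C N \<and> module C A \<and> finite J \<and>
     (\<exists>f g c c'. (\<forall>i\<in>J. f i \<in> module_hom C N A \<and> g i \<in> module_hom C A N) \<and>
        c \<in> carrier C \<and> c' \<in> carrier C \<and> c' \<otimes>\<^bsub>C\<^esub> c = \<one>\<^bsub>C\<^esub> \<and>
        (\<forall>x\<in>carrier N. finsum N (\<lambda>i. g i (f i x)) J = c \<odot>\<^bsub>N\<^esub> x))"

lemma factors_throughI:
  assumes "module C N" "module C A" "finite J" "\<And>i. i \<in> J \<Longrightarrow> f i \<in> module_hom C N A"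
    "\<And>i. i \<in> J \<Longrightarrow> g i \<in> module_hom C A N" "c \<in> carrier C" "c' \<in> carrier C" "c' \<otimes>\<^bsub>C\<^esub> c = \<one>\<^bsub>C\<^esub>"
    "\<And>x. x \<in> carrier N \<Longrightarrow> finsum N (\<lambda>i. g i (f i x)) J = c \<odot>\<^bsub>N\<^esub> x"
  shows "factors_through C N A J"
  using assms unfolding factors_through_def by blast

lemma module_dim_mono:
  "module_supp C N \<subseteq> module_supp C A \<Longrightarrow> module_dim C N \<le> module_dim C A"
  unfolding module_dim_def dim_primes_def by (rule SUP_subset_mono) blast+

text \<open>For the supports, let \<open>p\<close> lie outside the support of \<open>A\<close>. Then
  each \<open>f i x\<close> is killed by an element outside \<open>p\<close>. The product of these
  finitely many elements is again outside \<open>p\<close> and kills all \<open>f i x\<close>, hence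
  \<open>c x\<close> and hence \<open>x\<close>.\<close>

lemma factors_through_le:
  assumes "factors_through C N A J"
  shows "injdim C N \<le> injdim C A" "module_dim C N \<le> module_dim C A"
proof -
  obtain f g c c' where N: "module C N" and A: "module C A" and J: "finite J"
    and f: "\<And>i. i \<in> J \<Longrightarrow> f i \<in> module_hom C N A" and g: "\<And>i. i \<in> J \<Longrightarrow> g i \<in> module_hom C A N"
    and c: "c \<in> carrier C" "c' \<in> carrier C" "c' \<otimes>\<^bsub>C\<^esub> c = \<one>\<^bsub>C\<^esub>"
    and sum: "\<And>x. x \<in> carrier N \<Longrightarrow> finsum N (\<lambda>i. g i (f i x)) J = c \<odot>\<^bsub>N\<^esub> x"
    using assms unfolding factors_through_def by blast
  show "injdim C N \<le> injdim C A" by (rule injdim_le_of_factorization[OF A N J f g c sum])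
  interpret N: module C N by (rule N)
  interpret A: module C A by (rule A)
  have "p \<in> module_supp C A" if p: "p \<in> elt_supp C N x" and x: "x \<in> carrier N" for p x
  proof (rule ccontr)
    assume np: "p \<notin> module_supp C A"
    have pp: "primeideal p C" using p by (simp add: elt_supp_def Spec_def)
    have one: "\<one>\<^bsub>C\<^esub> \<in> carrier C - p"
      using primeideal.I_notcarr[OF pp] ideal.one_imp_carrier[OF primeideal.axioms(1)[OF pp]] by auto
    have "\<exists>t\<in>carrier C - p. \<forall>i\<in>I. t \<odot>\<^bsub>A\<^esub> f i x = \<zero>\<^bsub>A\<^esub>" if "finite I" "I \<subseteq> J" for I
      using that
    proof (induction I rule: finite_induct)
      case empty
      then show ?case using one by blast
    next
      case (insert i I)
      then obtain t where t: "t \<in> carrier C - p" "\<forall>i\<in>I. t \<odot>\<^bsub>A\<^esub> f i x = \<zero>\<^bsub>A\<^esub>" by auto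
      have i: "i \<in> J" using insert.prems by blast
      have fx: "f j x \<in> carrier A" if "j \<in> J" for j using module_hom_closed[OF f[OF that] x] .
      have "p \<notin> elt_supp C A (f i x)" using np fx[OF i] by (auto simp: module_supp_def)
      then obtain u where u: "u \<in> carrier C - p" "u \<odot>\<^bsub>A\<^esub> f i x = \<zero>\<^bsub>A\<^esub>"
        using pp by (auto simp: elt_supp_def Spec_def)
      have "(t \<otimes>\<^bsub>C\<^esub> u) \<odot>\<^bsub>A\<^esub> f j x = \<zero>\<^bsub>A\<^esub>" if j: "j \<in> insert i I" for j
      proof (cases "j = i")
        case True
        then show ?thesis using t(1) u fx[OF i] by (simp add: A.smult_assoc1)
      next
        case False
        then have "(u \<otimes>\<^bsub>C\<^esub> t) \<odot>\<^bsub>A\<^esub> f j x = \<zero>\<^bsub>A\<^esub>"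
          using t u(1) fx[of j] j insert.prems by (simp add: A.smult_assoc1 subset_eq)
        then show ?thesis using t(1) u(1) N.R.m_comm[of t u] by simp
      qed
      then show ?case using primeideal_mult_closed[OF pp t(1) u(1) N.R.is_cring] by blast
    qed
    from this[OF J order_refl] obtain t where t: "t \<in> carrier C - p" "\<forall>i\<in>J. t \<odot>\<^bsub>A\<^esub> f i x = \<zero>\<^bsub>A\<^esub>" by blast
    have gf: "g i (f i x) \<in> carrier N" if "i \<in> J" for i
      using module_hom_closed[OF g[OF that] module_hom_closed[OF f[OF that] x]] .
    have "t \<odot>\<^bsub>N\<^esub> (c \<odot>\<^bsub>N\<^esub> x) = finsum N (\<lambda>i. t \<odot>\<^bsub>N\<^esub> g i (f i x)) J"
      unfolding sum[OF x, symmetric] using t(1) gf by (intro N.finsum_smult_ldistr J) auto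
    also have "\<dots> = finsum N (\<lambda>i. \<zero>\<^bsub>N\<^esub>) J"
    proof (rule N.M.finsum_cong')
      fix i assume i: "i \<in> J"
      have "t \<odot>\<^bsub>N\<^esub> g i (f i x) = g i (t \<odot>\<^bsub>A\<^esub> f i x)"
        using module_hom_smult[OF g[OF i], of t "f i x"] module_hom_closed[OF f[OF i] x] t(1) by simp
      then show "t \<odot>\<^bsub>N\<^esub> g i (f i x) = \<zero>\<^bsub>N\<^esub>" using t(2) i module_hom_zero[OF A N g[OF i]] by simp
    qed auto
    finally have "t \<odot>\<^bsub>N\<^esub> (c \<odot>\<^bsub>N\<^esub> x) = \<zero>\<^bsub>N\<^esub>" by simp
    then have "c' \<odot>\<^bsub>N\<^esub> (t \<odot>\<^bsub>N\<^esub> (c \<odot>\<^bsub>N\<^esub> x)) = \<zero>\<^bsub>N\<^esub>" using c(2) by simp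
    moreover have "c' \<odot>\<^bsub>N\<^esub> (t \<odot>\<^bsub>N\<^esub> (c \<odot>\<^bsub>N\<^esub> x)) = t \<odot>\<^bsub>N\<^esub> ((c' \<otimes>\<^bsub>C\<^esub> c) \<odot>\<^bsub>N\<^esub> x)"
      using t(1) c(1,2) x by (simp add: N.smult_assoc1[symmetric] N.R.m_ac)
    ultimately have "t \<odot>\<^bsub>N\<^esub> x = \<zero>\<^bsub>N\<^esub>" using c(3) x by simp
    then show False using p t(1) by (simp add: elt_supp_def)
  qed
  then have "module_supp C N \<subseteq> module_supp C A" unfolding module_supp_def[of C N] by blast
  then show "module_dim C N \<le> module_dim C A" by (rule module_dim_mono)
qed

text \<open>The positive multiples of \<open>1\<close> lie in the subfield and are nonzero, hence
  invertible there; a negative integer is handled by a change of sign.\<close>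

lemma (in cring) int_unit:
  assumes "contains_field_char_0 R" "(k::int) \<noteq> 0"
  shows "\<exists>c\<in>carrier R. c \<otimes> [k] \<cdot> \<one> = \<one>"
proof -
  obtain K where K: "subfield K R" and nz: "\<And>k::nat. k > 0 \<Longrightarrow> [k] \<cdot> \<one> \<noteq> \<zero>"
    using assms(1) unfolding contains_field_char_0_def by blast
  note sK = subringE[OF subfieldE(1)[OF K]]
  have inK: "[k] \<cdot> \<one> \<in> K" for k :: nat
    by (induction k) (use sK in simp_all)
  have nat: "\<exists>c\<in>carrier R. c \<otimes> [k] \<cdot> \<one> = \<one>" if k: "k > 0" for k :: nat
  proof -
    have "[k] \<cdot> \<one> \<in> K - {\<zero>}" using inK nz[OF k] by blast
    then have "[k] \<cdot> \<one> \<in> Units (R\<lparr>carrier := K\<rparr>)" using subfield.subfield_Units[OF K] by simp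
    then show ?thesis using sK(1) unfolding Units_def by auto
  qed
  show ?thesis
  proof (cases "k > 0")
    case True
    then show ?thesis using nat[of "nat k"] add_pow_int_ge[of k R \<one>] by simp
  next
    case False
    then have "k < 0" using assms(2) by simp
    then obtain c where "c \<in> carrier R" "c \<otimes> [nat (- k)] \<cdot> \<one> = \<one>" using nat[of "nat (- k)"] by auto
    then show ?thesis using add_pow_int_lt[OF \<open>k < 0\<close>, of R \<one>]
      by (intro bexI[of _ "\<ominus> c"]) (simp_all add: l_minus r_minus)
  qed
qed

lemma (in euler_ring) euler_module_ring: "euler_module R \<delta>"
proof -
  interpret R: module R R by (rule bigraded_moduleD[OF R])
  have "leibniz_map R s (\<delta> i) (\<lambda>x. x) R R (\<delta> i)" if "i \<in> J" for i
    using graded_derivationD[OF \<delta>[OF that]] by (intro leibniz_mapI) (simp_all add: smult_R)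
  then show ?thesis
    using R euler_R by (simp add: euler_module_def connection_def euler_op_def smult_R)
qed

lemma (in euler_ring) euler_module_of_lyubeznik_value:
  fixes M :: "('r, 'u) bigraded"
  assumes "\<forall>t\<in>set T. valid_step R t" "lyubeznik_value R T R M"
  shows "\<exists>D. euler_module M D"
  using assms
proof (induction T arbitrary: M)
  case Nil
  then show ?case using euler_module_iso[OF euler_module_ring] by simp
next
  case (Cons t T)
  then obtain M' :: "('r, 'u) bigraded" where "lyubeznik_value R T R M'" "step_value R t M' M" by auto
  then show ?case using Cons euler_module_of_step_value by (metis list.set_intros)
qed

text \<open>The recursion ends in an isomorphism of bigraded modules out of \<open>R\<close>, and
  \<open>bigraded_iso\<close> includes that \<open>R\<close> is bigraded over itself. This is the
  source of the ring and grading axioms for the polynomial ring.\<close>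

lemma lyubeznik_value_bigraded:
  fixes M :: "('r, 'u) bigraded"
  shows "lyubeznik_value R T R M \<Longrightarrow> bigraded_module R R"
proof (induction T arbitrary: M)
  case Nil
  then show ?case by (simp add: bigraded_iso_def)
qed auto

section \<open>Graded components as modules over the base ring\<close>

lemma component_simps [simp]:
  "carrier (component C M e) = homog M e" "\<zero>\<^bsub>component C M e\<^esub> = \<zero>\<^bsub>M\<^esub>"
  "x \<oplus>\<^bsub>component C M e\<^esub> y = x \<oplus>\<^bsub>M\<^esub> y"
  "c \<odot>\<^bsub>component C M e\<^esub> x = ring.indexed_const C c \<odot>\<^bsub>M\<^esub> x"
  by (simp_all add: component_def)

context cring
begin

lemma indexed_const_carrier: "c \<in> carrier R \<Longrightarrow> indexed_const c \<in> carrier (bipoly_ring R n m)"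
  using indexed_const_homog[of c n m] by simp

context
  fixes n m and M :: "((nat + nat) multiset \<Rightarrow> 'a, 'u) bigraded"
  assumes M: "bigraded_module (bipoly_ring R n m) M"
begin

interpretation M: module "bipoly_ring R n m" M by (rule bigraded_moduleD[OF M])

lemma component_module: "module R (component R M e)"
proof (rule moduleI)
  let ?R = "bipoly_ring R n m"
  have hM: "x \<in> carrier M" if "x \<in> homog M e" for x using bigraded_moduleD(5)[OF M that] .
  note h = bigraded_moduleD(4,6)[OF M, where e = e]
  show "cring R" by (rule is_cring)
  show "abelian_group (component R M e)"
  proof (rule abelian_groupI)
    fix x assume x: "x \<in> carrier (component R M e)"
    then have "\<zero>\<^bsub>M\<^esub> \<ominus>\<^bsub>M\<^esub> x \<in> homog M e" using bigraded_moduleD(7)[OF M h(1)] by simp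
    moreover have "(\<zero>\<^bsub>M\<^esub> \<ominus>\<^bsub>M\<^esub> x) \<oplus>\<^bsub>M\<^esub> x = \<zero>\<^bsub>M\<^esub>" using M.M.diff_add_cancel hM x by simp
    ultimately show "\<exists>y\<in>carrier (component R M e). y \<oplus>\<^bsub>component R M e\<^esub> x = \<zero>\<^bsub>component R M e\<^esub>" by auto
  qed (use hM h M.M.a_ac in auto)
  show "\<one> \<odot>\<^bsub>component R M e\<^esub> x = x" if "x \<in> carrier (component R M e)" for x
    using M.smult_one[of x] hM that by simp
  fix a x assume a: "a \<in> carrier R" and x: "x \<in> carrier (component R M e)"
  then have xM: "x \<in> carrier M" using hM by simp
  note ac = indexed_const_carrier[OF a]
  show "a \<odot>\<^bsub>component R M e\<^esub> x \<in> carrier (component R M e)"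
    using bigraded_moduleD(8)[OF M indexed_const_homog[OF a], of x e] x by simp
  { fix y assume "y \<in> carrier (component R M e)"
    then show "a \<odot>\<^bsub>component R M e\<^esub> (x \<oplus>\<^bsub>component R M e\<^esub> y) =
        a \<odot>\<^bsub>component R M e\<^esub> x \<oplus>\<^bsub>component R M e\<^esub> a \<odot>\<^bsub>component R M e\<^esub> y"
      using M.smult_r_distr[OF ac xM] hM by simp }
  { fix b assume b: "b \<in> carrier R"
    note bc = indexed_const_carrier[OF b]
    show "(a \<oplus> b) \<odot>\<^bsub>component R M e\<^esub> x = a \<odot>\<^bsub>component R M e\<^esub> x \<oplus>\<^bsub>component R M e\<^esub> b \<odot>\<^bsub>component R M e\<^esub> x"
      using M.smult_l_distr[OF ac bc xM] by (simp add: indexed_padd_const)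
    have "mpoly_mult R (indexed_const a) (indexed_const b) = (indexed_const (a \<otimes> b) :: (nat + nat) multiset \<Rightarrow> 'a)"
    proof
      fix \<mu> :: "(nat + nat) multiset"
      have "indexed_const b \<mu>' \<in> carrier R" for \<mu>' :: "(nat + nat) multiset" using b by (simp add: indexed_const_def)
      then show "mpoly_mult R (indexed_const a) (indexed_const b) \<mu> = indexed_const (a \<otimes> b) \<mu>"
        using mpoly_mult_const[OF a, of "indexed_const b" \<mu>] a by (simp add: indexed_const_def)
    qed
    then show "(a \<otimes> b) \<odot>\<^bsub>component R M e\<^esub> x = a \<odot>\<^bsub>component R M e\<^esub> (b \<odot>\<^bsub>component R M e\<^esub> x)"
      using M.smult_assoc1[OF ac bc xM] by simp }
qed

lemma smult_component_hom:
  assumes r: "r \<in> homog (bipoly_ring R n m) f" and e': "e' = f + e"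
  shows "(\<lambda>x. r \<odot>\<^bsub>M\<^esub> x) \<in> module_hom R (component R M e) (component R M e')"
proof (rule module_homI)
  let ?R = "bipoly_ring R n m"
  have rc: "r \<in> carrier ?R" using r by simp
  fix x assume x: "x \<in> carrier (component R M e)"
  then have xM: "x \<in> carrier M" using bigraded_moduleD(5)[OF M] by simp
  show "r \<odot>\<^bsub>M\<^esub> x \<in> carrier (component R M e')" using bigraded_moduleD(8)[OF M r] x e' by simp
  { fix y assume "y \<in> carrier (component R M e)"
    then show "r \<odot>\<^bsub>M\<^esub> (x \<oplus>\<^bsub>component R M e\<^esub> y) = r \<odot>\<^bsub>M\<^esub> x \<oplus>\<^bsub>component R M e'\<^esub> r \<odot>\<^bsub>M\<^esub> y"
      using M.smult_r_distr[OF rc xM] bigraded_moduleD(5)[OF M] by simp }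
  { fix a assume "a \<in> carrier R"
    note ac = indexed_const_carrier[OF this]
    show "r \<odot>\<^bsub>M\<^esub> (a \<odot>\<^bsub>component R M e\<^esub> x) = a \<odot>\<^bsub>component R M e'\<^esub> (r \<odot>\<^bsub>M\<^esub> x)"
      using M.smult_assoc1[OF rc ac xM] M.smult_assoc1[OF ac rc xM] M.R.m_comm[OF rc ac] by simp }
qed

text \<open>Partial derivatives kill constants, so the Leibniz term vanishes for scalars from the
  base ring.\<close>

lemma leibniz_component_hom:
  assumes D: "leibniz_map (bipoly_ring R n m) s (partial_derivative R v) (\<lambda>x. x) M M D" and e': "e' = e + s"
  shows "D \<in> module_hom R (component R M e) (component R M e')"
proof (rule module_homI)
  let ?R = "bipoly_ring R n m"
  fix x assume x: "x \<in> carrier (component R M e)"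
  then have xM: "x \<in> carrier M" using bigraded_moduleD(5)[OF M] by simp
  show "D x \<in> carrier (component R M e')" using leibniz_mapD(4)[OF D] x e' by simp
  { fix y assume "y \<in> carrier (component R M e)"
    then show "D (x \<oplus>\<^bsub>component R M e\<^esub> y) = D x \<oplus>\<^bsub>component R M e'\<^esub> D y"
      using leibniz_mapD(2)[OF D xM] bigraded_moduleD(5)[OF M] by simp }
  { fix a assume "a \<in> carrier R"
    note ac = indexed_const_carrier[OF this]
    have "\<zero>\<^bsub>?R\<^esub> \<odot>\<^bsub>M\<^esub> x = \<zero>\<^bsub>M\<^esub>" by (rule M.smult_l_null[OF xM])
    then show "D (a \<odot>\<^bsub>component R M e\<^esub> x) = a \<odot>\<^bsub>component R M e'\<^esub> D x"
      using leibniz_mapD(3)[OF D ac xM] M.smult_closed[OF ac leibniz_mapD(1)[OF D xM]]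
      by (simp add: partial_derivative_const) }
qed

lemma finsum_component:
  assumes "finite J" "\<And>i. i \<in> J \<Longrightarrow> f i \<in> homog M e"
  shows "finsum (component R M e) f J = finsum M f J"
  using assms bigraded_moduleD(5)[OF M]
    additive_finsum[OF module_abelian_group[OF component_module[of e]] M.M.abelian_group_axioms, of "\<lambda>x. x" J f]
  by (simp add: Pi_iff)

end

text \<open>\<open>s\<close> is opposite to the degree of the variables, so \<open>e + s\<close> is
  one step down and \<open>e - s\<close> one step up. Going down and back is
  \<open>\<Sum> X\<^sub>v D\<^sub>v = wt e\<close>; going up and back is
  \<open>\<Sum> D\<^sub>v X\<^sub>v\<close>, where each variable contributes one more copy of the
  identity.\<close>

lemma component_factors_through:
  fixes M :: "((nat + nat) multiset \<Rightarrow> 'a, 'u) bigraded"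
  assumes E: "euler_ring (bipoly_ring R n m) J indexed_var (partial_derivative R) s
      (\<lambda>e. indexed_const ([wt e] \<cdot> \<one>))" and J: "J \<subseteq> variables n m"
    and char: "contains_field_char_0 R"
    and M: "euler_ring.euler_module (bipoly_ring R n m) J indexed_var (partial_derivative R) s
      (\<lambda>e. indexed_const ([wt e] \<cdot> \<one>)) M D"
  shows "wt e \<noteq> 0 \<Longrightarrow> factors_through R (component R M e) (component R M (e + s)) J"
    "wt e + int (card J) \<noteq> 0 \<Longrightarrow> factors_through R (component R M e) (component R M (e - s)) J"
proof -
  let ?R = "bipoly_ring R n m"
  interpret E: euler_ring ?R J indexed_var "partial_derivative R" s "\<lambda>e. indexed_const ([wt e] \<cdot> \<one>)" by (rule E)
  have bM: "bigraded_module ?R M" and D: "E.connection M D"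
    and euler: "\<And>x. x \<in> homog M e \<Longrightarrow> E.euler_op M D x = indexed_const ([wt e] \<cdot> \<one>) \<odot>\<^bsub>M\<^esub> x"
    using M unfolding E.euler_module_def by blast+
  interpret M: module ?R M by (rule bigraded_moduleD[OF bM])
  have v: "indexed_var v \<in> homog ?R (- s)" "indexed_var v \<in> carrier ?R" if "v \<in> J" for v
    using E.\<xi>[OF that] E.\<xi>_carrier[OF that] by blast+
  have hM: "x \<in> carrier M" if "x \<in> homog M e" for x e using bigraded_moduleD(5)[OF bM that] .
  have Dh: "D v x \<in> homog M (e + s)" if "v \<in> J" "x \<in> homog M e" for v x e
    using leibniz_mapD(4)[OF E.connectionD[OF D that(1)] that(2)] .
  have vh: "indexed_var v \<odot>\<^bsub>M\<^esub> x \<in> homog M (- s + e)" if "v \<in> J" "x \<in> homog M e" for v x e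
    using bigraded_moduleD(8)[OF bM v(1)[OF that(1)] that(2)] .
  have es: "e = - s + (e + s)" "e - s = - s + e" "e = (e - s) + s" by (simp_all add: algebra_simps)
  { assume "wt e \<noteq> 0"
    then obtain c where c: "c \<in> carrier R" "c \<otimes> [wt e] \<cdot> \<one> = \<one>" using int_unit[OF char] by blast
    show "factors_through R (component R M e) (component R M (e + s)) J"
    proof (rule factors_throughI[where f = D and g = "\<lambda>v x. indexed_var v \<odot>\<^bsub>M\<^esub> x",
          OF component_module[OF bM] component_module[OF bM] E.finite_J _ _ _ c])
      show "D v \<in> module_hom R (component R M e) (component R M (e + s))" if "v \<in> J" for v
        using leibniz_component_hom[OF bM E.connectionD[OF D that]] by simp
      show "(\<odot>\<^bsub>M\<^esub>) (indexed_var v) \<in> module_hom R (component R M (e + s)) (component R M e)" if "v \<in> J" for v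
        using smult_component_hom[OF bM v(1)[OF that] es(1)] by simp
      fix x assume "x \<in> carrier (component R M e)"
      then have x: "x \<in> homog M e" by simp
      have "indexed_var v \<odot>\<^bsub>M\<^esub> D v x \<in> homog M e" if "v \<in> J" for v
        using vh[OF that Dh[OF that x]] es(1) by simp
      then show "finsum (component R M e) (\<lambda>v. indexed_var v \<odot>\<^bsub>M\<^esub> D v x) J = ([wt e] \<cdot> \<one>) \<odot>\<^bsub>component R M e\<^esub> x"
        using finsum_component[OF bM E.finite_J] euler[OF x] by (simp add: E.euler_op_def)
    qed simp }
  { assume "wt e + int (card J) \<noteq> 0"
    then obtain c where c: "c \<in> carrier R" "c \<otimes> [(wt e + int (card J))] \<cdot> \<one> = \<one>" using int_unit[OF char] by blast
    show "factors_through R (component R M e) (component R M (e - s)) J"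
    proof (rule factors_throughI[where f = "\<lambda>v x. indexed_var v \<odot>\<^bsub>M\<^esub> x" and g = D,
          OF component_module[OF bM] component_module[OF bM] E.finite_J _ _ _ c])
      show "D v \<in> module_hom R (component R M (e - s)) (component R M e)" if "v \<in> J" for v
        using leibniz_component_hom[OF bM E.connectionD[OF D that] es(3)] by simp
      show "(\<odot>\<^bsub>M\<^esub>) (indexed_var v) \<in> module_hom R (component R M e) (component R M (e - s))" if "v \<in> J" for v
        using smult_component_hom[OF bM v(1)[OF that] es(2)] by simp
      fix x assume "x \<in> carrier (component R M e)"
      then have x: "x \<in> homog M e" by simp
      note xM = hM[OF x]
      have Dv: "D v (indexed_var v \<odot>\<^bsub>M\<^esub> x) = indexed_var v \<odot>\<^bsub>M\<^esub> D v x \<oplus>\<^bsub>M\<^esub> x" if "v \<in> J" for v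
        using leibniz_mapD(3)[OF E.connectionD[OF D that] v(2)[OF that] xM] M.smult_one[OF xM]
        by (simp add: partial_derivative_var)
      have t: "indexed_var v \<odot>\<^bsub>M\<^esub> D v x \<in> carrier M" if "v \<in> J" for v
        using M.smult_closed[OF v(2)[OF that] hM[OF Dh[OF that x]]] .
      have h: "D v (indexed_var v \<odot>\<^bsub>M\<^esub> x) \<in> homog M e" if "v \<in> J" for v
        using Dh[OF that vh[OF that x]] by simp
      \<comment> \<open>The extra term \<open>x\<close> occurs once for each variable; its sum over
        \<open>J\<close> is multiplication by \<open>card J\<close>, written as a constant
        polynomial.\<close>
      have ones: "finsum M (\<lambda>v. x) A = indexed_const ([int (card A)] \<cdot> \<one>) \<odot>\<^bsub>M\<^esub> x" if "finite A" for A :: "(nat + nat) set"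
        using that
      proof (induction A rule: finite_induct)
        case empty
        have "indexed_const ([(0::int)] \<cdot> \<one>) = \<zero>\<^bsub>?R\<^esub>" by (simp add: add_pow_int_ge)
        then show ?case using M.smult_l_null[OF xM] by simp
      next
        case (insert a A)
        have "indexed_const ([int (card (insert a A))] \<cdot> \<one>) = \<one>\<^bsub>?R\<^esub> \<oplus>\<^bsub>?R\<^esub> indexed_const ([int (card A)] \<cdot> \<one>)"
          using insert.hyps add.int_pow_mult[of \<one> 1 "int (card A)"] by (simp add: indexed_padd_const add_pow_int_ge)
        then have "indexed_const ([int (card (insert a A))] \<cdot> \<one>) \<odot>\<^bsub>M\<^esub> x = x \<oplus>\<^bsub>M\<^esub> indexed_const ([int (card A)] \<cdot> \<one>) \<odot>\<^bsub>M\<^esub> x"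
          using M.smult_l_distr[OF M.R.one_closed indexed_const_carrier xM, of "[int (card A)] \<cdot> \<one>"] M.smult_one[OF xM]
          by simp
        moreover have "finsum M (\<lambda>v. x) (insert a A) = x \<oplus>\<^bsub>M\<^esub> finsum M (\<lambda>v. x) A"
          using insert.hyps xM by (intro M.M.finsum_insert) auto
        ultimately show ?case using insert.IH by simp
      qed
      have "finsum (component R M e) (\<lambda>v. D v (indexed_var v \<odot>\<^bsub>M\<^esub> x)) J = finsum M (\<lambda>v. D v (indexed_var v \<odot>\<^bsub>M\<^esub> x)) J"
        by (rule finsum_component[OF bM E.finite_J h])
      also have "\<dots> = finsum M (\<lambda>v. indexed_var v \<odot>\<^bsub>M\<^esub> D v x \<oplus>\<^bsub>M\<^esub> x) J"
        using Dv t xM by (intro M.M.finsum_cong') auto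
      also have "\<dots> = E.euler_op M D x \<oplus>\<^bsub>M\<^esub> finsum M (\<lambda>v. x) J"
        unfolding E.euler_op_def using t xM by (intro M.M.finsum_addf) auto
      also have "\<dots> = (indexed_const ([wt e] \<cdot> \<one>) \<oplus>\<^bsub>?R\<^esub> indexed_const ([int (card J)] \<cdot> \<one>)) \<odot>\<^bsub>M\<^esub> x"
        unfolding euler[OF x] ones[OF E.finite_J]
        by (rule M.smult_l_distr[symmetric, OF _ _ xM]) (rule indexed_const_carrier, simp)+
      also have "\<dots> = ([(wt e + int (card J))] \<cdot> \<one>) \<odot>\<^bsub>component R M e\<^esub> x"
        using add.int_pow_mult[of \<one> "wt e" "int (card J)"] by (simp add: indexed_padd_const)
      finally show "finsum (component R M e) (\<lambda>v. D v (indexed_var v \<odot>\<^bsub>M\<^esub> x)) J =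
          ([(wt e + int (card J))] \<cdot> \<one>) \<odot>\<^bsub>component R M e\<^esub> x" .
    qed simp }
qed

end

text \<open>A step down is blocked only at \<open>b\<close> and a step up only at \<open>a\<close>.
  From \<open>u > a\<close> the value \<open>b\<close> is reached by steps up if
  \<open>u \<le> b\<close>, all of which start above \<open>a\<close>, and otherwise by steps down,
  which end on arrival at \<open>b\<close>. The way to \<open>a\<close> from below \<open>b\<close>
  is symmetric. The lemma is applied with \<open>b = 0\<close> and with \<open>a\<close> equal to
  \<open>- n\<close> or \<open>- m\<close>.\<close>

lemma int_chain:
  fixes r :: "int \<Rightarrow> int \<Rightarrow> bool" and a b :: int
  assumes refl: "\<And>u. r u u" and trans: "\<And>u v w. r u v \<Longrightarrow> r v w \<Longrightarrow> r u w"
    and down: "\<And>u. u \<noteq> b \<Longrightarrow> r u (u - 1)" and up: "\<And>u. u \<noteq> a \<Longrightarrow> r u (u + 1)"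
  shows "a < u \<Longrightarrow> a < b \<Longrightarrow> r u b" "u < b \<Longrightarrow> a < b \<Longrightarrow> r u a"
proof -
  have ups: "r (v - int k) v" if "\<And>i. i \<ge> v - int k \<Longrightarrow> i < v \<Longrightarrow> i \<noteq> a" for v k
    using that
  proof (induction k)
    case (Suc k)
    have "r (v - int (Suc k)) (v - int (Suc k) + 1)" using Suc.prems by (intro up) simp
    moreover have "v - int (Suc k) + 1 = v - int k" by simp
    ultimately show ?case using Suc trans[of "v - int (Suc k)" "v - int k" v] by simp
  qed (simp add: refl)
  have downs: "r (v + int k) v" if "\<And>i. i \<le> v + int k \<Longrightarrow> v < i \<Longrightarrow> i \<noteq> b" for v k
    using that
  proof (induction k)
    case (Suc k)
    have "r (v + int (Suc k)) (v + int (Suc k) - 1)" using Suc.prems by (intro down) simp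
    moreover have "v + int (Suc k) - 1 = v + int k" by simp
    ultimately show ?case using Suc trans[of "v + int (Suc k)" "v + int k" v] by simp
  qed (simp add: refl)
  show "r u b" if "a < u" "a < b"
  proof (cases "u \<le> b")
    case True
    then show ?thesis using ups[of b "nat (b - u)"] that by simp
  next
    case False
    then show ?thesis using downs[of b "nat (u - b)"] that by simp
  qed
  show "r u a" if "u < b" "a < b"
  proof (cases "u \<le> a")
    case True
    then show ?thesis using ups[of a "nat (a - u)"] that by simp
  next
    case False
    then show ?thesis using downs[of a "nat (u - a)"] that by simp
  qed
qed

lemma size_eq_sum_count: "set_mset \<mu> \<subseteq> J \<Longrightarrow> finite J \<Longrightarrow> size \<mu> = (\<Sum>v\<in>J. count \<mu> v)"
  unfolding size_multiset_overloaded_eq by (rule sum.mono_neutral_left) (auto simp: not_in_iff)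

theorem theorem7p15:
  fixes C :: "('c, 'x) ring_scheme"
    and n m :: nat
    and R :: "((nat + nat) multiset \<Rightarrow> 'c, (nat + nat) multiset \<Rightarrow> 'c) bigraded"
    and T :: "((nat + nat) multiset \<Rightarrow> 'c) lyubeznik_step list"
    and M :: "((nat + nat) multiset \<Rightarrow> 'c, 'u) bigraded"
  assumes "regular_ring C" and "contains_field_char_0 C"
    and "n \<ge> 2" and "m \<ge> 2"
    and "R = bipoly_ring C n m"
    and "lyubeznik_functor R T"
    and "lyubeznik_value R T R M"
  shows
    "(\<forall>u v. - int n < u \<and> u < 0 \<and> - int m < v \<and> v < 0 \<longrightarrow>
        injdim C (component C M (u, v)) \<le>
          Min {injdim C (component C M (0, 0)), injdim C (component C M (- int n, 0)),
               injdim C (component C M (- int n, - int m)), injdim C (component C M (0, - int m))} \<and>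
        module_dim C (component C M (u, v)) \<le>
          Min {module_dim C (component C M (0, 0)), module_dim C (component C M (- int n, 0)),
               module_dim C (component C M (- int n, - int m)), module_dim C (component C M (0, - int m))}) \<and>
     (\<forall>(region, c\<^sub>1, c\<^sub>2) \<in>
        {({(u, v). - int n < u \<and> u < 0 \<and> v \<ge> 0}, (0, 0), (- int n, 0)),
         ({(u, v). u \<le> - int n \<and> - int m < v \<and> v < 0}, (- int n, 0), (- int n, - int m)),
         ({(u, v). - int n < u \<and> u < 0 \<and> v \<le> - int m}, (- int n, - int m), (0, - int m)),
         ({(u, v). u \<ge> 0 \<and> - int m < v \<and> v < 0}, (0, - int m), (0, 0))}.
        \<forall>e\<in>region.
          injdim C (component C M e) \<le> min (injdim C (component C M c\<^sub>1)) (injdim C (component C M c\<^sub>2)) \<and>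
          module_dim C (component C M e) \<le> min (module_dim C (component C M c\<^sub>1)) (module_dim C (component C M c\<^sub>2)))"
proof -
  interpret C: cring C using assms(1) by (simp add: regular_ring_def)
  have bR: "bigraded_module R R" by (rule lyubeznik_value_bigraded[OF assms(7)])
  have steps: "\<forall>t\<in>set T. valid_step R t" using assms(6) by (simp add: lyubeznik_functor_def)
  \<comment> \<open>Distinct integers differ by a unit of \<open>C\<close>, so they have distinct
    images in \<open>C\<close>. The infinite type is what lets twisted sums fit into the test type
    for injectivity.\<close>
  have inf: "infinite (UNIV :: 'c set)"
  proof -
    have "inj (\<lambda>k::nat. [int k] \<cdot>\<^bsub>C\<^esub> \<one>\<^bsub>C\<^esub>)"
    proof (rule injI, rule ccontr)
      fix k l :: nat assume eq: "[int k] \<cdot>\<^bsub>C\<^esub> \<one>\<^bsub>C\<^esub> = [int l] \<cdot>\<^bsub>C\<^esub> \<one>\<^bsub>C\<^esub>" and "k \<noteq> l"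
      then obtain c where c: "c \<in> carrier C" "c \<otimes>\<^bsub>C\<^esub> [(int k - int l)] \<cdot>\<^bsub>C\<^esub> \<one>\<^bsub>C\<^esub> = \<one>\<^bsub>C\<^esub>"
        using C.int_unit[OF assms(2), of "int k - int l"] by auto
      have "[(int k - int l)] \<cdot>\<^bsub>C\<^esub> \<one>\<^bsub>C\<^esub> \<oplus>\<^bsub>C\<^esub> [int l] \<cdot>\<^bsub>C\<^esub> \<one>\<^bsub>C\<^esub> = [int k] \<cdot>\<^bsub>C\<^esub> \<one>\<^bsub>C\<^esub>"
        using C.add.int_pow_mult[of "\<one>\<^bsub>C\<^esub>" "int k - int l" "int l"] by simp
      then have "[(int k - int l)] \<cdot>\<^bsub>C\<^esub> \<one>\<^bsub>C\<^esub> = \<zero>\<^bsub>C\<^esub>"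
        unfolding eq by (metis C.add.int_pow_closed C.add.r_cancel_one C.one_closed)
      then have one: "\<one>\<^bsub>C\<^esub> = \<zero>\<^bsub>C\<^esub>" using c by simp
      have "[(1::nat)] \<cdot>\<^bsub>C\<^esub> \<one>\<^bsub>C\<^esub> \<noteq> \<zero>\<^bsub>C\<^esub>"
        using assms(2) unfolding contains_field_char_0_def by (metis zero_less_one)
      then show False using one by simp
    qed
    then show ?thesis by (metis finite_imageD finite_subset infinite_UNIV_nat subset_UNIV)
  qed
  have filters: "set_mset (filter_mset isl \<mu>) \<subseteq> Inl ` {1..n}" "set_mset (filter_mset (\<lambda>v. \<not> isl v) \<mu>) \<subseteq> Inr ` {1..m}"
    if "set_mset \<mu> \<subseteq> variables n m" for \<mu> :: "(nat + nat) multiset"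
    using that by auto
  let ?X = "Inl ` {1..n} :: (nat + nat) set" and ?Y = "Inr ` {1..m} :: (nat + nat) set"
  have EX: "euler_ring (bipoly_ring C n m) ?X C.indexed_var (partial_derivative C) (-1, 0)
      (\<lambda>e. C.indexed_const ([fst e] \<cdot>\<^bsub>C\<^esub> \<one>\<^bsub>C\<^esub>))"
  proof (rule C.bipoly_ring_euler[OF bR[unfolded assms(5)] inf])
    fix \<mu> :: "(nat + nat) multiset" assume "set_mset \<mu> \<subseteq> variables n m"
    from size_eq_sum_count[OF filters(1)[OF this]]
    show "fst (bideg \<mu>) = (\<Sum>v\<in>?X. int (count \<mu> v))" by (auto simp: bideg_def intro!: sum.cong)
  qed (auto simp: bideg_def)
  have EY: "euler_ring (bipoly_ring C n m) ?Y C.indexed_var (partial_derivative C) (0, -1)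
      (\<lambda>e. C.indexed_const ([snd e] \<cdot>\<^bsub>C\<^esub> \<one>\<^bsub>C\<^esub>))"
  proof (rule C.bipoly_ring_euler[OF bR[unfolded assms(5)] inf])
    fix \<mu> :: "(nat + nat) multiset" assume "set_mset \<mu> \<subseteq> variables n m"
    from size_eq_sum_count[OF filters(2)[OF this]]
    show "snd (bideg \<mu>) = (\<Sum>v\<in>?Y. int (count \<mu> v))" by (auto simp: bideg_def intro!: sum.cong)
  qed (auto simp: bideg_def)
  obtain DX where DX: "euler_ring.euler_module (bipoly_ring C n m) ?X C.indexed_var (partial_derivative C) (-1, 0)
      (\<lambda>e. C.indexed_const ([fst e] \<cdot>\<^bsub>C\<^esub> \<one>\<^bsub>C\<^esub>)) M DX"
    using euler_ring.euler_module_of_lyubeznik_value[OF EX] steps assms(7) unfolding assms(5) by blast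
  obtain DY where DY: "euler_ring.euler_module (bipoly_ring C n m) ?Y C.indexed_var (partial_derivative C) (0, -1)
      (\<lambda>e. C.indexed_const ([snd e] \<cdot>\<^bsub>C\<^esub> \<one>\<^bsub>C\<^esub>)) M DY"
    using euler_ring.euler_module_of_lyubeznik_value[OF EY] steps assms(7) unfolding assms(5) by blast
  have card: "card ?X = n" "card ?Y = m" by (simp_all add: card_image inj_on_def)
  \<comment> \<open>The two inequalities are carried together: both follow from
    \<open>factors_through\<close>, and both are reflexive and transitive.\<close>
  define le where "le = (\<lambda>e e'. injdim C (component C M e) \<le> injdim C (component C M e') \<and>
      module_dim C (component C M e) \<le> module_dim C (component C M e'))"
  have le_refl: "le e e" for e by (simp add: le_def)
  have le_trans: "le e e' \<Longrightarrow> le e' e'' \<Longrightarrow> le e e''" for e e' e'' unfolding le_def by (meson order_trans)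
  have le_factor: "le e e'" if "factors_through C (component C M e) (component C M e') J"
    for e e' and J :: "(nat + nat) set"
    using factors_through_le[OF that] by (simp add: le_def)
  have X1: "le (u, v) (u - 1, v)" if "u \<noteq> 0" for u v
    using le_factor[OF C.component_factors_through(1)[OF EX _ assms(2) DX, of "(u, v)"]] that by simp
  have X2: "le (u, v) (u + 1, v)" if "u \<noteq> - int n" for u v
    using le_factor[OF C.component_factors_through(2)[OF EX _ assms(2) DX, of "(u, v)"]] that card by simp
  have Y1: "le (u, v) (u, v - 1)" if "v \<noteq> 0" for u v
    using le_factor[OF C.component_factors_through(1)[OF EY _ assms(2) DY, of "(u, v)"]] that by simp
  have Y2: "le (u, v) (u, v + 1)" if "v \<noteq> - int m" for u v
    using le_factor[OF C.component_factors_through(2)[OF EY _ assms(2) DY, of "(u, v)"]] that card by simp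
  have n: "- int n < 0" and m: "- int m < 0" using assms(3,4) by auto
  have X: "le (u, v) (0, v)" if "- int n < u" for u v
    by (rule int_chain(1)[of "\<lambda>u u'. le (u, v) (u', v)" 0 "- int n"])
      (erule (1) le_trans | (rule le_refl X1 X2 that n; assumption?))+
  have X': "le (u, v) (- int n, v)" if "u < 0" for u v
    by (rule int_chain(2)[of "\<lambda>u u'. le (u, v) (u', v)" 0 "- int n"])
      (erule (1) le_trans | (rule le_refl X1 X2 that n; assumption?))+
  have Y: "le (u, v) (u, 0)" if "- int m < v" for u v
    by (rule int_chain(1)[of "\<lambda>v v'. le (u, v) (u, v')" 0 "- int m"])
      (erule (1) le_trans | (rule le_refl Y1 Y2 that m; assumption?))+
  have Y': "le (u, v) (u, - int m)" if "v < 0" for u v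
    by (rule int_chain(2)[of "\<lambda>v v'. le (u, v) (u, v')" 0 "- int m"])
      (erule (1) le_trans | (rule le_refl Y1 Y2 that m; assumption?))+
  \<comment> \<open>Each corner bounds a quadrant, which is crossed along the first coordinate and
    then along the second. The open rectangle lies in all four quadrants, and each of the four
    regions lies in the two quadrants of its corners.\<close>
  have c00: "le (u, v) (0, 0)" if "- int n < u" "- int m < v" for u v
    using le_trans[OF X Y] that by blast
  have cn0: "le (u, v) (- int n, 0)" if "u < 0" "- int m < v" for u v
    using le_trans[OF X' Y] that by blast
  have cnm: "le (u, v) (- int n, - int m)" if "u < 0" "v < 0" for u v
    using le_trans[OF X' Y'] that by blast
  have c0m: "le (u, v) (0, - int m)" if "- int n < u" "v < 0" for u v
    using le_trans[OF X Y'] that by blast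
  note corners = c00 cn0 cnm c0m
  show ?thesis
  proof (intro conjI allI impI)
    fix u v :: int assume uv: "- int n < u \<and> u < 0 \<and> - int m < v \<and> v < 0"
    show "injdim C (component C M (u, v)) \<le>
          Min {injdim C (component C M (0, 0)), injdim C (component C M (- int n, 0)),
               injdim C (component C M (- int n, - int m)), injdim C (component C M (0, - int m))}"
      "module_dim C (component C M (u, v)) \<le>
          Min {module_dim C (component C M (0, 0)), module_dim C (component C M (- int n, 0)),
               module_dim C (component C M (- int n, - int m)), module_dim C (component C M (0, - int m))}"
      using corners[of u v] uv by (simp_all add: le_def)
  next
    show "\<forall>(region, c\<^sub>1, c\<^sub>2) \<in>
        {({(u, v). - int n < u \<and> u < 0 \<and> v \<ge> 0}, (0, 0), (- int n, 0)),
         ({(u, v). u \<le> - int n \<and> - int m < v \<and> v < 0}, (- int n, 0), (- int n, - int m)),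
         ({(u, v). - int n < u \<and> u < 0 \<and> v \<le> - int m}, (- int n, - int m), (0, - int m)),
         ({(u, v). u \<ge> 0 \<and> - int m < v \<and> v < 0}, (0, - int m), (0, 0))}.
        \<forall>e\<in>region.
          injdim C (component C M e) \<le> min (injdim C (component C M c\<^sub>1)) (injdim C (component C M c\<^sub>2)) \<and>
          module_dim C (component C M e) \<le> min (module_dim C (component C M c\<^sub>1)) (module_dim C (component C M c\<^sub>2))"
      using n m by (auto simp: corners[unfolded le_def])
  qed
qed

end
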